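(* Let $\mathcal{B}$ be a unital $C^*$-algebra and let $G=(G^{(n)})_{n\ge1}$ be a family of functions defined on $H^+(\mathcal{B})$, with $G^{(n)}:M_n^+(\mathcal{B})\to M_n(\mathcal{B})$. The following are equivalent: \begin{enumerate} \item[(I)] $G$ is an analytic non-commutative function $G:H^+(\mathcal{B})\to H^-(\mathcal{B})$ with the property that $H=(H^{(n)})_{n\ge1}$, defined by $H^{(n)}(b):=G^{(n)}(b^{-1})$ for all $n\in\mathbb{N}$, has a uniformly analytic extension to a neighborhood of $0$ satisfying $H^{(n)}(0)=0$. \item[(II)] There exists a $\mathbb{C}$-linear map $\sigma:\mathcal{B}\langle X\rangle\to\mathcal{B}$ which is completely positive and exponentially bounded, i.e. for some constant $M$ $$\|\sigma(b_1Xb_2\cdots Xb_{n+1})\|\le M^{n}\|b_1\|\|b_2\|\cdots\|b_{n+1}\|,$$ such that $G^{(n)}(b)=(\sigma\otimes1_n)((b-X\otimes1_n)^{-1})$ for all $n$. \end{enumerate}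
   Context: $\mathcal{B}\langle X\rangle$ is the $*$-algebra of noncommutative polynomials in a self-adjoint symbol $X$ with coefficients in $\mathcal{B}$ (algebraic free product of $\mathcal{B}$ and $\mathbb{C}[X]$). A linear map $\sigma:\mathcal{B}\langle X\rangle\to\mathcal{B}$ is called completely positive if $[\sigma(P_iP_j^* )]_{i,j=1}^n\ge0$ for all $n$ and $P_1,\dots,P_n\in\mathcal{B}\langle X\rangle$; $\sigma$ is not assumed to be a $\mathcal{B}$-bimodule map. $\Im b=(b-b^* )/2i$. $M_n^{+}(\mathcal{B})=\bigcup_{\epsilon>0}\{b\in M_n(\mathcal{B}):\Im b>\epsilon1_n\}$, $M_n^-(\mathcal{B})=-M_n^+(\mathcal{B})$, $H^{\pm}(\mathcal{B})=\bigsqcup_{n\ge1}M_n^{\pm}(\mathcal{B})$. $H^{(n)}(b)=G^{(n)}(b^{-1})$ is initially defined for invertible $b\in M_n(\mathcal{B})$ with $b^{-1}\in M_n^{+}(\mathcal{B})$. A non-commutative function $f=(f^{(n)})$ on $\Omega=\bigsqcup_n\Omega_n$ (a set closed under direct sums, $\Omega_n\subset M_n(\mathcal{B})$) satisfies $f^{(n)}(\Omega_n)\subset M_n(\mathcal{B})$, $f(x\oplus y)=f(x)\oplus f(y)$, and $f(SxS^{-1})=Sf(x)S^{-1}$ whenever $x,SxS^{-1}\in\Omega_n$, $S\in M_n(\mathbb{C})$ invertible. A uniformly analytic extension to a neighborhood of $0$ means: for some $r>0$ there is an analytic non-commutative function, bounded on $B_r^{nc}(0)=\bigsqcup_n\{b\in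 M_n(\mathcal{B}):\|b\|<r\}$, agreeing with $H$ where both are defined. The expression $(\sigma\otimes1_n)((b-X\otimes1_n)^{-1})$ is understood as the geometric series $\sum_{k\ge0}(\sigma\otimes1_n)((b^{-1}X)^kb^{-1})$ when $\|b^{-1}\|$ is small, and by analytic continuation for other $b\in M_n^+(\mathcal{B})$.
   Formalization: The claim fails for G(b)=(b+i)^{-1} and for σ=0, so: in (I) the extension of H must also satisfy H(b* )=H(b)*; and either G may take values in the closure of H^-, or (II) also requires σ(1) invertible. The exponential bound is taken for n≥1. *)

theory Defs
  imports
    Complex_Main
    "HOL-Library.Poly_Mapping"
    "Jordan_Normal_Form.Matrix"
begin

section \<open>Unital complex star-algebras and C*-algebras\<close>

class scaleC =
  fixes scaleC :: "complex \<Rightarrow> 'a \<Rightarrow> 'a" (infixr "*\<^sub>C" 75)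

class star =
  fixes star :: "'a \<Rightarrow> 'a"

class complex_star_algebra = ring_1 + scaleC + star +
  assumes scaleC_add_right: "c *\<^sub>C (x + y) = c *\<^sub>C x + c *\<^sub>C y"
    and scaleC_add_left: "(c + d) *\<^sub>C x = c *\<^sub>C x + d *\<^sub>C x"
    and scaleC_scaleC: "c *\<^sub>C (d *\<^sub>C x) = (c * d) *\<^sub>C x"
    and scaleC_one: "1 *\<^sub>C x = x"
    and mult_scaleC_left: "(c *\<^sub>C x) * y = c *\<^sub>C (x * y)"
    and mult_scaleC_right: "x * (c *\<^sub>C y) = c *\<^sub>C (x * y)"
    and star_star: "star (star x) = x"
    and star_add: "star (x + y) = star x + star y"
    and star_mult: "star (x * y) = star y * star x"
    and star_scaleC: "star (c *\<^sub>C x) = cnj c *\<^sub>C star x"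

text \<open>The unit is assumed to be different from zero.\<close>

class cstar_algebra = complex_star_algebra + real_normed_algebra_1 + banach +
  assumes scaleR_scaleC: "scaleR r x = complex_of_real r *\<^sub>C x"
    and norm_scaleC: "norm (c *\<^sub>C x) = cmod c * norm x"
    and cstar_identity: "norm (star x * x) = (norm x)\<^sup>2"

instantiation complex :: cstar_algebra
begin
definition scaleC_complex :: "complex \<Rightarrow> complex \<Rightarrow> complex" where
  "scaleC_complex c x = c * x"
definition star_complex :: "complex \<Rightarrow> complex" where
  "star_complex = cnj"
instance
proof
  fix x :: complex
  show "norm (star x * x) = (norm x)\<^sup>2"
    by (simp add: star_complex_def norm_mult power2_eq_square)
qed (simp_all add: scaleC_complex_def star_complex_def algebra_simps norm_mult scaleR_conv_of_real)
end

context complex_star_algebra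
begin

lemma scaleC_zero_left [simp]: "0 *\<^sub>C x = 0"
  using scaleC_add_left [of 0 0 x] by simp

lemma scaleC_zero_right [simp]: "c *\<^sub>C 0 = 0"
  using scaleC_add_right [of c 0 0] by simp

lemma star_zero [simp]: "star 0 = 0"
  using star_add [of 0 0] by simp

lemma star_one [simp]: "star 1 = 1"
  by (metis star_star star_mult mult_1_left mult_1_right)

end

section \<open>The star-algebra of noncommutative polynomials\<close>

text \<open>
  Noncommutative words \<open>b\<^sub>0 X b\<^sub>1 X \<dots> X b\<^sub>k\<close>: \<open>Coeff b\<close> is \<open>b\<close>, and \<open>CoeffX b w\<close> is \<open>b X w\<close>.
  They form a monoid, the free product of the multiplicative monoid of the algebra with the free
  monoid on \<open>X\<close>. It is written additively because \<open>poly_mapping\<close> takes convolution products with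
  respect to \<open>+\<close>, so that \<open>'b ncword \<Rightarrow>\<^sub>0 complex\<close> is the monoid algebra.
\<close>

datatype 'b ncword = Coeff 'b | CoeffX 'b "'b ncword"

fun lmult_ncword :: "'b::times \<Rightarrow> 'b ncword \<Rightarrow> 'b ncword" where
  "lmult_ncword a (Coeff b) = Coeff (a * b)"
| "lmult_ncword a (CoeffX b w) = CoeffX (a * b) w"

instantiation ncword :: (monoid_mult) monoid_add
begin
definition zero_ncword :: "'a ncword" where "zero_ncword = Coeff 1"
primrec plus_ncword :: "'a ncword \<Rightarrow> 'a ncword \<Rightarrow> 'a ncword" where
  "plus_ncword (Coeff a) w = lmult_ncword a w"
| "plus_ncword (CoeffX a v) w = CoeffX a (plus_ncword v w)"
instance
proof
  have lm: "lmult_ncword a (lmult_ncword b w) = lmult_ncword (a * b) w" for a b and w :: "'a ncword"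
    by (cases w) (simp_all add: mult.assoc)
  have lp: "lmult_ncword a v + w = lmult_ncword a (v + w)" for a and v w :: "'a ncword"
    by (cases v) (simp_all add: lm)
  fix u v w :: "'a ncword"
  show "u + v + w = u + (v + w)"
    by (induction u) (simp_all add: lp)
  show "0 + u = u"
    by (cases u) (simp_all add: zero_ncword_def)
  show "u + 0 = u"
    by (induction u) (simp_all add: zero_ncword_def)
qed
end

primrec star_ncword :: "'b::cstar_algebra ncword \<Rightarrow> 'b ncword" where
  "star_ncword (Coeff b) = Coeff (star b)"
| "star_ncword (CoeffX b w) = star_ncword w + CoeffX 1 (Coeff (star b))"

lemma star_ncword_plus: "star_ncword (v + w) = star_ncword w + star_ncword v"
proof (induction v)
  case (Coeff a)
  have "u + CoeffX 1 (Coeff (star b * star a)) = (u + CoeffX 1 (Coeff (star b))) + Coeff (star a)"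
    for u b by (simp add: add.assoc)
  then show ?case
    by (cases w) (simp_all add: star_mult)
qed (simp add: add.assoc)

lemma lmult_ncword_one [simp]: "lmult_ncword (1::'b::monoid_mult) w = w"
  by (cases w) simp_all

lemma star_ncword_star_ncword [simp]: "star_ncword (star_ncword w) = w"
  by (induction w) (simp_all add: star_ncword_plus star_star)

lemma star_ncword_zero [simp]: "star_ncword 0 = 0"
  by (simp add: zero_ncword_def)

type_synonym 'b ncfree = "'b ncword \<Rightarrow>\<^sub>0 complex"

abbreviation ncsingle :: "'b ncword \<Rightarrow> complex \<Rightarrow> 'b ncfree" where
  "ncsingle \<equiv> Poly_Mapping.single"

text \<open>
  The two-sided ideal generated by the relations which make \<open>b \<mapsto> Coeff b\<close> linear; the quotient of
  the monoid algebra by it is the algebraic free product of the coefficient algebra with the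
  polynomials in \<open>X\<close>, amalgamated over the complex scalars.
\<close>

inductive_set ncideal :: "'b::cstar_algebra ncfree set" where
  add_rel: "ncsingle (Coeff (a + b)) 1 - ncsingle (Coeff a) 1 - ncsingle (Coeff b) 1 \<in> ncideal"
| scale_rel: "ncsingle (Coeff (c *\<^sub>C a)) 1 - ncsingle (Coeff a) c \<in> ncideal"
| zero: "0 \<in> ncideal"
| add: "p \<in> ncideal \<Longrightarrow> q \<in> ncideal \<Longrightarrow> p + q \<in> ncideal"
| mult: "p \<in> ncideal \<Longrightarrow> u * p * v \<in> ncideal"

lemma ncideal_left: "p \<in> ncideal \<Longrightarrow> u * p \<in> ncideal"
  using ncideal.mult [of p u 1] by simp

lemma ncideal_right: "p \<in> ncideal \<Longrightarrow> p * v \<in> ncideal"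
  using ncideal.mult [of p 1 v] by simp

lemma ncideal_uminus: "p \<in> ncideal \<Longrightarrow> - p \<in> ncideal"
  using ncideal_left [of p "- 1"] by simp

lemma ncideal_minus: "p \<in> ncideal \<Longrightarrow> q \<in> ncideal \<Longrightarrow> p - q \<in> ncideal"
  using ncideal.add [of p "- q"] ncideal_uminus [of q] by simp

lemma ncfree_induct [case_names single add]:
  assumes single: "\<And>w c. P (ncsingle w c)"
    and add: "\<And>p q. P p \<Longrightarrow> P q \<Longrightarrow> P (p + q)"
  shows "P p"
proof (induction p rule: update_induct)
  case const
  show ?case using single [of undefined 0] by simp
next
  case (update p w c)
  have "Poly_Mapping.update w c p = p + ncsingle w c"
    using update by (intro poly_mapping_eqI)
      (auto simp: lookup_update lookup_add lookup_single when_def in_keys_iff)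
  then show ?case using update single add by simp
qed

lift_definition star_ncfree :: "'b::cstar_algebra ncfree \<Rightarrow> 'b ncfree" is
  "\<lambda>p w. cnj (p (star_ncword w))"
proof -
  fix p :: "'b ncword \<Rightarrow> complex"
  assume "finite {w. p w \<noteq> 0}"
  then have "finite (star_ncword ` {w. p w \<noteq> 0})" by simp
  moreover have "{w. cnj (p (star_ncword w)) \<noteq> 0} \<subseteq> star_ncword ` {w. p w \<noteq> 0}"
    by (auto intro!: image_eqI [where x = "star_ncword _"])
  ultimately show "finite {w. cnj (p (star_ncword w)) \<noteq> 0}"
    by (rule finite_subset [rotated])
qed

lemma star_ncfree_add: "star_ncfree (p + q) = star_ncfree p + star_ncfree q"
  by (rule poly_mapping_eqI) (simp add: star_ncfree.rep_eq lookup_add)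

lemma star_ncfree_diff: "star_ncfree (p - q) = star_ncfree p - star_ncfree q"
  by (rule poly_mapping_eqI) (simp add: star_ncfree.rep_eq lookup_minus)

lemma star_ncfree_zero [simp]: "star_ncfree 0 = 0"
  by (rule poly_mapping_eqI) (simp add: star_ncfree.rep_eq)

lemma star_ncfree_single [simp]: "star_ncfree (ncsingle w c) = ncsingle (star_ncword w) (cnj c)"
proof (rule poly_mapping_eqI)
  fix k
  have "(w = star_ncword k) = (star_ncword w = k)" by auto
  then show "Poly_Mapping.lookup (star_ncfree (ncsingle w c)) k = Poly_Mapping.lookup (ncsingle (star_ncword w) (cnj c)) k"
    by (simp add: star_ncfree.rep_eq lookup_single when_def)
qed

lemma star_ncfree_star_ncfree [simp]: "star_ncfree (star_ncfree p) = p"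
  by (rule poly_mapping_eqI) (simp add: star_ncfree.rep_eq)

lemma star_ncfree_mult: "star_ncfree (p * q) = star_ncfree q * star_ncfree p"
proof (induction p rule: ncfree_induct)
  case (single v c)
  show ?case
    by (induction q rule: ncfree_induct)
      (simp_all add: mult_single star_ncword_plus mult.commute distrib_left distrib_right star_ncfree_add)
qed (simp add: distrib_left distrib_right star_ncfree_add)

lemma star_ncfree_ncideal: "p \<in> ncideal \<Longrightarrow> star_ncfree p \<in> ncideal"
proof (induction rule: ncideal.induct)
  case (mult p u v)
  then show ?case by (simp add: star_ncfree_mult mult.assoc [symmetric] ncideal.mult)
qed (simp_all add: star_ncfree_diff star_ncfree_add star_add star_scaleC ncideal.intros)

text \<open>Evaluation at \<open>X = 0\<close>, used only to see that the quotient is not the zero ring.\<close>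

definition eval0 :: "'b::cstar_algebra ncfree \<Rightarrow> 'b" where
  "eval0 p = (\<Sum>w\<in>Poly_Mapping.keys p. Poly_Mapping.lookup p w *\<^sub>C (case w of Coeff b \<Rightarrow> b | CoeffX _ _ \<Rightarrow> 0))"

lemma eval0_superset:
  assumes "finite A" "Poly_Mapping.keys p \<subseteq> A"
  shows "eval0 p = (\<Sum>w\<in>A. Poly_Mapping.lookup p w *\<^sub>C (case w of Coeff b \<Rightarrow> b | CoeffX _ _ \<Rightarrow> 0))"
  unfolding eval0_def using assms
  by (intro sum.mono_neutral_left) (auto simp: in_keys_iff)

lemma eval0_add: "eval0 (p + q) = eval0 p + eval0 q"
proof -
  have "Poly_Mapping.keys (p + q) \<subseteq> Poly_Mapping.keys p \<union> Poly_Mapping.keys q" by (rule Poly_Mapping.keys_add)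
  then show ?thesis
    by (simp add: eval0_superset [of "Poly_Mapping.keys p \<union> Poly_Mapping.keys q"] lookup_add scaleC_add_left sum.distrib)
qed

lemma eval0_single: "eval0 (ncsingle w c) = c *\<^sub>C (case w of Coeff b \<Rightarrow> b | CoeffX _ _ \<Rightarrow> 0)"
  by (simp add: eval0_superset [of "{w}"])

lemma eval0_zero: "eval0 0 = 0"
  by (simp add: eval0_def)

lemma eval0_diff: "eval0 (p - q) = eval0 p - eval0 q"
  using eval0_add [of "p - q" q] by simp

lemma eval0_mult: "eval0 (p * q) = eval0 p * eval0 q"
proof (induction p rule: ncfree_induct)
  case (single v c)
  show ?case
  proof (induction q rule: ncfree_induct)
    case (single w d)
    show ?case
      by (cases v; cases w)
        (simp_all add: mult_single eval0_single mult_scaleC_left mult_scaleC_right scaleC_scaleC mult.commute)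
  qed (simp add: distrib_left eval0_add)
qed (simp add: distrib_right eval0_add)

lemma eval0_ncideal: "p \<in> ncideal \<Longrightarrow> eval0 p = 0"
  by (induction rule: ncideal.induct)
    (simp_all add: eval0_add eval0_diff eval0_mult eval0_zero eval0_single scaleC_one)

definition ncrel :: "'b::cstar_algebra ncfree \<Rightarrow> 'b ncfree \<Rightarrow> bool" where
  "ncrel p q \<longleftrightarrow> p - q \<in> ncideal"

quotient_type (overloaded) 'b ncpoly = "'b::cstar_algebra ncfree" / ncrel
proof (rule equivpI)
  show "reflp ncrel" by (auto simp: reflp_def ncrel_def ncideal.zero)
  show "symp ncrel" using ncideal_uminus by (force simp: symp_def ncrel_def)
  show "transp ncrel" using ncideal.add by (force simp: transp_def ncrel_def)
qed

lemma ncrel_mult: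
  assumes "ncrel p p'" "ncrel q q'"
  shows "ncrel (p * q) (p' * q')"
proof -
  have "p * q - p' * q' = (p - p') * q + p' * (q - q')" by (simp add: algebra_simps)
  then show ?thesis
    using assms by (simp add: ncrel_def ncideal.add ncideal_left ncideal_right)
qed

instantiation ncpoly :: (cstar_algebra) complex_star_algebra
begin
lift_definition zero_ncpoly :: "'a ncpoly" is 0 .
lift_definition one_ncpoly :: "'a ncpoly" is 1 .
lift_definition plus_ncpoly :: "'a ncpoly \<Rightarrow> 'a ncpoly \<Rightarrow> 'a ncpoly" is "(+)"
proof -
  fix p p' q q' :: "'a ncfree"
  assume "ncrel p p'" "ncrel q q'"
  then show "ncrel (p + q) (p' + q')"
    using ncideal.add [of "p - p'" "q - q'"] by (simp add: ncrel_def algebra_simps)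
qed
lift_definition uminus_ncpoly :: "'a ncpoly \<Rightarrow> 'a ncpoly" is uminus
  using ncideal_uminus by (force simp: ncrel_def)
lift_definition minus_ncpoly :: "'a ncpoly \<Rightarrow> 'a ncpoly \<Rightarrow> 'a ncpoly" is "(-)"
proof -
  fix p p' q q' :: "'a ncfree"
  assume "ncrel p p'" "ncrel q q'"
  then show "ncrel (p - q) (p' - q')"
    using ncideal_minus [of "p - p'" "q - q'"] by (simp add: ncrel_def algebra_simps)
qed
lift_definition times_ncpoly :: "'a ncpoly \<Rightarrow> 'a ncpoly \<Rightarrow> 'a ncpoly" is "(*)"
  by (rule ncrel_mult)
lift_definition scaleC_ncpoly :: "complex \<Rightarrow> 'a ncpoly \<Rightarrow> 'a ncpoly" is "\<lambda>c p. ncsingle 0 c * p"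
  by (intro ncrel_mult) (simp_all add: ncrel_def ncideal.zero)
lift_definition star_ncpoly :: "'a ncpoly \<Rightarrow> 'a ncpoly" is star_ncfree
  by (metis ncrel_def star_ncfree_diff star_ncfree_ncideal)
instance
proof
  have central: "p * ncsingle 0 c = ncsingle 0 c * p" for p :: "'a ncfree" and c
    by (induction p rule: ncfree_induct) (simp_all add: mult_single distrib_left distrib_right mult.commute)
  have refl: "ncrel p p" for p :: "'a ncfree" by (simp add: ncrel_def ncideal.zero)
  fix x y z :: "'a ncpoly" and c d :: complex
  show "x + y + z = x + (y + z)" by transfer (simp add: add.assoc refl)
  show "x + y = y + x" by transfer (simp add: add.commute refl)
  show "0 + x = x" by transfer (simp add: refl)
  show "- x + x = 0" by transfer (simp add: refl)
  show "x - y = x + - y" by transfer (simp add: refl)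
  show "x * y * z = x * (y * z)" by transfer (simp add: mult.assoc refl)
  show "1 * x = x" by transfer (simp add: refl)
  show "x * 1 = x" by transfer (simp add: refl)
  show "(x + y) * z = x * z + y * z" by transfer (simp add: distrib_right refl)
  show "x * (y + z) = x * y + x * z" by transfer (simp add: distrib_left refl)
  show "(0 :: 'a ncpoly) \<noteq> 1"
  proof transfer
    have "eval0 (0 - 1 :: 'a ncfree) \<noteq> 0"
      unfolding eval0_diff eval0_zero single_one [symmetric] eval0_single
      by (simp add: zero_ncword_def scaleC_one)
    then show "\<not> ncrel (0 :: 'a ncfree) 1"
      unfolding ncrel_def using eval0_ncideal by blast
  qed
  show "c *\<^sub>C (x + y) = c *\<^sub>C x + c *\<^sub>C y" by transfer (simp add: distrib_left refl)
  show "(c + d) *\<^sub>C x = c *\<^sub>C x + d *\<^sub>C x" by transfer (simp add: single_add distrib_right refl)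
  show "c *\<^sub>C (d *\<^sub>C x) = (c * d) *\<^sub>C x"
    by transfer (simp add: mult.assoc [symmetric] mult_single refl)
  show "1 *\<^sub>C x = x" by transfer (simp add: refl)
  show "(c *\<^sub>C x) * y = c *\<^sub>C (x * y)" by transfer (simp add: mult.assoc refl)
  show "x * (c *\<^sub>C y) = c *\<^sub>C (x * y)"
    by transfer (metis central mult.assoc refl)
  show "star (star x) = x" by transfer (simp add: refl)
  show "star (x + y) = star x + star y" by transfer (simp add: star_ncfree_add refl)
  show "star (x * y) = star y * star x" by transfer (simp add: star_ncfree_mult refl)
  show "star (c *\<^sub>C x) = cnj c *\<^sub>C star x"
    by transfer (simp add: star_ncfree_mult central refl)
qed
end

lift_definition nc_const :: "'b::cstar_algebra \<Rightarrow> 'b ncpoly" is "\<lambda>b. ncsingle (Coeff b) 1" .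

lift_definition nc_X :: "'b::cstar_algebra ncpoly" is "ncsingle (CoeffX 1 (Coeff 1)) 1" .

lemma nc_const_add: "nc_const (a + b) = nc_const a + nc_const b"
proof transfer
  fix a b :: 'a
  show "ncrel (ncsingle (Coeff (a + b)) 1) (ncsingle (Coeff a) 1 + ncsingle (Coeff b) 1)"
    using ncideal.add_rel [of a b] by (simp add: ncrel_def diff_diff_eq)
qed

lemma nc_const_scaleC: "nc_const (c *\<^sub>C a) = c *\<^sub>C nc_const a"
proof transfer
  fix a :: 'a and c
  show "ncrel (ncsingle (Coeff (c *\<^sub>C a)) 1) (ncsingle 0 c * ncsingle (Coeff a) 1)"
    using ncideal.scale_rel [of c a] by (simp add: ncrel_def mult_single)
qed

lemma nc_const_mult: "nc_const (a * b) = nc_const a * nc_const b"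
  by transfer (simp add: mult_single ncrel_def ncideal.zero)

lemma nc_const_one: "nc_const 1 = 1"
  by transfer (simp add: zero_ncword_def [symmetric] ncrel_def ncideal.zero)

lemma star_nc_const: "star (nc_const b) = nc_const (star b)"
  by transfer (simp add: ncrel_def ncideal.zero)

lemma star_nc_X: "star nc_X = nc_X"
  by transfer (simp add: ncrel_def ncideal.zero)

text \<open>\<open>nc_monomial b n\<close> is \<open>b 0 * X * b 1 * X * \<dots> * X * b n\<close>.\<close>

primrec nc_monomial :: "(nat \<Rightarrow> 'b::cstar_algebra) \<Rightarrow> nat \<Rightarrow> 'b ncpoly" where
  "nc_monomial b 0 = nc_const (b 0)"
| "nc_monomial b (Suc n) = nc_monomial b n * nc_X * nc_const (b (Suc n))"

section \<open>Matrices over a C*-algebra\<close>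

definition mat_star :: "'b::star mat \<Rightarrow> 'b mat" where
  "mat_star A = mat (dim_col A) (dim_row A) (\<lambda>(i, j). star (A $$ (j, i)))"

text \<open>
  The C*-norm on matrices: the operator norm for the action on the right Hilbert C*-module of column
  vectors, whose inner product is \<open>\<Sum>i. star (v i) * w i\<close>.
\<close>

definition hvec_norm :: "'b::cstar_algebra vec \<Rightarrow> real" where
  "hvec_norm v = sqrt (norm (\<Sum>i<dim_vec v. star (v $ i) * (v $ i)))"

definition mat_norm :: "'b::cstar_algebra mat \<Rightarrow> real" where
  "mat_norm A = Sup {hvec_norm (A *\<^sub>v v) | v. v \<in> carrier_vec (dim_col A) \<and> hvec_norm v \<le> 1}"

definition mat_pos :: "'b::cstar_algebra mat \<Rightarrow> bool" where
  "mat_pos A \<longleftrightarrow> square_mat A \<and> (\<exists>C \<in> carrier_mat (dim_row A) (dim_row A). A = mat_star C * C)"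

definition mat_Im :: "'b::cstar_algebra mat \<Rightarrow> 'b mat" where
  "mat_Im b = map_mat (scaleC (1 / (2 * \<i>))) (b - mat_star b)"

definition mat_inv :: "'b::semiring_1 mat \<Rightarrow> 'b mat" where
  "mat_inv b = (THE c. inverts_mat b c \<and> inverts_mat c b)"

text \<open>
  For the union over \<open>\<epsilon> > 0\<close> it does not matter whether \<open>Im b > \<epsilon> 1\<close> is read with \<open>\<ge>\<close> or as a strict
  inequality.
\<close>

definition Mplus :: "nat \<Rightarrow> 'b::cstar_algebra mat set" where
  "Mplus n = (\<Union>\<epsilon>\<in>{0<..}. {b \<in> carrier_mat n n. mat_pos (mat_Im b - of_real \<epsilon> \<cdot>\<^sub>m 1\<^sub>m n)})"

definition Mminus :: "nat \<Rightarrow> 'b::cstar_algebra mat set" where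
  "Mminus n = uminus ` Mplus n"

text \<open>The norm closure of \<open>Mminus n\<close>.\<close>

definition Mminus_closed :: "nat \<Rightarrow> 'b::cstar_algebra mat set" where
  "Mminus_closed n = {b \<in> carrier_mat n n. mat_pos (- mat_Im b)}"

text \<open>
  Disjoint unions over the matrix size \<open>n\<close> are plain unions, as the type \<open>'b mat\<close> contains matrices
  of all sizes. Correspondingly a graded family \<open>(f\<^sup>(\<^sup>n\<^sup>))\<close> is one function on \<open>'b mat\<close>.
\<close>

definition Hplus :: "'b::cstar_algebra mat set" where
  "Hplus = (\<Union>n\<in>{1..}. Mplus n)"

definition ncball :: "real \<Rightarrow> 'b::cstar_algebra mat set" where
  "ncball r = (\<Union>n\<in>{1..}. {b \<in> carrier_mat n n. mat_norm b < r})"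

section \<open>Analytic noncommutative functions\<close>

definition dsum :: "'b::zero mat \<Rightarrow> 'b mat \<Rightarrow> 'b mat" where
  "dsum x y = four_block_mat x (0\<^sub>m (dim_row x) (dim_col y)) (0\<^sub>m (dim_row y) (dim_col x)) y"

definition scalar_mat :: "complex mat \<Rightarrow> 'b::cstar_algebra mat" where
  "scalar_mat S = map_mat (\<lambda>c. c *\<^sub>C 1) S"

definition nc_function :: "'b::cstar_algebra mat set \<Rightarrow> ('b mat \<Rightarrow> 'b mat) \<Rightarrow> bool" where
  "nc_function \<Omega> f \<longleftrightarrow>
     (\<forall>x\<in>\<Omega>. \<forall>y\<in>\<Omega>. dsum x y \<in> \<Omega>) \<and>
     (\<forall>n\<ge>1. \<forall>x \<in> \<Omega> \<inter> carrier_mat n n. f x \<in> carrier_mat n n) \<and>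
     (\<forall>x\<in>\<Omega>. \<forall>y\<in>\<Omega>. f (dsum x y) = dsum (f x) (f y)) \<and>
     (\<forall>n\<ge>1. \<forall>x \<in> \<Omega> \<inter> carrier_mat n n. \<forall>S \<in> carrier_mat n n. \<forall>T \<in> carrier_mat n n.
        inverts_mat S T \<and> inverts_mat T S \<and> scalar_mat S * x * scalar_mat T \<in> \<Omega> \<longrightarrow>
        f (scalar_mat S * x * scalar_mat T) = scalar_mat S * f x * scalar_mat T)"

definition mat_clinear :: "nat \<Rightarrow> ('b::cstar_algebra mat \<Rightarrow> 'b mat) \<Rightarrow> bool" where
  "mat_clinear n L \<longleftrightarrow>
     (\<forall>x \<in> carrier_mat n n. L x \<in> carrier_mat n n) \<and>
     (\<forall>x \<in> carrier_mat n n. \<forall>y \<in> carrier_mat n n. L (x + y) = L x + L y) \<and>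
     (\<forall>c. \<forall>x \<in> carrier_mat n n. L (map_mat (scaleC c) x) = map_mat (scaleC c) (L x))"

text \<open>
  Analyticity between the Banach spaces of \<open>n \<times> n\<close> matrices is complex Frechet differentiability
  at every point; it is only used for open \<open>U\<close>.
\<close>

definition mat_analytic_on :: "nat \<Rightarrow> 'b::cstar_algebra mat set \<Rightarrow> ('b mat \<Rightarrow> 'b mat) \<Rightarrow> bool" where
  "mat_analytic_on n U f \<longleftrightarrow>
     (\<forall>a\<in>U. f a \<in> carrier_mat n n \<and>
       (\<exists>L. mat_clinear n L \<and>
            (\<exists>K. \<forall>h \<in> carrier_mat n n. mat_norm (L h) \<le> K * mat_norm h) \<and>
            (\<forall>e>0. \<exists>d>0. \<forall>h \<in> carrier_mat n n. mat_norm h < d \<and> a + h \<in> U \<longrightarrow>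
               mat_norm (f (a + h) - f a - L h) \<le> e * mat_norm h)))"

definition analytic_nc_function :: "'b::cstar_algebra mat set \<Rightarrow> ('b mat \<Rightarrow> 'b mat) \<Rightarrow> bool" where
  "analytic_nc_function \<Omega> f \<longleftrightarrow>
     nc_function \<Omega> f \<and> (\<forall>n\<ge>1. mat_analytic_on n (\<Omega> \<inter> carrier_mat n n) f)"

text \<open>
  \<open>uniform_extension0 D H F r\<close>: \<open>F\<close> is a uniformly analytic extension of \<open>H\<close>, which is
  defined on \<open>D\<close>, to the noncommutative ball of radius \<open>r\<close> around \<open>0\<close>.
\<close>

definition uniform_extension0 ::
  "'b::cstar_algebra mat set \<Rightarrow> ('b mat \<Rightarrow> 'b mat) \<Rightarrow> ('b mat \<Rightarrow> 'b mat) \<Rightarrow> real \<Rightarrow> bool" where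
  "uniform_extension0 D H F r \<longleftrightarrow>
     r > 0 \<and> analytic_nc_function (ncball r) F \<and>
     (\<exists>K. \<forall>b \<in> ncball r. mat_norm (F b) \<le> K) \<and>
     (\<forall>b \<in> ncball r \<inter> D. F b = H b)"

text \<open>
  The transform at infinity is \<open>H b = G (b\<inverse>)\<close>, on the \<open>b\<close> whose inverse lies in the domain of \<open>G\<close>.
  The extension is required to be hermitian, \<open>F (b*) = (F b)*\<close>, that is, it also extends the usual
  reflection \<open>G (b*) = (G b)*\<close> of \<open>G\<close> to the lower half plane. Without this requirement
  \<open>G b = (b + \<i> 1)\<inverse>\<close> would be admitted, which is not the transform of any positive map. The codomain
  at level \<open>n\<close> is the parameter \<open>V n\<close>.
\<close>

definition transform_cond ::
  "(nat \<Rightarrow> 'b::cstar_algebra mat set) \<Rightarrow> ('b mat \<Rightarrow> 'b mat) \<Rightarrow> bool" where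
  "transform_cond V G \<longleftrightarrow>
     analytic_nc_function Hplus G \<and>
     (\<forall>n\<ge>1. \<forall>b \<in> Mplus n. G b \<in> V n) \<and>
     (\<exists>F r. uniform_extension0 {b. invertible_mat b \<and> mat_inv b \<in> Hplus} (\<lambda>b. G (mat_inv b)) F r \<and>
        (\<forall>b \<in> ncball r. F (mat_star b) = mat_star (F b)) \<and>
        (\<forall>n\<ge>1. F (0\<^sub>m n n) = 0\<^sub>m n n))"

section \<open>Completely positive maps and their Cauchy transforms\<close>

definition completely_positive :: "('b::cstar_algebra ncpoly \<Rightarrow> 'b) \<Rightarrow> bool" where
  "completely_positive \<sigma> \<longleftrightarrow>
     (\<forall>n. \<forall>P :: nat \<Rightarrow> 'b ncpoly. mat_pos (mat n n (\<lambda>(i, j). \<sigma> (P i * star (P j)))))"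

text \<open>
  The bound is imposed on monomials containing at least one \<open>X\<close>. For \<open>n = 0\<close> it would force the
  restriction of \<open>\<sigma>\<close> to the coefficients to be a contraction.
\<close>

definition exponentially_bounded :: "('b::cstar_algebra ncpoly \<Rightarrow> 'b) \<Rightarrow> bool" where
  "exponentially_bounded \<sigma> \<longleftrightarrow>
     (\<exists>M. \<forall>n\<ge>1. \<forall>b. norm (\<sigma> (nc_monomial b n)) \<le> M ^ n * (\<Prod>i\<le>n. norm (b i)))"

text \<open>\<open>cauchy_term \<sigma> b k\<close> is \<open>(\<sigma> \<otimes> 1\<^sub>n) ((b\<inverse> X)\<^sup>k b\<inverse>)\<close>.\<close>

definition cauchy_term :: "('b::cstar_algebra ncpoly \<Rightarrow> 'b) \<Rightarrow> 'b mat \<Rightarrow> nat \<Rightarrow> 'b mat" where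
  "cauchy_term \<sigma> b k =
     (let c = map_mat nc_const (mat_inv b)
      in map_mat \<sigma> ((c * (nc_X \<cdot>\<^sub>m 1\<^sub>m (dim_row b))) ^\<^sub>m k * c))"

text \<open>
  \<open>continues_cauchy_series \<sigma> n f\<close>: \<open>f\<close> is analytic on \<open>Mplus n\<close> and is the sum of the geometric
  series wherever the inverse of the argument is small. Norm convergence in a matrix algebra
  is entrywise convergence.
\<close>

definition continues_cauchy_series ::
  "('b::cstar_algebra ncpoly \<Rightarrow> 'b) \<Rightarrow> nat \<Rightarrow> ('b mat \<Rightarrow> 'b mat) \<Rightarrow> bool" where
  "continues_cauchy_series \<sigma> n f \<longleftrightarrow>
     mat_analytic_on n (Mplus n) f \<and>
     (\<exists>\<delta>>0. \<forall>b \<in> Mplus n. mat_norm (mat_inv b) < \<delta> \<longrightarrow>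
        (\<forall>i<n. \<forall>j<n. (\<lambda>k. cauchy_term \<sigma> b k $$ (i, j)) sums (f b $$ (i, j))))"

text \<open>
  The value at \<open>b\<close> of the analytic continuation, which is unique because \<open>Mplus n\<close> is convex.
\<close>

definition cauchy_transform :: "('b::cstar_algebra ncpoly \<Rightarrow> 'b) \<Rightarrow> 'b mat \<Rightarrow> 'b mat" where
  "cauchy_transform \<sigma> b = (THE w. \<exists>f. continues_cauchy_series \<sigma> (dim_row b) f \<and> w = f b)"

definition is_cp_transform ::
  "('b::cstar_algebra ncpoly \<Rightarrow> 'b) \<Rightarrow> ('b mat \<Rightarrow> 'b mat) \<Rightarrow> bool" where
  "is_cp_transform \<sigma> G \<longleftrightarrow>
     (\<forall>p q. \<sigma> (p + q) = \<sigma> p + \<sigma> q) \<and> (\<forall>c p. \<sigma> (c *\<^sub>C p) = c *\<^sub>C \<sigma> p) \<and>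
     completely_positive \<sigma> \<and> exponentially_bounded \<sigma> \<and>
     (\<forall>n\<ge>1. \<forall>b \<in> Mplus n. G b = cauchy_transform \<sigma> b)"

end

theory Submission
 imports Defs "HOL-Complex_Analysis.Conformal_Mappings"
begin

text \<open>
 From a map to a transform. Matrices of all sizes are handled at once in the C*-algebra of bounded
 families of matrices. A completely positive, exponentially bounded \<open>\<sigma>\<close> is a positive map on families of
 polynomial matrices, and by an iteration of \<open>2 X\<^sup>2\<^sup>k \<le> 1 + X\<^sup>4\<^sup>k\<close> the growth of its moments makes \<open>X\<close> a
 bounded operator in the Gelfand--Naimark--Segal seminorm (\<open>positive_map_exists\<close>). Hence \<open>b - X\<close> has
 an approximate inverse \<open>R\<close> for every \<open>b\<close> in the half plane, as a geometric series in the contraction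
 \<open>1 + \<i> t (b - X)\<close> (\<open>ainv_approx\<close>), and \<open>G b\<close> is the limit of \<open>\<sigma> R\<close>. It respects intertwining, is analytic by the
 resolvent identity, has \<open>- Im (G b)\<close> as the limit of \<open>\<sigma> (R\<^sup>* (Im b) R) \<ge> 0\<close>, and is the power series
 in \<open>b\<inverse>\<close> near infinity. Two-sided bounds of \<open>- Im (G b)\<close> by multiples of \<open>\<sigma> 1\<close> show that the values are in
 the open half plane if and only if \<open>\<sigma> 1\<close> is invertible (\<open>half_strict\<close>, \<open>strict_imp_invertible\<close>). That
 this function is the \<open>cauchy_transform\<close> is the identity theorem along complex lines (\<open>continuation_unique\<close>).

 From a transform to a map. A noncommutative function \<open>F\<close> on a ball respects intertwining by rectangular scalar matrices
 (\<open>nc_function_itw\<close>). With a matrix read as a weighted graph this yields rules for the entries of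
 \<open>F\<close> under coverings and rescalings of the graph, from which everything is derived. The corner of \<open>F\<close>
 at a chain with weights \<open>b\<^sub>0, \<dots>, b\<^sub>k\<close> is multilinear (\<open>coef_homogeneous\<close>, \<open>coef_add\<close>), and is taken as
 the moment \<open>\<sigma> (b\<^sub>0 X b\<^sub>1 X \<dots> X b\<^sub>k)\<close>; boundedness of \<open>F\<close> makes \<open>\<sigma>\<close> exponentially bounded. A covering by
 a tree expands \<open>F\<close> into the sum of the moments over all walks (\<open>walk_sums\<close>), which is the geometric
 series of the transform. For complete positivity, the moments of \<open>P\<^sub>i P\<^sub>j\<^sup>*\<close> are read off from the upper
 right corner of \<open>F\<close> at a block matrix \<open>[[U, D], [0, U\<^sup>*]]\<close> with \<open>D \<ge> 0\<close>, where \<open>U\<close> consists of chains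
 (\<open>word_kernel_small\<close>). For blocks \<open>X\<close>, \<open>- Im X\<close> and \<open>X\<^sup>*\<close> this corner is the difference quotient
 \<open>- Im (F X) \<ge> 0\<close> (\<open>corner_eq_Im\<close>), and a rescaling deforms these into the former (\<open>block_positive\<close>).
\<close>

hide_const (open) Finite_Cartesian_Product.mat Finite_Cartesian_Product.vec Finite_Cartesian_Product.row
 Finite_Cartesian_Product.column Finite_Cartesian_Product.transpose Determinants.det Old_Datatype.dsum
hide_fact (open) Old_Datatype.dsum_def
hide_type (open) Finite_Cartesian_Product.vec
unbundle no vec_syntax

section \<open>Square roots in Banach algebras\<close>

text \<open>The coefficients of the power series of \<open>sqrt (1 - x)\<close>.\<close>

definition root_coeff :: "nat => real" where
 "root_coeff k = (-1) ^ k * ((1/2) gchoose k)"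

lemma root_coeff_0: "root_coeff 0 = 1"
 by (simp add: root_coeff_def)

lemma root_coeff_convolution:
 "(\<Sum>i\<le>k. root_coeff i * root_coeff (k - i)) = (if k = 0 then 1 else if k = 1 then -1 else 0)"
proof -
 have "(\<Sum>i\<le>k. root_coeff i * root_coeff (k - i))
   = (\<Sum>i\<le>k. (-1) ^ k * (((1/2) gchoose i) * ((1/2::real) gchoose (k - i))))"
 proof (rule sum.cong)
  fix i assume "i \<in> {..k}"
  then have "(-1::real) ^ k = (-1) ^ i * (-1) ^ (k - i)"
   by (simp flip: power_add)
  then show "root_coeff i * root_coeff (k - i)
    = (-1) ^ k * (((1/2) gchoose i) * ((1/2) gchoose (k - i)))"
   by (simp add: root_coeff_def)
 qed simp
 also have "\<dots> = (-1) ^ k * ((1/2 + 1/2 :: real) gchoose k)"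
  by (subst gbinomial_Vandermonde [symmetric]) (simp add: sum_distrib_left atLeast0AtMost)
 also have "(1/2 + 1/2 :: real) gchoose k = of_nat (1 choose k)"
  by (simp add: binomial_gbinomial)
 finally show ?thesis
  by (cases k rule: nat.exhaust; cases "k = 1") (auto simp: binomial_eq_0)
qed

lemma root_coeff_nonpos: "root_coeff (Suc k) \<le> 0"
proof (induction k)
 case 0
 then show ?case by (simp add: root_coeff_def)
next
 case (Suc k)
 have "((1/2::real) gchoose Suc (Suc k)) * (2 + real k) = ((1/2) gchoose Suc k) * (1/2 - (real k + 1))"
  using gbinomial_absorb_comp [of "1/2::real" "Suc k"] gbinomial_absorption [of "Suc k" "1/2::real"]
  by (simp add: mult.commute)
 then have "(-1) ^ k * (((1/2::real) gchoose Suc (Suc k)) * (2 + real k))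
   = (-1) ^ k * (((1/2) gchoose Suc k) * (1/2 - (real k + 1)))" by simp
 then have "root_coeff (Suc (Suc k)) * (2 + real k) = root_coeff (Suc k) * (real k + 1/2)"
  by (simp add: root_coeff_def algebra_simps)
 moreover have "root_coeff (Suc k) * (real k + 1/2) \<le> 0"
  using Suc by (simp add: mult_le_0_iff)
 ultimately have "root_coeff (Suc (Suc k)) * (2 + real k) \<le> 0" by simp
 then show ?case by (simp add: mult_le_0_iff)
qed

text \<open>
 Except for the first, all coefficients are nonpositive, so a partial sum of their absolute values
 is the limit, as \<open>x\<close> increases to \<open>1\<close>, of a partial sum of \<open>1 - sqrt (1 - x)\<close>, which is at most \<open>1\<close>.
\<close>

lemma root_coeff_sum_le: "(\<Sum>k<n. \<bar>root_coeff (Suc k)\<bar>) \<le> 1"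
proof -
 have *: "(\<Sum>k<n. \<bar>root_coeff (Suc k)\<bar> * x ^ Suc k) \<le> 1" if x: "0 < x" "x < 1" for x :: real
 proof -
  have s: "(\<lambda>n. root_coeff n * x ^ n) sums (1 - x) powr (1/2)"
   using gen_binomial_real [of "- x" "1/2"] x
   by (simp add: root_coeff_def power_minus [of x] mult_ac)
  have "(\<lambda>n. root_coeff (Suc n) * x ^ Suc n) sums ((1 - x) powr (1/2) - 1)"
   using s by (subst sums_Suc_iff) (simp add: root_coeff_0)
  from sums_minus [OF this]
  have s': "(\<lambda>n. \<bar>root_coeff (Suc n)\<bar> * x ^ Suc n) sums (1 - (1 - x) powr (1/2))"
   using root_coeff_nonpos by (simp add: abs_of_nonpos)
  have "(\<Sum>k<n. \<bar>root_coeff (Suc k)\<bar> * x ^ Suc k) \<le> 1 - (1 - x) powr (1/2)"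
   using s' x by (intro sum_le_suminf [THEN order_trans [OF _ eq_refl]])
    (auto simp: sums_iff)
  also have "\<dots> \<le> 1" by simp
  finally show ?thesis .
 qed
 have "((\<lambda>x. \<Sum>k<n. \<bar>root_coeff (Suc k)\<bar> * x ^ Suc k) \<longlongrightarrow> (\<Sum>k<n. \<bar>root_coeff (Suc k)\<bar> * 1 ^ Suc k)) (at_left 1)"
  by (intro tendsto_intros)
 moreover have "eventually (\<lambda>x::real. (\<Sum>k<n. \<bar>root_coeff (Suc k)\<bar> * x ^ Suc k) \<le> 1) (at_left 1)"
  using eventually_at_left_real [of 0 1] by (rule eventually_mono) (use * in auto)
 ultimately have "(\<Sum>k<n. \<bar>root_coeff (Suc k)\<bar> * 1 ^ Suc k) \<le> 1"
  by (rule tendsto_upperbound) simp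
 then show ?thesis by simp
qed

lemma summable_root_coeff_Suc: "summable (\<lambda>k. \<bar>root_coeff (Suc k)\<bar>)"
 by (rule summableI_nonneg_bounded [where x = 1]) (use root_coeff_sum_le in auto)

lemma summable_root_coeff: "summable (\<lambda>k. \<bar>root_coeff k\<bar>)"
 using summable_root_coeff_Suc by (subst (asm) summable_Suc_iff)

lemma suminf_root_coeff_le: "suminf (\<lambda>k. \<bar>root_coeff (Suc k)\<bar>) \<le> 1"
 using summable_root_coeff_Suc root_coeff_sum_le by (rule suminf_le_const)

definition root_one_minus :: "'a::{real_normed_algebra_1, banach} => 'a" where
 "root_one_minus x = suminf (\<lambda>k. root_coeff k *\<^sub>R x ^ k)"

lemma summable_root_series:
 fixes x :: "'a::{real_normed_algebra_1, banach}"
 assumes "norm x \<le> 1"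
 shows "summable (\<lambda>k. norm (root_coeff k *\<^sub>R x ^ k))"
proof (rule summable_comparison_test [OF _ summable_root_coeff], intro exI allI impI)
 fix n
 have "norm (x ^ n) \<le> norm x ^ n" by (rule norm_power_ineq)
 also have "\<dots> \<le> 1" using assms by (intro power_le_one) auto
 finally show "norm (norm (root_coeff n *\<^sub>R x ^ n)) \<le> \<bar>root_coeff n\<bar>"
  by (simp add: mult_left_le)
qed

lemma root_one_minus_square:
 fixes x :: "'a::{real_normed_algebra_1, banach}"
 assumes "norm x \<le> 1"
 shows "root_one_minus x * root_one_minus x = 1 - x"
proof -
 have conv: "(\<Sum>i\<le>k. (root_coeff i *\<^sub>R x ^ i) * (root_coeff (k - i) *\<^sub>R x ^ (k - i)))
   = (if k = 0 then 1 else if k = 1 then - x else 0)" for k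
 proof -
  have "(\<Sum>i\<le>k. (root_coeff i *\<^sub>R x ^ i) * (root_coeff (k - i) *\<^sub>R x ^ (k - i)))
    = (\<Sum>i\<le>k. (root_coeff i * root_coeff (k - i)) *\<^sub>R x ^ k)"
   by (intro sum.cong) (auto simp flip: power_add)
  also have "\<dots> = (\<Sum>i\<le>k. root_coeff i * root_coeff (k - i)) *\<^sub>R x ^ k"
   by (simp add: scaleR_sum_left)
  finally show ?thesis by (simp add: root_coeff_convolution)
 qed
 have "(\<lambda>k. if k = 0 then 1 else if k = 1 then - x else 0) sums (root_one_minus x * root_one_minus x)"
  using Cauchy_product_sums [OF summable_root_series [OF assms] summable_root_series [OF assms]]
  unfolding conv root_one_minus_def .
 moreover have "(\<lambda>k. if k = 0 then 1 else if k = 1 then - x else 0) sums (\<Sum>k\<in>{0,1::nat}. if k = 0 then 1 else if k = 1 then - x else 0)"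
  by (rule sums_finite) auto
 ultimately show ?thesis
  using sums_unique2 by fastforce
qed

lemma root_one_minus_commute:
 fixes x y :: "'a::{real_normed_algebra_1, banach}"
 assumes "norm x \<le> 1" "x * y = y * x"
 shows "root_one_minus x * y = y * root_one_minus x"
proof -
 have sm: "summable (\<lambda>k. root_coeff k *\<^sub>R x ^ k)"
  using summable_root_series [OF assms(1)] by (rule summable_norm_cancel)
 have "root_one_minus x * y = suminf (\<lambda>k. (root_coeff k *\<^sub>R x ^ k) * y)"
  unfolding root_one_minus_def using sm by (rule suminf_mult2)
 also have "\<dots> = suminf (\<lambda>k. y * (root_coeff k *\<^sub>R x ^ k))"
  using power_commuting_commutes [OF assms(2)] by simp
 also have "\<dots> = y * root_one_minus x"
  unfolding root_one_minus_def using sm by (rule suminf_mult)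
 finally show ?thesis .
qed

lemma norm_one_minus_root_one_minus:
 fixes x :: "'a::{real_normed_algebra_1, banach}"
 assumes "norm x \<le> 1"
 shows "norm (1 - root_one_minus x) \<le> 1"
proof -
 have sm: "summable (\<lambda>k. norm (root_coeff k *\<^sub>R x ^ k))"
  using assms by (rule summable_root_series)
 have smS: "summable (\<lambda>k. norm (root_coeff (Suc k) *\<^sub>R x ^ Suc k))"
  using sm by (subst summable_Suc_iff)
 have "root_one_minus x = suminf (\<lambda>k. root_coeff (Suc k) *\<^sub>R x ^ Suc k) + 1"
  unfolding root_one_minus_def
  using suminf_split_head [OF summable_norm_cancel [OF sm]] by (simp add: root_coeff_0)
 then have "norm (1 - root_one_minus x) = norm (suminf (\<lambda>k. root_coeff (Suc k) *\<^sub>R x ^ Suc k))"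
  by (simp add: norm_minus_commute)
 also have "\<dots> \<le> suminf (\<lambda>k. norm (root_coeff (Suc k) *\<^sub>R x ^ Suc k))"
  by (rule summable_norm [OF smS])
 also have "\<dots> \<le> suminf (\<lambda>k. \<bar>root_coeff (Suc k)\<bar>)"
 proof (rule suminf_le [OF _ smS])
  fix k
  have "norm (x ^ Suc k) \<le> norm x ^ Suc k" by (rule norm_power_ineq)
  also have "\<dots> \<le> 1" using assms by (intro power_le_one) auto
  finally show "norm (root_coeff (Suc k) *\<^sub>R x ^ Suc k) \<le> \<bar>root_coeff (Suc k)\<bar>"
   by (simp add: mult_left_le del: power_Suc)
 qed (rule summable_root_coeff_Suc)
 also have "\<dots> \<le> 1" by (rule suminf_root_coeff_le)
 finally show ?thesis .
qed

section \<open>Positivity in C*-algebras\<close>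

abbreviation self_adj :: "'a::star => bool" where
 "self_adj a \<equiv> star a = a"

lemma star_minus [simp]: "star (- x) = - star (x::'a::complex_star_algebra)"
 by (metis add_eq_0_iff star_add star_zero)

lemma star_diff: "star (x - y) = star x - star (y::'a::complex_star_algebra)"
 by (simp only: diff_conv_add_uminus star_add star_minus)

lemma star_sum: "star (sum f A) = (\<Sum>x\<in>A. star (f x :: 'a::complex_star_algebra))"
 by (induction A rule: infinite_finite_induct) (simp_all add: star_add)

lemma star_power: "star (x ^ n) = star (x::'a::complex_star_algebra) ^ n"
 by (induction n) (simp_all add: star_mult power_commutes)

lemma scaleC_minus_left: "(- c) *\<^sub>C x = - (c *\<^sub>C (x::'a::complex_star_algebra))"
 by (metis add_eq_0_iff ab_left_minus scaleC_add_left scaleC_zero_left)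

lemma scaleC_minus_right: "c *\<^sub>C (- x) = - (c *\<^sub>C (x::'a::complex_star_algebra))"
 by (metis add_eq_0_iff ab_left_minus scaleC_add_right scaleC_zero_right)

lemma scaleC_diff_right: "c *\<^sub>C (x - y) = c *\<^sub>C x - c *\<^sub>C (y::'a::complex_star_algebra)"
 by (simp only: diff_conv_add_uminus scaleC_add_right scaleC_minus_right)

lemma scaleC_diff_left: "(c - d) *\<^sub>C x = c *\<^sub>C x - d *\<^sub>C (x::'a::complex_star_algebra)"
 by (simp only: diff_conv_add_uminus scaleC_add_left scaleC_minus_left)

lemmas scaleC_simps = mult_scaleC_left mult_scaleC_right scaleC_scaleC scaleC_minus_left
 scaleC_minus_right scaleC_one scaleC_add_right scaleC_diff_right

lemma star_scaleR: "star (r *\<^sub>R x) = r *\<^sub>R star (x::'a::cstar_algebra)"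
 by (simp add: scaleR_scaleC star_scaleC)

lemma norm_star [simp]: "norm (star x) = norm (x::'a::cstar_algebra)"
proof -
 have *: "norm y \<le> norm (star y)" for y :: 'a
 proof (cases "y = 0")
  case False
  have "norm y * norm y \<le> norm (star y) * norm y"
   using norm_mult_ineq [of "star y" y] by (simp add: cstar_identity power2_eq_square)
  then show ?thesis using False by simp
 qed simp
 show ?thesis using * [of x] * [of "star x"] by (simp add: star_star)
qed

lemma bounded_linear_star: "bounded_linear (star :: 'a::cstar_algebra => 'a)"
 by (rule bounded_linear_intro [where K = 1]) (simp_all add: star_add star_scaleR)

lemmas tendsto_star [tendsto_intros] = bounded_linear.tendsto [OF bounded_linear_star]

lemma norm_square_self_adj: "self_adj h ==> norm (h * h) = (norm (h::'a::cstar_algebra))\<^sup>2"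
 using cstar_identity [of h] by simp

lemma self_adj_of_real [simp]: "self_adj (of_real r :: 'a::cstar_algebra)"
 by (simp add: of_real_def star_scaleR)

lemma self_adj_star_mult [simp]: "self_adj (star x * (x::'a::cstar_algebra))"
 by (simp add: star_mult star_star)

lemma self_adj_root_one_minus:
 assumes "norm (x::'a::cstar_algebra) \<le> 1" "self_adj x"
 shows "self_adj (root_one_minus x)"
proof -
 have "summable (\<lambda>k. root_coeff k *\<^sub>R x ^ k)"
  using summable_root_series [OF assms(1)] by (rule summable_norm_cancel)
 from bounded_linear.suminf [OF bounded_linear_star this]
 show ?thesis
  by (simp add: root_one_minus_def star_scaleR star_power assms(2))
qed

text \<open>
 A working description of the positive elements, for which the convex cone axioms and the existence
 of roots are immediate. That it contains every \<open>star c * c\<close> is the Kelley--Vaught theorem below.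
\<close>

definition psd :: "'a::cstar_algebra => bool" where
 "psd a \<longleftrightarrow> self_adj a \<and> (\<exists>t\<ge>0. norm (of_real t - a) \<le> t)"

lemma psdI: "self_adj a ==> norm (of_real t - a) \<le> t ==> psd a"
 unfolding psd_def by (intro conjI exI [of _ t]) (auto intro: order_trans [OF norm_ge_zero])

lemma psd_self_adj: "psd a ==> self_adj a"
 by (simp add: psd_def)

lemma psd_add: "psd a ==> psd b ==> psd (a + b)"
proof -
 assume "psd a" "psd b"
 then obtain s t where st: "self_adj a" "self_adj b" "norm (of_real s - a) \<le> s" "norm (of_real t - b) \<le> t"
  unfolding psd_def by auto
 have "norm (of_real (s + t) - (a + b)) \<le> norm (of_real s - a) + norm (of_real t - b)"
  using norm_triangle_ineq [of "of_real s - a" "of_real t - b"] by (simp add: algebra_simps)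
 with st show ?thesis by (intro psdI [where t = "s + t"]) (auto simp: star_add)
qed

lemma psd_scaleR:
 assumes "psd a" "0 \<le> r"
 shows "psd (r *\<^sub>R a)"
proof -
 obtain t where t: "self_adj a" "norm (of_real t - a) \<le> t"
  using assms unfolding psd_def by auto
 have "of_real (r * t) - r *\<^sub>R a = r *\<^sub>R (of_real t - a)"
  by (simp add: scaleR_diff_right of_real_def)
 then have "norm (of_real (r * t) - r *\<^sub>R a) \<le> r * t"
  using t assms by (simp add: mult_left_mono)
 with t show ?thesis by (intro psdI [where t = "r * t"]) (auto simp: star_scaleR)
qed

lemma psd_norm_minus:
 assumes "self_adj a" "norm a \<le> t"
 shows "psd (of_real t - a)"
 by (rule psdI [where t = t]) (use assms in \<open>auto simp: star_diff\<close>)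

lemma psd_of_real: "0 \<le> t ==> psd (of_real t)"
 by (rule psdI [where t = t]) auto

lemma psd_0 [simp]: "psd 0"
 using psd_of_real [of 0] by simp

text \<open>Every element of the cone has a root which commutes with whatever the element commutes with.\<close>

lemma psd_root:
 assumes "psd a"
 obtains h where "self_adj h" "psd h" "h * h = a" "\<And>y. a * y = y * a ==> h * y = y * h"
proof -
 obtain t where t: "self_adj a" "t \<ge> 0" "norm (of_real t - a) \<le> t"
  using assms unfolding psd_def by auto
 show ?thesis
 proof (cases "t = 0")
  case True
  then have "a = 0" using t by simp
  then show ?thesis using that [of 0] by simp
 next
  case False
  define x where "x = 1 - (1/t) *\<^sub>R a"
  have "x = (1/t) *\<^sub>R (of_real t - a)"
   using False by (simp add: x_def scaleR_diff_right of_real_def)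
  then have nx: "norm x \<le> 1" using t False by (simp add: divide_le_eq)
  have sx: "self_adj x" using t by (simp add: x_def star_diff star_scaleR)
  define h where "h = sqrt t *\<^sub>R root_one_minus x"
  have "h * h = t *\<^sub>R (root_one_minus x * root_one_minus x)"
   using t by (simp add: h_def)
  then have "h * h = a"
   using False unfolding root_one_minus_square [OF nx] by (simp add: x_def)
  moreover have "self_adj h"
   by (simp add: h_def star_scaleR self_adj_root_one_minus [OF nx sx])
  moreover have "psd h"
   unfolding h_def using t
   by (intro psd_scaleR psdI [where t = 1])
    (auto simp: self_adj_root_one_minus [OF nx sx] norm_one_minus_root_one_minus [OF nx])
  moreover have "h * y = y * h" if "a * y = y * a" for y
   using root_one_minus_commute [OF nx, of y] that
   by (simp add: h_def x_def algebra_simps)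
  ultimately show ?thesis using that by blast
 qed
qed

lemma norm_le_of_square_sum:
 fixes h k :: "'a::cstar_algebra"
 assumes "self_adj h" "self_adj k" "h * k = k * h" "h * h + k * k = of_real t" "t \<ge> 0"
 shows "norm (h * h) \<le> t"
proof -
 define u where "u = h + \<i> *\<^sub>C k"
 have su: "star u = h - \<i> *\<^sub>C k"
  by (simp add: u_def star_add star_scaleC assms scaleC_minus_left)
 have "star u * u = of_real t"
  unfolding su using assms(3,4) by (simp add: u_def algebra_simps scaleC_simps)
 then have nu: "(norm u)\<^sup>2 = t" using cstar_identity [of u] assms by simp
 have "2 *\<^sub>R h = u + star u" by (simp add: su) (simp add: u_def scaleR_2)
 then have "2 * norm h \<le> 2 * norm u"
  using norm_triangle_ineq [of u "star u"] norm_scaleR [of 2 h] by simp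
 then have "(norm h)\<^sup>2 \<le> t" using nu by (simp add: power_mono flip: nu)
 then show ?thesis by (simp add: norm_square_self_adj assms)
qed

text \<open>The commuting roots of \<open>a\<close> and \<open>r - a\<close> are the real and imaginary parts of an element of norm \<open>sqrt r\<close>.\<close>

lemma psd_norm_le:
 assumes "psd a" "psd (of_real r - a)" "r \<ge> 0"
 shows "norm a \<le> r"
proof -
 obtain h where h: "self_adj h" "h * h = a" "\<And>y. a * y = y * a ==> h * y = y * h"
  using psd_root [OF assms(1)] by metis
 obtain k where k: "self_adj k" "k * k = of_real r - a"
  "\<And>y. (of_real r - a) * y = y * (of_real r - a) ==> k * y = y * k"
  using psd_root [OF assms(2)] by metis
 have "a * h = h * a" using h(2) by (metis mult.assoc)
 then have "k * h = h * k"
  by (intro k(3)) (simp add: algebra_simps of_real_def)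
 then show ?thesis
  using norm_le_of_square_sum [of h k r] h(1,2) k(1,2) assms(3) by simp
qed

lemma psd_square:
 assumes "self_adj h"
 shows "norm (of_real ((norm h)\<^sup>2) - h * h) \<le> (norm (h::'a::cstar_algebra))\<^sup>2"
proof -
 have "norm (h * h) = (norm h)\<^sup>2" using assms by (rule norm_square_self_adj)
 then have p: "psd (of_real ((norm h)\<^sup>2) - h * h)"
  using assms by (intro psd_norm_minus) (auto simp: star_mult)
 obtain k where k: "self_adj k" "k * k = of_real ((norm h)\<^sup>2) - h * h"
  "\<And>y. (of_real ((norm h)\<^sup>2) - h * h) * y = y * (of_real ((norm h)\<^sup>2) - h * h) ==> k * y = y * k"
  using psd_root [OF p] by metis
 have "k * h = h * k"
  by (rule k(3)) (simp add: algebra_simps of_real_def)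
 then show ?thesis
  using norm_le_of_square_sum [of k h "(norm h)\<^sup>2"] assms k(1,2) by simp
qed

lemma psd_square': "self_adj h ==> psd (h * (h::'a::cstar_algebra))"
 by (rule psdI [OF _ psd_square]) (simp_all add: star_mult)

lemma psd_norm_bound:
 assumes "psd a"
 shows "norm (of_real (norm a) - a) \<le> norm a"
proof -
 obtain h where h: "self_adj h" "h * h = a"
  using psd_root [OF assms] by metis
 show ?thesis using psd_square [OF h(1)] norm_square_self_adj [OF h(1)] h by simp
qed

lemma psd_limit:
 assumes "\<And>n. psd (f n)" "f \<longlonglongrightarrow> a"
 shows "psd a"
proof (rule psdI [where t = "norm a"])
 have "(\<lambda>n. star (f n)) \<longlonglongrightarrow> star a" by (intro tendsto_intros assms)
 then have "f \<longlonglongrightarrow> star a" using assms by (simp add: psd_self_adj)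
 then show "self_adj a" using assms LIMSEQ_unique by blast
 have "(\<lambda>n. norm (of_real (norm (f n)) - f n)) \<longlonglongrightarrow> norm (of_real (norm a) - a)"
  by (intro tendsto_intros assms)
 moreover have "(\<lambda>n. norm (f n)) \<longlonglongrightarrow> norm a" by (intro tendsto_intros assms)
 ultimately show "norm (of_real (norm a) - a) \<le> norm a"
  by (rule LIMSEQ_le) (use assms psd_norm_bound in blast)
qed

text \<open>
 The root of \<open>a\<close> commutes with \<open>h\<close> too, so that \<open>h a h\<close> is a square.
\<close>

lemma psd_mult_commute:
 assumes "psd a" "self_adj h" "a * h = h * a"
 shows "psd (h * a * h)"
proof -
 obtain g where g: "self_adj g" "g * g = a" "\<And>y. a * y = y * a ==> g * y = y * g"
  using psd_root [OF assms(1)] by metis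
 have gh: "g * h = h * g" by (rule g(3) [OF assms(3)])
 have "h * a * h = (g * h) * (g * h)"
  using gh g(2) by (metis mult.assoc)
 moreover have "self_adj (g * h)" using gh g(1) assms(2) by (simp add: star_mult)
 ultimately show ?thesis using psd_square' by metis
qed

text \<open>
 Conjugation of \<open>y \<le> norm y\<close> with the root of \<open>e\<close>, which commutes with \<open>y\<close>.
\<close>

lemma psd_invertible_ge:
 assumes "psd e" "e * y = 1" "y * e = 1"
 shows "psd (e - of_real (1 / norm (y::'a::cstar_algebra)))"
proof -
 obtain h where h: "self_adj h" "h * h = e" "\<And>y. e * y = y * e ==> h * y = y * h"
  using psd_root [OF assms(1)] by metis
 have y0: "norm y > 0" using assms by auto
 have "star y = star y * (e * y)" using assms by simp
 also have "\<dots> = star (e * y) * y" by (simp add: star_mult psd_self_adj [OF assms(1)] mult.assoc)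
 also have "\<dots> = y" using assms by simp
 finally have sy: "self_adj y" .
 have hy: "h * y = y * h" using assms h(3) by simp
 have "psd (of_real (norm y) - y)" using sy by (intro psd_norm_minus) auto
 moreover have "(of_real (norm y) - y) * h = h * (of_real (norm y) - y)"
  using hy by (simp add: algebra_simps of_real_def)
 ultimately have "psd (h * (of_real (norm y) - y) * h)"
  using h(1) by (intro psd_mult_commute)
 moreover have "h * (of_real (norm y) - y) * h = norm y *\<^sub>R e - 1"
 proof -
  have "h * y * h = y * (h * h)" using hy by (simp add: mult.assoc)
  then have "h * y * h = 1" using assms h(2) by simp
  then show ?thesis using h(2) by (simp add: algebra_simps of_real_def)
 qed
 ultimately have "psd ((1 / norm y) *\<^sub>R (norm y *\<^sub>R e - 1))"
  by (intro psd_scaleR) auto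
 then show ?thesis using y0 by (simp add: scaleR_diff_right of_real_def)
qed

text \<open>The top of the spectrum of a positive element is its norm.\<close>

lemma norm_minus_psd_not_invertible:
 assumes "psd (a::'a::cstar_algebra)" "(of_real (norm a) - a) * y = 1" "y * (of_real (norm a) - a) = 1"
 shows "a = 0"
proof (rule ccontr)
 assume "a \<noteq> 0"
 define d where "d = min (1 / norm y) (norm a)"
 have "y \<noteq> 0" using assms by auto
 then have d: "d > 0" using \<open>a \<noteq> 0\<close> by (simp add: d_def)
 have sa: "self_adj a" using assms psd_self_adj by blast
 have "psd (of_real (norm a) - a)" using sa by (rule psd_norm_minus) simp
 then have "psd (of_real (norm a) - a - of_real (1 / norm y))"
  using assms by (intro psd_invertible_ge)
 then have "psd (of_real (norm a) - a - of_real (1 / norm y) + of_real (1 / norm y - d))"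
  by (intro psd_add psd_of_real) (auto simp: d_def)
 then have "psd (of_real (norm a - d) - a)" by (simp add: algebra_simps)
 then have "norm a \<le> norm a - d" using assms by (intro psd_norm_le) (auto simp: d_def)
 with d show False by simp
qed

lemma psd_one_plus_invertible:
 assumes "psd (a::'a::cstar_algebra)"
 obtains y where "(1 + a) * y = 1" "y * (1 + a) = 1"
proof -
 define t where "t = norm a + 1"
 define x where "x = (1 / t) *\<^sub>R (of_real (norm a) - a)"
 have t: "t > 0" using norm_ge_zero [of a] unfolding t_def by linarith
 have "norm x \<le> norm a / t" using psd_norm_bound [OF assms] t by (simp add: x_def divide_right_mono)
 also have "\<dots> < 1" using t by (simp add: t_def)
 finally have nx: "norm x < 1" .
 have eq: "1 + a = t *\<^sub>R (1 - x)"
  using t by (simp add: x_def scaleR_diff_right) (simp add: t_def scaleR_add_left of_real_def)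
 define z where "z = suminf (\<lambda>n. x ^ n)"
 have sm: "summable (\<lambda>n. x ^ n)" by (rule complete_algebra_summable_geometric [OF nx])
 have z1: "x * z = z - 1"
  using suminf_mult [OF sm, of x] suminf_split_head [OF sm] by (simp add: z_def)
 have z2: "z * x = z - 1"
  using suminf_mult2 [OF sm, of x] suminf_split_head [OF sm] by (simp add: z_def power_commutes)
 show ?thesis
  using z1 z2 t by (intro that [of "(1 / t) *\<^sub>R z"]) (simp_all add: eq algebra_simps)
qed

text \<open>
 \<open>w w\<^sup>*\<close> and \<open>w\<^sup>* w\<close> have the same spectrum up to \<open>0\<close>. Here this is the passage from an inverse \<open>y\<close>
 of \<open>1 + w w\<^sup>*\<close> to the inverse \<open>1 - w\<^sup>* y w\<close> of \<open>1 + w\<^sup>* w\<close>.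
\<close>

lemma star_mult_nonpos_eq_0:
 assumes "psd (w * star w)" "psd (- (star w * (w::'a::cstar_algebra)))"
 shows "w = 0"
proof (rule ccontr)
 assume "w \<noteq> 0"
 define a where "a = - (star w * w)"
 define s where "s = norm a"
 have s: "s > 0" using \<open>w \<noteq> 0\<close> by (simp add: s_def a_def cstar_identity)
 define v where "v = (1 / sqrt s) *\<^sub>R w"
 have vv: "star v * v = (1/s) *\<^sub>R (star w * w)" "v * star v = (1/s) *\<^sub>R (w * star w)"
  using s by (simp_all add: v_def star_scaleR)
 have "psd (v * star v)" unfolding vv using assms s by (intro psd_scaleR) auto
 then obtain y where y: "(1 + v * star v) * y = 1" "y * (1 + v * star v) = 1"
  using psd_one_plus_invertible by metis
 define z where "z = 1 - star v * y * v"
 have y1: "v * star v * y = 1 - y" using y(1) by (simp add: algebra_simps)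
 have y2: "y * v * star v = 1 - y" using y(2) by (simp add: algebra_simps)
 have z1: "(1 + star v * v) * z = 1"
 proof -
  have "star v * (v * star v * y) * v = star v * v - star v * y * v"
   unfolding y1 by (simp add: algebra_simps)
  then show ?thesis by (simp add: z_def algebra_simps)
 qed
 have z2: "z * (1 + star v * v) = 1"
 proof -
  have "star v * (y * v * star v) * v = star v * v - star v * y * v"
   unfolding y2 by (simp add: algebra_simps)
  then show ?thesis by (simp add: z_def algebra_simps)
 qed
 have eq: "of_real s - a = s *\<^sub>R (1 + star v * v)"
  using s by (simp add: vv scaleR_add_right a_def of_real_def)
 have "a = 0"
 proof (rule norm_minus_psd_not_invertible [of a "(1/s) *\<^sub>R z"])
  show "psd a" using assms by (simp add: a_def)
  show "(of_real (norm a) - a) * (1/s) *\<^sub>R z = 1" "(1/s) *\<^sub>R z * (of_real (norm a) - a) = 1"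
   using z1 z2 s eq unfolding s_def [symmetric] by simp_all
 qed
 then show False using s by (simp add: s_def)
qed

text \<open>
 With the modulus \<open>m\<close> of \<open>a = c\<^sup>* c\<close> and \<open>y = m - a\<close>, the element \<open>w = c y\<close> satisfies
 \<open>w\<^sup>* w = - y\<^sup>3 / 2\<close>, which is nonpositive, so \<open>w w\<^sup>*\<close> is nonnegative because \<open>w\<^sup>* w + w w\<^sup>*\<close> is.
\<close>

theorem psd_star_mult: "psd (star c * (c::'a::cstar_algebra))"
proof -
 define a where "a = star c * c"
 have sa: "self_adj a" by (simp add: a_def)
 obtain m where m: "self_adj m" "psd m" "m * m = a * a" "\<And>y. a * a * y = y * (a * a) ==> m * y = y * m"
  using psd_root [OF psd_square' [OF sa]] by metis
 have ma: "m * a = a * m" by (rule m(4)) (simp add: mult.assoc)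
 define y where "y = m - a"
 have sy: "self_adj y" by (simp add: y_def star_diff sa m(1))
 have my: "m * y = y * m" by (simp add: y_def algebra_simps ma)
 have yy: "y * y = 2 *\<^sub>R (m * y)"
  by (simp add: y_def algebra_simps ma m(3) scaleR_2)
 have ay: "a * y = - (1/2) *\<^sub>R (y * y)"
 proof -
  have "a * y = m * y - y * y" by (simp add: y_def algebra_simps)
  then show ?thesis by (simp add: yy) (simp add: scaleR_2)
 qed
 define w where "w = c * y"
 have w: "- (star w * w) = (1/2) *\<^sub>R (y * y * y)"
 proof -
  have "star w * w = y * (a * y)" by (simp add: w_def star_mult sy a_def mult.assoc)
  then show ?thesis by (simp add: ay mult.assoc)
 qed
 have "y * y * y = 2 *\<^sub>R (y * m * y)"
  using arg_cong [OF yy, of "(*) y"] by (simp add: mult.assoc)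
 then have "psd (y * y * y)"
  using psd_mult_commute [OF m(2) sy my] psd_scaleR [of "y * m * y" 2] by simp
 then have n: "psd (- (star w * w))" unfolding w by (intro psd_scaleR) auto
 define p q where "p = w + star w" and "q = \<i> *\<^sub>C (star w - w)"
 have sp: "self_adj p" "self_adj q"
  by (simp_all add: p_def q_def star_add star_star star_scaleC star_diff scaleC_minus_left scaleC_diff_right)
 have "p * p + q * q = 2 *\<^sub>R (star w * w + w * star w)"
  by (simp add: p_def q_def algebra_simps scaleC_simps scaleR_2)
 then have "w * star w = (1/2) *\<^sub>R (p * p + q * q) + - (star w * w)" by simp
 moreover have "psd \<dots>"
  by (intro psd_add psd_scaleR psd_square' sp n) auto
 ultimately have "psd (w * star w)" by simp
 then have "w = 0" using n star_mult_nonpos_eq_0 by blast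
 then have "y * y * y = 0" using w by simp
 then have "norm ((y * y) * (y * y)) = 0" by (simp flip: mult.assoc)
 then have "y = 0" using sy by (simp add: norm_square_self_adj star_mult)
 then show ?thesis using m(2) by (simp add: y_def a_def)
qed

lemma psd_iff: "psd a \<longleftrightarrow> (\<exists>c. a = star c * c)"
 using psd_star_mult psd_root by metis

lemma psd_congruence:
 assumes "psd a"
 shows "psd (star x * a * x)"
proof -
 obtain c where "a = star c * c" using assms psd_iff by blast
 then have "star x * a * x = star (c * x) * (c * x)" by (simp add: star_mult mult.assoc)
 then show ?thesis by (simp only: psd_star_mult)
qed

lemma psd_norm_mono:
 assumes "psd a" "psd (b - a)"
 shows "norm a \<le> norm b"
proof -
 have "psd (b - a + a)" using assms by (intro psd_add)
 then have "self_adj b" using psd_self_adj by fastforce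
 then have "psd (of_real (norm b) - b + (b - a))" using assms by (intro psd_add psd_norm_minus) auto
 then show ?thesis using assms by (intro psd_norm_le) auto
qed

lemma psd_norm_square_minus: "psd (of_real ((norm x)\<^sup>2) - star x * x)"
 by (rule psd_norm_minus) (auto simp: cstar_identity)

section \<open>The matrix algebras over a C*-algebra\<close>

lemma scaleC_sum_right: "c *\<^sub>C sum f I = (\<Sum>j\<in>I. c *\<^sub>C (f j :: 'b::complex_star_algebra))"
 by (induction I rule: infinite_finite_induct) (simp_all add: scaleC_add_right)

lemma psd_sum: "(\<And>i. i \<in> I ==> psd (f i)) ==> psd (sum f I)"
 by (induction I rule: infinite_finite_induct) (auto intro: psd_add)

lemma norm_psd_sum_ge:
 assumes "finite I" "j \<in> I" "\<And>i. i \<in> I ==> psd (f i)"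
 shows "norm (f j) \<le> norm (sum f I :: 'b::cstar_algebra)"
proof (rule psd_norm_mono)
 have "sum f I - f j = sum f (I - {j})" using assms by (simp add: sum_diff1)
 moreover have "psd (sum f (I - {j}))" by (rule psd_sum) (use assms in auto)
 ultimately show "psd (sum f I - f j)" by simp
qed (use assms in auto)

definition inner_on :: "'i set => ('i => 'b::cstar_algebra) => ('i => 'b) => 'b" where
 "inner_on I f g = (\<Sum>i\<in>I. star (f i) * g i)"

lemma psd_inner_on: "psd (inner_on I f f)"
 unfolding inner_on_def by (intro psd_sum psd_star_mult)

lemma star_inner_on: "star (inner_on I f g) = inner_on I g f"
 by (simp add: inner_on_def star_sum star_mult star_star)

lemma inner_on_add_left: "inner_on I (\<lambda>i. f i + g i) h = inner_on I f h + inner_on I g h"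
 by (simp add: inner_on_def star_add distrib_right sum.distrib)

lemma inner_on_add_right: "inner_on I h (\<lambda>i. f i + g i) = inner_on I h f + inner_on I h g"
 by (simp add: inner_on_def distrib_left sum.distrib)

lemma inner_on_mult_right: "inner_on I f (\<lambda>i. g i * x) = inner_on I f g * x"
 by (simp add: inner_on_def sum_distrib_right mult.assoc)

lemma inner_on_mult_left: "inner_on I (\<lambda>i. f i * x) g = star x * inner_on I f g"
 by (simp add: inner_on_def sum_distrib_left star_mult mult.assoc)

lemma norm_inner_on_ge: "finite I ==> j \<in> I ==> (norm (f j))\<^sup>2 \<le> norm (inner_on I f f)"
 unfolding inner_on_def using norm_psd_sum_ge [of I j "\<lambda>i. star (f i) * f i"]
 by (simp add: cstar_identity psd_star_mult)

text \<open>
 As in a Hilbert space, from the positivity of the inner product of \<open>f - g x / a\<close> with itself, where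
 \<open>x\<close> is the inner product of \<open>g\<close> and \<open>f\<close>. In the quadratic term the inner product of \<open>g\<close> with itself
 stands between \<open>x\<^sup>*\<close> and \<open>x\<close>; it is at most its norm \<open>a\<close>.
\<close>

lemma inner_on_Cauchy_Schwarz:
 assumes "finite I"
 shows "(norm (inner_on I f g))\<^sup>2 \<le> norm (inner_on I f f) * norm (inner_on I g g)"
proof (cases "inner_on I g g = 0")
 case True
 then have "\<And>i. i \<in> I ==> g i = 0"
  using norm_inner_on_ge [OF assms, of _ g] by simp
 then have "inner_on I f g = 0" by (simp add: inner_on_def)
 then show ?thesis by simp
next
 case False
 define a where "a = norm (inner_on I g g)"
 have a: "a > 0" using False by (simp add: a_def)
 define x where "x = inner_on I g f"
 define y where "y = - (1/a) *\<^sub>R x"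
 define P where "P = inner_on I f f - (2/a) *\<^sub>R (star x * x) + (1/a\<^sup>2) *\<^sub>R (star x * inner_on I g g * x)"
 have "inner_on I (\<lambda>i. f i + g i * y) (\<lambda>i. f i + g i * y)
   = inner_on I f f + inner_on I f g * y + star y * inner_on I g f + star y * inner_on I g g * y"
  by (simp add: inner_on_add_left inner_on_add_right inner_on_mult_left inner_on_mult_right algebra_simps)
 also have "inner_on I f g = star x" by (simp add: x_def star_inner_on)
 also have "inner_on I f f + star x * y + star y * inner_on I g f + star y * inner_on I g g * y = P"
 proof -
  have "star x * y = - ((1/a) *\<^sub>R (star x * x))" "star y * x = - ((1/a) *\<^sub>R (star x * x))"
   "star y * inner_on I g g * y = (1/a\<^sup>2) *\<^sub>R (star x * inner_on I g g * x)"
   by (simp_all add: y_def star_scaleR power2_eq_square)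
  moreover have "(2/a) *\<^sub>R (star x * x) = (1/a) *\<^sub>R (star x * x) + (1/a) *\<^sub>R (star x * x)"
   by (simp flip: scaleR_left.add)
  ultimately show ?thesis by (simp add: P_def flip: x_def)
 qed
 finally have "psd P" using psd_inner_on by metis
 moreover have "psd (star x * (of_real a - inner_on I g g) * x)"
  unfolding a_def by (intro psd_congruence psd_norm_minus) (auto simp: star_inner_on)
 ultimately have "psd (P + (1/a\<^sup>2) *\<^sub>R (star x * (of_real a - inner_on I g g) * x))"
  by (intro psd_add psd_scaleR) auto
 moreover have "P + (1/a\<^sup>2) *\<^sub>R (star x * (of_real a - inner_on I g g) * x)
   = inner_on I f f - (1/a) *\<^sub>R (star x * x)"
 proof -
  have "(1/a\<^sup>2) *\<^sub>R (star x * (of_real a - inner_on I g g) * x)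
    = (1/a) *\<^sub>R (star x * x) - (1/a\<^sup>2) *\<^sub>R (star x * inner_on I g g * x)"
   using a by (simp add: algebra_simps of_real_def power2_eq_square)
  moreover have "(2/a) *\<^sub>R (star x * x) = (1/a) *\<^sub>R (star x * x) + (1/a) *\<^sub>R (star x * x)"
   by (simp add: scaleR_left.add [symmetric])
  ultimately show ?thesis by (simp add: P_def)
 qed
 ultimately have "norm ((1/a) *\<^sub>R (star x * x)) \<le> norm (inner_on I f f)"
  using a by (intro psd_norm_mono psd_scaleR psd_star_mult) auto
 then have "(norm x)\<^sup>2 \<le> norm (inner_on I f f) * a"
  using a by (simp add: cstar_identity divide_le_eq)
 moreover have "norm x = norm (inner_on I f g)"
  unfolding x_def by (metis star_inner_on norm_star)
 ultimately show ?thesis by (simp add: a_def)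
qed

lemma hvec_norm_alt: "hvec_norm v = sqrt (norm (inner_on {..<dim_vec v} (($) v) (($) v)))"
 by (simp add: hvec_norm_def inner_on_def)

lemma hvec_norm_nonneg [simp]: "hvec_norm v \<ge> 0"
 by (simp add: hvec_norm_def)

lemma hvec_norm_power2: "(hvec_norm v)\<^sup>2 = norm (inner_on {..<dim_vec v} (($) v) (($) v))"
 by (simp add: hvec_norm_alt)

lemma norm_index_le_hvec_norm: "j < dim_vec v ==> norm (v $ j) \<le> hvec_norm v"
 using norm_inner_on_ge [of "{..<dim_vec v}" j "($) v"]
 by (simp add: hvec_norm_alt real_le_rsqrt)

lemma hvec_norm_le_sum: "hvec_norm v \<le> (\<Sum>i<dim_vec v. norm (v $ i))"
proof -
 have "(hvec_norm v)\<^sup>2 \<le> (\<Sum>i<dim_vec v. norm (star (v $ i) * v $ i))"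
  unfolding hvec_norm_power2 inner_on_def by (rule norm_sum)
 also have "\<dots> = (\<Sum>i<dim_vec v. (norm (v $ i))\<^sup>2)" by (simp add: cstar_identity)
 also have "\<dots> \<le> (\<Sum>i<dim_vec v. norm (v $ i))\<^sup>2"
 proof -
  have "(L2_set (\<lambda>i. norm (v $ i)) {..<dim_vec v})\<^sup>2 \<le> (\<Sum>i<dim_vec v. norm (v $ i))\<^sup>2"
   by (intro power_mono L2_set_le_sum L2_set_nonneg) auto
  then show ?thesis by (simp add: L2_set_def sum_nonneg)
 qed
 finally show ?thesis by (rule power2_le_imp_le) (simp add: sum_nonneg)
qed

lemma hvec_norm_add:
 assumes "v \<in> carrier_vec n" "w \<in> carrier_vec n"
 shows "hvec_norm (v + w) \<le> hvec_norm v + hvec_norm w"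
proof -
 let ?i = "\<lambda>v w. inner_on {..<n} (($) v) (($) w)"
 have cs: "norm (?i v w) \<le> hvec_norm v * hvec_norm w" if "v \<in> carrier_vec n" "w \<in> carrier_vec n" for v w
  using inner_on_Cauchy_Schwarz [of "{..<n}" "($) v" "($) w"] that
  by (simp add: hvec_norm_alt carrier_vecD real_le_rsqrt flip: real_sqrt_mult)
 have "?i (v + w) (v + w) = inner_on {..<n} (\<lambda>i. v $ i + w $ i) (\<lambda>i. v $ i + w $ i)"
  using assms by (auto simp: inner_on_def)
 then have eq: "?i (v + w) (v + w) = ?i v v + ?i v w + ?i w v + ?i w w"
  by (simp add: inner_on_add_left inner_on_add_right)
 have "(hvec_norm (v + w))\<^sup>2 = norm (?i v v + ?i v w + ?i w v + ?i w w)"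
  using assms eq by (simp add: hvec_norm_power2 carrier_vecD)
 also have "\<dots> \<le> norm (?i v v) + norm (?i v w) + norm (?i w v) + norm (?i w w)"
  by (intro norm_triangle_le add_mono order_refl norm_triangle_ineq)
 also have "\<dots> \<le> (hvec_norm v)\<^sup>2 + hvec_norm v * hvec_norm w + hvec_norm w * hvec_norm v + (hvec_norm w)\<^sup>2"
  using assms by (intro add_mono cs) (simp_all add: hvec_norm_power2 carrier_vecD)
 also have "\<dots> = (hvec_norm v + hvec_norm w)\<^sup>2" by (simp add: power2_eq_square algebra_simps)
 finally show ?thesis by (rule power2_le_imp_le) simp
qed

lemma hvec_norm_scaleC: "hvec_norm (map_vec (scaleC c) v) = cmod c * hvec_norm v"
proof -
 have "inner_on {..<dim_vec v} (($) (map_vec (scaleC c) v)) (($) (map_vec (scaleC c) v))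
   = (cnj c * c) *\<^sub>C inner_on {..<dim_vec v} (($) v) (($) v)"
  unfolding inner_on_def
  by (simp add: star_scaleC scaleC_simps scaleC_sum_right mult.commute)
 then have "(hvec_norm (map_vec (scaleC c) v))\<^sup>2 = (cmod c * hvec_norm v)\<^sup>2"
  by (simp add: hvec_norm_power2 norm_scaleC norm_mult power_mult_distrib)
   (simp add: power2_eq_square)
 then show ?thesis by (simp add: power2_eq_iff_nonneg)
qed

lemma index_mult_mat_vec': "i < dim_row A ==> v \<in> carrier_vec (dim_col A) ==>
  (A *\<^sub>v v) $ i = (\<Sum>j<dim_col A. A $$ (i, j) * v $ j)"
 by (simp add: scalar_prod_def lessThan_atLeast0 carrier_vecD)

lemma hvec_norm_mult_le_entries:
 assumes "v \<in> carrier_vec (dim_col A)"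
 shows "hvec_norm (A *\<^sub>v v) \<le> (\<Sum>i<dim_row A. \<Sum>j<dim_col A. norm (A $$ (i, j))) * hvec_norm v"
proof -
 have "hvec_norm (A *\<^sub>v v) \<le> (\<Sum>i<dim_row A. norm ((A *\<^sub>v v) $ i))"
  using hvec_norm_le_sum [of "A *\<^sub>v v"] by simp
 also have "\<dots> \<le> (\<Sum>i<dim_row A. (\<Sum>j<dim_col A. norm (A $$ (i, j)) * hvec_norm v))"
 proof (rule sum_mono)
  fix i assume "i \<in> {..<dim_row A}"
  then have "norm ((A *\<^sub>v v) $ i) = norm (\<Sum>j<dim_col A. A $$ (i, j) * v $ j)"
   using assms by (simp add: index_mult_mat_vec' del: index_mult_mat_vec)
  also have "\<dots> \<le> (\<Sum>j<dim_col A. norm (A $$ (i, j)) * norm (v $ j))"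
   by (rule order_trans [OF norm_sum]) (intro sum_mono norm_mult_ineq)
  also have "\<dots> \<le> (\<Sum>j<dim_col A. norm (A $$ (i, j)) * hvec_norm v)"
   using assms by (intro sum_mono mult_left_mono norm_index_le_hvec_norm) (auto simp: carrier_vecD)
  finally show "norm ((A *\<^sub>v v) $ i) \<le> (\<Sum>j<dim_col A. norm (A $$ (i, j)) * hvec_norm v)" .
 qed
 also have "\<dots> = (\<Sum>i<dim_row A. \<Sum>j<dim_col A. norm (A $$ (i, j))) * hvec_norm v"
  by (simp add: sum_distrib_right)
 finally show ?thesis .
qed

lemma hvec_norm_0 [simp]: "hvec_norm (0\<^sub>v n) = 0"
 by (simp add: hvec_norm_def)

lemma hvec_norm_eq_0: "hvec_norm v = 0 ==> v = 0\<^sub>v (dim_vec v)"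
 using norm_index_le_hvec_norm [of _ v] by (intro eq_vecI) auto

lemma mat_norm_set_bdd: "bdd_above {hvec_norm (A *\<^sub>v v) | v. v \<in> carrier_vec (dim_col A) \<and> hvec_norm v \<le> 1}"
proof (rule bdd_aboveI)
 fix x assume "x \<in> {hvec_norm (A *\<^sub>v v) | v. v \<in> carrier_vec (dim_col A) \<and> hvec_norm v \<le> 1}"
 then obtain v where v: "x = hvec_norm (A *\<^sub>v v)" "v \<in> carrier_vec (dim_col A)" "hvec_norm v \<le> 1" by auto
 have "x \<le> (\<Sum>i<dim_row A. \<Sum>j<dim_col A. norm (A $$ (i, j))) * hvec_norm v"
  using hvec_norm_mult_le_entries v by simp
 also have "\<dots> \<le> (\<Sum>i<dim_row A. \<Sum>j<dim_col A. norm (A $$ (i, j))) * 1"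
  using v by (intro mult_left_mono) (auto intro!: sum_nonneg)
 finally show "x \<le> (\<Sum>i<dim_row A. \<Sum>j<dim_col A. norm (A $$ (i, j))) * 1" .
qed

lemma mat_norm_leI:
 assumes "\<And>v. v \<in> carrier_vec (dim_col A) ==> hvec_norm (A *\<^sub>v v) \<le> c * hvec_norm v" "c \<ge> 0"
 shows "mat_norm A \<le> c"
 unfolding mat_norm_def
proof (rule cSup_least)
 show "{hvec_norm (A *\<^sub>v v) |v. v \<in> carrier_vec (dim_col A) \<and> hvec_norm v \<le> 1} \<noteq> {}"
  by (auto intro!: exI [of _ "0\<^sub>v (dim_col A)"])
 fix x assume "x \<in> {hvec_norm (A *\<^sub>v v) |v. v \<in> carrier_vec (dim_col A) \<and> hvec_norm v \<le> 1}"
 then obtain v where v: "x = hvec_norm (A *\<^sub>v v)" "v \<in> carrier_vec (dim_col A)" "hvec_norm v \<le> 1" by auto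
 then show "x \<le> c" using assms(1) [of v] mult_left_le [of "hvec_norm v" c] assms(2) by simp
qed

lemma mat_norm_bound1:
 "v \<in> carrier_vec (dim_col A) ==> hvec_norm v \<le> 1 ==> hvec_norm (A *\<^sub>v v) \<le> mat_norm A"
 unfolding mat_norm_def by (rule cSup_upper [OF _ mat_norm_set_bdd]) auto

lemma mat_norm_nonneg [simp]: "mat_norm A \<ge> 0"
 using order_trans [OF hvec_norm_nonneg mat_norm_bound1 [of "0\<^sub>v (dim_col A)" A]] by simp

lemma mult_mat_vec_scaleC:
 assumes "v \<in> carrier_vec (dim_col A)"
 shows "A *\<^sub>v map_vec (scaleC c) v = map_vec (scaleC c) (A *\<^sub>v (v :: 'b::cstar_algebra vec))"
proof (rule eq_vecI)
 fix i assume "i < dim_vec (map_vec (scaleC c) (A *\<^sub>v v))"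
 then have i: "i < dim_row A" by simp
 have "map_vec (scaleC c) v \<in> carrier_vec (dim_col A)" using assms by simp
 then show "(A *\<^sub>v map_vec (scaleC c) v) $ i = map_vec (scaleC c) (A *\<^sub>v v) $ i"
  using i assms by (simp add: index_mult_mat_vec' scaleC_sum_right scaleC_simps carrier_vecD del: index_mult_mat_vec)
qed simp

lemma mat_norm_bound:
 assumes "v \<in> carrier_vec (dim_col A)"
 shows "hvec_norm (A *\<^sub>v v) \<le> mat_norm A * hvec_norm v"
proof (cases "hvec_norm v = 0")
 case True
 then have "v = 0\<^sub>v (dim_col A)" using hvec_norm_eq_0 [of v] assms by (simp add: carrier_vecD)
 then have "A *\<^sub>v v = 0\<^sub>v (dim_row A)" by (auto simp: scalar_prod_def intro!: eq_vecI)
 then show ?thesis using True by simp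
next
 case False
 let ?c = "complex_of_real (1 / hvec_norm v)"
 have "hvec_norm (A *\<^sub>v map_vec (scaleC ?c) v) \<le> mat_norm A"
  using assms False by (intro mat_norm_bound1) (auto simp: hvec_norm_scaleC norm_divide)
 moreover have "hvec_norm v > 0" using False hvec_norm_nonneg [of v] by linarith
 ultimately show ?thesis
  by (simp add: mult_mat_vec_scaleC [OF assms] hvec_norm_scaleC norm_divide divide_le_eq)
qed

lemma mat_norm_le_entries: "mat_norm A \<le> (\<Sum>i<dim_row A. \<Sum>j<dim_col A. norm (A $$ (i, j)))"
 by (rule mat_norm_leI) (auto simp: hvec_norm_mult_le_entries sum_nonneg)

lemma hvec_norm_unit: "j < n ==> hvec_norm (unit_vec n j :: 'b::cstar_algebra vec) = 1"
proof -
 assume "j < n"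
 have "(\<Sum>i<n. star (unit_vec n j $ i) * unit_vec n j $ i) = (\<Sum>i<n. if i = j then 1 else 0 :: 'b)"
  using \<open>j < n\<close> by (intro sum.cong) (auto simp: unit_vec_def)
 then show ?thesis using \<open>j < n\<close> by (simp add: hvec_norm_def)
qed

lemma norm_index_le_mat_norm:
 assumes "i < dim_row A" "j < dim_col A"
 shows "norm (A $$ (i, j)) \<le> mat_norm A"
proof -
 have "A *\<^sub>v unit_vec (dim_col A) j = col A j"
  using assms by (intro eq_vecI) auto
 then have "norm (A $$ (i, j)) \<le> hvec_norm (A *\<^sub>v unit_vec (dim_col A) j)"
  using norm_index_le_hvec_norm [of i "col A j"] assms by simp
 also have "\<dots> \<le> mat_norm A"
  using assms by (intro mat_norm_bound1) (auto simp: hvec_norm_unit)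
 finally show ?thesis .
qed

lemma mat_norm_add:
 assumes "A \<in> carrier_mat m n" "B \<in> carrier_mat m n"
 shows "mat_norm (A + B) \<le> mat_norm A + mat_norm B"
proof (rule mat_norm_leI)
 fix v :: "'a vec" assume v: "v \<in> carrier_vec (dim_col (A + B))"
 have "(A + B) *\<^sub>v v = A *\<^sub>v v + B *\<^sub>v v"
  using assms v by (intro add_mult_distrib_mat_vec) auto
 then have "hvec_norm ((A + B) *\<^sub>v v) \<le> hvec_norm (A *\<^sub>v v) + hvec_norm (B *\<^sub>v v)"
  using hvec_norm_add [of "A *\<^sub>v v" m "B *\<^sub>v v"] assms by (simp add: carrier_vecI)
 also have "\<dots> \<le> mat_norm A * hvec_norm v + mat_norm B * hvec_norm v"
  using assms v by (intro add_mono mat_norm_bound) auto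
 finally show "hvec_norm ((A + B) *\<^sub>v v) \<le> (mat_norm A + mat_norm B) * hvec_norm v"
  by (simp add: distrib_right)
qed simp

lemma mat_norm_mult:
 assumes "A \<in> carrier_mat m n" "B \<in> carrier_mat n k"
 shows "mat_norm (A * B) \<le> mat_norm A * mat_norm B"
proof (rule mat_norm_leI)
 fix v :: "'a vec" assume v: "v \<in> carrier_vec (dim_col (A * B))"
 have "(A * B) *\<^sub>v v = A *\<^sub>v (B *\<^sub>v v)"
  using assms v by (intro assoc_mult_mat_vec) auto
 moreover have "B *\<^sub>v v \<in> carrier_vec (dim_col A)"
  by (rule carrier_vecI) (use assms in auto)
 ultimately have "hvec_norm ((A * B) *\<^sub>v v) \<le> mat_norm A * hvec_norm (B *\<^sub>v v)"
  using mat_norm_bound [of "B *\<^sub>v v" A] by simp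
 also have "\<dots> \<le> mat_norm A * (mat_norm B * hvec_norm v)"
  using assms v by (intro mult_left_mono mat_norm_bound) auto
 finally show "hvec_norm ((A * B) *\<^sub>v v) \<le> mat_norm A * mat_norm B * hvec_norm v"
  by (simp add: mult.assoc)
qed simp

lemma map_mat_scaleC_1 [simp]: "map_mat (scaleC 1) A = (A :: 'b::cstar_algebra mat)"
 by (rule eq_matI) (auto simp: scaleC_one)

lemma mat_norm_scaleC_le: "mat_norm (map_mat (scaleC c) A) \<le> cmod c * mat_norm A"
proof (rule mat_norm_leI)
 fix v :: "'a vec" assume "v \<in> carrier_vec (dim_col (map_mat (scaleC c) A))"
 then have v: "v \<in> carrier_vec (dim_col A)" by simp
 have "map_mat (scaleC c) A *\<^sub>v v = map_vec (scaleC c) (A *\<^sub>v v)"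
  using v by (intro eq_vecI) (auto simp: index_mult_mat_vec' scaleC_sum_right scaleC_simps simp del: index_mult_mat_vec)
 then show "hvec_norm (map_mat (scaleC c) A *\<^sub>v v) \<le> cmod c * mat_norm A * hvec_norm v"
  using mat_norm_bound [OF v] by (simp add: hvec_norm_scaleC mult_left_mono mult.assoc)
qed simp

lemma mat_norm_scaleC: "mat_norm (map_mat (scaleC c) A) = cmod c * mat_norm (A :: 'b::cstar_algebra mat)"
proof (cases "c = 0")
 case True
 then show ?thesis using mat_norm_scaleC_le [of c A] mat_norm_nonneg [of "map_mat (scaleC c) A"]
  by (simp del: mat_norm_nonneg)
next
 case False
 have "map_mat (scaleC (1/c)) (map_mat (scaleC c) A) = A"
  using False by (intro eq_matI) (auto simp: scaleC_simps)
 then have "mat_norm A \<le> cmod (1/c) * mat_norm (map_mat (scaleC c) A)"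
  using mat_norm_scaleC_le [of "1/c" "map_mat (scaleC c) A"] by simp
 then show ?thesis using False mat_norm_scaleC_le [of c A]
  by (simp add: norm_divide field_simps)
qed

lemma mat_star_carrier [simp]: "A \<in> carrier_mat m n ==> mat_star A \<in> carrier_mat n m"
 by (auto simp: mat_star_def)

lemma dim_mat_star [simp]: "dim_row (mat_star A) = dim_col A" "dim_col (mat_star A) = dim_row A"
 by (simp_all add: mat_star_def)

lemma index_mat_star [simp]:
 "i < dim_col A ==> j < dim_row A ==> mat_star A $$ (i, j) = star (A $$ (j, i))"
 by (simp add: mat_star_def)

lemma mat_star_star [simp]: "mat_star (mat_star A) = (A :: 'b::complex_star_algebra mat)"
 by (rule eq_matI) (auto simp: star_star)

lemma index_mult_mat': "i < dim_row A ==> j < dim_col B ==> dim_col A = dim_row B ==>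
  (A * B) $$ (i, j) = (\<Sum>k<dim_col A. A $$ (i, k) * B $$ (k, j))"
 by (simp add: scalar_prod_def lessThan_atLeast0)

lemma mat_star_mult:
 assumes "A \<in> carrier_mat m n" "B \<in> carrier_mat n k"
 shows "mat_star (A * B) = mat_star B * mat_star (A :: 'b::complex_star_algebra mat)"
 using assms by (intro eq_matI) (auto simp: index_mult_mat' star_sum star_mult simp del: index_mult_mat(1))

lemma inner_on_adjoint:
 assumes "A \<in> carrier_mat m n" "v \<in> carrier_vec n" "w \<in> carrier_vec m"
 shows "inner_on {..<m} (($) (A *\<^sub>v v)) (($) w) = inner_on {..<n} (($) v) (($) (mat_star A *\<^sub>v w))"
proof -
 have "inner_on {..<m} (($) (A *\<^sub>v v)) (($) w)
   = (\<Sum>i<m. \<Sum>j<n. star (v $ j) * star (A $$ (i, j)) * w $ i)"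
  using assms by (auto simp: inner_on_def index_mult_mat_vec' star_sum star_mult sum_distrib_right
    simp del: index_mult_mat_vec)
 also have "\<dots> = (\<Sum>j<n. \<Sum>i<m. star (v $ j) * star (A $$ (i, j)) * w $ i)" by (rule sum.swap)
 also have "\<dots> = inner_on {..<n} (($) v) (($) (mat_star A *\<^sub>v w))"
  using assms by (auto simp: inner_on_def index_mult_mat_vec' sum_distrib_left mult.assoc
    simp del: index_mult_mat_vec)
 finally show ?thesis .
qed

lemma mat_norm_square_le:
 assumes "A \<in> carrier_mat m n"
 shows "(mat_norm A)\<^sup>2 \<le> mat_norm (mat_star A * A)"
proof -
 have "mat_norm A \<le> sqrt (mat_norm (mat_star A * A))"
 proof (rule mat_norm_leI)
  fix v :: "'a vec" assume "v \<in> carrier_vec (dim_col A)"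
  then have v: "v \<in> carrier_vec n" using assms by simp
  have Av: "A *\<^sub>v v \<in> carrier_vec m" using assms v by auto
  let ?w = "(mat_star A * A) *\<^sub>v v"
  have w: "?w \<in> carrier_vec n" using assms v by (intro carrier_vecI) simp
  have "(hvec_norm (A *\<^sub>v v))\<^sup>2 = norm (inner_on {..<m} (($) (A *\<^sub>v v)) (($) (A *\<^sub>v v)))"
   using assms by (simp add: hvec_norm_power2)
  also have "\<dots> = norm (inner_on {..<n} (($) v) (($) ?w))"
   using inner_on_adjoint [OF assms v Av] assms v by (simp add: assoc_mult_mat_vec [of _ n m _ n])
  also have "\<dots> \<le> hvec_norm v * hvec_norm ?w"
   using inner_on_Cauchy_Schwarz [of "{..<n}" "($) v" "($) ?w"] v w
   by (simp add: hvec_norm_alt carrier_vecD real_le_rsqrt flip: real_sqrt_mult del: dim_mult_mat_vec)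
  also have "\<dots> \<le> hvec_norm v * (mat_norm (mat_star A * A) * hvec_norm v)"
   using v assms by (intro mult_left_mono mat_norm_bound) auto
  also have "\<dots> = (sqrt (mat_norm (mat_star A * A)) * hvec_norm v)\<^sup>2"
   by (simp add: power_mult_distrib power2_eq_square)
  finally show "hvec_norm (A *\<^sub>v v) \<le> sqrt (mat_norm (mat_star A * A)) * hvec_norm v"
   by (rule power2_le_imp_le) simp
 qed simp
 then have "(mat_norm A)\<^sup>2 \<le> (sqrt (mat_norm (mat_star A * A)))\<^sup>2"
  by (intro power_mono) auto
 then show ?thesis by simp
qed

lemma mat_norm_star [simp]: "mat_norm (mat_star A) = mat_norm (A :: 'b::cstar_algebra mat)"
proof -
 have *: "mat_norm A \<le> mat_norm (mat_star A)" for A :: "'b mat"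
 proof (cases "mat_norm A = 0")
  case False
  then have p: "mat_norm A > 0" using mat_norm_nonneg [of A] by linarith
  have A: "A \<in> carrier_mat (dim_row A) (dim_col A)" by auto
  have "(mat_norm A)\<^sup>2 \<le> mat_norm (mat_star A * A)" by (rule mat_norm_square_le [OF A])
  also have "\<dots> \<le> mat_norm (mat_star A) * mat_norm A"
   by (rule mat_norm_mult [OF mat_star_carrier [OF A] A])
  finally have "mat_norm A * mat_norm A \<le> mat_norm (mat_star A) * mat_norm A"
   by (simp add: power2_eq_square)
  then show ?thesis using p by simp
 qed simp
 show ?thesis using * [of A] * [of "mat_star A"] by simp
qed

lemma mat_norm_cstar_identity:
 assumes "A \<in> carrier_mat m n"
 shows "mat_norm (mat_star A * A) = (mat_norm A)\<^sup>2"
 using mat_norm_square_le [OF assms] mat_norm_mult [OF mat_star_carrier [OF assms] assms]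
 by (simp add: power2_eq_square)

lemma mat_norm_0 [simp]: "mat_norm (0\<^sub>m m n :: 'b::cstar_algebra mat) = 0"
 using mat_norm_le_entries [of "0\<^sub>m m n :: 'b mat"] by (intro antisym) auto

lemma mat_norm_eq_0: "A \<in> carrier_mat m n ==> mat_norm A = 0 ==> A = 0\<^sub>m m n"
 using norm_index_le_mat_norm [of _ A] by (intro eq_matI) auto

lemma mat_norm_1: "n \<ge> 1 ==> mat_norm (1\<^sub>m n :: 'b::cstar_algebra mat) = 1"
proof (rule antisym)
 show "mat_norm (1\<^sub>m n :: 'b mat) \<le> 1"
  by (rule mat_norm_leI) auto
 show "n \<ge> 1 ==> 1 \<le> mat_norm (1\<^sub>m n :: 'b mat)"
  using norm_index_le_mat_norm [of 0 "1\<^sub>m n :: 'b mat" 0] by simp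
qed

section \<open>All matrix levels in one algebra\<close>

text \<open>
 The size of a matrix varies in the arguments below, but positivity, roots and norms have been
 treated for the elements of one C*-algebra. A family with one matrix of every size is such an element:
 the families form a ring, and the bounded ones a C*-algebra for the supremum norm.
\<close>

typedef (overloaded) 'a mfam = "{x :: nat => 'a::zero mat. \<forall>n. x n \<in> carrier_mat n n}"
 morphisms lev mfam
 by (rule exI [of _ "\<lambda>n. 0\<^sub>m n n"]) auto

setup_lifting type_definition_mfam

lemma lev_carrier [simp]: "lev x n \<in> carrier_mat n n"
 using lev [of x] by auto

lemma dim_lev [simp]: "dim_row (lev x n) = n" "dim_col (lev x n) = n"
 using lev_carrier [of x n] by (auto simp del: lev_carrier)

lemma mfam_eqI: "(\<And>n. lev x n = lev y n) ==> x = y"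
 by (simp add: lev_inject [symmetric] fun_eq_iff)

instantiation mfam :: (ring_1) ring_1
begin
lift_definition zero_mfam :: "'a mfam" is "\<lambda>n. 0\<^sub>m n n" by simp
lift_definition one_mfam :: "'a mfam" is "\<lambda>n. 1\<^sub>m n" by simp
lift_definition plus_mfam :: "'a mfam => 'a mfam => 'a mfam" is "\<lambda>x y n. x n + y n" by simp
lift_definition minus_mfam :: "'a mfam => 'a mfam => 'a mfam" is "\<lambda>x y n. x n - y n"
 by (simp add: minus_carrier_mat)
lift_definition uminus_mfam :: "'a mfam => 'a mfam" is "\<lambda>x n. - x n" by simp
lift_definition times_mfam :: "'a mfam => 'a mfam => 'a mfam" is "\<lambda>x y n. x n * y n"
proof -
 fix x y :: "nat => 'a mat" and n
 assume "\<And>n. x n \<in> carrier_mat n n" "\<And>n. y n \<in> carrier_mat n n"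
 then show "x n * y n \<in> carrier_mat n n" using mult_carrier_mat [of "x n" n n "y n" n] by blast
qed
instance
proof
 note le = zero_mfam.rep_eq one_mfam.rep_eq plus_mfam.rep_eq minus_mfam.rep_eq uminus_mfam.rep_eq times_mfam.rep_eq
 fix x y z :: "'a mfam"
 show "x + y + z = x + (y + z)" by (intro mfam_eqI, unfold le, rule assoc_add_mat) (rule lev_carrier)+
 show "x + y = y + x" by (intro mfam_eqI, unfold le, rule comm_add_mat) (rule lev_carrier)+
 show "0 + x = x" by (intro mfam_eqI, unfold le, rule left_add_zero_mat) (rule lev_carrier)+
 show "- x + x = 0" by (intro mfam_eqI, unfold le, rule uminus_l_inv_mat) (rule lev_carrier)+
 show "x - y = x + - y" by (intro mfam_eqI, unfold le, rule minus_add_uminus_mat) (rule lev_carrier)+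
 show "x * y * z = x * (y * z)" by (intro mfam_eqI, unfold le, rule assoc_mult_mat) (rule lev_carrier)+
 show "1 * x = x" by (intro mfam_eqI, unfold le, rule left_mult_one_mat) (rule lev_carrier)+
 show "x * 1 = x" by (intro mfam_eqI, unfold le, rule right_mult_one_mat) (rule lev_carrier)+
 show "(x + y) * z = x * z + y * z" by (intro mfam_eqI, unfold le, rule add_mult_distrib_mat) (rule lev_carrier)+
 show "x * (y + z) = x * y + x * z" by (intro mfam_eqI, unfold le, rule mult_add_distrib_mat) (rule lev_carrier)+
 show "(0 :: 'a mfam) \<noteq> 1"
 proof transfer
  have "(0\<^sub>m 1 1 :: 'a mat) $$ (0, 0) \<noteq> 1\<^sub>m 1 $$ (0, 0)" by simp
  then show "(\<lambda>n. 0\<^sub>m n n) \<noteq> (\<lambda>n. 1\<^sub>m n :: 'a mat)" by metis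
 qed
qed
end

lemma lev_ring_simps [simp]:
 "lev 0 n = 0\<^sub>m n n" "lev 1 n = 1\<^sub>m n" "lev (x + y) n = lev x n + lev y n"
 "lev (x - y) n = lev x n - lev y n" "lev (- x) n = - lev x n" "lev (x * y) n = lev x n * lev y n"
 by (transfer; simp)+

instantiation mfam :: (complex_star_algebra) complex_star_algebra
begin
lift_definition scaleC_mfam :: "complex => 'a mfam => 'a mfam" is "\<lambda>c x n. map_mat (scaleC c) (x n)" by simp
lift_definition star_mfam :: "'a mfam => 'a mfam" is "\<lambda>x n. mat_star (x n)" by simp
instance
proof
 note le = scaleC_mfam.rep_eq star_mfam.rep_eq
 fix x y z :: "'a mfam" and c d :: complex
 show "c *\<^sub>C (x + y) = c *\<^sub>C x + c *\<^sub>C y"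
  by (intro mfam_eqI eq_matI) (simp_all add: le scaleC_add_right)
 show "(c + d) *\<^sub>C x = c *\<^sub>C x + d *\<^sub>C x"
  by (intro mfam_eqI eq_matI) (simp_all add: le scaleC_add_left)
 show "c *\<^sub>C (d *\<^sub>C x) = (c * d) *\<^sub>C x"
  by (intro mfam_eqI eq_matI) (simp_all add: le scaleC_scaleC)
 show "1 *\<^sub>C x = x"
  by (intro mfam_eqI eq_matI) (simp_all add: le scaleC_one)
 show "(c *\<^sub>C x) * y = c *\<^sub>C (x * y)"
  by (intro mfam_eqI eq_matI)
   (simp_all add: le index_mult_mat' scaleC_sum_right scaleC_simps del: index_mult_mat(1))
 show "x * (c *\<^sub>C y) = c *\<^sub>C (x * y)"
  by (intro mfam_eqI eq_matI)
   (simp_all add: le index_mult_mat' scaleC_sum_right scaleC_simps del: index_mult_mat(1))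
 show "star (star x) = x" by transfer simp
 show "star (x + y) = star x + star y"
  by (intro mfam_eqI eq_matI) (simp_all add: le star_add)
 show "star (x * y) = star y * star x"
  by (intro mfam_eqI, unfold le times_mfam.rep_eq, rule mat_star_mult) (rule lev_carrier)+
 show "star (c *\<^sub>C x) = cnj c *\<^sub>C star x"
  by (intro mfam_eqI eq_matI) (simp_all add: le star_scaleC)
qed
end

lemma lev_star_simps [simp]:
 "lev (c *\<^sub>C x) n = map_mat (scaleC c) (lev x n)" "lev (star x) n = mat_star (lev x n)"
 by (transfer; simp)+

lemma minus_mat_eq_scaleC: "A \<in> carrier_mat m n ==> - A = map_mat (scaleC (-1)) (A :: 'b::cstar_algebra mat)"
 by (rule eq_matI) (auto simp: scaleC_minus_left scaleC_one)

lemma mat_norm_minus [simp]: "mat_norm (- A) = mat_norm (A :: 'b::cstar_algebra mat)"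
 using mat_norm_scaleC [of "-1" A] minus_mat_eq_scaleC [of A "dim_row A" "dim_col A"] by simp

lemma mat_norm_diff:
 assumes "A \<in> carrier_mat m n" "B \<in> carrier_mat m n"
 shows "mat_norm (A - B) \<le> mat_norm A + mat_norm (B :: 'b::cstar_algebra mat)"
 using mat_norm_add [of A m n "- B"] assms by (simp add: minus_add_uminus_mat [of A m n B])

lemma mat_norm_entries_tendsto:
 fixes A :: "nat => 'b::cstar_algebra mat"
 assumes "\<And>k. A k \<in> carrier_mat n n" "L \<in> carrier_mat n n"
  and "\<And>i j. i < n ==> j < n ==> (\<lambda>k. A k $$ (i, j)) \<longlonglongrightarrow> L $$ (i, j)"
 shows "(\<lambda>k. mat_norm (A k - L)) \<longlonglongrightarrow> 0"
proof -
 have "(\<lambda>k. \<Sum>i<n. \<Sum>j<n. norm (A k $$ (i, j) - L $$ (i, j))) \<longlonglongrightarrow> (\<Sum>i<n. \<Sum>j<n. norm (L $$ (i, j) - L $$ (i, j)))"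
  by (intro tendsto_intros assms) auto
 then have z: "(\<lambda>k. \<Sum>i<n. \<Sum>j<n. norm (A k $$ (i, j) - L $$ (i, j))) \<longlonglongrightarrow> 0" by simp
 have "mat_norm (A k - L) \<le> (\<Sum>i<n. \<Sum>j<n. norm (A k $$ (i, j) - L $$ (i, j)))" for k
  using mat_norm_le_entries [of "A k - L"] assms(1) [of k] assms(2) by simp
 then have "\<forall>k. norm (mat_norm (A k - L)) \<le> (\<Sum>i<n. \<Sum>j<n. norm (A k $$ (i, j) - L $$ (i, j)))" by simp
 then show ?thesis by (rule Lim_null_comparison [OF always_eventually z])
qed

lemma mat_norm_le_of_diff:
 fixes A L :: "'b::cstar_algebra mat"
 assumes "A \<in> carrier_mat n n" "L \<in> carrier_mat n n"
 shows "mat_norm L \<le> mat_norm A + mat_norm (A - L)" "mat_norm A \<le> mat_norm L + mat_norm (A - L)"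
proof -
 have "A - (A - L) = L" "L + (A - L) = A" using assms by (auto intro: eq_matI)
 then show "mat_norm L \<le> mat_norm A + mat_norm (A - L)" "mat_norm A \<le> mat_norm L + mat_norm (A - L)"
  using mat_norm_diff [of A n n "A - L"] mat_norm_add [of L n n "A - L"] assms by (metis minus_carrier_mat)+
qed

lemma mat_norm_limit:
 fixes A :: "nat => 'b::cstar_algebra mat"
 assumes "\<And>k. A k \<in> carrier_mat n n" "L \<in> carrier_mat n n"
  and "\<And>i j. i < n ==> j < n ==> (\<lambda>k. A k $$ (i, j)) \<longlonglongrightarrow> L $$ (i, j)"
  and c: "\<forall>\<^sub>F k in sequentially. mat_norm (A k) \<le> c"
 shows "mat_norm L \<le> c"
proof -
 have "(\<lambda>k. mat_norm (A k - L) + c) \<longlonglongrightarrow> 0 + c"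
  by (intro tendsto_add tendsto_const mat_norm_entries_tendsto [OF assms(1-3)])
 moreover have "\<forall>\<^sub>F k in sequentially. mat_norm L \<le> mat_norm (A k - L) + c"
  using c
 proof eventually_elim
  case (elim k)
  then show ?case using mat_norm_le_of_diff(1) [OF assms(1,2), of k] by linarith
 qed
 ultimately show ?thesis using tendsto_lowerbound [of _ "0 + c" sequentially] by simp
qed

typedef (overloaded) 'b bfam = "{x :: 'b::cstar_algebra mfam. bdd_above (range (\<lambda>n. mat_norm (lev x n)))}"
 morphisms mfam_of bfam
 by (rule exI [of _ 0]) (auto intro!: bdd_aboveI)

setup_lifting type_definition_bfam

lemma bdd_mat_norm_combine:
 assumes "bdd_above (range (\<lambda>n. mat_norm (lev x n)))" "bdd_above (range (\<lambda>n. mat_norm (lev y n)))"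
  and "\<And>n a b. mat_norm (lev x n) \<le> a ==> mat_norm (lev y n) \<le> b ==> mat_norm (lev z n) \<le> f a b"
 shows "bdd_above (range (\<lambda>n. mat_norm (lev z n)))"
proof -
 obtain a b where "\<And>n. mat_norm (lev x n) \<le> a" "\<And>n. mat_norm (lev y n) \<le> b"
  using assms(1,2) by (auto simp: bdd_above_def)
 then show ?thesis using assms(3) by (intro bdd_aboveI [of _ "f a b"]) auto
qed

instantiation bfam :: (cstar_algebra) complex_star_algebra
begin
lift_definition zero_bfam :: "'a bfam" is 0 by (auto intro!: bdd_aboveI)
lift_definition one_bfam :: "'a bfam" is 1
proof -
 have "mat_norm (1\<^sub>m n :: 'a mat) \<le> 1" for n by (rule mat_norm_leI) auto
 then show "bdd_above (range (\<lambda>n. mat_norm (lev 1 n :: 'a mat)))" by (auto intro!: bdd_aboveI [of _ 1])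
qed
lift_definition plus_bfam :: "'a bfam => 'a bfam => 'a bfam" is "(+)"
 by (erule (1) bdd_mat_norm_combine [where f = "(+)"]) (auto intro: order_trans [OF mat_norm_add])
lift_definition minus_bfam :: "'a bfam => 'a bfam => 'a bfam" is "(-)"
 by (erule (1) bdd_mat_norm_combine [where f = "(+)"]) (auto intro: order_trans [OF mat_norm_diff])
lift_definition uminus_bfam :: "'a bfam => 'a bfam" is uminus by simp
lift_definition times_bfam :: "'a bfam => 'a bfam => 'a bfam" is "(*)"
 by (erule (1) bdd_mat_norm_combine [where f = "(*)"])
  (auto intro!: order_trans [OF mat_norm_mult] mult_mono order_trans [OF mat_norm_nonneg])
lift_definition scaleC_bfam :: "complex => 'a bfam => 'a bfam" is scaleC
proof -
 fix c and x :: "'a mfam"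
 assume *: "bdd_above (range (\<lambda>n. mat_norm (lev x n)))"
 show "bdd_above (range (\<lambda>n. mat_norm (lev (c *\<^sub>C x) n)))"
  by (rule bdd_mat_norm_combine [where f = "\<lambda>a b. cmod c * a", OF * *])
   (simp add: mat_norm_scaleC mult_left_mono)
qed
lift_definition star_bfam :: "'a bfam => 'a bfam" is star by simp
instance
 by standard (transfer; simp add: algebra_simps scaleC_simps scaleC_add_left star_star star_add star_mult star_scaleC)+
end

definition blev :: "'b::cstar_algebra bfam => nat => 'b mat" where
 "blev x n = lev (mfam_of x) n"

lemma blev_carrier [simp]: "blev x n \<in> carrier_mat n n"
 by (simp add: blev_def)

lemma dim_blev [simp]: "dim_row (blev x n) = n" "dim_col (blev x n) = n"
 by (simp_all add: blev_def)

lemma blev_simps [simp]: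
 "blev 0 n = 0\<^sub>m n n" "blev 1 n = 1\<^sub>m n" "blev (x + y) n = blev x n + blev y n"
 "blev (x - y) n = blev x n - blev y n" "blev (- x) n = - blev x n" "blev (x * y) n = blev x n * blev y n"
 "blev (c *\<^sub>C x) n = map_mat (scaleC c) (blev x n)" "blev (star x) n = mat_star (blev x n)"
 by (simp_all add: blev_def zero_bfam.rep_eq one_bfam.rep_eq plus_bfam.rep_eq minus_bfam.rep_eq
   uminus_bfam.rep_eq times_bfam.rep_eq scaleC_bfam.rep_eq star_bfam.rep_eq)

lemma bfam_eqI: "(\<And>n. blev x n = blev y n) ==> x = y"
 by (simp add: blev_def mfam_eqI mfam_of_inject [symmetric])

lemma bdd_blev: "bdd_above (range (\<lambda>n. mat_norm (blev x n)))"
 using mfam_of [of x] by (simp add: blev_def)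

instantiation bfam :: (cstar_algebra) real_normed_algebra_1
begin
definition norm_bfam :: "'a bfam => real" where "norm x = (SUP n. mat_norm (blev x n))"
definition scaleR_bfam :: "real => 'a bfam => 'a bfam" where "r *\<^sub>R (x :: 'a bfam) = complex_of_real r *\<^sub>C x"
definition dist_bfam :: "'a bfam => 'a bfam => real" where "dist (x :: 'a bfam) y = norm (x - y)"
definition sgn_bfam :: "'a bfam => 'a bfam" where "sgn (x :: 'a bfam) = inverse (norm x) *\<^sub>R x"
definition uniformity_bfam :: "('a bfam \<times> 'a bfam) filter" where
 "uniformity = (INF e\<in>{0<..}. principal {(x :: 'a bfam, y). dist x y < e})"
definition open_bfam :: "'a bfam set => bool" where
 "open (U :: 'a bfam set) \<longleftrightarrow> (\<forall>x\<in>U. eventually (\<lambda>(x', y). x' = x --> y \<in> U) uniformity)"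

lemma mat_norm_blev_le: "mat_norm (blev x n) \<le> norm (x :: 'a bfam)"
 unfolding norm_bfam_def by (rule cSUP_upper [OF _ bdd_blev]) simp

lemma norm_bfam_le: "(\<And>n. mat_norm (blev x n) \<le> c) ==> norm (x :: 'a bfam) \<le> c"
 unfolding norm_bfam_def by (rule cSUP_least) auto

lemma norm_bfam_scaleC: "norm (c *\<^sub>C x) = cmod c * norm (x :: 'a bfam)"
proof -
 have le: "norm (c *\<^sub>C x) \<le> cmod c * norm x" for c and x :: "'a bfam"
  by (rule norm_bfam_le) (simp add: mat_norm_scaleC mult_left_mono mat_norm_blev_le)
 show ?thesis
 proof (cases "c = 0")
  case True
  have "norm (0 :: 'a bfam) = 0" by (simp add: norm_bfam_def)
  then show ?thesis using True by simp
 next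
  case False
  have "(1/c) *\<^sub>C (c *\<^sub>C x) = x" using False by (simp add: scaleC_simps)
  then have "norm x \<le> cmod (1/c) * norm (c *\<^sub>C x)" using le [of "1/c" "c *\<^sub>C x"] by simp
  then show ?thesis using le [of c x] False by (simp add: norm_divide field_simps)
 qed
qed

instance
proof
 fix x y z :: "'a bfam" and r s :: real and c :: complex
 show "dist x y = norm (x - y)" by (rule dist_bfam_def)
 show "sgn x = inverse (norm x) *\<^sub>R x" by (rule sgn_bfam_def)
 show "uniformity = (INF e\<in>{0<..}. principal {(x, y). dist x (y :: 'a bfam) < e})"
  by (rule uniformity_bfam_def)
 show "open U \<longleftrightarrow> (\<forall>x\<in>U. eventually (\<lambda>(x', y). x' = x --> y \<in> U) uniformity)" for U :: "'a bfam set"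
  by (rule open_bfam_def)
 show "r *\<^sub>R (x + y) = r *\<^sub>R x + r *\<^sub>R y" by (simp add: scaleR_bfam_def scaleC_add_right)
 show "(r + s) *\<^sub>R x = r *\<^sub>R x + s *\<^sub>R x" by (simp add: scaleR_bfam_def scaleC_add_left)
 show "r *\<^sub>R s *\<^sub>R x = (r * s) *\<^sub>R x" by (simp add: scaleR_bfam_def scaleC_scaleC)
 show "1 *\<^sub>R x = x" by (simp add: scaleR_bfam_def scaleC_one)
 show "r *\<^sub>R x * y = r *\<^sub>R (x * y)" "x * r *\<^sub>R y = r *\<^sub>R (x * y)"
  by (simp_all add: scaleR_bfam_def scaleC_simps)
 have nonneg: "norm x \<ge> 0" for x :: "'a bfam"
  using mat_norm_blev_le [of x 0] mat_norm_nonneg [of "blev x 0"] by linarith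
 have n0: "norm (0 :: 'a bfam) = 0" by (simp add: norm_bfam_def)
 show "norm x = 0 \<longleftrightarrow> x = 0"
 proof
  assume "norm x = 0"
  then have "mat_norm (blev x n) = 0" for n
   using mat_norm_blev_le [of x n] mat_norm_nonneg [of "blev x n"] by linarith
  then have "blev x n = 0\<^sub>m n n" for n by (intro mat_norm_eq_0) auto
  then show "x = 0" by (intro bfam_eqI) simp
 qed (simp add: n0)
 show "norm (x + y) \<le> norm x + norm y"
 proof (rule norm_bfam_le)
  fix n
  have "mat_norm (blev (x + y) n) \<le> mat_norm (blev x n) + mat_norm (blev y n)"
   using mat_norm_add [of "blev x n" n n "blev y n"] by simp
  also have "\<dots> \<le> norm x + norm y" by (intro add_mono mat_norm_blev_le)
  finally show "mat_norm (blev (x + y) n) \<le> norm x + norm y" .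
 qed
 show "norm (x * y) \<le> norm x * norm y"
 proof (rule norm_bfam_le)
  fix n
  have "mat_norm (blev (x * y) n) \<le> mat_norm (blev x n) * mat_norm (blev y n)"
   using mat_norm_mult [of "blev x n" n n "blev y n" n] by simp
  also have "\<dots> \<le> norm x * norm y" by (intro mult_mono mat_norm_blev_le nonneg) simp
  finally show "mat_norm (blev (x * y) n) \<le> norm x * norm y" .
 qed
 show "norm (r *\<^sub>R x) = \<bar>r\<bar> * norm x" by (simp add: scaleR_bfam_def norm_bfam_scaleC)
 show "norm (1 :: 'a bfam) = 1"
 proof (rule antisym)
  show "norm (1 :: 'a bfam) \<le> 1" by (rule norm_bfam_le) (auto intro!: mat_norm_leI)
  show "1 \<le> norm (1 :: 'a bfam)" using mat_norm_blev_le [of 1 1] mat_norm_1 [of 1, where 'b = 'a] by simp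
 qed
qed
end

instance bfam :: (cstar_algebra) banach
proof
 show "convergent X" if "Cauchy X" for X :: "nat => 'a bfam"
 proof -
  have ent: "norm (blev (X m) n $$ (i, j) - blev (X k) n $$ (i, j)) \<le> norm (X m - X k)"
   if "i < n" "j < n" for m k n i j
  proof -
   have "norm (blev (X m - X k) n $$ (i, j)) \<le> mat_norm (blev (X m - X k) n)"
    using that by (intro norm_index_le_mat_norm) (auto simp del: blev_simps)
   also have "\<dots> \<le> norm (X m - X k)" by (rule mat_norm_blev_le)
   finally show ?thesis using that by simp
  qed
  have C: "\<exists>N. \<forall>m\<ge>N. \<forall>k\<ge>N. norm (X m - X k) < e" if "e > 0" for e
   using \<open>Cauchy X\<close> that unfolding Cauchy_def dist_norm by auto
  have "Cauchy (\<lambda>k. blev (X k) n $$ (i, j))" if "i < n" "j < n" for n i j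
  proof (rule metric_CauchyI)
   fix e :: real assume "e > 0"
   then obtain N where "\<forall>m\<ge>N. \<forall>k\<ge>N. norm (X m - X k) < e" using C by blast
   then show "\<exists>N. \<forall>m\<ge>N. \<forall>k\<ge>N. dist (blev (X m) n $$ (i, j)) (blev (X k) n $$ (i, j)) < e"
    unfolding dist_norm using ent [OF that] by (meson le_less_trans)
  qed
  then have conv: "convergent (\<lambda>k. blev (X k) n $$ (i, j))" if "i < n" "j < n" for n i j
   using that by (intro Cauchy_convergent)
  define l where "l n i j = lim (\<lambda>k. blev (X k) n $$ (i, j))" for n i j
  have l: "(\<lambda>k. blev (X k) n $$ (i, j)) \<longlonglongrightarrow> l n i j" if "i < n" "j < n" for n i j
   using conv [OF that] by (simp add: l_def convergent_LIMSEQ_iff)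
  define M where "M n = mat n n (\<lambda>(i, j). l n i j)" for n
  have M: "M n \<in> carrier_mat n n" for n by (simp add: M_def)
  have near: "mat_norm (blev (X m) n - M n) \<le> e"
   if N: "\<forall>m\<ge>N. \<forall>k\<ge>N. norm (X m - X k) < e" and m: "m \<ge> N" for m n N e
  proof (rule mat_norm_limit [where A = "\<lambda>k. blev (X m - X k) n" and n = n])
   show "(\<lambda>k. blev (X m - X k) n $$ (i, j)) \<longlonglongrightarrow> (blev (X m) n - M n) $$ (i, j)" if "i < n" "j < n" for i j
    using that l [OF that] M [of n] by (auto simp: M_def intro!: tendsto_intros)
   show "\<forall>\<^sub>F k in sequentially. mat_norm (blev (X m - X k) n) \<le> e"
    using eventually_ge_at_top [of N]
   proof eventually_elim
    case (elim k)
    then have "norm (X m - X k) < e" using N m by blast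
    then show ?case using mat_norm_blev_le [of "X m - X k" n] by linarith
   qed
   show "blev (X m) n - M n \<in> carrier_mat n n" using M by (intro minus_carrier_mat)
   show "blev (X m - X k) n \<in> carrier_mat n n" for k by (rule blev_carrier)
  qed
  obtain N where N: "\<forall>m\<ge>N. \<forall>k\<ge>N. norm (X m - X k) < 1" using C [of 1] by auto
  have "mat_norm (M n) \<le> norm (X N) + 1" for n
   using mat_norm_le_of_diff(1) [OF blev_carrier [of "X N"] M [of n]] near [OF N order_refl, of n] mat_norm_blev_le [of "X N" n]
   by linarith
  moreover have lM: "lev (mfam M) = M" by (rule mfam_inverse) (use M in auto)
  ultimately have "mfam_of (bfam (mfam M)) = mfam M"
   by (intro bfam_inverse) (auto intro!: bdd_aboveI)
  then have bM: "blev (bfam (mfam M)) n = M n" for n by (simp add: blev_def lM)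
  have "X \<longlonglongrightarrow> bfam (mfam M)"
  proof (rule metric_LIMSEQ_I)
   fix e :: real assume "e > 0"
   then obtain N where N: "\<forall>m\<ge>N. \<forall>k\<ge>N. norm (X m - X k) < e / 2" using C [of "e/2"] by auto
   have "dist (X m) (bfam (mfam M)) < e" if "m \<ge> N" for m
   proof -
    have "norm (X m - bfam (mfam M)) \<le> e / 2"
     by (rule norm_bfam_le) (simp only: blev_simps bM near [OF N that])
    then show ?thesis using \<open>e > 0\<close> by (simp add: dist_norm)
   qed
   then show "\<exists>N. \<forall>m\<ge>N. dist (X m) (bfam (mfam M)) < e" by blast
  qed
  then show ?thesis by (auto simp: convergent_def)
 qed
qed

instance bfam :: (cstar_algebra) cstar_algebra
proof
 fix x y z :: "'a bfam" and r s :: real and c :: complex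
 show "norm (c *\<^sub>C x) = cmod c * norm x" by (rule norm_bfam_scaleC)
 show "r *\<^sub>R x = complex_of_real r *\<^sub>C x" by (rule scaleR_bfam_def)
 show "norm (star x * x) = (norm x)\<^sup>2"
 proof (rule antisym)
  have m: "mat_norm (blev (star x * x) n) = (mat_norm (blev x n))\<^sup>2" for n
   using mat_norm_cstar_identity [of "blev x n" n n] by simp
  show "norm (star x * x) \<le> (norm x)\<^sup>2"
   by (rule norm_bfam_le) (simp only: m, intro power_mono mat_norm_blev_le mat_norm_nonneg)
  have "norm x \<le> sqrt (norm (star x * x))"
  proof (rule norm_bfam_le)
   fix n
   have "(mat_norm (blev x n))\<^sup>2 \<le> norm (star x * x)" using mat_norm_blev_le [of "star x * x" n] m by simp
   then show "mat_norm (blev x n) \<le> sqrt (norm (star x * x))" by (rule real_le_rsqrt)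
  qed
  then have "(norm x)\<^sup>2 \<le> (sqrt (norm (star x * x)))\<^sup>2" by (intro power_mono) auto
  then show "(norm x)\<^sup>2 \<le> norm (star x * x)" by simp
 qed
qed

section \<open>The Cauchy transform of a positive map\<close>

definition Im_part :: "'a::complex_star_algebra => 'a" where
 "Im_part b = (1 / (2 * \<i>)) *\<^sub>C (b - star b)"

lemma self_adj_Im_part: "self_adj (Im_part b)"
 by (simp add: Im_part_def star_scaleC star_diff star_star scaleC_diff_right scaleC_minus_left)

lemma norm_Im_part_le: "norm (Im_part b) \<le> norm (b::'c::cstar_algebra)"
proof -
 have "norm (b - star b) \<le> 2 * norm b" using norm_triangle_ineq4 [of b "star b"] by simp
 then show ?thesis by (simp add: Im_part_def norm_scaleC norm_divide norm_mult)
qed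

lemma scaleC_of_real: "complex_of_real r *\<^sub>C x = r *\<^sub>R (x::'c::cstar_algebra)"
 by (simp add: scaleR_scaleC)

lemma of_real_eq_scaleC: "(of_real r :: 'c::cstar_algebra) = complex_of_real r *\<^sub>C 1"
 by (metis of_real_def scaleR_scaleC)

text \<open>Complex differentiability with the quadratic error that the resolvent identity provides.\<close>

definition quad_diff :: "('c::cstar_algebra => 'c) => 'c => bool" where
 "quad_diff f b \<longleftrightarrow> (\<exists>L K C d. d > 0 \<and> (\<forall>h k. L (h + k) = L h + L k) \<and> (\<forall>z h. L (z *\<^sub>C h) = z *\<^sub>C L h)
   \<and> (\<forall>h. norm (L h) \<le> K * norm h)
   \<and> (\<forall>h. norm h < d --> norm (f (b + h) - f b - L h) \<le> C * (norm h)\<^sup>2))"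

text \<open>
 \<open>X\<close> is bounded for the Gelfand--Naimark--Segal construction of the positive map \<open>s\<close>, and \<open>emb\<close> embeds
 the codomain of \<open>s\<close> as scalars. Instead of representing the elements as operators, estimates are
 stated as inequalities between the values of \<open>s\<close>.
\<close>

locale positive_map =
 fixes s :: "'a::complex_star_algebra => 'c::cstar_algebra"
  and emb :: "'c => 'a" and X :: 'a and M :: real
 assumes s_add: "s (p + q) = s p + s q"
  and s_scaleC: "s (z *\<^sub>C p) = z *\<^sub>C s p"
  and s_pos: "psd (s (star Y * Y))"
  and emb_add: "emb (b + c) = emb b + emb c"
  and emb_mult: "emb (b * c) = emb b * emb c"
  and emb_scaleC: "emb (z *\<^sub>C b) = z *\<^sub>C emb b"
  and emb_star: "emb (star b) = star (emb b)"
  and emb_1: "emb 1 = 1"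
  and X_sa: "star X = X"
  and M_pos: "M > 0"
  and X_bound: "psd (M\<^sup>2 *\<^sub>R s (star Y * Y) - s (star (X * Y) * (X * Y)))"
begin

abbreviation sq :: "'a => 'c" where "sq Y \<equiv> s (star Y * Y)"

lemma s_0 [simp]: "s 0 = 0"
 using s_add [of 0 0] by simp

lemma s_minus: "s (- p) = - s p"
 using s_add [of p "- p"] by (simp add: add_eq_0_iff)

lemma s_diff: "s (p - q) = s p - s q"
 by (simp only: diff_conv_add_uminus s_add s_minus)

lemma emb_0 [simp]: "emb 0 = 0"
 using emb_add [of 0 0] by simp

lemma emb_minus: "emb (- b) = - emb b"
 using emb_add [of b "- b"] by (simp add: add_eq_0_iff)

lemma emb_diff: "emb (b - c) = emb b - emb c"
 by (simp only: diff_conv_add_uminus emb_add emb_minus)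

lemma emb_scaleR: "emb (r *\<^sub>R b) = complex_of_real r *\<^sub>C emb b"
 by (simp add: scaleR_scaleC emb_scaleC)

text \<open>\<open>bdd P r\<close> says that \<open>P\<close> acts with norm at most \<open>r\<close> in the Gelfand--Naimark--Segal construction for \<open>s\<close>.\<close>

definition bdd :: "'a => real => bool" where
 "bdd P r \<longleftrightarrow> 0 \<le> r \<and> (\<forall>Y. psd (r\<^sup>2 *\<^sub>R sq Y - sq (P * Y)))"

lemma bdd_nonneg: "bdd P r ==> 0 \<le> r"
 by (simp add: bdd_def)

lemma bddD: "bdd P r ==> psd (r\<^sup>2 *\<^sub>R sq Y - sq (P * Y))"
 by (simp add: bdd_def)

lemma bdd_mono:
 assumes "bdd P r" "r \<le> t"
 shows "bdd P t"
proof -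
 have "psd (r\<^sup>2 *\<^sub>R sq Y - sq (P * Y) + (t\<^sup>2 - r\<^sup>2) *\<^sub>R sq Y)" for Y
  using assms bdd_nonneg [OF assms(1)] by (intro psd_add psd_scaleR bddD s_pos) (auto intro: power_mono)
 then show ?thesis using assms bdd_nonneg [OF assms(1)] by (simp add: bdd_def scaleR_diff_left)
qed

lemma bdd_limit:
 assumes "\<And>e. e > 0 ==> bdd P (r + e)" "0 \<le> r"
 shows "bdd P r"
proof -
 have "psd (r\<^sup>2 *\<^sub>R sq Y - sq (P * Y))" for Y
 proof (rule psd_limit)
  show "psd ((r + 1 / real (Suc n))\<^sup>2 *\<^sub>R sq Y - sq (P * Y))" for n
   by (intro bddD assms) simp
  have "(\<lambda>n. (r + 1 / real (Suc n))\<^sup>2 *\<^sub>R sq Y - sq (P * Y)) \<longlonglongrightarrow> (r + 0)\<^sup>2 *\<^sub>R sq Y - sq (P * Y)"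
   by (intro tendsto_intros LIMSEQ_Suc [OF lim_1_over_n])
  then show "(\<lambda>n. (r + 1 / real (Suc n))\<^sup>2 *\<^sub>R sq Y - sq (P * Y)) \<longlonglongrightarrow> r\<^sup>2 *\<^sub>R sq Y - sq (P * Y)"
   by simp
 qed
 then show ?thesis using assms by (simp add: bdd_def)
qed

lemma bdd_mult:
 assumes "bdd P r" "bdd Q t"
 shows "bdd (P * Q) (r * t)"
proof -
 have "psd (r\<^sup>2 *\<^sub>R (t\<^sup>2 *\<^sub>R sq Y - sq (Q * Y)) + (r\<^sup>2 *\<^sub>R sq (Q * Y) - sq (P * (Q * Y))))" for Y
  using assms by (intro psd_add psd_scaleR bddD) auto
 then show ?thesis
  using assms [THEN bdd_nonneg] by (simp add: bdd_def scaleR_diff_right power_mult_distrib mult.assoc)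
qed

lemma sq_scaleC: "sq (c *\<^sub>C Y) = (cmod c)\<^sup>2 *\<^sub>R sq Y"
proof -
 have "sq (c *\<^sub>C Y) = (cnj c * c) *\<^sub>C sq Y"
  by (simp add: star_scaleC scaleC_simps s_scaleC mult.commute)
 also have "cnj c * c = complex_of_real ((cmod c)\<^sup>2)"
  by (metis complex_norm_square mult.commute)
 finally show ?thesis by (simp add: scaleR_scaleC)
qed

lemma bdd_scaleC:
 assumes "bdd P r"
 shows "bdd (c *\<^sub>C P) (cmod c * r)"
proof -
 have "psd ((cmod c)\<^sup>2 *\<^sub>R (r\<^sup>2 *\<^sub>R sq Y - sq (P * Y)))" for Y
  using assms by (intro psd_scaleR bddD) auto
 then show ?thesis
  using bdd_nonneg [OF assms]
  by (simp add: bdd_def scaleR_diff_right power_mult_distrib mult_scaleC_left sq_scaleC)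
qed

lemma bdd_minus: "bdd P r ==> bdd (- P) r"
 using bdd_scaleC [of P r "-1"] by (simp add: scaleC_minus_left scaleC_one)

text \<open>
 \<open>|u + v|\<^sup>2 + |a u - b v|\<^sup>2\<close> with \<open>a\<^sup>2 = t / r\<close> and \<open>a b = 1\<close> has no mixed terms.
\<close>

lemma bdd_add:
 assumes "bdd P r" "bdd Q t"
 shows "bdd (P + Q) (r + t)"
proof -
 have *: "bdd (P + Q) (r + t)" if "bdd P r" "bdd Q t" "r > 0" "t > 0" for r t
 proof -
  have "psd ((r + t)\<^sup>2 *\<^sub>R sq Y - sq ((P + Q) * Y))" for Y
  proof -
   define u v where "u = P * Y" and "v = Q * Y"
   define a b where "a = complex_of_real (sqrt (t / r))" and "b = complex_of_real (sqrt (r / t))"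
   have ab: "a * b = 1" "(cmod a)\<^sup>2 = t / r" "(cmod b)\<^sup>2 = r / t" "cnj a = a" "cnj b = b"
    using that by (simp_all add: a_def b_def flip: of_real_mult real_sqrt_mult)
   have "sq (a *\<^sub>C u - b *\<^sub>C v) = sq (a *\<^sub>C u) + sq (b *\<^sub>C v) - (a * b) *\<^sub>C (s (star u * v) + s (star v * u))"
    by (simp add: star_diff star_scaleC algebra_simps s_add s_diff scaleC_simps s_scaleC ab(4,5))
   then have e1: "sq (a *\<^sub>C u - b *\<^sub>C v) = (t / r) *\<^sub>R sq u + (r / t) *\<^sub>R sq v - (s (star u * v) + s (star v * u))"
    by (simp add: ab sq_scaleC scaleC_one)
   have e2: "sq (u + v) = sq u + sq v + (s (star u * v) + s (star v * u))"
    by (simp add: star_add algebra_simps s_add)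
   have c: "1 + t / r = (r + t) / r" "1 + r / t = (r + t) / t" using that by (simp_all add: field_simps)
   have "sq (a *\<^sub>C u - b *\<^sub>C v) + sq (u + v) = (1 + t / r) *\<^sub>R sq u + (1 + r / t) *\<^sub>R sq v"
    unfolding e1 e2 by (simp add: scaleR_add_left)
   then have e3: "sq (u + v) = ((r + t) / r) *\<^sub>R sq u + ((r + t) / t) *\<^sub>R sq v - sq (a *\<^sub>C u - b *\<^sub>C v)"
    unfolding c by (simp add: algebra_simps)
   have "psd (((r + t) / r) *\<^sub>R (r\<^sup>2 *\<^sub>R sq Y - sq u) + ((r + t) / t) *\<^sub>R (t\<^sup>2 *\<^sub>R sq Y - sq v) + sq (a *\<^sub>C u - b *\<^sub>C v))"
    unfolding u_def v_def using that by (intro psd_add psd_scaleR bddD s_pos) auto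
   moreover have "(r + t)\<^sup>2 *\<^sub>R sq Y = ((r + t) / r) *\<^sub>R (r\<^sup>2 *\<^sub>R sq Y) + ((r + t) / t) *\<^sub>R (t\<^sup>2 *\<^sub>R sq Y)"
   proof -
    have "(r + t)\<^sup>2 = (r + t) / r * r\<^sup>2 + (r + t) / t * t\<^sup>2"
     using that by (simp add: power2_eq_square add_divide_distrib distrib_left distrib_right)
    then show ?thesis by (simp only: scaleR_add_left scaleR_scaleR)
   qed
   ultimately have "psd ((r + t)\<^sup>2 *\<^sub>R sq Y - sq (u + v))"
    unfolding e3 by (simp only: scaleR_diff_right) (simp add: algebra_simps)
   then show ?thesis by (simp add: u_def v_def distrib_right)
  qed
  then show ?thesis using that by (simp add: bdd_def)
 qed
 show ?thesis
 proof (rule bdd_limit)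
  fix e :: real assume "e > 0"
  then have "bdd (P + Q) ((r + e/2) + (t + e/2))"
   using assms bdd_nonneg [OF assms(1)] bdd_nonneg [OF assms(2)]
   by (intro *) (auto intro: bdd_mono)
  then show "bdd (P + Q) (r + t + e)" by (simp add: algebra_simps)
 qed (use assms [THEN bdd_nonneg] in simp)
qed

lemma bdd_diff: "bdd P r ==> bdd Q t ==> bdd (P - Q) (r + t)"
 using bdd_add [of P r "- Q" t] bdd_minus [of Q t] by simp

lemma bdd_1: "bdd 1 1"
 by (simp add: bdd_def)

lemma bdd_0: "bdd 0 0"
 by (simp add: bdd_def)

lemma bdd_X: "bdd X M"
 using X_bound M_pos by (simp add: bdd_def)

lemma psd_s_emb:
 assumes "psd b"
 shows "psd (s (star Y * emb b * Y))"
proof -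
 obtain c where c: "b = star c * c" using assms psd_iff by blast
 have "star Y * emb b * Y = star (emb c * Y) * (emb c * Y)"
  by (simp add: c emb_mult emb_star star_mult mult.assoc)
 then show ?thesis using s_pos by metis
qed

lemma emb_of_real: "emb (of_real r) = complex_of_real r *\<^sub>C 1"
 by (simp add: of_real_def emb_scaleR emb_1)

lemma s_emb_of_real: "s (Y * emb (of_real r) * Z) = r *\<^sub>R s (Y * Z)"
 by (simp add: emb_of_real scaleC_simps s_scaleC scaleR_scaleC)

lemma s_emb_of_real': "s (Y * (emb (of_real r) * Z)) = r *\<^sub>R s (Y * Z)"
 using s_emb_of_real [of Y r Z] by (simp add: mult.assoc)

lemma bdd_emb: "bdd (emb b) (norm b)"
proof -
 define r where "r = (norm b)\<^sup>2"
 have "psd (r *\<^sub>R sq Y - sq (emb b * Y))" for Y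
 proof -
  have "psd (s (star Y * emb (of_real r - star b * b) * Y))"
   unfolding r_def by (intro psd_s_emb psd_norm_square_minus)
  then show ?thesis
   by (simp add: emb_diff s_diff right_diff_distrib left_diff_distrib s_emb_of_real)
    (simp add: emb_mult emb_star star_mult mult.assoc)
 qed
 then show ?thesis by (simp add: bdd_def r_def)
qed

lemma bdd_power: "bdd P r ==> bdd (P ^ n) (r ^ n)"
 by (induction n) (auto intro: bdd_1 bdd_mult)

lemma bdd_sum: "finite I ==> (\<And>i. i \<in> I ==> bdd (P i) (r i)) ==> bdd (sum P I) (sum r I)"
 by (induction I rule: finite_induct) (auto intro: bdd_0 bdd_add)

text \<open>The polarization identity \<open>4 B\<^sup>* A = \<Sum>\<omega> (A + \<omega> B)\<^sup>* (A + \<omega> B)\<close>, the sum over the fourth roots of unity.\<close>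

lemma sq_expand:
 "\<i> *\<^sub>C sq (A + \<i> *\<^sub>C B) = \<i> *\<^sub>C sq A + \<i> *\<^sub>C sq B - s (star A * B) + s (star B * A)"
 "\<i> *\<^sub>C sq (A - \<i> *\<^sub>C B) = \<i> *\<^sub>C sq A + \<i> *\<^sub>C sq B + s (star A * B) - s (star B * A)"
 "sq (A + B) = sq A + sq B + s (star A * B) + s (star B * A)"
 "sq (A - B) = sq A + sq B - s (star A * B) - s (star B * A)"
 by (simp_all add: star_add star_diff star_scaleC algebra_simps s_add s_diff s_minus scaleC_simps s_scaleC scaleC_minus_left)

lemma scaleR_4: "4 *\<^sub>R x = x + x + x + (x :: 'c)"
 using scaleR_left.add [of 2 2 x] by (simp add: scaleR_2 add.assoc)

lemma s_polarization:
 "4 *\<^sub>R s (star B * A) = sq (A + B) + \<i> *\<^sub>C sq (A + \<i> *\<^sub>C B) - sq (A - B) - \<i> *\<^sub>C sq (A - \<i> *\<^sub>C B)"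
 "4 *\<^sub>R s (star A * B) = sq (A + B) - \<i> *\<^sub>C sq (A + \<i> *\<^sub>C B) - sq (A - B) + \<i> *\<^sub>C sq (A - \<i> *\<^sub>C B)"
 unfolding scaleR_4 by ((simp only: sq_expand(1,2)), (simp only: sq_expand(3,4)), simp)+

lemma norm_sq_le: "bdd P r ==> norm (sq P) \<le> r\<^sup>2 * norm (s 1)"
proof -
 assume "bdd P r"
 from bddD [OF this, of 1] have "psd (r\<^sup>2 *\<^sub>R s 1 - sq P)" by simp
 then have "norm (sq P) \<le> norm (r\<^sup>2 *\<^sub>R s 1)" by (intro psd_norm_mono s_pos)
 then show ?thesis by simp
qed

lemma norm_s_star_mult_le:
 assumes "bdd B b" "bdd A a"
 shows "norm (s (star B * A)) \<le> 4 * b * a * norm (s 1)"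
proof -
 have *: "norm (s (star B * A)) \<le> 4 * b * a * norm (s 1)" if ab: "bdd B b" "bdd A a" "b > 0" "a > 0" for a b
 proof -
  define A' B' where "A' = complex_of_real (1/a) *\<^sub>C A" and "B' = complex_of_real (1/b) *\<^sub>C B"
  have A': "bdd A' 1" and B': "bdd B' 1"
   using bdd_scaleC [OF ab(2), of "complex_of_real (1/a)"] bdd_scaleC [OF ab(1), of "complex_of_real (1/b)"] ab
   by (simp_all add: A'_def B'_def norm_divide)
  have iB': "bdd (\<i> *\<^sub>C B') 1" using bdd_scaleC [OF B', of \<i>] by simp
  have 4: "norm (sq Z) \<le> 4 * norm (s 1)" if "bdd Z (1 + 1)" for Z
   using norm_sq_le [OF that] by simp
  have "norm (4 *\<^sub>R s (star B' * A')) \<le> norm (sq (A' + B')) + norm (\<i> *\<^sub>C sq (A' + \<i> *\<^sub>C B'))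
    + norm (sq (A' - B')) + norm (\<i> *\<^sub>C sq (A' - \<i> *\<^sub>C B'))"
   unfolding s_polarization by (intro norm_triangle_le_diff norm_triangle_le add_mono order_refl)
  also have "\<dots> \<le> 4 * norm (s 1) + 4 * norm (s 1) + 4 * norm (s 1) + 4 * norm (s 1)"
   using A' B' iB' by (intro add_mono) (auto simp: norm_scaleC intro!: 4 bdd_add bdd_diff)
  finally have "norm (s (star B' * A')) \<le> 4 * norm (s 1)" by simp
  moreover have "s (star B' * A') = (1 / (a * b)) *\<^sub>R s (star B * A)"
   by (simp add: A'_def B'_def star_scaleC scaleC_simps s_scaleC scaleR_scaleC)
  ultimately show ?thesis using ab by (simp add: divide_le_eq mult_ac)
 qed
 have "(\<lambda>n. 4 * (b + 1 / real (Suc n)) * (a + 1 / real (Suc n)) * norm (s 1)) \<longlonglongrightarrow> 4 * (b + 0) * (a + 0) * norm (s 1)"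
  by (intro tendsto_intros LIMSEQ_Suc [OF lim_1_over_n])
 moreover have "norm (s (star B * A)) \<le> 4 * (b + 1 / real (Suc n)) * (a + 1 / real (Suc n)) * norm (s 1)" for n
  using assms [THEN bdd_nonneg] assms
  by (intro *) (auto intro: bdd_mono add_nonneg_pos)
 ultimately show ?thesis using LIMSEQ_le_const by fastforce
qed

lemma norm_s_le: "bdd A a ==> norm (s A) \<le> 4 * a * norm (s 1)"
 using norm_s_star_mult_le [OF bdd_1, of A a] by simp

lemma s_star: "s (star P) = star (s P)"
proof -
 have sa: "star (sq Z) = sq Z" for Z using s_pos [of Z] psd_self_adj by blast
 have gen: "star (a + \<i> *\<^sub>C b - c - \<i> *\<^sub>C d) = a - \<i> *\<^sub>C b - c + \<i> *\<^sub>C d"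
  if "star a = a" "star b = b" "star c = c" "star d = d" for a b c d :: 'c
  by (simp add: star_add star_diff star_scaleC that scaleC_minus_left)
 have "star (4 *\<^sub>R s (star 1 * P)) = 4 *\<^sub>R s (star P * 1)"
  unfolding s_polarization(1) [where A = P and B = 1] s_polarization(2) [where A = P and B = 1]
  by (rule gen [OF sa sa sa sa])
 then show ?thesis by (simp add: star_scaleR)
qed

text \<open>
 Sequences that are bounded and Cauchy in the Gelfand--Naimark--Segal seminorm stand for the elements
 of its completion, and null sequences for \<open>0\<close>.
\<close>

definition null :: "(nat => 'a) => bool" where
 "null P \<longleftrightarrow> (\<exists>e. e \<longlonglongrightarrow> 0 \<and> (\<forall>m. bdd (P m) (e m)))"

definition unif_bdd :: "(nat => 'a) => real => bool" where
 "unif_bdd P r \<longleftrightarrow> (\<forall>m. bdd (P m) r)"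

definition cau :: "(nat => 'a) => bool" where
 "cau P \<longleftrightarrow> (\<exists>r. unif_bdd P r) \<and> (\<exists>e. e \<longlonglongrightarrow> 0 \<and> (\<forall>m l. bdd (P m - P l) (e m + e l)))"

lemma null_add: "null P ==> null Q ==> null (\<lambda>m. P m + Q m)"
 unfolding null_def by (metis (no_types, lifting) add_0 bdd_add tendsto_add)

lemma null_minus: "null P ==> null (\<lambda>m. - P m)"
 unfolding null_def using bdd_minus by blast

lemma null_diff: "null P ==> null Q ==> null (\<lambda>m. P m - Q m)"
 using null_add [of P "\<lambda>m. - Q m"] null_minus [of Q] by simp

lemma null_mult_left:
 assumes "null P" "unif_bdd Q r"
 shows "null (\<lambda>m. Q m * P m)"
proof -
 obtain e where e: "e \<longlonglongrightarrow> 0" "\<And>m. bdd (P m) (e m)" using assms by (auto simp: null_def)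
 have "(\<lambda>m. r * e m) \<longlonglongrightarrow> r * 0" by (intro tendsto_intros e)
 then show ?thesis
  using bdd_mult [OF _ e(2)] assms(2) unfolding null_def unif_bdd_def
  by (intro exI [of _ "\<lambda>m. r * e m"]) auto
qed

lemma null_mult_right:
 assumes "null P" "unif_bdd Q r"
 shows "null (\<lambda>m. P m * Q m)"
proof -
 obtain e where e: "e \<longlonglongrightarrow> 0" "\<And>m. bdd (P m) (e m)" using assms by (auto simp: null_def)
 have "(\<lambda>m. e m * r) \<longlonglongrightarrow> 0 * r" by (intro tendsto_intros e)
 then show ?thesis
  using bdd_mult [OF e(2)] assms(2) unfolding null_def unif_bdd_def
  by (intro exI [of _ "\<lambda>m. e m * r"]) auto
qed

lemma null_tendsto:
 assumes "null P"
 shows "(\<lambda>m. s (P m)) \<longlonglongrightarrow> 0"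
proof -
 obtain e where e: "e \<longlonglongrightarrow> 0" "\<And>m. bdd (P m) (e m)" using assms by (auto simp: null_def)
 have "(\<lambda>m. 4 * e m * norm (s 1)) \<longlonglongrightarrow> 4 * 0 * norm (s 1)" by (intro tendsto_intros e)
 then have lim: "(\<lambda>m. 4 * e m * norm (s 1)) \<longlonglongrightarrow> 0" by simp
 show ?thesis
  by (rule Lim_null_comparison [OF _ lim]) (simp add: norm_s_le [OF e(2)])
qed

lemma null_geometric:
 assumes "bdd E q" "q < 1"
 shows "null (\<lambda>m. E ^ m)"
 unfolding null_def using assms bdd_nonneg [OF assms(1)]
 by (intro exI [of _ "\<lambda>m. q ^ m"]) (auto intro: bdd_power LIMSEQ_realpow_zero)

lemma unif_bdd_const: "bdd P r ==> unif_bdd (\<lambda>m. P) r"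
 by (simp add: unif_bdd_def)

lemma unif_bdd_mult: "unif_bdd P r ==> unif_bdd Q t ==> unif_bdd (\<lambda>m. P m * Q m) (r * t)"
 by (simp add: unif_bdd_def bdd_mult)

lemma cau_const: "bdd P r ==> cau (\<lambda>m. P)"
 unfolding cau_def using bdd_0 by (auto intro!: exI [of _ "\<lambda>_. 0"] exI [of _ r] unif_bdd_const)

lemma cau_mult:
 assumes "cau P" "cau Q"
 shows "cau (\<lambda>m. P m * Q m)"
proof -
 obtain r t e d where P: "unif_bdd P r" "e \<longlonglongrightarrow> 0" "\<And>m l. bdd (P m - P l) (e m + e l)"
  and Q: "unif_bdd Q t" "d \<longlonglongrightarrow> 0" "\<And>m l. bdd (Q m - Q l) (d m + d l)"
  using assms unfolding cau_def by blast
 have "bdd (P m * Q m - P l * Q l) ((e m * t + r * d m) + (e l * t + r * d l))" for m l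
 proof -
  have "bdd ((P m - P l) * Q m + P l * (Q m - Q l)) ((e m + e l) * t + r * (d m + d l))"
   using P Q by (intro bdd_add bdd_mult) (auto simp: unif_bdd_def)
  then show ?thesis by (simp add: algebra_simps)
 qed
 moreover have "(\<lambda>m. e m * t + r * d m) \<longlonglongrightarrow> 0 * t + r * 0"
  by (intro tendsto_intros P Q)
 ultimately show ?thesis
  unfolding cau_def using unif_bdd_mult [OF P(1) Q(1)]
  by (intro conjI exI [of _ "r * t"] exI [of _ "\<lambda>m. e m * t + r * d m"]) auto
qed

lemma cau_convergent:
 assumes "cau P"
 shows "convergent (\<lambda>m. s (P m))"
proof (rule Cauchy_convergent, rule metric_CauchyI)
 obtain e where e: "e \<longlonglongrightarrow> 0" "\<And>m l. bdd (P m - P l) (e m + e l)"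
  using assms unfolding cau_def by blast
 fix d :: real assume d: "d > 0"
 define c where "c = 4 * norm (s 1)"
 have c: "c \<ge> 0" by (simp add: c_def)
 define w where "w = d / (c + 1)"
 have w: "w > 0" using c d by (simp add: w_def)
 then have "\<forall>\<^sub>F m in sequentially. dist (e m) 0 < w / 2"
  using e(1) by (intro tendstoD) auto
 then obtain N where N: "\<And>m. m \<ge> N ==> \<bar>e m\<bar> < w / 2"
  by (auto simp: eventually_sequentially)
 have "dist (s (P m)) (s (P l)) < d" if "m \<ge> N" "l \<ge> N" for m l
 proof -
  have "dist (s (P m)) (s (P l)) = norm (s (P m - P l))" by (simp add: dist_norm s_diff)
  also have "\<dots> \<le> (e m + e l) * c" using norm_s_le [OF e(2), of m l] by (simp add: c_def mult_ac)
  also have "\<dots> \<le> w * c"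
   using N [OF that(1)] N [OF that(2)] by (intro mult_right_mono c) linarith
  also have "\<dots> < d" using c d by (simp add: w_def divide_less_eq)
  finally show ?thesis .
 qed
 then show "\<exists>N. \<forall>m\<ge>N. \<forall>l\<ge>N. dist (s (P m)) (s (P l)) < d" by blast
qed

definition slim :: "(nat => 'a) => 'c" where
 "slim P = lim (\<lambda>m. s (P m))"

lemma cau_tendsto: "cau P ==> (\<lambda>m. s (P m)) \<longlonglongrightarrow> slim P"
 using cau_convergent by (simp add: slim_def convergent_LIMSEQ_iff)

text \<open>
 The inverse of \<open>T\<close> lives in the completion only, as the limit of the sequence \<open>R\<close>.
\<close>

definition ainv :: "'a => (nat => 'a) => real => bool" where
 "ainv T R r \<longleftrightarrow> unif_bdd R r \<and> null (\<lambda>m. 1 - T * R m) \<and> null (\<lambda>m. 1 - R m * T)"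

lemma ainv_resolvent:
 assumes "ainv T R r" "ainv T' R' r'"
 shows "null (\<lambda>m. R' m - R m - R' m * (T - T') * R m)"
proof -
 have "null (\<lambda>m. R' m * (1 - T * R m) - (1 - R' m * T') * R m)"
  using assms unfolding ainv_def by (auto intro: null_diff [OF null_mult_left null_mult_right])
 moreover have "R' m * (1 - T * R m) - (1 - R' m * T') * R m = R' m - R m - R' m * (T - T') * R m" for m
  by (simp add: algebra_simps)
 ultimately show ?thesis by simp
qed

lemma ainv_cau:
 assumes "ainv T R r"
 shows "cau R"
proof -
 obtain e d where R: "unif_bdd R r" and e: "e \<longlonglongrightarrow> 0" "\<And>m. bdd (1 - T * R m) (e m)"
  and d: "d \<longlonglongrightarrow> 0" "\<And>m. bdd (1 - R m * T) (d m)"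
  using assms unfolding ainv_def null_def by blast
 have "bdd (R m - R l) ((r * e m + r * d m) + (r * e l + r * d l))" for m l
 proof -
  have "bdd (R m * (1 - T * R l) - (1 - R m * T) * R l) (r * e l + d m * r)"
   using R e d by (intro bdd_diff bdd_mult) (auto simp: unif_bdd_def)
  then have "bdd (R m - R l) (r * e l + d m * r)" by (simp add: algebra_simps)
  then show ?thesis
   using bdd_nonneg [OF R [unfolded unif_bdd_def, rule_format, of 0]]
    bdd_nonneg [OF e(2)] bdd_nonneg [OF d(2)]
   by (elim bdd_mono) (simp add: mult_ac)
 qed
 moreover have "(\<lambda>m. r * e m + r * d m) \<longlonglongrightarrow> r * 0 + r * 0"
  by (intro tendsto_intros e d)
 ultimately show ?thesis
  unfolding cau_def using R by (intro conjI exI [of _ r] exI [of _ "\<lambda>m. r * e m + r * d m"]) auto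
qed

lemma ainv_unique:
 assumes "ainv T R r" "ainv T R' r'"
 shows "slim R = slim R'"
proof -
 have "(\<lambda>m. s (R' m - R m - R' m * (T - T) * R m)) \<longlonglongrightarrow> 0"
  by (intro null_tendsto ainv_resolvent [OF assms])
 then have "(\<lambda>m. s (R' m) - s (R m)) \<longlonglongrightarrow> 0" by (simp add: s_diff)
 moreover have "(\<lambda>m. s (R' m) - s (R m)) \<longlonglongrightarrow> slim R' - slim R"
  by (intro tendsto_diff cau_tendsto ainv_cau [OF assms(1)] ainv_cau [OF assms(2)])
 ultimately show ?thesis using LIMSEQ_unique by fastforce
qed

text \<open>
 On the half plane and near infinity alike, the derivative is the limit of \<open>h \<mapsto> z s (P h Q)\<close> with
 approximate inverses \<open>P\<close> and \<open>Q\<close>, and the resolvent identity gives the remainder \<open>s A\<close> of second order.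
\<close>

lemma quad_diffI:
 assumes P: "cau P" "cau Q"
  and d: "d > 0"
  and *: "\<And>h. norm h < d ==> \<exists>A. (\<lambda>m. s (A m)) \<longlonglongrightarrow> f (b + h) - f b - z *\<^sub>C slim (\<lambda>m. P m * emb h * Q m)
    \<and> (\<forall>m. norm (s (A m)) \<le> C * (norm h)\<^sup>2)"
 shows "quad_diff f b"
proof -
 define L where "L h = slim (\<lambda>m. P m * emb h * Q m)" for h
 have lim: "(\<lambda>m. s (P m * emb h * Q m)) \<longlonglongrightarrow> L h" for h
  unfolding L_def by (intro cau_tendsto cau_mult P cau_const [OF bdd_emb])
 have add: "L (h + k) = L h + L k" for h k
  using tendsto_add [OF lim [of h] lim [of k]] lim [of "h + k"]
  by (intro LIMSEQ_unique [of "\<lambda>m. s (P m * emb (h + k) * Q m)"]) (auto simp: emb_add algebra_simps s_add)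
 have bl: "bounded_linear (scaleC w :: 'c => 'c)" for w
  by (rule bounded_linear_intro [of _ "cmod w"]) (auto simp: scaleC_simps scaleR_scaleC norm_scaleC mult.commute)
 have scale: "L (w *\<^sub>C h) = w *\<^sub>C L h" for w h
  using bounded_linear.tendsto [OF bl [of w] lim [of h]] lim [of "w *\<^sub>C h"]
  by (intro LIMSEQ_unique [of "\<lambda>m. s (P m * emb (w *\<^sub>C h) * Q m)"]) (auto simp: emb_scaleC scaleC_simps s_scaleC)
 obtain r t where rt: "unif_bdd P r" "unif_bdd Q t" using P unfolding cau_def by blast
 have nL: "norm (L h) \<le> 4 * (r * t) * norm (s 1) * norm h" for h
 proof (rule LIMSEQ_le_const2 [OF tendsto_norm [OF lim [of h]]], intro exI allI impI)
  fix m
  have "bdd (P m * emb h * Q m) (r * norm h * t)"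
   using rt bdd_emb [of h] by (intro bdd_mult) (auto simp: unif_bdd_def)
  from norm_s_le [OF this]
  show "norm (s (P m * emb h * Q m)) \<le> 4 * (r * t) * norm (s 1) * norm h" by (simp add: mult_ac)
 qed
 show ?thesis
  unfolding quad_diff_def
 proof (intro exI conjI allI impI)
  show "d > 0" by (rule d)
  show "z *\<^sub>C L (h + k) = z *\<^sub>C L h + z *\<^sub>C L k" for h k by (simp add: add scaleC_add_right)
  show "z *\<^sub>C L (w *\<^sub>C h) = w *\<^sub>C z *\<^sub>C L h" for w h by (simp add: scale scaleC_simps mult.commute)
  show "norm (z *\<^sub>C L h) \<le> (cmod z * (4 * (r * t) * norm (s 1))) * norm h" for h
   using nL [of h] by (simp add: norm_scaleC mult_left_mono mult.assoc)
  fix h :: 'c assume "norm h < d"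
  from * [OF this] obtain A where A: "(\<lambda>m. s (A m)) \<longlonglongrightarrow> f (b + h) - f b - z *\<^sub>C L h"
   "\<And>m. norm (s (A m)) \<le> C * (norm h)\<^sup>2" by (auto simp: L_def)
  show "norm (f (b + h) - f b - z *\<^sub>C L h) \<le> C * (norm h)\<^sup>2"
   using LIMSEQ_le_const2 [OF tendsto_norm [OF A(1)]] A(2) by blast
 qed
qed

subsection \<open>The half plane\<close>

definition approx :: "real => 'c => nat => 'a" where
 "approx t b m = (- \<i> * complex_of_real t) *\<^sub>C (\<Sum>k<m. (1 + (\<i> * complex_of_real t) *\<^sub>C (emb b - X)) ^ k)"

lemma sum_power_mult_left: "(1 - x) * (\<Sum>k<m. x ^ k) = 1 - (x::'a) ^ m"
proof (induction m)
 case (Suc m)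
 have "(1 - x) * (\<Sum>k<Suc m. x ^ k) = (1 - x) * (\<Sum>k<m. x ^ k) + (1 - x) * x ^ m"
  by (simp add: distrib_left)
 then show ?case unfolding Suc by (simp add: left_diff_distrib)
qed simp

lemma sum_power_mult_right: "(\<Sum>k<m. x ^ k) * (1 - x) = 1 - (x::'a) ^ m"
proof (induction m)
 case (Suc m)
 have "(\<Sum>k<Suc m. x ^ k) * (1 - x) = (\<Sum>k<m. x ^ k) * (1 - x) + x ^ m * (1 - x)"
  by (simp add: distrib_right)
 then show ?case unfolding Suc by (simp add: right_diff_distrib power_commutes)
qed simp

lemmas sum_power_mult = sum_power_mult_left sum_power_mult_right

lemma bdd_pencil: "bdd (emb b - X) (norm b + M)"
 by (intro bdd_diff bdd_emb bdd_X)

text \<open>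
 For small \<open>t\<close> the element \<open>S = 1 + i t (b - X)\<close> is a contraction, because the first order term of
 \<open>S\<^sup>* S\<close> is \<open>- 2 t Im b\<close>. So the resolvent of \<open>X\<close> at \<open>b\<close> is a convergent geometric series in \<open>S\<close>,
 anywhere in the half plane.
\<close>

lemma ainv_approx:
 assumes im: "psd (Im_part b - of_real \<epsilon>)" and e: "\<epsilon> > 0" "\<epsilon> \<le> R" "norm b + M \<le> R" and t: "0 < t" "t * R\<^sup>2 \<le> \<epsilon>"
 shows "ainv (emb b - X) (approx t b) (2 / \<epsilon>)"
proof -
 define T where "T = emb b - X"
 define c where "c = \<i> * complex_of_real t"
 define S where "S = 1 + c *\<^sub>C T"
 define \<kappa> where "\<kappa> = sqrt (1 - t * \<epsilon>)"
 have R: "R > 0" using e by linarith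
 have "t * \<epsilon> * R\<^sup>2 \<le> \<epsilon> * \<epsilon>" using t e mult_left_mono [OF t(2), of \<epsilon>] by (simp add: mult_ac)
 also have "\<dots> \<le> R\<^sup>2" using e by (simp add: power2_eq_square mult_mono)
 finally have te: "t * \<epsilon> \<le> 1" using R by simp
 have tep: "t * \<epsilon> > 0" using t e by simp
 have \<kappa>: "0 \<le> \<kappa>" "\<kappa> < 1" "\<kappa>\<^sup>2 = 1 - t * \<epsilon>" using te tep by (auto simp: \<kappa>_def)
 have "(1 - t * \<epsilon> / 2)\<^sup>2 = 1 - t * \<epsilon> + (t * \<epsilon> / 2)\<^sup>2" by (simp add: power2_eq_square algebra_simps)
 then have "(1 - t * \<epsilon> / 2)\<^sup>2 \<ge> 1 - t * \<epsilon>" by simp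
 then have \<kappa>2: "\<kappa> \<le> 1 - t * \<epsilon> / 2" unfolding \<kappa>_def using te by (intro real_le_lsqrt) auto
 have bS: "bdd S \<kappa>"
 proof -
  have "psd (\<kappa>\<^sup>2 *\<^sub>R sq Y - sq (S * Y))" for Y
  proof -
   have cc: "cnj c = - c" "c * c = - complex_of_real (t\<^sup>2)"
    by (simp_all add: c_def power_mult_distrib flip: power2_eq_square)
   have ImT: "T - star T = (2 * \<i>) *\<^sub>C emb (Im_part b)"
    by (simp add: T_def Im_part_def emb_scaleC emb_diff emb_star star_diff X_sa scaleC_simps)
   have "star S * S = 1 + c *\<^sub>C (T - star T) + complex_of_real (t\<^sup>2) *\<^sub>C (star T * T)"
    by (simp add: S_def star_add star_scaleC cc algebra_simps scaleC_simps)
   also have "c *\<^sub>C (T - star T) = - (complex_of_real (2 * t) *\<^sub>C emb (Im_part b))"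
    unfolding ImT by (simp add: c_def scaleC_scaleC scaleC_minus_left [symmetric] algebra_simps)
   finally have SS: "star S * S = 1 - complex_of_real (2 * t) *\<^sub>C emb (Im_part b) + complex_of_real (t\<^sup>2) *\<^sub>C (star T * T)"
    by simp
   have sqS: "sq (S * Y) = sq Y - (2 * t) *\<^sub>R s (star Y * emb (Im_part b) * Y) + t\<^sup>2 *\<^sub>R sq (T * Y)"
   proof -
    have "star (S * Y) * (S * Y) = star Y * (star S * S) * Y" by (simp add: star_mult mult.assoc)
    also have "\<dots> = star Y * Y - complex_of_real (2 * t) *\<^sub>C (star Y * emb (Im_part b) * Y)
      + complex_of_real (t\<^sup>2) *\<^sub>C (star (T * Y) * (T * Y))"
     unfolding SS by (simp add: algebra_simps scaleC_simps star_mult)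
    finally show ?thesis by (simp only: s_add s_diff s_scaleC scaleC_of_real)
   qed
   have 1: "psd (s (star Y * emb (Im_part b) * Y) - \<epsilon> *\<^sub>R sq Y)"
    using psd_s_emb [OF im, of Y] by (simp add: emb_diff algebra_simps s_diff s_emb_of_real s_emb_of_real')
   have 2: "psd (R\<^sup>2 *\<^sub>R sq Y - sq (T * Y))"
    unfolding T_def by (intro bddD bdd_mono [OF bdd_pencil] e)
   have "psd ((2 * t) *\<^sub>R (s (star Y * emb (Im_part b) * Y) - \<epsilon> *\<^sub>R sq Y)
     + t\<^sup>2 *\<^sub>R (R\<^sup>2 *\<^sub>R sq Y - sq (T * Y)) + (t * \<epsilon> - t\<^sup>2 * R\<^sup>2) *\<^sub>R sq Y)"
    using t by (intro psd_add psd_scaleR 1 2 s_pos) (auto simp: power2_eq_square mult.assoc intro: mult_left_mono)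
   moreover have "(2 * t) *\<^sub>R (s (star Y * emb (Im_part b) * Y) - \<epsilon> *\<^sub>R sq Y)
     + t\<^sup>2 *\<^sub>R (R\<^sup>2 *\<^sub>R sq Y - sq (T * Y)) + (t * \<epsilon> - t\<^sup>2 * R\<^sup>2) *\<^sub>R sq Y = \<kappa>\<^sup>2 *\<^sub>R sq Y - sq (S * Y)"
    unfolding sqS \<kappa>(3) by (simp add: algebra_simps)
     (simp add: mult.assoc [symmetric] scaleR_left.add [symmetric] del: scaleR_left.add)
   ultimately show ?thesis by simp
  qed
  then show ?thesis using \<kappa> by (simp add: bdd_def)
 qed
 have c0: "c \<noteq> 0" using t by (simp add: c_def)
 have ap: "approx t b m = (- c) *\<^sub>C (\<Sum>k<m. S ^ k)" for m by (simp add: approx_def S_def T_def c_def)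
 have T1: "(- c) *\<^sub>C T = 1 - S" by (simp add: S_def scaleC_minus_left)
 have TR: "T * approx t b m = 1 - S ^ m" for m
 proof -
  have "T * approx t b m = ((- c) *\<^sub>C T) * (\<Sum>k<m. S ^ k)" unfolding ap by (simp only: mult_scaleC_left mult_scaleC_right)
  then show ?thesis unfolding T1 sum_power_mult .
 qed
 have RT: "approx t b m * T = 1 - S ^ m" for m
 proof -
  have "approx t b m * T = (\<Sum>k<m. S ^ k) * ((- c) *\<^sub>C T)" unfolding ap by (simp only: mult_scaleC_left mult_scaleC_right)
  then show ?thesis unfolding T1 sum_power_mult .
 qed
 have "bdd (approx t b m) (2 / \<epsilon>)" for m
 proof -
  have "bdd (approx t b m) (cmod (- c) * (\<Sum>k<m. \<kappa> ^ k))"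
   unfolding ap by (intro bdd_scaleC bdd_sum bdd_power bS) auto
  moreover have "cmod (- c) * (\<Sum>k<m. \<kappa> ^ k) \<le> 2 / \<epsilon>"
  proof -
   have "(\<Sum>k<m. \<kappa> ^ k) = (1 - \<kappa> ^ m) / (1 - \<kappa>)"
    using \<kappa> sum_gp_strict [of \<kappa> m] by simp
   also have "\<dots> \<le> 1 / (1 - \<kappa>)" using \<kappa> by (intro divide_right_mono) auto
   also have "\<dots> \<le> 1 / (t * \<epsilon> / 2)" using \<kappa> \<kappa>2 tep by (intro divide_left_mono) auto
   finally have "t * (\<Sum>k<m. \<kappa> ^ k) \<le> t * (1 / (t * \<epsilon> / 2))" using t by (intro mult_left_mono) auto
   then show ?thesis using t e by (simp add: c_def norm_mult)
  qed
  ultimately show ?thesis by (rule bdd_mono)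
 qed
 then show ?thesis
  unfolding ainv_def T_def [symmetric] TR RT
  using null_geometric [OF bS \<kappa>(2)] by (simp add: unif_bdd_def)
qed

text \<open>
 How small \<open>t\<close> has to be depends on \<open>b\<close>, but the limit does not depend on \<open>t\<close>.
\<close>

definition transform :: "'c => 'c" where
 "transform b = (THE w. \<exists>t0>0. \<forall>t. 0 < t \<and> t < t0 --> (\<lambda>m. s (approx t b m)) \<longlonglongrightarrow> w)"

lemma transform_eq_slim:
 assumes im: "psd (Im_part b - of_real \<epsilon>)" and e: "\<epsilon> > 0" and R: "ainv (emb b - X) R r"
 shows "transform b = slim R"
  and "\<exists>t0>0. \<forall>t. 0 < t \<and> t < t0 --> (\<lambda>m. s (approx t b m)) \<longlonglongrightarrow> transform b"
proof -
 define R0 where "R0 = max \<epsilon> (norm b + M)"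
 have R0: "R0 > 0" "\<epsilon> \<le> R0" "norm b + M \<le> R0" using e by (auto simp: R0_def)
 have lim: "(\<lambda>m. s (approx t b m)) \<longlonglongrightarrow> slim R" if "0 < t" "t < \<epsilon> / R0\<^sup>2" for t
 proof -
  have "ainv (emb b - X) (approx t b) (2 / \<epsilon>)"
   using that R0 by (intro ainv_approx [OF im e]) (auto simp: less_divide_eq)
  then show ?thesis using cau_tendsto [OF ainv_cau] ainv_unique [OF R] by metis
 qed
 show eq: "transform b = slim R"
  unfolding transform_def
 proof (rule the_equality)
  show "\<exists>t0>0. \<forall>t. 0 < t \<and> t < t0 --> (\<lambda>m. s (approx t b m)) \<longlonglongrightarrow> slim R"
   using lim e R0 by (intro exI [of _ "\<epsilon> / R0\<^sup>2"]) auto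
  fix w assume "\<exists>t0>0. \<forall>t. 0 < t \<and> t < t0 --> (\<lambda>m. s (approx t b m)) \<longlonglongrightarrow> w"
  then obtain t0 where t0: "t0 > 0" "\<And>t. 0 < t ==> t < t0 ==> (\<lambda>m. s (approx t b m)) \<longlonglongrightarrow> w" by auto
  define u where "u = \<epsilon> / R0\<^sup>2"
  define t where "t = min t0 u / 2"
  have "u > 0" using e R0 by (simp add: u_def)
  then have "0 < t" "t < t0" "t < \<epsilon> / R0\<^sup>2" using t0 unfolding u_def [symmetric] t_def by auto
  then show "w = slim R" using lim t0 LIMSEQ_unique by blast
 qed
 show "\<exists>t0>0. \<forall>t. 0 < t \<and> t < t0 --> (\<lambda>m. s (approx t b m)) \<longlonglongrightarrow> transform b"
  unfolding eq using lim e R0 by (intro exI [of _ "\<epsilon> / R0\<^sup>2"]) auto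
qed

lemma ainv_exists:
 assumes "psd (Im_part b - of_real \<epsilon>)" "\<epsilon> > 0"
 obtains R where "ainv (emb b - X) R (2 / \<epsilon>)"
proof -
 define R0 where "R0 = max \<epsilon> (norm b + M)"
 have R0: "R0 > 0" "\<epsilon> \<le> R0" "norm b + M \<le> R0" using assms by (auto simp: R0_def)
 have "ainv (emb b - X) (approx (\<epsilon> / R0\<^sup>2) b) (2 / \<epsilon>)"
  using R0 assms by (intro ainv_approx) auto
 then show ?thesis using that by blast
qed

lemma quad_diff_transform:
 assumes im: "psd (Im_part b - of_real \<epsilon>)" and e: "\<epsilon> > 0"
 shows "quad_diff transform b"
proof -
 obtain R where R: "ainv (emb b - X) R (2 / \<epsilon>)" using ainv_exists [OF im e] .
 have RB: "unif_bdd R (2 / \<epsilon>)" using R by (simp add: ainv_def)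
 show ?thesis
 proof (rule quad_diffI [OF ainv_cau [OF R] ainv_cau [OF R], where d = "\<epsilon> / 2" and z = "-1"
    and C = "4 * (4 / \<epsilon> * (2 / \<epsilon>) * (2 / \<epsilon>)) * norm (s 1)"])
  fix h :: 'c assume h: "norm h < \<epsilon> / 2"
  have "psd (Im_part b - of_real \<epsilon> + (of_real (norm (Im_part h)) - Im_part (- h)) + of_real (\<epsilon> / 2 - norm (Im_part h)))"
   using h norm_Im_part_le [of h] im
   by (intro psd_add psd_of_real psd_norm_minus self_adj_Im_part)
    (auto simp: Im_part_def norm_scaleC norm_minus_commute)
  moreover have "Im_part (- h) = - Im_part h" "Im_part (b + h) = Im_part b + Im_part h"
   by (simp_all add: Im_part_def star_add scaleC_simps)
  moreover have "(of_real \<epsilon> :: 'c) = of_real (\<epsilon> / 2) + of_real (\<epsilon> / 2)" by (simp flip: of_real_add)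
  ultimately have im': "psd (Im_part (b + h) - of_real (\<epsilon> / 2))" by (simp add: algebra_simps)
  have e2: "\<epsilon> / 2 > 0" using e by simp
  obtain R' where R': "ainv (emb (b + h) - X) R' (2 / (\<epsilon> / 2))" using ainv_exists [OF im' e2] .
  have RB': "unif_bdd R' (4 / \<epsilon>)" using R' by (simp add: ainv_def)
  define D where "D m = R' m - R m - R' m * (- emb h) * R m" for m
  have D: "null D"
   using ainv_resolvent [OF R R'] by (simp add: D_def [abs_def] emb_add)
  define A where "A m = R' m * emb h * R m * emb h * R m" for m
  have id: "s (A m) = s (R' m) - s (R m) + s (R m * emb h * R m) - s (D m) + s (D m * emb h * R m)" for m
   unfolding s_add [symmetric] s_diff [symmetric] by (rule arg_cong [of _ _ s]) (simp add: A_def D_def algebra_simps)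
  have "(\<lambda>m. s (A m)) \<longlonglongrightarrow> slim R' - slim R + slim (\<lambda>m. R m * emb h * R m) - 0 + 0"
   unfolding id
   by (intro tendsto_add tendsto_diff cau_tendsto null_tendsto cau_mult ainv_cau [OF R] ainv_cau [OF R'] D
     cau_const [OF bdd_emb] null_mult_right [OF null_mult_right [OF D unif_bdd_const [OF bdd_emb]] RB])
  then have "(\<lambda>m. s (A m)) \<longlonglongrightarrow> transform (b + h) - transform b - (-1) *\<^sub>C slim (\<lambda>m. R m * emb h * R m)"
   using transform_eq_slim(1) [OF im e R] transform_eq_slim(1) [OF im' e2 R']
   by (simp add: scaleC_minus_left scaleC_one)
  moreover have "norm (s (A m)) \<le> 4 * (4 / \<epsilon> * (2 / \<epsilon>) * (2 / \<epsilon>)) * norm (s 1) * (norm h)\<^sup>2" for m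
  proof -
   have "bdd (A m) (4 / \<epsilon> * norm h * (2 / \<epsilon>) * norm h * (2 / \<epsilon>))"
    unfolding A_def using RB RB' bdd_emb [of h] by (intro bdd_mult) (auto simp: unif_bdd_def)
   from norm_s_le [OF this] show ?thesis by (simp add: power2_eq_square mult_ac)
  qed
  ultimately show "\<exists>A. (\<lambda>m. s (A m)) \<longlonglongrightarrow> transform (b + h) - transform b - (-1) *\<^sub>C slim (\<lambda>m. R m * emb h * R m)
    \<and> (\<forall>m. norm (s (A m)) \<le> 4 * (4 / \<epsilon> * (2 / \<epsilon>) * (2 / \<epsilon>)) * norm (s 1) * (norm h)\<^sup>2)" by blast
 qed (use e in simp)
qed

lemma sq_tendsto_s_1:
 assumes "null E"
 shows "(\<lambda>m. sq (1 - E m)) \<longlonglongrightarrow> s 1"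
proof -
 obtain e where e: "e \<longlonglongrightarrow> 0" "\<And>m. bdd (E m) (e m)" using assms by (auto simp: null_def)
 have EE: "(\<lambda>m. sq (E m)) \<longlonglongrightarrow> 0"
 proof (rule Lim_null_comparison [where g = "\<lambda>m. (e m)\<^sup>2 * norm (s 1)"])
  have "(\<lambda>m. (e m)\<^sup>2 * norm (s 1)) \<longlonglongrightarrow> 0\<^sup>2 * norm (s 1)" by (intro tendsto_intros e)
  then show "(\<lambda>m. (e m)\<^sup>2 * norm (s 1)) \<longlonglongrightarrow> 0" by simp
 qed (simp add: norm_sq_le [OF e(2)])
 have "(\<lambda>m. s 1 - s (E m) - star (s (E m)) + sq (E m)) \<longlonglongrightarrow> s 1 - 0 - star 0 + 0"
  by (intro tendsto_intros null_tendsto assms EE)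
 moreover have "sq (1 - E m) = s 1 - s (E m) - star (s (E m)) + sq (E m)" for m
  by (simp add: star_diff algebra_simps s_add s_diff flip: s_star)
 ultimately show ?thesis by simp
qed

text \<open>
 For an exact inverse \<open>R\<close> of \<open>T = b - X\<close>, the identity is \<open>- Im R = R\<^sup>* (Im b) R\<close>.
\<close>

lemma Im_transform:
 assumes R: "ainv (emb b - X) R r" and slim: "transform b = slim R"
 shows "(\<lambda>m. s (star (R m) * emb (Im_part b) * R m)) \<longlonglongrightarrow> - Im_part (transform b)"
proof -
 define T where "T = emb b - X"
 define E where "E m = 1 - T * R m" for m
 obtain e where e: "e \<longlonglongrightarrow> 0" "\<And>m. bdd (E m) (e m)" using R by (auto simp: ainv_def null_def E_def T_def)
 have RB: "bdd (R m) r" for m using R by (simp add: ainv_def unif_bdd_def)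
 have ImT: "emb (Im_part b) = (1 / (2 * \<i>)) *\<^sub>C (T - star T)"
  by (simp add: T_def Im_part_def emb_scaleC emb_diff emb_star star_diff X_sa)
 have z: "(\<lambda>m. s (star (R m) * E m)) \<longlonglongrightarrow> 0"
 proof (rule Lim_null_comparison [where g = "\<lambda>m. 4 * r * e m * norm (s 1)"])
  have "(\<lambda>m. 4 * r * e m * norm (s 1)) \<longlonglongrightarrow> 4 * r * 0 * norm (s 1)" by (intro tendsto_intros e)
  then show "(\<lambda>m. 4 * r * e m * norm (s 1)) \<longlonglongrightarrow> 0" by simp
 qed (simp add: norm_s_star_mult_le [OF RB e(2)])
 have bl: "bounded_linear (scaleC w :: 'c => 'c)" for w
  by (rule bounded_linear_intro [of _ "cmod w"]) (auto simp: scaleC_simps scaleR_scaleC norm_scaleC mult.commute)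
 have "star (R m) * emb (Im_part b) * R m = (1 / (2 * \<i>)) *\<^sub>C (star (R m) * (T * R m) - star (T * R m) * R m)" for m
  unfolding ImT by (simp add: scaleC_simps algebra_simps star_mult)
 moreover have "T * R m = 1 - E m" for m by (simp add: E_def)
 ultimately have "star (R m) * emb (Im_part b) * R m
   = (1 / (2 * \<i>)) *\<^sub>C (star (R m) - star (R m) * E m - R m + star (E m) * R m)" for m
  by (simp add: algebra_simps star_diff)
 then have "s (star (R m) * emb (Im_part b) * R m)
   = (1 / (2 * \<i>)) *\<^sub>C (star (s (R m)) - s (star (R m) * E m) - s (R m) + star (s (star (R m) * E m)))" for m
  by (simp add: s_scaleC s_add s_diff star_mult star_star flip: s_star)
 moreover have "(\<lambda>m. (1 / (2 * \<i>)) *\<^sub>C (star (s (R m)) - s (star (R m) * E m) - s (R m) + star (s (star (R m) * E m))))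
   \<longlonglongrightarrow> (1 / (2 * \<i>)) *\<^sub>C (star (slim R) - 0 - slim R + star 0)"
  by (intro bounded_linear.tendsto [OF bl] tendsto_intros cau_tendsto ainv_cau [OF R] z)
 moreover have "(1 / (2 * \<i>)) *\<^sub>C (star (slim R) - 0 - slim R + star 0) = - Im_part (transform b)"
  by (simp add: Im_part_def slim scaleC_simps)
 ultimately show ?thesis by simp
qed

text \<open>
 \<open>1 = R\<^sup>* T\<^sup>* T R \<le> (norm b + M)\<^sup>2 R\<^sup>* R\<close>, and \<open>Im b \<ge> \<epsilon>\<close>.
\<close>

lemma Im_transform_lower:
 assumes im: "psd (Im_part b - of_real \<epsilon>)" and e: "\<epsilon> > 0"
 shows "psd (- Im_part (transform b) - (\<epsilon> / (norm b + M)\<^sup>2) *\<^sub>R s 1)"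
proof -
 obtain R where R: "ainv (emb b - X) R (2 / \<epsilon>)" using ainv_exists [OF im e] .
 define T where "T = emb b - X"
 define E where "E m = 1 - T * R m" for m
 define c where "c = norm b + M"
 have c: "c > 0" using M_pos norm_ge_zero [of b] unfolding c_def by linarith
 have E: "null E" using R by (simp add: ainv_def E_def [abs_def] T_def)
 have "psd (s (star (R m) * emb (Im_part b) * R m) - (\<epsilon> / c\<^sup>2) *\<^sub>R sq (1 - E m))" for m
 proof -
  have "psd (s (star (R m) * emb (Im_part b - of_real \<epsilon>) * R m) + (\<epsilon> / c\<^sup>2) *\<^sub>R (c\<^sup>2 *\<^sub>R sq (R m) - sq (T * R m)))"
   using e unfolding T_def c_def by (intro psd_add psd_scaleR psd_s_emb im bddD bdd_pencil) auto
  then show ?thesis using c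
   by (simp add: emb_diff s_diff algebra_simps s_emb_of_real s_emb_of_real' E_def)
 qed
 moreover have "(\<lambda>m. s (star (R m) * emb (Im_part b) * R m) - (\<epsilon> / c\<^sup>2) *\<^sub>R sq (1 - E m))
   \<longlonglongrightarrow> - Im_part (transform b) - (\<epsilon> / c\<^sup>2) *\<^sub>R s 1"
  by (intro tendsto_intros Im_transform [OF R] sq_tendsto_s_1 [OF E] transform_eq_slim(1) [OF im e R])
 ultimately show ?thesis unfolding c_def [symmetric] by (rule psd_limit)
qed

lemma Im_transform_neg:
 assumes im: "psd (Im_part b - of_real \<epsilon>)" and e: "\<epsilon> > 0"
 shows "psd (- Im_part (transform b))"
proof -
 have "psd (- Im_part (transform b) - (\<epsilon> / (norm b + M)\<^sup>2) *\<^sub>R s 1 + (\<epsilon> / (norm b + M)\<^sup>2) *\<^sub>R sq 1)"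
  using e by (intro psd_add Im_transform_lower [OF im e] psd_scaleR s_pos) auto
 then show ?thesis by simp
qed

text \<open>
 \<open>T\<^sup>* T = y\<^sup>2 + X\<^sup>2 \<ge> y\<^sup>2\<close> for \<open>T = \<i> y - X\<close>.
\<close>

lemma Im_transform_imaginary:
 assumes y: "y > 0" and b: "b = (\<i> * complex_of_real y) *\<^sub>C 1"
 shows "psd ((1 / y) *\<^sub>R s 1 + Im_part (transform b))"
proof -
 have Imb: "Im_part b = of_real y"
 proof -
  have "b - star b = (\<i> * complex_of_real y + \<i> * complex_of_real y) *\<^sub>C 1"
   unfolding scaleC_add_left by (simp add: b star_scaleC scaleC_minus_left)
  then show ?thesis by (simp add: Im_part_def scaleC_scaleC of_real_eq_scaleC [where 'c = 'c])
 qed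
 then have im: "psd (Im_part b - of_real y)" by simp
 obtain R where R: "ainv (emb b - X) R (2 / y)" using ainv_exists [OF im y] .
 define T where "T = emb b - X"
 define E where "E m = 1 - T * R m" for m
 have E: "null E" using R by (simp add: ainv_def E_def [abs_def] T_def)
 have TT: "star T * T = complex_of_real (y\<^sup>2) *\<^sub>C 1 + X * X"
  by (simp add: T_def b emb_scaleC emb_1 star_diff star_scaleC X_sa algebra_simps scaleC_simps power2_eq_square scaleC_minus_left)
 have "psd ((1 / y) *\<^sub>R sq (1 - E m) - s (star (R m) * emb (Im_part b) * R m))" for m
 proof -
  have "sq (T * R m) = s (star (R m) * (star T * T) * R m)" by (simp add: star_mult mult.assoc)
  also have "\<dots> = y\<^sup>2 *\<^sub>R sq (R m) + sq (X * R m)"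
   unfolding TT by (simp add: algebra_simps scaleC_simps s_add s_scaleC scaleR_scaleC star_mult X_sa)
  finally have "(1 / y) *\<^sub>R sq (1 - E m) - s (star (R m) * emb (Im_part b) * R m) = (1 / y) *\<^sub>R sq (X * R m)"
   using y by (simp add: E_def Imb s_emb_of_real scaleR_add_right power2_eq_square)
  then show ?thesis using y by (simp add: psd_scaleR s_pos)
 qed
 moreover have "(\<lambda>m. (1 / y) *\<^sub>R sq (1 - E m) - s (star (R m) * emb (Im_part b) * R m))
   \<longlonglongrightarrow> (1 / y) *\<^sub>R s 1 - (- Im_part (transform b))"
  by (intro tendsto_intros Im_transform [OF R] sq_tendsto_s_1 [OF E] transform_eq_slim(1) [OF im y R])
 ultimately show ?thesis using psd_limit by fastforce
qed

subsection \<open>The neighbourhood of infinity\<close>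

definition geom :: "'c => nat => 'a" where
 "geom c m = (\<Sum>k<m. (emb c * X) ^ k)"

definition geom' :: "'c => nat => 'a" where
 "geom' c m = (\<Sum>k<m. (X * emb c) ^ k)"

lemma power_swap: "(x * y) ^ k * x = x * (y * x) ^ k" for x y :: 'a
 by (induction k) (simp_all add: mult.assoc)

lemma geom_swap: "geom c m * emb c = emb c * geom' c m"
 by (simp add: geom_def geom'_def sum_distrib_left sum_distrib_right power_swap)

lemma geom_sum_le: "0 \<le> q ==> q < 1 ==> (\<Sum>k<m. q ^ k) \<le> 1 / (1 - q :: real)"
proof -
 assume q: "0 \<le> q" "q < 1"
 have "(\<Sum>k<m. q ^ k) = (1 - q ^ m) / (1 - q)" using q sum_gp_strict [of q m] by simp
 also have "\<dots> \<le> 1 / (1 - q)" using q by (intro divide_right_mono) auto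
 finally show ?thesis .
qed

lemma ainv_geom:
 assumes "norm c * M \<le> q" "q < 1"
 shows "ainv (1 - emb c * X) (geom c) (1 / (1 - q))" "ainv (1 - X * emb c) (geom' c) (1 / (1 - q))"
proof -
 have q: "0 \<le> q" using assms M_pos by (meson order_trans mult_nonneg_nonneg norm_ge_zero less_imp_le)
 have *: "ainv (1 - x) (\<lambda>m. \<Sum>k<m. x ^ k) (1 / (1 - q))" if x: "bdd x q" for x
 proof -
  have "bdd (\<Sum>k<m. x ^ k) (1 / (1 - q))" for m
   by (rule bdd_mono [OF bdd_sum [OF _ bdd_power [OF x]] geom_sum_le]) (use q assms in auto)
  then show ?thesis
   unfolding ainv_def sum_power_mult using null_geometric [OF x assms(2)] by (simp add: unif_bdd_def)
 qed
 have "bdd (emb c * X) (norm c * M)" "bdd (X * emb c) (M * norm c)" by (intro bdd_mult bdd_emb bdd_X)+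
 then have "bdd (emb c * X) q" "bdd (X * emb c) q" using assms by (auto elim!: bdd_mono simp: mult.commute)
 then show "ainv (1 - emb c * X) (geom c) (1 / (1 - q))" "ainv (1 - X * emb c) (geom' c) (1 / (1 - q))"
  using * unfolding geom_def [abs_def] geom'_def [abs_def] by auto
qed

definition moment_series :: "'c => 'c" where
 "moment_series c = slim (\<lambda>m. geom c m * emb c)"

lemma cau_moment_series: "norm c * M < 1 ==> cau (\<lambda>m. geom c m * emb c)"
 by (intro cau_mult ainv_cau [OF ainv_geom(1) [OF order_refl]] cau_const [OF bdd_emb])

lemma moment_series_tendsto:
 "norm c * M < 1 ==> (\<lambda>m. s (geom c m * emb c)) \<longlonglongrightarrow> moment_series c"
 unfolding moment_series_def by (intro cau_tendsto cau_moment_series)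

lemma moment_series_sums:
 assumes "norm c * M < 1"
 shows "(\<lambda>k. s ((emb c * X) ^ k * emb c)) sums moment_series c"
proof -
 have "s (geom c m * emb c) = (\<Sum>k<m. s ((emb c * X) ^ k * emb c))" for m
  by (induction m) (simp_all add: geom_def distrib_right s_add)
 then show ?thesis using moment_series_tendsto [OF assms] by (simp add: sums_def)
qed

lemma norm_moment_series_le:
 assumes "norm c * M \<le> q" "q < 1"
 shows "norm (moment_series c) \<le> 4 * (1 / (1 - q) * norm c) * norm (s 1)"
proof (rule LIMSEQ_le_const2 [OF tendsto_norm [OF moment_series_tendsto]])
 have "unif_bdd (geom c) (1 / (1 - q))" using ainv_geom(1) [OF assms] by (simp add: ainv_def)
 then have "bdd (geom c m * emb c) (1 / (1 - q) * norm c)" for m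
  by (intro bdd_mult bdd_emb) (auto simp: unif_bdd_def)
 then show "\<exists>N. \<forall>n\<ge>N. norm (s (geom c n * emb c)) \<le> 4 * (1 / (1 - q) * norm c) * norm (s 1)"
  using norm_s_le by blast
qed (use assms in auto)

lemma moment_series_star:
 assumes "norm c * M < 1"
 shows "moment_series (star c) = star (moment_series c)"
proof -
 have "star ((emb c * X) ^ k * emb c) = (emb (star c) * X) ^ k * emb (star c)" for k
  by (simp add: star_mult star_power emb_star X_sa power_swap)
 then have "star (s ((emb c * X) ^ k * emb c)) = s ((emb (star c) * X) ^ k * emb (star c))" for k
  by (metis s_star)
 moreover have "(\<lambda>k. star (s ((emb c * X) ^ k * emb c))) sums star (moment_series c)"
  by (intro bounded_linear.sums [OF bounded_linear_star] moment_series_sums assms)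
 ultimately show ?thesis
  using moment_series_sums [of "star c"] assms sums_unique2 by fastforce
qed

lemma moment_series_eq_transform:
 assumes im: "psd (Im_part b - of_real \<epsilon>)" and e: "\<epsilon> > 0" and c: "b * c = 1" "c * b = 1" "norm c * M < 1"
 shows "moment_series c = transform b"
proof -
 define q where "q = norm c * M"
 have q: "norm c * M \<le> q" "q < 1" using c by (auto simp: q_def)
 have ec: "emb b * emb c = 1" "emb c * emb b = 1" using c by (simp_all add: emb_1 flip: emb_mult)
 have ec': "emb b * (emb c * x) = x" "emb c * (emb b * x) = x" for x
  using ec by (simp_all flip: mult.assoc)
 note G = ainv_geom [OF q, unfolded ainv_def]
 have "1 - (emb b - X) * (geom c m * emb c) = 1 - (1 - X * emb c) * geom' c m" for m
  unfolding geom_swap by (simp add: left_diff_distrib ec' mult.assoc)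
 moreover have "1 - geom c m * emb c * (emb b - X) = 1 - geom c m * (1 - emb c * X)" for m
  by (simp add: right_diff_distrib ec mult.assoc)
 ultimately have "ainv (emb b - X) (\<lambda>m. geom c m * emb c) (1 / (1 - q) * norm c)"
  using G unif_bdd_mult [OF _ unif_bdd_const [OF bdd_emb, of c], of "geom c" "1 / (1 - q)"]
  unfolding ainv_def by simp
 then show ?thesis using transform_eq_slim(1) [OF im e] by (simp add: moment_series_def)
qed

lemma quad_diff_moment_series:
 assumes "norm c * M < 1"
 shows "quad_diff moment_series c"
proof -
 define q where "q = (norm c * M + 1) / 2"
 have half: "p \<le> (p + 1) / 2" "(p + 1) / 2 < 1" if "p < 1" for p :: real using that by auto
 have q: "norm c * M \<le> q" "q < 1" using half [OF assms] by (simp_all only: q_def)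
 define r where "r = 1 / (1 - q)"
 note G = ainv_geom(1) [OF q, folded r_def]
 note P = ainv_geom(2) [OF q, folded r_def]
 have GB: "unif_bdd (geom c) r" and PB: "unif_bdd (geom' c) r" using G P by (auto simp: ainv_def)
 show ?thesis
 proof (rule quad_diffI [OF ainv_cau [OF G] ainv_cau [OF P], where d = "(1 - norm c * M) / (2 * M)" and z = 1
    and C = "4 * (r * M * r * r) * norm (s 1)"])
  show "0 < (1 - norm c * M) / (2 * M)" using assms M_pos by simp
  fix h :: 'c assume h: "norm h < (1 - norm c * M) / (2 * M)"
  have "norm (c + h) * M \<le> norm c * M + norm h * M"
   using norm_triangle_ineq [of c h] M_pos by (metis distrib_right less_imp_le mult_right_mono)
  also have "norm h * M \<le> (1 - norm c * M) / 2" using h M_pos by (simp add: field_simps)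
  finally have q': "norm (c + h) * M \<le> q" by (simp add: q_def field_simps)
  note G' = ainv_geom(1) [OF q' q(2), folded r_def]
  have GB': "unif_bdd (geom (c + h)) r" using G' by (simp add: ainv_def)
  have lim': "(\<lambda>m. s (geom (c + h) m * emb (c + h))) \<longlonglongrightarrow> moment_series (c + h)"
   by (rule moment_series_tendsto) (use q' q in linarith)
  define D where "D m = geom (c + h) m - geom c m - geom (c + h) m * (emb h * X) * geom c m" for m
  have D: "null D" using ainv_resolvent [OF G G'] by (simp add: D_def [abs_def] emb_add algebra_simps)
  define F where "F m = geom (c + h) m * emb (c + h) * (1 - (1 - X * emb c) * geom' c m)
    - (1 - geom (c + h) m * (1 - emb (c + h) * X)) * (emb c * geom' c m)" for m
  have F: "null F"
  proof -
   have U: "unif_bdd (\<lambda>m. geom (c + h) m * emb (c + h)) (r * norm (c + h))"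
    by (rule unif_bdd_mult [OF GB' unif_bdd_const [OF bdd_emb]])
   have V: "unif_bdd (\<lambda>m. emb c * geom' c m) (norm c * r)"
    by (rule unif_bdd_mult [OF unif_bdd_const [OF bdd_emb] PB])
   have "null (\<lambda>m. 1 - (1 - X * emb c) * geom' c m)" "null (\<lambda>m. 1 - geom (c + h) m * (1 - emb (c + h) * X))"
    using P G' by (auto simp: ainv_def)
   from null_diff [OF null_mult_left [OF this(1) U] null_mult_right [OF this(2) V]]
   show ?thesis unfolding F_def [abs_def] .
  qed
  define A where "A m = geom (c + h) m * (emb h * X) * geom c m * emb h * geom' c m" for m
  have "geom (c + h) m * emb (c + h) - geom c m * emb c = geom (c + h) m * emb h * geom' c m + F m" for m
   unfolding geom_swap [of c] by (simp add: F_def emb_add algebra_simps)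
  then have id: "s (A m) = s (geom (c + h) m * emb (c + h)) - s (geom c m * emb c) - s (geom c m * emb h * geom' c m)
    - s (F m) - s (D m * emb h * geom' c m)" for m
   unfolding s_add [symmetric] s_diff [symmetric] by (intro arg_cong [of _ _ s]) (simp add: A_def D_def algebra_simps)
  have "(\<lambda>m. s (A m)) \<longlonglongrightarrow> moment_series (c + h) - moment_series c - slim (\<lambda>m. geom c m * emb h * geom' c m) - 0 - 0"
   unfolding id
   by (intro tendsto_diff lim' moment_series_tendsto [OF assms] null_tendsto cau_tendsto cau_mult ainv_cau [OF G] ainv_cau [OF P]
     cau_const [OF bdd_emb] F null_mult_right [OF null_mult_right [OF D unif_bdd_const [OF bdd_emb]] PB])
  then have "(\<lambda>m. s (A m)) \<longlonglongrightarrow> moment_series (c + h) - moment_series c - 1 *\<^sub>C slim (\<lambda>m. geom c m * emb h * geom' c m)"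
   by (simp add: scaleC_one)
  moreover have "norm (s (A m)) \<le> 4 * (r * M * r * r) * norm (s 1) * (norm h)\<^sup>2" for m
  proof -
   have "bdd (A m) (r * (norm h * M) * r * norm h * r)"
    unfolding A_def using GB GB' PB bdd_emb [of h] bdd_X by (intro bdd_mult) (auto simp: unif_bdd_def)
   from norm_s_le [OF this] show ?thesis by (simp add: power2_eq_square mult_ac)
  qed
  ultimately show "\<exists>A. (\<lambda>m. s (A m)) \<longlonglongrightarrow> moment_series (c + h) - moment_series c - 1 *\<^sub>C slim (\<lambda>m. geom c m * emb h * geom' c m)
    \<and> (\<forall>m. norm (s (A m)) \<le> 4 * (r * M * r * r) * norm (s 1) * (norm h)\<^sup>2)" by blast
 qed
qed

end

section \<open>Positivity and noncommutative functions on matrices\<close>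

definition family :: "(nat => 'b::cstar_algebra mat) => 'b bfam" where
 "family A = bfam (mfam A)"

lemma blev_family:
 assumes "\<And>n. A n \<in> carrier_mat n n" "\<And>n. mat_norm (A n) \<le> c"
 shows "blev (family A) n = A n"
proof -
 have l: "lev (mfam A) = A" by (rule mfam_inverse) (use assms in auto)
 have "mfam_of (bfam (mfam A)) = mfam A"
  by (rule bfam_inverse) (use assms l in \<open>auto intro!: bdd_aboveI\<close>)
 then show ?thesis by (simp add: family_def blev_def l)
qed

text \<open>
 The scalar \<open>z\<close> on all levels other than \<open>n\<close> is \<open>0\<close> in linear questions, and \<open>\<i>\<close> for points of the
 half plane, in order to stay in the half plane on all levels.
\<close>

definition level :: "complex => nat => 'b::cstar_algebra mat => 'b bfam" where
 "level z n A = family (\<lambda>k. if k = n then A else map_mat (scaleC z) (1\<^sub>m k))"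

lemma mat_norm_one_le: "mat_norm (1\<^sub>m n :: 'b::cstar_algebra mat) \<le> 1"
 by (rule mat_norm_leI) auto

lemma blev_level:
 assumes "A \<in> carrier_mat n n"
 shows "blev (level z n A) k = (if k = n then A else map_mat (scaleC z) (1\<^sub>m k))"
 unfolding level_def
proof (rule blev_family)
 fix k
 show "mat_norm (if k = n then A else map_mat (scaleC z) (1\<^sub>m k)) \<le> max (mat_norm A) (cmod z)"
  using mult_left_mono [OF mat_norm_one_le [of k, where 'b = 'a], of "cmod z"]
  by (auto simp: mat_norm_scaleC le_max_iff_disj)
qed (use assms in auto)

lemma blev_level_same [simp]: "A \<in> carrier_mat n n ==> blev (level z n A) n = A"
 by (simp add: blev_level)

lemma norm_level_le:
 assumes "A \<in> carrier_mat n n"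
 shows "norm (level 0 n A) \<le> mat_norm A"
proof (rule norm_bfam_le)
 fix k
 have "map_mat (scaleC 0) (1\<^sub>m k :: 'a mat) = 0\<^sub>m k k" by (rule eq_matI) auto
 then show "mat_norm (blev (level 0 n A) k) \<le> mat_norm A" using assms by (simp add: blev_level)
qed

lemma norm_level: "A \<in> carrier_mat n n ==> norm (level 0 n A) = mat_norm A"
 using norm_level_le [of A n] mat_norm_blev_le [of "level 0 n A" n] by simp

lemma psd_bfam_iff: "psd x \<longleftrightarrow> (\<forall>n. mat_pos (blev x n))"
proof
 assume "psd x"
 then obtain c where "x = star c * c" using psd_iff by blast
 then show "\<forall>n. mat_pos (blev x n)" unfolding mat_pos_def by (auto intro!: bexI [of _ "blev c _"])
next
 assume "\<forall>n. mat_pos (blev x n)"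
 then obtain C where C: "\<And>n. C n \<in> carrier_mat n n" "\<And>n. blev x n = mat_star (C n) * C n"
  unfolding mat_pos_def by simp metis
 have "mat_norm (C n) \<le> sqrt (norm x)" for n
  using mat_norm_blev_le [of x n] mat_norm_cstar_identity [OF C(1), of n]
  by (simp add: C(2) real_le_rsqrt)
 then have "blev (family C) n = C n" for n using C(1) by (intro blev_family)
 then have "x = star (family C) * family C" by (intro bfam_eqI) (simp add: C(2))
 then show "psd x" using psd_star_mult by metis
qed

lemma mat_pos_zero: "mat_pos (0\<^sub>m n n :: 'b::cstar_algebra mat)"
 unfolding mat_pos_def by (auto intro!: bexI [of _ "0\<^sub>m n n"] eq_matI simp: scalar_prod_def)

lemma mat_pos_level_iff:
 assumes "A \<in> carrier_mat n n"
 shows "mat_pos A \<longleftrightarrow> psd (level 0 n A)"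
proof
 assume A: "mat_pos A"
 have "map_mat (scaleC 0) (1\<^sub>m k :: 'a mat) = 0\<^sub>m k k" for k by (rule eq_matI) auto
 then show "psd (level 0 n A)" unfolding psd_bfam_iff using A assms by (simp add: blev_level mat_pos_zero)
qed (use assms in \<open>auto simp: psd_bfam_iff dest: spec [of _ n]\<close>)

lemma level_add:
 assumes "A \<in> carrier_mat n n" "B \<in> carrier_mat n n"
 shows "level 0 n (A + B) = level 0 n A + level 0 n B"
proof (rule bfam_eqI)
 fix k
 have "map_mat (scaleC 0) (1\<^sub>m k :: 'a mat) = 0\<^sub>m k k" by (rule eq_matI) auto
 then show "blev (level 0 n (A + B)) k = blev (level 0 n A + level 0 n B) k"
  using assms by (simp add: blev_level)
qed

lemma level_diff:
 assumes "A \<in> carrier_mat n n" "B \<in> carrier_mat n n"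
 shows "level 0 n (A - B) = level 0 n A - level 0 n B"
proof (rule bfam_eqI)
 fix k
 have "map_mat (scaleC 0) (1\<^sub>m k :: 'a mat) = 0\<^sub>m k k" by (rule eq_matI) auto
 moreover have "A - B \<in> carrier_mat n n" using assms by (simp add: minus_carrier_mat)
 ultimately show "blev (level 0 n (A - B)) k = blev (level 0 n A - level 0 n B) k"
  using assms by (auto simp: blev_level intro!: eq_matI)
qed

lemma level_scaleC: "A \<in> carrier_mat n n ==> level 0 n (map_mat (scaleC z) A) = z *\<^sub>C level 0 n (A :: 'b::cstar_algebra mat)"
proof (rule bfam_eqI)
 fix k assume A: "A \<in> carrier_mat n n"
 have "map_mat (scaleC 0) (1\<^sub>m k :: 'b mat) = 0\<^sub>m k k" "map_mat (scaleC z) (0\<^sub>m k k :: 'b mat) = 0\<^sub>m k k"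
  by (auto intro!: eq_matI)
 then show "blev (level 0 n (map_mat (scaleC z) A)) k = blev (z *\<^sub>C level 0 n A) k"
  using A by (simp add: blev_level)
qed

lemma level_shift:
 assumes "A \<in> carrier_mat n n" "h \<in> carrier_mat n n"
 shows "level z n (A + h) = level z n A + level 0 n (h :: 'b::cstar_algebra mat)"
proof (rule bfam_eqI)
 fix k
 have "map_mat (scaleC 0) (1\<^sub>m k :: 'b mat) = 0\<^sub>m k k" by (auto intro!: eq_matI)
 then show "blev (level z n (A + h)) k = blev (level z n A + level 0 n h) k"
  using assms by (simp add: blev_level)
qed

lemma star_level: "A \<in> carrier_mat n n ==> star (level 0 n A) = level 0 n (mat_star (A :: 'b::cstar_algebra mat))"
proof (rule bfam_eqI)
 fix k assume A: "A \<in> carrier_mat n n"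
 have "map_mat (scaleC 0) (1\<^sub>m k :: 'b mat) = 0\<^sub>m k k" "mat_star (0\<^sub>m k k :: 'b mat) = 0\<^sub>m k k"
  by (auto intro!: eq_matI)
 then show "blev (star (level 0 n A)) k = blev (level 0 n (mat_star A)) k"
  using A by (simp add: blev_level)
qed

lemma mat_pos_add:
 assumes "mat_pos A" "mat_pos B" "A \<in> carrier_mat n n" "B \<in> carrier_mat n n"
 shows "mat_pos (A + B)"
 using assms psd_add [of "level 0 n A" "level 0 n B"]
 by (simp add: mat_pos_level_iff [of _ n] level_add)

lemma mat_pos_limit:
 assumes "\<And>k. mat_pos (A k)" "\<And>k. A k \<in> carrier_mat n n" "L \<in> carrier_mat n n"
  and lim: "\<And>i j. i < n ==> j < n ==> (\<lambda>k. A k $$ (i, j)) \<longlonglongrightarrow> L $$ (i, j)"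
 shows "mat_pos L"
proof -
 have "norm (level 0 n (A k) - level 0 n L) = mat_norm (A k - L)" for k
  using assms by (simp add: norm_level minus_carrier_mat flip: level_diff)
 then have "(\<lambda>k. level 0 n (A k) - level 0 n L) \<longlonglongrightarrow> 0"
  using mat_norm_entries_tendsto [OF assms(2,3) lim] by (intro tendsto_norm_zero_cancel [of "\<lambda>k. level 0 n (A k) - level 0 n L"]) simp
 then have "(\<lambda>k. level 0 n (A k)) \<longlonglongrightarrow> level 0 n L" by (rule LIM_zero_cancel)
 then have "psd (level 0 n L)"
  by (rule psd_limit [rotated]) (use assms(1,2) mat_pos_level_iff in blast)
 then show ?thesis using assms(3) mat_pos_level_iff by blast
qed

lemma mat_pos_sum:
 fixes A :: "nat => 'b::cstar_algebra mat"
 assumes "\<And>k. k < m ==> mat_pos (A k)" "\<And>k. k < m ==> A k \<in> carrier_mat n n"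
 shows "mat_pos (mat n n (\<lambda>ij. \<Sum>k<m. A k $$ ij))"
 using assms
proof (induction m)
 case 0
 have "mat n n (\<lambda>ij. \<Sum>k<0. A k $$ ij) = 0\<^sub>m n n" by (rule eq_matI) auto
 then show ?case by (simp only: mat_pos_zero)
next
 case (Suc m)
 have eq: "mat n n (\<lambda>ij. \<Sum>k<Suc m. A k $$ ij) = mat n n (\<lambda>ij. \<Sum>k<m. A k $$ ij) + A m"
  using Suc.prems(2) [of m] by (intro eq_matI) auto
 show ?case
  unfolding eq by (rule mat_pos_add [of _ _ n]) (use Suc in auto)
qed

text \<open>Each row of a rectangular matrix contributes the Gram matrix of a square matrix with one nonzero row.\<close>

lemma mat_pos_gram:
 fixes D :: "'b::cstar_algebra mat"
 assumes D: "D \<in> carrier_mat k m"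
 shows "mat_pos (mat_star D * D)"
proof (cases "m = 0")
 case True
 then have "mat_star D * D = 0\<^sub>m 0 0" using D by (intro eq_matI) auto
 then show ?thesis by (simp only: mat_pos_zero)
next
 case False
 define E where "E r = mat m m (\<lambda>(i, j). if i = 0 then D $$ (r, j) else 0)" for r
 have "(mat_star (E r) * E r) $$ (i, j) = star (D $$ (r, i)) * D $$ (r, j)" if "i < m" "j < m" for i j r
 proof -
  have "(mat_star (E r) * E r) $$ (i, j) = (\<Sum>l<m. mat_star (E r) $$ (i, l) * E r $$ (l, j))"
   using that by (simp add: index_mult_mat' E_def del: index_mult_mat(1))
  also have "\<dots> = (\<Sum>l<m. if l = 0 then star (D $$ (r, i)) * D $$ (r, j) else 0)"
   using that by (intro sum.cong) (auto simp: E_def)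
  finally show ?thesis using False by simp
 qed
 then have eq: "mat_star D * D = mat m m (\<lambda>ij. \<Sum>r<k. (mat_star (E r) * E r) $$ ij)"
  using D by (intro eq_matI) (auto simp: index_mult_mat' simp del: index_mult_mat(1))
 show ?thesis
  unfolding eq
 proof (rule mat_pos_sum)
  fix r
  show "mat_star (E r) * E r \<in> carrier_mat m m" by (simp add: E_def carrier_matI)
  show "mat_pos (mat_star (E r) * E r)"
   unfolding mat_pos_def by (auto intro!: bexI [of _ "E r"] simp: E_def)
 qed
qed

lemma mat_pos_congruence:
 assumes "mat_pos A" "A \<in> carrier_mat n n" "V \<in> carrier_mat n m"
 shows "mat_pos (mat_star V * A * V)"
proof -
 obtain C where C: "C \<in> carrier_mat n n" "A = mat_star C * C" using assms unfolding mat_pos_def by auto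
 have CV: "C * V \<in> carrier_mat n m" using C assms by auto
 have "mat_star (C * V) * (C * V) = mat_star V * mat_star C * (C * V)"
  using mat_star_mult [of C n n V m] C assms by simp
 also have "\<dots> = mat_star V * (mat_star C * (C * V))"
  using C assms CV by (intro assoc_mult_mat [of _ m n _ n _ m]) auto
 also have "mat_star C * (C * V) = mat_star C * C * V"
  using C assms by (intro assoc_mult_mat [symmetric, of _ n n _ n _ m]) auto
 also have "mat_star V * (mat_star C * C * V) = mat_star V * (mat_star C * C) * V"
  using C assms by (intro assoc_mult_mat [symmetric, of _ m n _ n _ m]) auto
 finally show ?thesis using mat_pos_gram [OF CV] by (simp add: C(2))
qed

lemma mat_star_eq_of_mat_pos:
 assumes "mat_pos A"
 shows "mat_star A = A"
proof -
 obtain n C where C: "C \<in> carrier_mat n n" "A = mat_star C * C" using assms unfolding mat_pos_def by auto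
 show ?thesis
  unfolding C(2) mat_star_mult [OF mat_star_carrier [OF C(1)] C(1)] by simp
qed

definition iform :: "nat => 'b::cstar_algebra mat => 'b bfam" where
 "iform n b = level \<i> n b"

lemma map_mat_scaleC_one: "map_mat (scaleC z) (1\<^sub>m k :: 'b::cstar_algebra mat) = z *\<^sub>C 1 \<cdot>\<^sub>m 1\<^sub>m k"
 by (rule eq_matI) (auto simp: scaleC_simps)

lemma of_real_bfam: "blev (of_real r) k = map_mat (scaleC (complex_of_real r)) (1\<^sub>m k :: 'b::cstar_algebra mat)"
 by (simp add: of_real_eq_scaleC [where 'c = "'b bfam"])

lemma blev_Im_part [simp]: "blev (Im_part x) n = mat_Im (blev x n)"
 by (simp add: Im_part_def mat_Im_def)

lemma mat_Im_carrier [simp]: "b \<in> carrier_mat n n ==> mat_Im b \<in> carrier_mat n n"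
 by (auto simp: mat_Im_def intro!: minus_carrier_mat)

lemma index_mat_Im:
 "b \<in> carrier_mat n n ==> i < n ==> j < n ==>
  mat_Im b $$ (i, j) = (1 / (2 * \<i>)) *\<^sub>C (b $$ (i, j) - star (b $$ (j, i)))"
 by (auto simp: mat_Im_def)

lemma mat_pos_scale_one: "r \<ge> 0 ==> mat_pos (map_mat (scaleC (complex_of_real r)) (1\<^sub>m k :: 'b::cstar_algebra mat))"
 using psd_of_real [of r, where 'a = "'b bfam"] unfolding psd_bfam_iff of_real_bfam by blast

lemma MplusD:
 assumes "b \<in> Mplus n"
 obtains \<epsilon> where "\<epsilon> > 0" "psd (Im_part (iform n b) - of_real \<epsilon>)" "b \<in> carrier_mat n n"
proof -
 obtain \<epsilon> where e: "\<epsilon> > 0" "b \<in> carrier_mat n n" "mat_pos (mat_Im b - of_real \<epsilon> \<cdot>\<^sub>m 1\<^sub>m n)"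
  using assms by (auto simp: Mplus_def)
 define d where "d = min \<epsilon> 1"
 have d: "0 < d" "d \<le> \<epsilon>" "d \<le> 1" using e by (auto simp: d_def)
 have "mat_pos (blev (Im_part (iform n b) - of_real d) k)" for k
 proof (cases "k = n")
  case True
  have "mat_Im b - map_mat (scaleC (complex_of_real d)) (1\<^sub>m n)
    = (mat_Im b - of_real \<epsilon> \<cdot>\<^sub>m 1\<^sub>m n) + map_mat (scaleC (complex_of_real (\<epsilon> - d))) (1\<^sub>m n)"
   using e by (intro eq_matI)
    (auto simp: mat_Im_def scaleC_diff_left of_real_eq_scaleC [where 'c = 'a] scaleC_simps)
  moreover have "mat_pos \<dots>"
   using d e by (intro mat_pos_add [of _ _ n] mat_pos_scale_one)
    (auto simp: mat_Im_def intro!: minus_carrier_mat)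
  ultimately show ?thesis using True e by (simp add: iform_def of_real_bfam)
 next
  case False
  have "mat_Im (map_mat (scaleC \<i>) (1\<^sub>m k)) - map_mat (scaleC (complex_of_real d)) (1\<^sub>m k)
    = map_mat (scaleC (complex_of_real (1 - d))) (1\<^sub>m k :: 'a mat)"
   by (rule eq_matI)
    (auto simp: mat_Im_def star_scaleC scaleC_diff_left scaleC_simps simp flip: scaleC_add_left)
  then show ?thesis using False e d mat_pos_scale_one [of "1 - d" k, where 'b = 'a]
   by (simp add: iform_def blev_level of_real_bfam)
 qed
 then show ?thesis using that d e psd_bfam_iff by metis
qed

lemma MplusI:
 assumes "psd (Im_part x - of_real \<epsilon>)" "\<epsilon> > 0"
 shows "blev x n \<in> Mplus n"
proof -
 have "mat_pos (mat_Im (blev x n) - map_mat (scaleC (complex_of_real \<epsilon>)) (1\<^sub>m n))"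
  using assms unfolding psd_bfam_iff by (simp add: of_real_bfam)
 moreover have "map_mat (scaleC (complex_of_real \<epsilon>)) (1\<^sub>m n) = of_real \<epsilon> \<cdot>\<^sub>m (1\<^sub>m n :: 'a mat)"
  by (simp add: map_mat_scaleC_one of_real_eq_scaleC [where 'c = 'a])
 ultimately show ?thesis using assms by (auto simp: Mplus_def)
qed

text \<open>
 For small \<open>t\<close> the element \<open>1 + \<i> t b\<close> is a contraction, and the Neumann series inverts \<open>b\<close>.
\<close>

lemma psd_Im_imp_invertible:
 assumes "psd (Im_part b - of_real \<epsilon>)" "\<epsilon> > 0"
 obtains c where "b * c = 1" "c * (b :: 'c::cstar_algebra) = 1"
proof -
 define R where "R = max \<epsilon> (norm b)"
 have R: "R > 0" "\<epsilon> \<le> R" "norm b \<le> R" using assms by (auto simp: R_def)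
 define t where "t = \<epsilon> / R\<^sup>2"
 have t: "t > 0" "t * R\<^sup>2 = \<epsilon>" using R assms by (auto simp: t_def)
 define u where "u = \<i> * complex_of_real t"
 define S where "S = 1 + u *\<^sub>C b"
 have uu: "cnj u = - u" "u * u = - complex_of_real (t\<^sup>2)"
  by (simp_all add: u_def power_mult_distrib flip: power2_eq_square)
 have Imb: "b - star b = (2 * \<i>) *\<^sub>C Im_part b"
  by (simp add: Im_part_def scaleC_simps)
 have "star S * S = 1 + u *\<^sub>C (b - star b) + complex_of_real (t\<^sup>2) *\<^sub>C (star b * b)"
  by (simp add: S_def star_add star_scaleC uu algebra_simps scaleC_simps)
 also have "u *\<^sub>C (b - star b) = complex_of_real (- (2 * t)) *\<^sub>C Im_part b"
 proof -
  have e: "u * (2 * \<i>) = complex_of_real (- (2 * t))" by (simp add: u_def complex_eq_iff)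
  show ?thesis by (simp only: Imb scaleC_scaleC e)
 qed
 finally have SS: "star S * S = 1 - (2 * t) *\<^sub>R Im_part b + t\<^sup>2 *\<^sub>R (star b * b)"
  unfolding scaleC_of_real by simp
 have "psd ((2 * t) *\<^sub>R (Im_part b - of_real \<epsilon>) + t\<^sup>2 *\<^sub>R (of_real (R\<^sup>2 - (norm b)\<^sup>2) + (of_real ((norm b)\<^sup>2) - star b * b)))"
  using t R assms by (intro psd_add psd_scaleR psd_of_real psd_norm_square_minus) (auto intro: power_mono)
 moreover have "(2 * t) *\<^sub>R (Im_part b - of_real \<epsilon>) + t\<^sup>2 *\<^sub>R (of_real (R\<^sup>2 - (norm b)\<^sup>2) + (of_real ((norm b)\<^sup>2) - star b * b))
   = of_real (1 - t * \<epsilon>) - star S * S"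
 proof -
  have "t\<^sup>2 * R\<^sup>2 = t * \<epsilon>" using t(2) by (simp add: power2_eq_square mult.assoc)
  then have r: "1 - t * \<epsilon> = 1 - (2 * t) * \<epsilon> + t\<^sup>2 * R\<^sup>2" by simp
  have "of_real (1 - t * \<epsilon>) = (1 - (2 * t) *\<^sub>R of_real \<epsilon> + t\<^sup>2 *\<^sub>R of_real (R\<^sup>2) :: 'c)"
   unfolding r by (simp add: scaleR_conv_of_real)
  then show ?thesis unfolding SS by (simp add: algebra_simps)
 qed
 ultimately have p: "psd (of_real (1 - t * \<epsilon>) - star S * S)" by simp
 have "t * \<epsilon> \<le> 1"
 proof -
  have "t * \<epsilon> * R\<^sup>2 \<le> R\<^sup>2 * 1" using t R assms by (simp add: mult_ac) (simp add: power2_eq_square mult_mono)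
  then show ?thesis using R by simp
 qed
 then have "norm (star S * S) \<le> 1 - t * \<epsilon>" by (intro psd_norm_le p psd_star_mult) simp
 moreover have "1 - t * \<epsilon> < 1" using t assms by simp
 ultimately have "(norm S)\<^sup>2 < 1" by (simp add: cstar_identity)
 then have nS: "norm S < 1" by (simp add: power_less_one_iff abs_square_less_1)
 define z where "z = suminf (\<lambda>n. S ^ n)"
 have sm: "summable (\<lambda>n. S ^ n)" by (rule complete_algebra_summable_geometric [OF nS])
 have z1: "S * z = z - 1"
  using suminf_mult [OF sm, of S] suminf_split_head [OF sm] by (simp add: z_def)
 have z2: "z * S = z - 1"
  using suminf_mult2 [OF sm, of S] suminf_split_head [OF sm] by (simp add: z_def power_commutes)
 have uS: "(- u) *\<^sub>C b = 1 - S" by (simp add: S_def scaleC_minus_left)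
 have "b * ((- u) *\<^sub>C z) = ((- u) *\<^sub>C b) * z" "((- u) *\<^sub>C z) * b = z * ((- u) *\<^sub>C b)"
  by (simp_all only: mult_scaleC_left mult_scaleC_right)
 then have "b * ((- u) *\<^sub>C z) = (1 - S) * z" "((- u) *\<^sub>C z) * b = z * (1 - S)"
  unfolding uS .
 then show ?thesis using z1 z2 by (intro that [of "(- u) *\<^sub>C z"]) (simp_all add: algebra_simps)
qed

lemma Im_part_inverse:
 assumes "b * c = 1" "c * (b :: 'c::cstar_algebra) = 1"
 shows "star c * Im_part b * c = - Im_part c"
proof -
 have "star c * (b - star b) * c = star c * (b * c) - star (b * c) * c"
  by (simp add: algebra_simps star_mult)
 then have "star c * (b - star b) * c = star c - c" using assms by simp
 then have "star c * Im_part b * c = (1 / (2 * \<i>)) *\<^sub>C (star c - c)"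
  by (simp only: Im_part_def mult_scaleC_left mult_scaleC_right)
 then show ?thesis by (simp add: Im_part_def scaleC_diff_right)
qed

subsection \<open>Intertwining\<close>

text \<open>\<open>itw n m A S B\<close> is \<open>A S = S B\<close> for a complex \<open>n\<close> by \<open>m\<close> matrix \<open>S\<close>.\<close>

definition itw :: "nat => nat => 'a::complex_star_algebra mat => (nat => nat => complex) => 'a mat => bool" where
 "itw n m A S B \<longleftrightarrow> (\<forall>i<n. \<forall>j<m. (\<Sum>l<n. S l j *\<^sub>C A $$ (i, l)) = (\<Sum>l<m. S i l *\<^sub>C B $$ (l, j)))"

lemma itw_mult:
 assumes "itw n m A S B" "itw n m A' S B'"
  and c: "A \<in> carrier_mat n n" "A' \<in> carrier_mat n n" "B \<in> carrier_mat m m" "B' \<in> carrier_mat m m"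
 shows "itw n m (A * A') S (B * B')"
 unfolding itw_def
proof (intro allI impI)
 fix i j assume ij: "i < n" "j < m"
 have "(\<Sum>l<n. S l j *\<^sub>C (A * A') $$ (i, l)) = (\<Sum>l<n. \<Sum>p<n. A $$ (i, p) * (S l j *\<^sub>C A' $$ (p, l)))"
  using c ij by (intro sum.cong) (auto simp: index_mult_mat' scaleC_sum_right scaleC_simps simp del: index_mult_mat(1))
 also have "\<dots> = (\<Sum>p<n. A $$ (i, p) * (\<Sum>l<n. S l j *\<^sub>C A' $$ (p, l)))"
  by (subst sum.swap) (simp add: sum_distrib_left)
 also have "\<dots> = (\<Sum>p<n. A $$ (i, p) * (\<Sum>l<m. S p l *\<^sub>C B' $$ (l, j)))"
  using assms(2) ij by (intro sum.cong) (auto simp: itw_def)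
 also have "\<dots> = (\<Sum>p<n. \<Sum>l<m. (S p l *\<^sub>C A $$ (i, p)) * B' $$ (l, j))"
  by (simp add: sum_distrib_left scaleC_simps)
 also have "\<dots> = (\<Sum>l<m. (\<Sum>p<n. S p l *\<^sub>C A $$ (i, p)) * B' $$ (l, j))"
  by (subst sum.swap) (simp add: sum_distrib_right)
 also have "\<dots> = (\<Sum>l<m. (\<Sum>p<m. S i p *\<^sub>C B $$ (p, l)) * B' $$ (l, j))"
  using assms(1) ij by (intro sum.cong) (auto simp: itw_def)
 also have "\<dots> = (\<Sum>l<m. \<Sum>p<m. S i p *\<^sub>C (B $$ (p, l) * B' $$ (l, j)))"
  by (simp add: sum_distrib_right scaleC_simps)
 also have "\<dots> = (\<Sum>p<m. S i p *\<^sub>C (B * B') $$ (p, j))"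
  using c ij by (subst sum.swap) (auto intro!: sum.cong simp: index_mult_mat' scaleC_sum_right simp del: index_mult_mat(1))
 finally show "(\<Sum>l<n. S l j *\<^sub>C (A * A') $$ (i, l)) = (\<Sum>p<m. S i p *\<^sub>C (B * B') $$ (p, j))" .
qed

lemma itw_add:
 assumes "itw n m A S B" "itw n m A' S B'"
  and c: "A \<in> carrier_mat n n" "A' \<in> carrier_mat n n" "B \<in> carrier_mat m m" "B' \<in> carrier_mat m m"
 shows "itw n m (A + A') S (B + B')"
 using assms unfolding itw_def by (auto simp: scaleC_add_right sum.distrib)

lemma itw_scaleC:
 assumes "itw n m A S B" "A \<in> carrier_mat n n" "B \<in> carrier_mat m m"
 shows "itw n m (map_mat (scaleC z) A) S (map_mat (scaleC z) B)"
 unfolding itw_def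
proof (intro allI impI)
 fix i j assume ij: "i < n" "j < m"
 have "(\<Sum>l<n. S l j *\<^sub>C map_mat (scaleC z) A $$ (i, l)) = z *\<^sub>C (\<Sum>l<n. S l j *\<^sub>C A $$ (i, l))"
  using assms ij by (auto simp: scaleC_sum_right scaleC_simps mult.commute intro!: sum.cong)
 also have "\<dots> = z *\<^sub>C (\<Sum>l<m. S i l *\<^sub>C B $$ (l, j))" using assms(1) ij by (simp add: itw_def)
 also have "\<dots> = (\<Sum>l<m. S i l *\<^sub>C map_mat (scaleC z) B $$ (l, j))"
  using assms ij by (auto simp: scaleC_sum_right scaleC_simps mult.commute intro!: sum.cong)
 finally show "(\<Sum>l<n. S l j *\<^sub>C map_mat (scaleC z) A $$ (i, l)) = (\<Sum>l<m. S i l *\<^sub>C map_mat (scaleC z) B $$ (l, j))" .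
qed

lemma itw_scalar: "itw n m (x \<cdot>\<^sub>m 1\<^sub>m n) S (x \<cdot>\<^sub>m 1\<^sub>m m)"
proof -
 have "(\<Sum>l<n. S l j *\<^sub>C (x * (if i = l then 1 else 0))) = S i j *\<^sub>C x"
  "(\<Sum>l<m. S i l *\<^sub>C (x * (if l = j then 1 else 0))) = S i j *\<^sub>C x" if "i < n" "j < m" for i j
 proof -
  have "(\<Sum>l<n. S l j *\<^sub>C (x * (if i = l then 1 else 0))) = (\<Sum>l<n. if l = i then S i j *\<^sub>C x else 0)"
   by (rule sum.cong) auto
  then show "(\<Sum>l<n. S l j *\<^sub>C (x * (if i = l then 1 else 0))) = S i j *\<^sub>C x" using that by simp
  have "(\<Sum>l<m. S i l *\<^sub>C (x * (if l = j then 1 else 0))) = (\<Sum>l<m. if l = j then S i j *\<^sub>C x else 0)"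
   by (rule sum.cong) auto
  then show "(\<Sum>l<m. S i l *\<^sub>C (x * (if l = j then 1 else 0))) = S i j *\<^sub>C x" using that by simp
 qed
 then show ?thesis by (simp add: itw_def)
qed

lemma itw_one: "itw n m (1\<^sub>m n :: 'a::complex_star_algebra mat) S (1\<^sub>m m)"
proof -
 have "1 \<cdot>\<^sub>m 1\<^sub>m k = (1\<^sub>m k :: 'a mat)" for k by (rule eq_matI) auto
 then show ?thesis using itw_scalar [of n m "1 :: 'a" S] by metis
qed

lemma itw_map:
 assumes "itw n m A S B" "A \<in> carrier_mat n n" "B \<in> carrier_mat m m"
  and "\<And>x y. f (x + y) = f x + f y" "\<And>z x. f (z *\<^sub>C x) = z *\<^sub>C f x"
 shows "itw n m (map_mat f A) S (map_mat f B)"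
proof -
 have f0: "f 0 = 0" using assms(4) [of 0 0] by simp
 have fs: "f (\<Sum>l<k. g l) = (\<Sum>l<k. f (g l))" for g and k :: nat
  by (induction k) (simp_all add: f0 assms(4))
 have "(\<Sum>l<n. S l j *\<^sub>C f (A $$ (i, l))) = (\<Sum>l<m. S i l *\<^sub>C f (B $$ (l, j)))" if "i < n" "j < m" for i j
 proof -
  have "f (\<Sum>l<n. S l j *\<^sub>C A $$ (i, l)) = f (\<Sum>l<m. S i l *\<^sub>C B $$ (l, j))"
   using assms(1) that by (simp add: itw_def)
  then show ?thesis by (simp only: fs assms(5))
 qed
 then show ?thesis using assms(2,3) by (auto simp: itw_def)
qed

lemma itw_limit:
 fixes A :: "nat => 'b::cstar_algebra mat"
 assumes "\<forall>\<^sub>F k in sequentially. itw n m (A k) S (B k)"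
  and "\<And>i j. i < n ==> j < n ==> (\<lambda>k. A k $$ (i, j)) \<longlonglongrightarrow> A' $$ (i, j)"
  and "\<And>i j. i < m ==> j < m ==> (\<lambda>k. B k $$ (i, j)) \<longlonglongrightarrow> B' $$ (i, j)"
 shows "itw n m A' S B'"
 unfolding itw_def
proof (intro allI impI)
 fix i j assume ij: "i < n" "j < m"
 have bl: "bounded_linear (scaleC w :: 'b => 'b)" for w
  by (rule bounded_linear_intro [of _ "cmod w"]) (auto simp: scaleC_simps scaleR_scaleC norm_scaleC mult.commute)
 have L1: "(\<lambda>k. \<Sum>l<n. S l j *\<^sub>C A k $$ (i, l)) \<longlonglongrightarrow> (\<Sum>l<n. S l j *\<^sub>C A' $$ (i, l))"
  using ij by (intro tendsto_sum bounded_linear.tendsto [OF bl] assms) auto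
 have L2: "(\<lambda>k. \<Sum>l<m. S i l *\<^sub>C B k $$ (l, j)) \<longlonglongrightarrow> (\<Sum>l<m. S i l *\<^sub>C B' $$ (l, j))"
  using ij by (intro tendsto_sum bounded_linear.tendsto [OF bl] assms) auto
 have ev: "\<forall>\<^sub>F k in sequentially. (\<Sum>l<n. S l j *\<^sub>C A k $$ (i, l)) = (\<Sum>l<m. S i l *\<^sub>C B k $$ (l, j))"
  using assms(1) by eventually_elim (use ij in \<open>auto simp: itw_def\<close>)
 show "(\<Sum>l<n. S l j *\<^sub>C A' $$ (i, l)) = (\<Sum>l<m. S i l *\<^sub>C B' $$ (l, j))"
  by (rule LIMSEQ_unique [OF Lim_transform_eventually [OF L1 ev] L2])
qed

lemma itw_scalar_mat:
 assumes "A \<in> carrier_mat n n" "B \<in> carrier_mat m m" "S \<in> carrier_mat n m"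
 shows "itw n m A (\<lambda>i j. S $$ (i, j)) B \<longleftrightarrow> A * scalar_mat S = scalar_mat S * B"
proof -
 have "(A * scalar_mat S) $$ (i, j) = (\<Sum>l<n. S $$ (l, j) *\<^sub>C A $$ (i, l))"
  "(scalar_mat S * B) $$ (i, j) = (\<Sum>l<m. S $$ (i, l) *\<^sub>C B $$ (l, j))" if "i < n" "j < m" for i j
  using assms that by (auto simp: index_mult_mat' scalar_mat_def scaleC_simps simp del: index_mult_mat(1))
 then show ?thesis
  using assms unfolding itw_def mat_eq_iff by (auto simp: scalar_mat_def)
qed

lemma dsum_carrier [simp]: "x \<in> carrier_mat n n ==> y \<in> carrier_mat m m ==> dsum x y \<in> carrier_mat (n + m) (n + m)"
 by (simp add: dsum_def)

lemma index_dsum: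
 assumes "x \<in> carrier_mat n n" "y \<in> carrier_mat m m" "i < n + m" "j < n + m"
 shows "dsum x y $$ (i, j) = (if i < n then if j < n then x $$ (i, j) else 0
  else if j < n then 0 else y $$ (i - n, j - n))"
 using assms by (auto simp: dsum_def)

lemma sum_indicator_scaleC:
 fixes k :: nat
 shows "k < n ==> (\<Sum>l<n. (if l = k then 1 else 0) *\<^sub>C f l) = (f k :: 'a::complex_star_algebra)"
proof -
 assume "k < n"
 have "(\<Sum>l<n. (if l = k then 1 else 0) *\<^sub>C f l) = (\<Sum>l<n. if l = k then f k else 0)"
  by (rule sum.cong) (auto simp: scaleC_one)
 then show ?thesis using \<open>k < n\<close> by simp
qed

lemma scalar_mat_mult:
 assumes "A \<in> carrier_mat n k" "B \<in> carrier_mat k m"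
 shows "scalar_mat (A * B) = scalar_mat A * (scalar_mat B :: 'b::cstar_algebra mat)"
proof (rule eq_matI)
 fix i j assume "i < dim_row (scalar_mat A * (scalar_mat B :: 'b mat))" "j < dim_col (scalar_mat A * (scalar_mat B :: 'b mat))"
 then have ij: "i < n" "j < m" using assms by (auto simp: scalar_mat_def)
 have "(\<Sum>l<k. f l) *\<^sub>C 1 = (\<Sum>l<k. f l *\<^sub>C (1 :: 'b))" for f and k :: nat
  by (induction k) (simp_all add: scaleC_add_left)
 then show "scalar_mat (A * B) $$ (i, j) = (scalar_mat A * (scalar_mat B :: 'b mat)) $$ (i, j)"
  using assms ij by (simp add: scalar_mat_def index_mult_mat' scaleC_simps mult.commute del: index_mult_mat(1))
qed (use assms in \<open>auto simp: scalar_mat_def\<close>)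

text \<open>
 Selecting the rows of \<open>x\<close> with the map \<open>h\<close> of indices is an intertwiner; if \<open>h\<close> is a covering of
 weighted graphs, the entries of \<open>f x\<close> over a fibre add up.
\<close>

lemma itw_fold_iff:
 fixes x y :: "'b::complex_star_algebra mat"
 assumes h: "\<forall>p<n. h p < m"
 shows "itw n m x (\<lambda>p q. if h p = q then 1 else 0) y \<longleftrightarrow>
  (\<forall>p<n. \<forall>q<m. (\<Sum>l\<in>{l. l < n \<and> h l = q}. x $$ (p, l)) = y $$ (h p, q))"
proof -
 have "(\<Sum>l<n. (if h l = q then 1 else 0) *\<^sub>C x $$ (p, l)) = (\<Sum>l\<in>{l. l < n \<and> h l = q}. x $$ (p, l))" for p q
 proof -
  have "(\<Sum>l<n. (if h l = q then 1 else 0) *\<^sub>C x $$ (p, l)) = (\<Sum>l\<in>{..<n}. if h l = q then x $$ (p, l) else 0)"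
   by (intro sum.cong) (auto simp: scaleC_one)
  also have "\<dots> = (\<Sum>l\<in>{..<n} \<inter> {l. h l = q}. x $$ (p, l))" by (simp add: sum.inter_restrict)
  also have "{..<n} \<inter> {l. h l = q} = {l. l < n \<and> h l = q}" by auto
  finally show ?thesis .
 qed
 moreover have "(\<Sum>l<m. (if h p = l then 1 else 0) *\<^sub>C y $$ (l, q)) = y $$ (h p, q)" if "p < n" for p q
  using sum_indicator_scaleC [OF h [rule_format, OF that], of "\<lambda>l. y $$ (l, q)"] by (simp add: eq_commute)
 ultimately show ?thesis by (simp add: itw_def)
qed

lemma itw_diag_iff:
 fixes x y :: "'b::complex_star_algebra mat"
 shows "itw n n x (\<lambda>p q. if p = q then s p else 0) y \<longleftrightarrow>
  (\<forall>p<n. \<forall>q<n. s q *\<^sub>C x $$ (p, q) = s p *\<^sub>C y $$ (p, q))"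
proof -
 have "(\<Sum>l<n. (if l = q then s l else 0) *\<^sub>C x $$ (p, l)) = s q *\<^sub>C x $$ (p, q)" if "q < n" for p q
 proof -
  have "(\<Sum>l<n. (if l = q then s l else 0) *\<^sub>C x $$ (p, l)) = (\<Sum>l<n. if l = q then s q *\<^sub>C x $$ (p, q) else 0)"
   by (rule sum.cong) auto
  then show ?thesis using that by simp
 qed
 moreover have "(\<Sum>l<n. (if p = l then s p else 0) *\<^sub>C y $$ (l, q)) = s p *\<^sub>C y $$ (p, q)" if "p < n" for p q
 proof -
  have "(\<Sum>l<n. (if p = l then s p else 0) *\<^sub>C y $$ (l, q)) = (\<Sum>l<n. if l = p then s p *\<^sub>C y $$ (p, q) else 0)"
   by (rule sum.cong) auto
  then show ?thesis using that by simp
 qed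
 ultimately show ?thesis by (simp add: itw_def)
qed
lemma itw_shift_iff:
 assumes "a + n \<le> m"
 shows "itw n m (x :: 'b::complex_star_algebra mat) (\<lambda>p q. if p + a = q then 1 else 0) y \<longleftrightarrow>
  (\<forall>p<n. \<forall>q<m. y $$ (p + a, q) = (if a \<le> q \<and> q < a + n then x $$ (p, q - a) else 0))"
proof -
 have "{l. l < n \<and> l + a = q} = (if a \<le> q \<and> q < a + n then {q - a} else {})" for q by auto
 then have e: "(\<Sum>l\<in>{l. l < n \<and> l + a = q}. x $$ (p, l)) = (if a \<le> q \<and> q < a + n then x $$ (p, q - a) else 0)" for p q
  by simp
 have h: "\<forall>p<n. p + a < m" using assms by simp
 show ?thesis unfolding itw_fold_iff [OF h] e by (intro iff_allI imp_cong refl) (rule eq_commute)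
qed

text \<open>
 The two axioms of a noncommutative function are the cases of a coordinate projection of a direct sum
 and of an invertible \<open>S\<close> of the rule that \<open>x S = S y\<close> implies \<open>f x S = S f y\<close>.
\<close>

lemma nc_functionI:
 fixes f :: "'b::cstar_algebra mat => 'b mat"
 assumes dsum: "\<And>x y. x \<in> \<Omega> ==> y \<in> \<Omega> ==> dsum x y \<in> \<Omega>"
  and sq: "\<And>x. x \<in> \<Omega> ==> \<exists>n\<ge>1. x \<in> carrier_mat n n"
  and car: "\<And>n x. x \<in> \<Omega> ==> x \<in> carrier_mat n n ==> f x \<in> carrier_mat n n"
  and itw: "\<And>n m x y S. x \<in> \<Omega> ==> y \<in> \<Omega> ==> x \<in> carrier_mat n n ==> y \<in> carrier_mat m m ==>
   itw n m x S y ==> itw n m (f x) S (f y)"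
 shows "nc_function \<Omega> f"
 unfolding nc_function_def
proof (intro conjI ballI allI impI)
 fix x y assume xy: "x \<in> \<Omega>" "y \<in> \<Omega>"
 show "dsum x y \<in> \<Omega>" using dsum xy by blast
 obtain n m where nm: "x \<in> carrier_mat n n" "y \<in> carrier_mat m m" using sq xy by blast
 have d: "dsum x y \<in> \<Omega>" "dsum x y \<in> carrier_mat (n + m) (n + m)" using dsum xy nm by auto
 note f = car [OF xy(1) nm(1)] car [OF xy(2) nm(2)] car [OF d]
 have "itw n (n + m) x (\<lambda>p q. if p + 0 = q then 1 else 0) (dsum x y)"
  by (subst itw_shift_iff) (auto simp: index_dsum [OF nm])
 then have 1: "itw n (n + m) (f x) (\<lambda>p q. if p + 0 = q then 1 else 0) (f (dsum x y))"
  by (rule itw [OF xy(1) d(1) nm(1) d(2)])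
 have "itw m (n + m) y (\<lambda>p q. if p + n = q then 1 else 0) (dsum x y)"
  by (subst itw_shift_iff) (auto simp: index_dsum [OF nm])
 then have 2: "itw m (n + m) (f y) (\<lambda>p q. if p + n = q then 1 else 0) (f (dsum x y))"
  by (rule itw [OF xy(2) d(1) nm(2) d(2)])
 show "f (dsum x y) = dsum (f x) (f y)"
 proof (rule eq_matI)
  fix p q assume "p < dim_row (dsum (f x) (f y))" "q < dim_col (dsum (f x) (f y))"
  then have pq: "p < n + m" "q < n + m" using f by (auto simp: dsum_def)
  show "f (dsum x y) $$ (p, q) = dsum (f x) (f y) $$ (p, q)"
  proof (cases "p < n")
   case True
   then show ?thesis
    using 1 pq itw_shift_iff [of 0 n "n + m" "f x" "f (dsum x y)"] by (simp add: index_dsum [OF f(1,2)])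
  next
   case False
   then have "p - n < m" using pq by linarith
   then show ?thesis
    using 2 pq False itw_shift_iff [of n m "n + m" "f y" "f (dsum x y)", THEN iffD1, rule_format, of "p - n" q]
    by (auto simp: index_dsum [OF f(1,2)])
  qed
 qed (use f in \<open>auto simp: dsum_def\<close>)
next
 fix n :: nat and x assume "n \<ge> 1" "x \<in> \<Omega> \<inter> carrier_mat n n"
 then show "f x \<in> carrier_mat n n" using car by blast
next
 fix n :: nat and x :: "'b mat" and S T :: "complex mat"
 assume n: "n \<ge> 1" and x: "x \<in> \<Omega> \<inter> carrier_mat n n" and S: "S \<in> carrier_mat n n" and T: "T \<in> carrier_mat n n"
  and ST: "inverts_mat S T \<and> inverts_mat T S \<and> scalar_mat S * x * scalar_mat T \<in> \<Omega>"
 have c: "scalar_mat S \<in> carrier_mat n n" "scalar_mat T \<in> carrier_mat n n" "x \<in> carrier_mat n n"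
  using S T x by (auto simp: scalar_mat_def)
 have "scalar_mat (1\<^sub>m n) = (1\<^sub>m n :: 'b mat)"
  by (rule eq_matI) (auto simp: scalar_mat_def scaleC_one)
 then have inv: "scalar_mat S * scalar_mat T = (1\<^sub>m n :: 'b mat)" "scalar_mat T * scalar_mat S = (1\<^sub>m n :: 'b mat)"
  using ST S T scalar_mat_mult [OF S T, where 'b = 'b] scalar_mat_mult [OF T S, where 'b = 'b] by (auto simp: inverts_mat_def)
 let ?y = "scalar_mat S * x * scalar_mat T"
 have y: "?y \<in> carrier_mat n n"
  by (rule mult_carrier_mat [OF mult_carrier_mat [OF c(1) c(3)] c(2)])
 have "?y * scalar_mat S = scalar_mat S * x * (scalar_mat T * scalar_mat S)"
  using c by (intro assoc_mult_mat [of _ n n _ n _ n]) auto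
 then have "?y * scalar_mat S = scalar_mat S * x" using c inv by simp
 then have "itw n n ?y (\<lambda>i j. S $$ (i, j)) x" using itw_scalar_mat [OF y c(3) S] by simp
 then have "itw n n (f ?y) (\<lambda>i j. S $$ (i, j)) (f x)" using ST x y by (intro itw) auto
 moreover have fc: "f ?y \<in> carrier_mat n n" "f x \<in> carrier_mat n n" using car ST x y by auto
 ultimately have "f ?y * scalar_mat S = scalar_mat S * f x" using itw_scalar_mat [OF fc S] by simp
 then have "f ?y * scalar_mat S * scalar_mat T = scalar_mat S * f x * scalar_mat T" by simp
 moreover have "f ?y * scalar_mat S * scalar_mat T = f ?y * (scalar_mat S * scalar_mat T)"
  using c fc by (intro assoc_mult_mat [of _ n n _ n _ n]) auto
 ultimately show "f ?y = scalar_mat S * f x * scalar_mat T" using inv fc by simp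
qed

lemma sum_lessThan_add_split:
 fixes f :: "nat => 'a::comm_monoid_add"
 shows "(\<Sum>l<n + m. f l) = (\<Sum>l<n. f l) + (\<Sum>l<m. f (l + n))"
 by (induction m) (simp_all add: ac_simps)

lemma dsum_star_mult:
 assumes C: "C \<in> carrier_mat n n" and D: "D \<in> carrier_mat m m"
 shows "mat_star (dsum C D) * dsum C D = dsum (mat_star C * C) (mat_star D * (D :: 'b::cstar_algebra mat))"
proof (rule eq_matI)
 have c: "mat_star C * C \<in> carrier_mat n n" "mat_star D * D \<in> carrier_mat m m" using C D by auto
 fix i j assume "i < dim_row (dsum (mat_star C * C) (mat_star D * D))" "j < dim_col (dsum (mat_star C * C) (mat_star D * D))"
 then have ij: "i < n + m" "j < n + m" using C D by (auto simp: dsum_def)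
 have "(mat_star (dsum C D) * dsum C D) $$ (i, j) = (\<Sum>l<n + m. star (dsum C D $$ (l, i)) * dsum C D $$ (l, j))"
  using C D ij by (subst index_mult_mat') (auto simp: dsum_def intro!: sum.cong)
 also have "\<dots> = (\<Sum>l<n. star (if i < n then C $$ (l, i) else 0) * (if j < n then C $$ (l, j) else 0))
   + (\<Sum>l<m. star (if i < n then 0 else D $$ (l, i - n)) * (if j < n then 0 else D $$ (l, j - n)))"
  unfolding sum_lessThan_add_split using ij by (simp add: index_dsum [OF C D] cong: if_cong)
 also have "\<dots> = dsum (mat_star C * C) (mat_star D * D) $$ (i, j)"
  unfolding index_dsum [OF c ij] using C D ij by (auto simp: index_mult_mat' simp del: index_mult_mat(1))
 finally show "(mat_star (dsum C D) * dsum C D) $$ (i, j) = dsum (mat_star C * C) (mat_star D * D) $$ (i, j)" .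
qed (use C D in \<open>auto simp: dsum_def\<close>)

lemma mat_pos_dsum:
 assumes "x \<in> carrier_mat n n" "y \<in> carrier_mat m m" "mat_pos x" "mat_pos y"
 shows "mat_pos (dsum x y)"
proof -
 obtain C D where CD: "C \<in> carrier_mat n n" "x = mat_star C * C" "D \<in> carrier_mat m m" "y = mat_star D * D"
  using assms unfolding mat_pos_def by auto
 have "dsum C D \<in> carrier_mat (n + m) (n + m)" using CD by simp
 then show ?thesis using mat_pos_gram dsum_star_mult [OF CD(1,3)] CD by metis
qed

lemma mat_norm_le_iff:
 assumes A: "(A :: 'b::cstar_algebra mat) \<in> carrier_mat n n" and c: "c \<ge> 0"
 shows "mat_norm A \<le> c \<longleftrightarrow> mat_pos (map_mat (scaleC (complex_of_real (c\<^sup>2))) (1\<^sub>m n) - mat_star A * A)"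
proof
 let ?L = "level 0 n A"
 have k: "blev (of_real (c\<^sup>2) - star ?L * ?L) n = map_mat (scaleC (complex_of_real (c\<^sup>2))) (1\<^sub>m n) - mat_star A * A"
  using A by (simp add: of_real_bfam del: of_real_power)
 assume "mat_norm A \<le> c"
 then have "norm (star ?L * ?L) \<le> c\<^sup>2" using A by (simp add: cstar_identity norm_level power_mono)
 then have "psd (of_real (c\<^sup>2) - star ?L * ?L)" by (intro psd_norm_minus) auto
 then show "mat_pos (map_mat (scaleC (complex_of_real (c\<^sup>2))) (1\<^sub>m n) - mat_star A * A)"
  unfolding psd_bfam_iff k [symmetric] by blast
next
 let ?L = "level 0 n A"
 assume p: "mat_pos (map_mat (scaleC (complex_of_real (c\<^sup>2))) (1\<^sub>m n) - mat_star A * A)"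
 have "mat_pos (blev (of_real (c\<^sup>2) - star ?L * ?L) k)" for k
 proof (cases "k = n")
  case True
  then show ?thesis using p A by (simp add: of_real_bfam del: of_real_power)
 next
  case False
  have "map_mat (scaleC 0) (1\<^sub>m k :: 'b mat) = 0\<^sub>m k k" "mat_star (0\<^sub>m k k) * 0\<^sub>m k k = (0\<^sub>m k k :: 'b mat)"
   "map_mat (scaleC (complex_of_real (c\<^sup>2))) (1\<^sub>m k) - 0\<^sub>m k k = map_mat (scaleC (complex_of_real (c\<^sup>2))) (1\<^sub>m k :: 'b mat)"
   by (auto intro!: eq_matI simp: scalar_prod_def)
  then show ?thesis using False A mat_pos_scale_one [of "c\<^sup>2" k, where 'b = 'b]
   by (simp add: blev_level of_real_bfam del: of_real_power)
 qed
 then have "psd (of_real (c\<^sup>2) - star ?L * ?L)" by (simp only: psd_bfam_iff) blast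
 then have "norm (star ?L * ?L) \<le> c\<^sup>2" by (intro psd_norm_le psd_star_mult) auto
 then have "(mat_norm A)\<^sup>2 \<le> c\<^sup>2" using A by (simp add: cstar_identity norm_level)
 then show "mat_norm A \<le> c" using c by (rule power2_le_imp_le)
qed

lemma mat_norm_dsum_le:
 assumes x: "x \<in> carrier_mat n n" and y: "y \<in> carrier_mat m m" and c: "mat_norm x \<le> c" "mat_norm y \<le> c"
 shows "mat_norm (dsum x (y :: 'b::cstar_algebra mat)) \<le> c"
proof -
 let ?B = "\<lambda>k A. map_mat (scaleC (complex_of_real (c\<^sup>2))) (1\<^sub>m k) - mat_star A * (A :: 'b mat)"
 have c0: "c \<ge> 0" using c mat_norm_nonneg [of x] by linarith
 have B: "?B n x \<in> carrier_mat n n" "?B m y \<in> carrier_mat m m" using x y by (auto intro!: minus_carrier_mat)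
 have q: "mat_star x * x \<in> carrier_mat n n" "mat_star y * y \<in> carrier_mat m m" using x y by auto
 have "mat_pos (dsum (?B n x) (?B m y))"
  using c x y c0 by (intro mat_pos_dsum [OF B]) (simp_all only: mat_norm_le_iff)
 moreover have "dsum (D n - U) (D m - V) = D (n + m) - dsum U V"
  if U: "U \<in> carrier_mat n n" and V: "V \<in> carrier_mat m m" and D: "D = (\<lambda>k. map_mat (scaleC z) (1\<^sub>m k))"
  for U V :: "'b mat" and D z
 proof (rule eq_matI)
  have B: "D n - U \<in> carrier_mat n n" "D m - V \<in> carrier_mat m m" using U V by (auto intro!: minus_carrier_mat)
  fix i j assume "i < dim_row (D (n + m) - dsum U V)" "j < dim_col (D (n + m) - dsum U V)"
  then have ij: "i < n + m" "j < n + m" using U V by (auto simp: dsum_def)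
  then show "dsum (D n - U) (D m - V) $$ (i, j) = (D (n + m) - dsum U V) $$ (i, j)"
   unfolding index_dsum [OF B ij] using U V ij carrier_matD [OF dsum_carrier [OF U V]]
   by (auto simp: index_dsum [OF U V ij] D)
 qed (use U V in \<open>auto simp: dsum_def\<close>)
 from this [OF q refl] have "dsum (?B n x) (?B m y) = ?B (n + m) (dsum x y)" unfolding dsum_star_mult [OF x y] .
 ultimately show ?thesis using mat_norm_le_iff [OF dsum_carrier [OF x y] c0] by simp
qed

lemma mat_pos_diagonal:
 assumes "\<And>i. i < n ==> psd (a i :: 'b::cstar_algebra)"
 shows "mat_pos (mat n n (\<lambda>(i, j). if i = j then a i else 0))"
proof -
 have "\<forall>i. \<exists>c. i < n --> a i = star c * c" using assms psd_iff by blast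
 then obtain c where c: "\<And>i. i < n ==> a i = star (c i) * c i" by metis
 define C where "C = mat n n (\<lambda>(i, j). if i = j then c i else 0)"
 have C: "C \<in> carrier_mat n n" by (simp add: C_def)
 have "mat n n (\<lambda>(i, j). if i = j then a i else 0) = mat_star C * C"
 proof (rule eq_matI)
  fix i j assume "i < dim_row (mat_star C * C)" "j < dim_col (mat_star C * C)"
  then have ij: "i < n" "j < n" using C by auto
  have "(mat_star C * C) $$ (i, j) = (\<Sum>k<n. star (C $$ (k, i)) * C $$ (k, j))"
   using ij C by (subst index_mult_mat') (auto intro!: sum.cong)
  also have "\<dots> = (\<Sum>k<n. if k = i then if i = j then a i else 0 else 0)"
   using ij by (intro sum.cong) (auto simp: C_def c)
  finally show "mat n n (\<lambda>(i, j). if i = j then a i else 0) $$ (i, j) = (mat_star C * C) $$ (i, j)" using ij by simp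
 qed (use C in auto)
 then show ?thesis using mat_pos_gram [OF C] by simp
qed

text \<open>
 If every row and column has at most one nonzero entry, then \<open>A* A\<close> is diagonal.
\<close>

lemma mat_norm_partial_perm:
 assumes A: "(A :: 'b::cstar_algebra mat) \<in> carrier_mat n n" and c: "c \<ge> 0" "\<And>i j. i < n ==> j < n ==> norm (A $$ (i, j)) \<le> c"
  and row: "\<And>i j k. i < n ==> j < n ==> k < n ==> A $$ (i, j) \<noteq> 0 ==> A $$ (i, k) \<noteq> 0 ==> j = k"
  and col: "\<And>i j k. i < n ==> j < n ==> k < n ==> A $$ (i, k) \<noteq> 0 ==> A $$ (j, k) \<noteq> 0 ==> i = j"
 shows "mat_norm A \<le> c"
proof -
 define d where "d j = of_real (c\<^sup>2) - (\<Sum>l<n. star (A $$ (l, j)) * A $$ (l, j))" for j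
 have d: "psd (d j)" if j: "j < n" for j
 proof (cases "\<exists>i<n. A $$ (i, j) \<noteq> 0")
  case True
  then obtain i where i: "i < n" "A $$ (i, j) \<noteq> 0" by auto
  have "(\<Sum>l<n. star (A $$ (l, j)) * A $$ (l, j)) = (\<Sum>l<n. if l = i then star (A $$ (i, j)) * A $$ (i, j) else 0)"
   by (rule sum.cong) (use col i j in \<open>force+\<close>)
  then have "d j = of_real (c\<^sup>2 - (norm (A $$ (i, j)))\<^sup>2) + (of_real ((norm (A $$ (i, j)))\<^sup>2) - star (A $$ (i, j)) * A $$ (i, j))"
   using i by (simp add: d_def)
  also have "psd \<dots>"
   using c i j by (intro psd_add psd_of_real psd_norm_square_minus) (auto intro: power_mono)
  finally show ?thesis .
 next
  case False
  then have "d j = of_real (c\<^sup>2)" by (simp add: d_def)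
  then show ?thesis by (simp only:) (rule psd_of_real, simp)
 qed
 have "map_mat (scaleC (complex_of_real (c\<^sup>2))) (1\<^sub>m n) - mat_star A * A = mat n n (\<lambda>(i, j). if i = j then d i else 0)"
 proof (rule eq_matI; simp only: dim_row_mat dim_col_mat index_mat split)
  fix i j assume ij: "i < n" "j < n"
  have "(\<Sum>l<n. star (A $$ (l, i)) * A $$ (l, j)) = 0" if "i \<noteq> j"
   by (rule sum.neutral) (use row ij that in \<open>force+\<close>)
  then show "(map_mat (scaleC (complex_of_real (c\<^sup>2))) (1\<^sub>m n) - mat_star A * A) $$ (i, j) = (if i = j then d i else 0)"
   using ij A by (simp add: d_def index_mult_mat' of_real_eq_scaleC [where 'c = 'b] del: index_mult_mat(1) of_real_power)
 qed (use A in auto)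
 then show ?thesis using mat_pos_diagonal [of n d] d mat_norm_le_iff [OF A c(1)] by simp
qed

lemma ncball_dsum:
 assumes "x \<in> ncball r" "y \<in> ncball r"
 shows "dsum x y \<in> ncball r"
proof -
 obtain n m where nm: "n \<ge> 1" "x \<in> carrier_mat n n" "mat_norm x < r" "y \<in> carrier_mat m m" "mat_norm y < r"
  using assms by (auto simp: ncball_def)
 have "mat_norm (dsum x y) \<le> max (mat_norm x) (mat_norm y)"
  using nm by (intro mat_norm_dsum_le) auto
 then have "mat_norm (dsum x y) < r" using nm by simp
 then show ?thesis using nm by (auto simp: ncball_def intro!: bexI [of _ "n + m"])
qed

lemma Hplus_dsum:
 assumes "x \<in> Hplus" "y \<in> Hplus"
 shows "dsum x y \<in> Hplus"
proof -
 have *: "\<exists>n \<epsilon>. n \<ge> 1 \<and> \<epsilon> > 0 \<and> x \<in> carrier_mat n n \<and> (\<forall>d. 0 < d \<and> d \<le> \<epsilon> --> mat_pos (mat_Im x - of_real d \<cdot>\<^sub>m 1\<^sub>m n))"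
  if h: "x \<in> Hplus" for x :: "'a mat"
 proof -
  obtain n where n: "n \<ge> 1" "x \<in> Mplus n" using h by (auto simp: Hplus_def)
  obtain \<epsilon> where e: "\<epsilon> > 0" "psd (Im_part (iform n x) - of_real \<epsilon>)" "x \<in> carrier_mat n n"
   using MplusD [OF n(2)] .
  have "mat_pos (mat_Im x - of_real d \<cdot>\<^sub>m 1\<^sub>m n)" if "0 < d" "d \<le> \<epsilon>" for d
  proof -
   have "psd (Im_part (iform n x) - of_real \<epsilon> + of_real (\<epsilon> - d))"
    using e that by (intro psd_add psd_of_real) auto
   then have "psd (Im_part (iform n x) - of_real d)" by (simp add: algebra_simps)
   then have "mat_pos (blev (Im_part (iform n x) - of_real d) n)" by (simp add: psd_bfam_iff)
   then show ?thesis using e by (simp add: iform_def of_real_bfam map_mat_scaleC_one of_real_eq_scaleC [where 'c = 'a])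
  qed
  then show ?thesis using n e by blast
 qed
 obtain n \<epsilon> where x: "n \<ge> 1" "\<epsilon> > 0" "x \<in> carrier_mat n n" "\<And>d. 0 < d ==> d \<le> \<epsilon> ==> mat_pos (mat_Im x - of_real d \<cdot>\<^sub>m 1\<^sub>m n)"
  using * [OF assms(1)] by blast
 obtain m \<delta> where y: "m \<ge> 1" "\<delta> > 0" "y \<in> carrier_mat m m" "\<And>d. 0 < d ==> d \<le> \<delta> ==> mat_pos (mat_Im y - of_real d \<cdot>\<^sub>m 1\<^sub>m m)"
  using * [OF assms(2)] by blast
 define d where "d = min \<epsilon> \<delta>"
 have d: "0 < d" "d \<le> \<epsilon>" "d \<le> \<delta>" using x y by (auto simp: d_def)
 have c: "mat_Im x - of_real d \<cdot>\<^sub>m 1\<^sub>m n \<in> carrier_mat n n" "mat_Im y - of_real d \<cdot>\<^sub>m 1\<^sub>m m \<in> carrier_mat m m"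
  by (simp_all add: minus_carrier_mat)
 have "mat_pos (dsum (mat_Im x - of_real d \<cdot>\<^sub>m 1\<^sub>m n) (mat_Im y - of_real d \<cdot>\<^sub>m 1\<^sub>m m))"
  using c d by (intro mat_pos_dsum [of _ n _ m] x y) auto
 moreover have "dsum (mat_Im x - of_real d \<cdot>\<^sub>m 1\<^sub>m n) (mat_Im y - of_real d \<cdot>\<^sub>m 1\<^sub>m m)
   = mat_Im (dsum x y) - of_real d \<cdot>\<^sub>m 1\<^sub>m (n + m)"
 proof (rule eq_matI)
  fix i j assume "i < dim_row (mat_Im (dsum x y) - of_real d \<cdot>\<^sub>m 1\<^sub>m (n + m))"
   "j < dim_col (mat_Im (dsum x y) - of_real d \<cdot>\<^sub>m 1\<^sub>m (n + m))"
  then have ij: "i < n + m" "j < n + m" by auto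
  then show "dsum (mat_Im x - of_real d \<cdot>\<^sub>m 1\<^sub>m n) (mat_Im y - of_real d \<cdot>\<^sub>m 1\<^sub>m m) $$ (i, j)
    = (mat_Im (dsum x y) - of_real d \<cdot>\<^sub>m 1\<^sub>m (n + m)) $$ (i, j)"
   using x(3) y(3)
   by (auto simp: index_dsum [OF c] index_mat_Im [OF dsum_carrier [OF x(3) y(3)]]
     index_mat_Im [OF x(3)] index_mat_Im [OF y(3)] index_dsum [OF x(3) y(3)])
 qed (use c in \<open>auto simp: dsum_def\<close>)
 ultimately have "dsum x y \<in> Mplus (n + m)" using d x y by (auto simp: Mplus_def)
 then show ?thesis using x by (auto simp: Hplus_def intro!: bexI [of _ "n + m"])
qed

section \<open>Words and monomials\<close>

fun nc_word :: "'b::cstar_algebra list => 'b ncpoly" where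
 "nc_word [] = 1"
| "nc_word [b] = nc_const b"
| "nc_word (b # c # bs) = nc_const b * nc_X * nc_word (c # bs)"

lemma nc_word_Cons: "bs \<noteq> [] ==> nc_word (b # bs) = nc_const b * nc_X * nc_word bs"
 by (cases bs) auto

lemma nc_word_append: "as \<noteq> [] ==> bs \<noteq> [] ==> nc_word (as @ bs) = nc_word as * nc_X * nc_word bs"
proof (induction as)
 case (Cons a as)
 then show ?case by (cases "as = []") (simp_all add: nc_word_Cons mult.assoc)
qed simp

lemma nc_monomial_eq_nc_word: "nc_monomial b n = nc_word (map b [0..<Suc n])"
proof (induction n)
 case (Suc n)
 have "nc_word (map b [0..<Suc (Suc n)]) = nc_word (map b [0..<Suc n] @ [b (Suc n)])" by simp
 also have "\<dots> = nc_monomial b (Suc n)" using Suc by (subst nc_word_append) auto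
 finally show ?case by simp
qed simp

primrec word_list :: "'b ncword => 'b list" where
 "word_list (Coeff b) = [b]"
| "word_list (CoeffX b w) = b # word_list w"

lemma word_list_nonempty [simp]: "word_list w \<noteq> []"
 by (cases w) auto

lemma abs_ncpoly_single: "abs_ncpoly (ncsingle w 1) = nc_word (word_list w)"
proof (induction w)
 case (Coeff b)
 then show ?case by (simp add: nc_const_def)
next
 case (CoeffX b w)
 have "nc_const b * nc_X * abs_ncpoly (ncsingle w 1)
   = abs_ncpoly (ncsingle (Coeff b) 1 * ncsingle (CoeffX 1 (Coeff 1)) 1 * ncsingle w 1)"
  by (simp add: nc_const_def nc_X_def times_ncpoly.abs_eq)
 also have "ncsingle (Coeff b) 1 * ncsingle (CoeffX 1 (Coeff 1)) 1 * ncsingle w 1 = (ncsingle (CoeffX b w) 1 :: 'a ncfree)"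
  by (simp add: mult_single)
 finally show ?case using CoeffX by (simp add: nc_word_Cons)
qed

lemma ncpoly_expansion:
 "\<exists>A c. finite A \<and> [] \<notin> A \<and> (p :: 'b::cstar_algebra ncpoly) = (\<Sum>w\<in>A. c w *\<^sub>C nc_word w)"
proof -
 have "\<exists>A c. finite A \<and> [] \<notin> A \<and> abs_ncpoly q = (\<Sum>w\<in>A. c w *\<^sub>C nc_word w)" for q :: "'b ncfree"
 proof (induction q rule: ncfree_induct)
  case (single w c)
  have "abs_ncpoly (ncsingle w c) = c *\<^sub>C abs_ncpoly (ncsingle w 1)"
   by (simp add: scaleC_ncpoly.abs_eq mult_single)
  then show ?case
   by (intro exI [of _ "{word_list w}"] exI [of _ "\<lambda>_. c"]) (simp add: abs_ncpoly_single word_list_nonempty [symmetric])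
 next
  case (add p q)
  then obtain A c B d where A: "finite A" "[] \<notin> A" "abs_ncpoly p = (\<Sum>w\<in>A. c w *\<^sub>C nc_word w)"
   and B: "finite B" "[] \<notin> B" "abs_ncpoly q = (\<Sum>w\<in>B. d w *\<^sub>C nc_word w)" by blast
  have "abs_ncpoly p = (\<Sum>w\<in>A \<union> B. (if w \<in> A then c w else 0) *\<^sub>C nc_word w)"
   unfolding A(3) using A B by (intro sum.mono_neutral_cong_left) auto
  moreover have "abs_ncpoly q = (\<Sum>w\<in>A \<union> B. (if w \<in> B then d w else 0) *\<^sub>C nc_word w)"
   unfolding B(3) using A B by (intro sum.mono_neutral_cong_left) auto
  ultimately have "abs_ncpoly (p + q) = (\<Sum>w\<in>A \<union> B. ((if w \<in> A then c w else 0) + (if w \<in> B then d w else 0)) *\<^sub>C nc_word w)"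
   by (simp only: scaleC_add_left sum.distrib flip: plus_ncpoly.abs_eq)
  moreover have "finite (A \<union> B)" "[] \<notin> A \<union> B" using A B by auto
  ultimately show ?case
   by (intro exI [of _ "A \<union> B"] exI [of _ "\<lambda>w. (if w \<in> A then c w else 0) + (if w \<in> B then d w else 0)"] conjI)
 qed
 moreover obtain q where "p = abs_ncpoly q" using Quotient3_abs_rep [OF Quotient3_ncpoly] by metis
 ultimately show ?thesis by simp
qed

section \<open>Completely positive maps at all matrix levels\<close>

definition emb_nc :: "'b::cstar_algebra bfam => 'b ncpoly mfam" where
 "emb_nc b = mfam (\<lambda>k. map_mat nc_const (blev b k))"

definition X_nc :: "'b::cstar_algebra ncpoly mfam" where
 "X_nc = mfam (\<lambda>k. nc_X \<cdot>\<^sub>m 1\<^sub>m k)"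

text \<open>
 The polynomial matrices of a family have no common bound, so that \<open>\<sigma>\<close> is applied on one level only.
\<close>

definition at_level :: "('b::cstar_algebra ncpoly => 'b) => nat => 'b ncpoly mfam => 'b bfam" where
 "at_level \<sigma> n P = level 0 n (map_mat \<sigma> (lev P n))"

lemma lev_emb_nc [simp]: "lev (emb_nc b) n = map_mat nc_const (blev b n)"
proof -
 have "lev (mfam (\<lambda>k. map_mat nc_const (blev b k))) = (\<lambda>k. map_mat nc_const (blev b k))"
  by (rule mfam_inverse) auto
 then show ?thesis by (simp add: emb_nc_def)
qed

lemma lev_X_nc [simp]: "lev X_nc n = nc_X \<cdot>\<^sub>m 1\<^sub>m n"
proof -
 have "lev (mfam (\<lambda>k. nc_X \<cdot>\<^sub>m 1\<^sub>m k)) = (\<lambda>k. nc_X \<cdot>\<^sub>m 1\<^sub>m k :: 'a ncpoly mat)"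
  by (rule mfam_inverse) auto
 then show ?thesis by (simp add: X_nc_def)
qed

lemma blev_at_level [simp]: "blev (at_level \<sigma> n P) n = map_mat \<sigma> (lev P n)"
 by (simp add: at_level_def)

lemma lev_power: "lev (x ^ k) n = lev x n ^\<^sub>m k"
 by (induction k) (simp_all add: power_Suc2 del: power_Suc)

lemma nc_const_0 [simp]: "nc_const 0 = 0"
 using nc_const_add [of 0 0] by simp

lemma nc_const_sum: "nc_const (sum f A) = (\<Sum>x\<in>A. nc_const (f x))"
 by (induction A rule: infinite_finite_induct) (simp_all add: nc_const_add)

lemma emb_nc_hom:
 "emb_nc (b + c) = emb_nc b + emb_nc c" "emb_nc (b * c) = emb_nc b * emb_nc c"
 "emb_nc (z *\<^sub>C b) = z *\<^sub>C emb_nc b" "emb_nc (star b) = star (emb_nc b)" "emb_nc 1 = 1"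
 by (intro mfam_eqI eq_matI; simp add: nc_const_add nc_const_mult nc_const_scaleC star_nc_const nc_const_one
   nc_const_sum index_mult_mat' del: index_mult_mat(1))+

lemma star_X_nc: "star X_nc = X_nc"
 by (intro mfam_eqI eq_matI) (auto simp: star_nc_X)

lemma index_X_nc_mult:
 assumes "i < n" "j < n"
 shows "lev (X_nc * Y) n $$ (i, j) = nc_X * lev Y n $$ (i, j)"
proof -
 have "lev (X_nc * Y) n $$ (i, j) = (\<Sum>l<n. nc_X * (if i = l then 1 else 0) * lev Y n $$ (l, j))"
  using assms by (simp add: index_mult_mat' del: index_mult_mat(1))
 also have "\<dots> = (\<Sum>l<n. if l = i then nc_X * lev Y n $$ (i, j) else 0)"
  by (rule sum.cong) auto
 finally show ?thesis using assms by simp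
qed

lemma index_X_nc_power_mult:
 assumes "i < n" "j < n"
 shows "lev (X_nc ^ k * Y) n $$ (i, j) = nc_X ^ k * lev Y n $$ (i, j)"
proof (induction k)
 case (Suc k)
 have "X_nc ^ Suc k * Y = X_nc * (X_nc ^ k * Y)" by (simp add: mult.assoc)
 then show ?case
  using Suc by (simp add: index_X_nc_mult [OF assms] mult.assoc del: lev_ring_simps)
qed simp

text \<open>
 Iterating \<open>2 y\<^sub>k \<le> y\<^sub>0 + y\<^sub>2\<^sub>k\<close> gives \<open>y\<^sub>1 \<le> (1 - 2\<^sup>-\<^sup>m) y\<^sub>0 + 2\<^sup>-\<^sup>m y\<^sub>k\<close> with \<open>k = 2\<^sup>m\<close>.
\<close>

lemma psd_of_doubling:
 fixes y :: "nat => 'c::cstar_algebra"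
 assumes dbl: "\<And>k. psd (y 0 + y (2 * k) - 2 *\<^sub>R y k)" and bd: "\<And>k. norm (y k) \<le> C"
 shows "psd (y 0 - y 1)"
proof (rule psd_limit)
 show "psd (y 0 - y 1 + (1/2) ^ m *\<^sub>R (y (2 ^ m) - y 0))" for m
 proof (induction m)
  case (Suc m)
  have "psd (y 0 - y 1 + (1/2) ^ m *\<^sub>R (y (2 ^ m) - y 0) + (1/2) ^ Suc m *\<^sub>R (y 0 + y (2 * 2 ^ m) - 2 *\<^sub>R y (2 ^ m)))"
   by (intro psd_add Suc psd_scaleR dbl) simp
  moreover have "(1/2) ^ m *\<^sub>R z = (1/2) ^ Suc m *\<^sub>R (2 *\<^sub>R z)" for z :: 'c by simp
  ultimately show ?case by (simp only:) (simp add: algebra_simps scaleR_2)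
 qed (simp add: psd_0)
 have "(\<lambda>m. (1/2) ^ m * (2 * C)) \<longlonglongrightarrow> 0 * (2 * C)" by (intro tendsto_intros LIMSEQ_realpow_zero) auto
 then have lim: "(\<lambda>m. (1/2) ^ m * (2 * C)) \<longlonglongrightarrow> 0" by simp
 have "\<forall>m. norm ((1/2) ^ m *\<^sub>R (y (2 ^ m) - y 0)) \<le> (1/2) ^ m * (2 * C)"
 proof
  fix m
  have "norm (y (2 ^ m) - y 0) \<le> 2 * C"
   using bd [of "2 ^ m"] bd [of 0] norm_triangle_ineq4 [of "y (2 ^ m)" "y 0"] by linarith
  then show "norm ((1/2) ^ m *\<^sub>R (y (2 ^ m) - y 0)) \<le> (1/2) ^ m * (2 * C)" by (simp add: mult_left_mono divide_right_mono)
 qed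
 then have "(\<lambda>m. (1/2) ^ m *\<^sub>R (y (2 ^ m) - y 0)) \<longlonglongrightarrow> 0" by (rule Lim_null_comparison [OF always_eventually lim])
 from tendsto_add [OF tendsto_const this, of "y 0 - y 1"]
 show "(\<lambda>m. y 0 - y 1 + (1/2) ^ m *\<^sub>R (y (2 ^ m) - y 0)) \<longlonglongrightarrow> y 0 - y 1" by simp
qed

locale cp_map =
 fixes \<sigma> :: "'b::cstar_algebra ncpoly => 'b"
 assumes \<sigma>_add: "\<sigma> (p + q) = \<sigma> p + \<sigma> q"
  and \<sigma>_scaleC: "\<sigma> (c *\<^sub>C p) = c *\<^sub>C \<sigma> p"
  and \<sigma>_cp: "completely_positive \<sigma>"
  and \<sigma>_exp: "exponentially_bounded \<sigma>"
begin

lemma \<sigma>_0 [simp]: "\<sigma> 0 = 0"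
 using \<sigma>_add [of 0 0] by simp

lemma \<sigma>_sum: "\<sigma> (sum f A) = (\<Sum>x\<in>A. \<sigma> (f x))"
 by (induction A rule: infinite_finite_induct) (simp_all add: \<sigma>_add)

lemma map_\<sigma>_add: "A \<in> carrier_mat n n ==> B \<in> carrier_mat n n ==> map_mat \<sigma> (A + B) = map_mat \<sigma> A + map_mat \<sigma> B"
 by (rule eq_matI) (auto simp: \<sigma>_add)

lemma at_level_add: "at_level \<sigma> n (p + q) = at_level \<sigma> n p + at_level \<sigma> n q"
 by (simp add: at_level_def map_\<sigma>_add [of _ n] level_add)

lemma at_level_scaleC: "at_level \<sigma> n (z *\<^sub>C p) = z *\<^sub>C at_level \<sigma> n p"
proof -
 have "map_mat \<sigma> (map_mat (scaleC z) (lev p n)) = map_mat (scaleC z) (map_mat \<sigma> (lev p n))"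
  by (rule eq_matI) (auto simp: \<sigma>_scaleC)
 then show ?thesis by (simp add: at_level_def level_scaleC)
qed

lemma at_level_pos: "psd (at_level \<sigma> n (star Y * Y))"
proof -
 define A where "A = lev Y n"
 have A: "A \<in> carrier_mat n n" by (simp add: A_def)
 define B where "B k = mat n n (\<lambda>(i, j). \<sigma> (star (A $$ (k, i)) * star (star (A $$ (k, j)))))" for k
 have "map_mat \<sigma> (mat_star A * A) = mat n n (\<lambda>ij. \<Sum>k<n. B k $$ ij)"
  using A by (intro eq_matI) (auto simp: B_def index_mult_mat' \<sigma>_sum star_star simp del: index_mult_mat(1))
 moreover have "mat_pos (mat n n (\<lambda>ij. \<Sum>k<n. B k $$ ij))"
 proof (rule mat_pos_sum)
  show "mat_pos (B k)" for k
   using \<sigma>_cp [unfolded completely_positive_def, rule_format, of n "\<lambda>i. star (A $$ (k, i))"]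
   unfolding B_def .
 qed (simp add: B_def)
 ultimately show ?thesis
  by (simp add: at_level_def A_def mat_pos_level_iff [symmetric] del: index_mult_mat(1))
qed

text \<open>
 Exponential boundedness enters as the growth of the moments, which turns into an operator bound for \<open>X\<close>,
 because \<open>2 X\<^sup>2\<^sup>k \<le> 1 + X\<^sup>4\<^sup>k\<close> can be iterated.
\<close>

lemma moment_growth_exists:
 obtains M where "M > 0" "\<And>p q. \<exists>C\<ge>0. \<forall>k. norm (\<sigma> (p * nc_X ^ k * q)) \<le> C * M ^ k"
proof -
 obtain M0 where M0: "\<And>n b. n \<ge> 1 ==> norm (\<sigma> (nc_monomial b n)) \<le> M0 ^ n * (\<Prod>i\<le>n. norm (b i))"
  using \<sigma>_exp unfolding exponentially_bounded_def by blast
 define M where "M = \<bar>M0\<bar> + 1"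
 have M: "M > 0" by (simp add: M_def)
 have word: "norm (\<sigma> (nc_word bs)) \<le> M ^ n * prod_list (map norm bs)" if n: "length bs = Suc n" "n \<ge> 1" for bs n
 proof -
  have "nc_word bs = nc_monomial ((!) bs) n"
   unfolding nc_monomial_eq_nc_word using n map_nth [of bs] by (simp del: upt_Suc)
  then have "norm (\<sigma> (nc_word bs)) \<le> M0 ^ n * (\<Prod>i\<le>n. norm (bs ! i))" using M0 [OF n(2)] by simp
  also have "\<dots> \<le> M ^ n * (\<Prod>i\<le>n. norm (bs ! i))"
  proof (rule mult_right_mono)
   have "M0 ^ n \<le> \<bar>M0\<bar> ^ n" using abs_ge_self [of "M0 ^ n"] by (simp add: power_abs)
   also have "\<dots> \<le> M ^ n" by (intro power_mono) (auto simp: M_def)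
   finally show "M0 ^ n \<le> M ^ n" .
  qed (simp add: prod_nonneg)
  also have "(\<Prod>i\<le>n. norm (bs ! i)) = prod_list (map norm bs)"
   using n by (simp add: prod.list_conv_set_nth atLeast0LessThan lessThan_Suc_atMost)
  finally show ?thesis .
 qed
 have words: "\<exists>C\<ge>0. \<forall>k. norm (\<sigma> (nc_word as * nc_X ^ k * nc_word bs)) \<le> C * M ^ k" if ne: "as \<noteq> []" "bs \<noteq> []" for as bs
 proof -
  define N where "N = prod_list (map norm as) * prod_list (map norm bs)"
  have N: "N \<ge> 0" unfolding N_def by (intro mult_nonneg_nonneg prod_list_nonneg) auto
  define a where "a = length as - 1 + (length bs - 1)"
  define C where "C = norm (\<sigma> (nc_word as * nc_word bs)) + M ^ a * N"
  have "norm (\<sigma> (nc_word as * nc_X ^ k * nc_word bs)) \<le> C * M ^ k" for k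
  proof (cases k)
   case 0
   then show ?thesis using N M by (simp add: C_def)
  next
   case (Suc l)
   have "nc_X ^ Suc l * nc_word bs = nc_X * nc_word (replicate l 1 @ bs)" for l
   proof (induction l)
    case (Suc l)
    have "nc_word (replicate (Suc l) 1 @ bs) = nc_const 1 * nc_X * nc_word (replicate l 1 @ bs)"
     using ne by (simp add: nc_word_Cons)
    then show ?case using Suc by (simp add: nc_const_one mult.assoc)
   qed simp
   then have "nc_word as * nc_X ^ k * nc_word bs = nc_word (as @ replicate l 1 @ bs)"
    using ne Suc by (subst nc_word_append) (simp_all add: mult.assoc)
   moreover have "length (as @ replicate l 1 @ bs) = Suc (a + k)"
    using ne Suc by (cases as; cases bs) (auto simp: a_def)
   ultimately have "norm (\<sigma> (nc_word as * nc_X ^ k * nc_word bs)) \<le> M ^ (a + k) * prod_list (map norm (as @ replicate l 1 @ bs))"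
    using word [of "as @ replicate l 1 @ bs" "a + k"] Suc by simp
   also have "prod_list (map norm (as @ replicate l (1::'b) @ bs)) = N"
    by (simp add: prod_list_replicate N_def)
   also have "M ^ (a + k) * N \<le> C * M ^ k"
    using M by (simp add: C_def power_add algebra_simps)
   finally show ?thesis .
  qed
  moreover have "C \<ge> 0" using N M by (simp add: C_def)
  ultimately show ?thesis by blast
 qed
 have "\<exists>C\<ge>0. \<forall>k. norm (\<sigma> (p * nc_X ^ k * q)) \<le> C * M ^ k" for p q
 proof -
  obtain A c where A: "finite A" "[] \<notin> A" "p = (\<Sum>w\<in>A. c w *\<^sub>C nc_word w)" using ncpoly_expansion by blast
  obtain B d where B: "finite B" "[] \<notin> B" "q = (\<Sum>w\<in>B. d w *\<^sub>C nc_word w)" using ncpoly_expansion by blast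
  have "\<forall>w v. \<exists>C. w \<in> A --> v \<in> B --> C \<ge> 0 \<and> (\<forall>k. norm (\<sigma> (nc_word w * nc_X ^ k * nc_word v)) \<le> C * M ^ k)"
   using words A(2) B(2) by metis
  then obtain C where C: "\<And>w v. w \<in> A ==> v \<in> B ==> C w v \<ge> 0"
   "\<And>w v k. w \<in> A ==> v \<in> B ==> norm (\<sigma> (nc_word w * nc_X ^ k * nc_word v)) \<le> C w v * M ^ k" by metis
  have "norm (\<sigma> (p * nc_X ^ k * q)) \<le> (\<Sum>w\<in>A. \<Sum>v\<in>B. cmod (c w) * cmod (d v) * C w v) * M ^ k" for k
  proof -
   have "p * nc_X ^ k * q = (\<Sum>w\<in>A. \<Sum>v\<in>B. (c w * d v) *\<^sub>C (nc_word w * nc_X ^ k * nc_word v))"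
    unfolding A(3) B(3) by (subst sum.swap)
     (simp add: sum_distrib_left sum_distrib_right scaleC_sum_right mult_scaleC_left mult_scaleC_right scaleC_scaleC mult.commute)
   then have "norm (\<sigma> (p * nc_X ^ k * q)) \<le> (\<Sum>w\<in>A. \<Sum>v\<in>B. norm ((c w * d v) *\<^sub>C \<sigma> (nc_word w * nc_X ^ k * nc_word v)))"
    by (simp only: \<sigma>_sum \<sigma>_scaleC) (intro order_trans [OF norm_sum] sum_mono norm_sum)
   also have "\<dots> \<le> (\<Sum>w\<in>A. \<Sum>v\<in>B. cmod (c w) * cmod (d v) * (C w v * M ^ k))"
    unfolding norm_scaleC norm_mult by (intro sum_mono mult_left_mono C) auto
   finally show ?thesis by (simp add: sum_distrib_right mult.assoc)
  qed
  moreover have "(\<Sum>w\<in>A. \<Sum>v\<in>B. cmod (c w) * cmod (d v) * C w v) \<ge> 0" using C by (intro sum_nonneg) auto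
  ultimately show ?thesis by blast
 qed
 then show ?thesis using that M by blast
qed

lemma positive_map_exists:
 obtains M where "\<And>n. positive_map (at_level \<sigma> n) emb_nc X_nc M"
proof -
 obtain M where M: "M > 0" "\<And>p q. \<exists>C\<ge>0. \<forall>k. norm (\<sigma> (p * nc_X ^ k * q)) \<le> C * M ^ k"
  using moment_growth_exists by blast
 obtain c where c: "\<And>p q k. norm (\<sigma> (p * nc_X ^ k * q)) \<le> c p q * M ^ k" using M(2) by metis
 have "psd (M\<^sup>2 *\<^sub>R at_level \<sigma> n (star Y * Y) - at_level \<sigma> n (star (X_nc * Y) * (X_nc * Y)))" for n Y
 proof -
  define x where "x k = at_level \<sigma> n (star Y * (X_nc ^ k * Y))" for k
  define C where "C = (\<Sum>i<n. \<Sum>j<n. \<Sum>l<n. c (star (lev Y n $$ (l, i))) (lev Y n $$ (l, j)))"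
  have nx: "norm (x k) \<le> C * M ^ k" for k
  proof -
   have "norm (x k) = mat_norm (map_mat \<sigma> (lev (star Y * (X_nc ^ k * Y)) n))"
    unfolding x_def at_level_def by (rule norm_level) (simp del: lev_ring_simps)
   also have "\<dots> \<le> (\<Sum>i<n. \<Sum>j<n. norm (\<sigma> (lev (star Y * (X_nc ^ k * Y)) n $$ (i, j))))"
    using mat_norm_le_entries [of "map_mat \<sigma> (lev (star Y * (X_nc ^ k * Y)) n)"] by (simp del: lev_ring_simps)
   also have "\<dots> \<le> (\<Sum>i<n. \<Sum>j<n. \<Sum>l<n. c (star (lev Y n $$ (l, i))) (lev Y n $$ (l, j)) * M ^ k)"
   proof (intro sum_mono)
    fix i j assume "i \<in> {..<n}" "j \<in> {..<n}"
    then have ij: "i < n" "j < n" by auto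
    have "lev (star Y * (X_nc ^ k * Y)) n $$ (i, j)
      = (\<Sum>l<n. mat_star (lev Y n) $$ (i, l) * lev (X_nc ^ k * Y) n $$ (l, j))"
     unfolding lev_ring_simps(6) [of "star Y"] using ij
     by (subst index_mult_mat') (simp_all del: lev_ring_simps)
    also have "\<dots> = (\<Sum>l<n. star (lev Y n $$ (l, i)) * nc_X ^ k * lev Y n $$ (l, j))"
     using ij by (intro sum.cong) (simp_all add: index_X_nc_power_mult mult.assoc del: lev_ring_simps)
    finally have "norm (\<sigma> (lev (star Y * (X_nc ^ k * Y)) n $$ (i, j)))
      = norm (\<Sum>l<n. \<sigma> (star (lev Y n $$ (l, i)) * nc_X ^ k * lev Y n $$ (l, j)))"
     by (simp only: \<sigma>_sum)
    also have "\<dots> \<le> (\<Sum>l<n. c (star (lev Y n $$ (l, i))) (lev Y n $$ (l, j)) * M ^ k)"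
     by (rule order_trans [OF norm_sum]) (intro sum_mono c)
    finally show "norm (\<sigma> (lev (star Y * (X_nc ^ k * Y)) n $$ (i, j)))
      \<le> (\<Sum>l<n. c (star (lev Y n $$ (l, i))) (lev Y n $$ (l, j)) * M ^ k)" .
   qed
   also have "\<dots> = C * M ^ k" by (simp add: C_def sum_distrib_right)
   finally show ?thesis .
  qed
  define y where "y k = (1 / M ^ (2 * k)) *\<^sub>R x (2 * k)" for k
  have "psd (y 0 - y 1)"
  proof (rule psd_of_doubling)
   show "norm (y k) \<le> C" for k
    using nx [of "2 * k"] M by (simp add: y_def divide_le_eq)
   fix k
   define u where "u = complex_of_real (1 / M ^ (2 * k))"
   define Q where "Q = Y - u *\<^sub>C (X_nc ^ (2 * k) * Y)"
   have "cnj u = u" by (simp add: u_def)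
   then have "star Q * Q = star Y * (X_nc ^ 0 * Y) + (u * u) *\<^sub>C (star Y * (X_nc ^ (2 * (2 * k)) * Y))
     + (- u) *\<^sub>C (star Y * (X_nc ^ (2 * k) * Y)) + (- u) *\<^sub>C (star Y * (X_nc ^ (2 * k) * Y))"
    unfolding Q_def mult_2 [of "2 * k"] power_add [of _ "2 * k" "2 * k"]
    by (simp add: star_diff star_scaleC star_mult star_power star_X_nc algebra_simps scaleC_simps scaleC_minus_left)
   then have "at_level \<sigma> n (star Q * Q) = x 0 + (u * u) *\<^sub>C x (2 * (2 * k)) + (- u) *\<^sub>C x (2 * k) + (- u) *\<^sub>C x (2 * k)"
    by (simp only: at_level_add at_level_scaleC x_def)
   also have "u * u = complex_of_real (1 / M ^ (2 * (2 * k)))"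
    by (simp add: u_def flip: power_add)
   finally have "at_level \<sigma> n (star Q * Q) = y 0 + y (2 * k) - 2 *\<^sub>R y k"
    unfolding scaleR_2 by (simp add: y_def u_def scaleC_of_real scaleC_minus_left del: of_real_divide of_real_power)
   then show "psd (y 0 + y (2 * k) - 2 *\<^sub>R y k)" using at_level_pos by metis
  qed
  then have "psd (M\<^sup>2 *\<^sub>R (y 0 - y 1))" by (intro psd_scaleR) auto
  moreover have "M\<^sup>2 *\<^sub>R (y 0 - y 1) = M\<^sup>2 *\<^sub>R x 0 - x 2"
   using M by (simp add: y_def scaleR_diff_right)
  moreover have "x 2 = at_level \<sigma> n (star (X_nc * Y) * (X_nc * Y))"
   by (simp add: x_def star_mult star_X_nc power2_eq_square mult.assoc)
  ultimately show ?thesis by (simp add: x_def)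
 qed
 then have "positive_map (at_level \<sigma> n) emb_nc X_nc M" for n
  using M by unfold_locales
   (simp_all add: at_level_add at_level_scaleC at_level_pos emb_nc_hom star_X_nc)
 then show ?thesis using that by blast
qed

end

section \<open>The transform of a completely positive map as a noncommutative function\<close>

definition lrel :: "nat => nat => (nat => nat => complex) => 'a::complex_star_algebra mfam => 'a mfam => bool" where
 "lrel n m S P Q \<longleftrightarrow> itw n m (lev P n) S (lev Q m)"

lemma lrel_add: "lrel n m S P Q ==> lrel n m S P' Q' ==> lrel n m S (P + P') (Q + Q')"
 by (simp add: lrel_def itw_add)

lemma lrel_mult: "lrel n m S P Q ==> lrel n m S P' Q' ==> lrel n m S (P * P') (Q * Q')"
 by (simp add: lrel_def itw_mult)

lemma lrel_scaleC: "lrel n m S P Q ==> lrel n m S (z *\<^sub>C P) (z *\<^sub>C Q)"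
 by (simp add: lrel_def itw_scaleC)

lemma lrel_one: "lrel n m S 1 1"
 by (simp add: lrel_def itw_one)

lemma lrel_X: "lrel n m S X_nc X_nc"
 by (simp add: lrel_def itw_scalar)

lemma lrel_minus: "lrel n m S P Q ==> lrel n m S P' Q' ==> lrel n m S (P - P') (Q - Q')"
 using lrel_add [of n m S P Q "(-1) *\<^sub>C P'" "(-1) *\<^sub>C Q'"] lrel_scaleC [of n m S P' Q' "-1"]
 by (simp add: scaleC_minus_left scaleC_one)

lemma lrel_power: "lrel n m S P Q ==> lrel n m S (P ^ k) (Q ^ k)"
 by (induction k) (simp_all add: lrel_one lrel_mult)

lemma lrel_zero: "lrel n m S 0 0"
 by (simp add: lrel_def itw_def)

lemma lrel_sum: "(\<And>k. k \<in> K ==> lrel n m S (P k) (Q k)) ==> lrel n m S (sum P K) (sum Q K)"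
 by (induction K rule: infinite_finite_induct) (simp_all add: lrel_zero lrel_add)

lemma lrel_emb: "itw n m (blev b n) S (blev c m) ==> lrel n m S (emb_nc b) (emb_nc c)"
 by (simp add: lrel_def itw_map nc_const_add nc_const_scaleC)

lemma lrel_identity: "lrel n n (\<lambda>i j. if i = j then 1 else 0) P Q ==> lev P n = lev Q n"
 unfolding lrel_def itw_diag_iff by (intro eq_matI) (auto simp: scaleC_one)

lemma itw_refl: "itw n n A (\<lambda>i j. if i = j then 1 else 0) A"
 unfolding itw_diag_iff by simp

lemma bounded_linear_entry:
 assumes "i < n" "j < n"
 shows "bounded_linear (\<lambda>x :: 'b::cstar_algebra bfam. blev x n $$ (i, j))"
proof (rule bounded_linear_intro [where K = 1])
 fix x y :: "'b bfam" and r :: real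
 show "blev (x + y) n $$ (i, j) = blev x n $$ (i, j) + blev y n $$ (i, j)" using assms by simp
 show "blev (r *\<^sub>R x) n $$ (i, j) = r *\<^sub>R blev x n $$ (i, j)" using assms by (simp add: scaleR_scaleC)
 have "norm (blev x n $$ (i, j)) \<le> mat_norm (blev x n)" using assms by (intro norm_index_le_mat_norm) auto
 also have "\<dots> \<le> norm x" by (rule mat_norm_blev_le)
 finally show "norm (blev x n $$ (i, j)) \<le> norm x * 1" by simp
qed

text \<open>Quadratic approximation on all levels gives Frechet differentiability on each level.\<close>

lemma mat_analytic_onI:
 fixes f :: "'b::cstar_algebra mat => 'b mat"
 assumes f: "\<And>a. a \<in> U ==> a \<in> carrier_mat n n \<and> f a = blev (\<phi> (level z n a)) n"
  and q: "\<And>a. a \<in> U ==> quad_diff \<phi> (level z n a)"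
 shows "mat_analytic_on n U f"
 unfolding mat_analytic_on_def
proof (intro ballI conjI)
 fix a assume a: "a \<in> U"
 show "f a \<in> carrier_mat n n" using f [OF a] by simp
 have ac: "a \<in> carrier_mat n n" using f [OF a] by simp
 obtain L K C d where L: "d > 0" "\<And>h k. L (h + k) = L h + L k" "\<And>z h. L (z *\<^sub>C h) = z *\<^sub>C L h"
  "\<And>h. norm (L h) \<le> K * norm h"
  "\<And>h. norm h < d ==> norm (\<phi> (level z n a + h) - \<phi> (level z n a) - L h) \<le> C * (norm h)\<^sup>2"
  using q [OF a] unfolding quad_diff_def by blast
 define L' where "L' h = blev (L (level 0 n h)) n" for h
 have "mat_clinear n L'"
  unfolding mat_clinear_def L'_def by (auto simp: level_add level_scaleC L)
 moreover have "\<forall>h\<in>carrier_mat n n. mat_norm (L' h) \<le> K * mat_norm h"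
 proof
  fix h :: "'b mat" assume h: "h \<in> carrier_mat n n"
  have "mat_norm (L' h) \<le> norm (L (level 0 n h))" unfolding L'_def by (rule mat_norm_blev_le)
  also have "\<dots> \<le> K * mat_norm h" using L(4) [of "level 0 n h"] h by (simp add: norm_level)
  finally show "mat_norm (L' h) \<le> K * mat_norm h" .
 qed
 moreover have "\<forall>e>0. \<exists>d>0. \<forall>h\<in>carrier_mat n n. mat_norm h < d \<and> a + h \<in> U -->
   mat_norm (f (a + h) - f a - L' h) \<le> e * mat_norm h"
 proof (intro allI impI)
  fix e :: real assume e: "e > 0"
  define d' where "d' = min d (e / (\<bar>C\<bar> + 1))"
  have d': "d' > 0" using L(1) e by (simp add: d'_def)
  have "mat_norm (f (a + h) - f a - L' h) \<le> e * mat_norm h"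
   if h: "h \<in> carrier_mat n n" "mat_norm h < d'" "a + h \<in> U" for h
  proof -
   have "f (a + h) - f a - L' h = blev (\<phi> (level z n a + level 0 n h) - \<phi> (level z n a) - L (level 0 n h)) n"
    using f [OF h(3)] f [OF a] level_shift [OF ac h(1), of z] by (simp add: L'_def)
   then have "mat_norm (f (a + h) - f a - L' h)
     \<le> norm (\<phi> (level z n a + level 0 n h) - \<phi> (level z n a) - L (level 0 n h))"
    using mat_norm_blev_le by metis
   also have "\<dots> \<le> C * (mat_norm h)\<^sup>2"
    using L(5) [of "level 0 n h"] h by (simp add: norm_level d'_def)
   also have "\<dots> \<le> (\<bar>C\<bar> + 1) * (mat_norm h)\<^sup>2" by (intro mult_right_mono) auto
   also have "\<dots> = ((\<bar>C\<bar> + 1) * mat_norm h) * mat_norm h" by (simp add: power2_eq_square)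
   also have "\<dots> \<le> e * mat_norm h"
   proof (rule mult_right_mono)
    have "mat_norm h < e / (\<bar>C\<bar> + 1)" "\<bar>C\<bar> + 1 > 0" using h by (auto simp: d'_def)
    then show "(\<bar>C\<bar> + 1) * mat_norm h \<le> e" by (simp add: pos_less_divide_eq mult.commute)
   qed simp
   finally show ?thesis .
  qed
  then show "\<exists>d>0. \<forall>h\<in>carrier_mat n n. mat_norm h < d \<and> a + h \<in> U -->
   mat_norm (f (a + h) - f a - L' h) \<le> e * mat_norm h" using d' by blast
 qed
 ultimately show "\<exists>L. mat_clinear n L \<and> (\<exists>K. \<forall>h\<in>carrier_mat n n. mat_norm (L h) \<le> K * mat_norm h) \<and>
   (\<forall>e>0. \<exists>d>0. \<forall>h\<in>carrier_mat n n. mat_norm h < d \<and> a + h \<in> U -->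
    mat_norm (f (a + h) - f a - L h) \<le> e * mat_norm h)" by blast
qed

lemma mat_inv_eqI:
 fixes b :: "'b::cstar_algebra mat"
 assumes "b \<in> carrier_mat n n" "c \<in> carrier_mat n n" "b * c = 1\<^sub>m n" "c * b = 1\<^sub>m n"
 shows "mat_inv b = c"
 unfolding mat_inv_def
proof (rule the_equality)
 show "inverts_mat b c \<and> inverts_mat c b" using assms by (simp add: inverts_mat_def)
 fix c' assume c': "inverts_mat b c' \<and> inverts_mat c' b"
 then have e: "b * c' = 1\<^sub>m n" "c' * b = 1\<^sub>m (dim_row c')" using assms by (auto simp: inverts_mat_def)
 have "dim_col c' = n" using arg_cong [OF e(1), of dim_col] by simp
 moreover have "dim_row c' = n" using arg_cong [OF e(2), of dim_col] assms by simp
 ultimately have cc: "c' \<in> carrier_mat n n" by auto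
 have "c' = c' * (b * c)" using assms cc by simp
 also have "\<dots> = c' * b * c" using assms cc by (intro assoc_mult_mat [symmetric, of _ n n _ n _ n]) auto
 also have "\<dots> = c" using e cc assms by simp
 finally show "c' = c" .
qed

lemma Hplus_level: "n \<ge> 1 ==> Hplus \<inter> carrier_mat n n = (Mplus n :: 'b::cstar_algebra mat set)"
 by (auto simp: Hplus_def Mplus_def)

lemma Mplus_inverse:
 assumes "b \<in> Mplus n"
 obtains c :: "'b::cstar_algebra mat" where "c \<in> carrier_mat n n" "b * c = 1\<^sub>m n" "c * b = 1\<^sub>m n" "mat_inv b = c"
proof -
 obtain \<epsilon> where e: "\<epsilon> > 0" "psd (Im_part (iform n b) - of_real \<epsilon>)" "b \<in> carrier_mat n n"
  using MplusD [OF assms] .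
 obtain c where c: "iform n b * c = 1" "c * iform n b = 1" using psd_Im_imp_invertible [OF e(2,1)] .
 have "blev (iform n b * c) n = 1\<^sub>m n" "blev (c * iform n b) n = 1\<^sub>m n" using c by simp_all
 then have "b * blev c n = 1\<^sub>m n" "blev c n * b = 1\<^sub>m n" using e by (simp_all add: iform_def)
 then show ?thesis using that [of "blev c n"] mat_inv_eqI [of b n "blev c n"] e by simp
qed

context cp_map
begin

definition xbound :: real where
 "xbound = (SOME N. \<forall>n. positive_map (at_level \<sigma> n) emb_nc X_nc N)"

lemma pm: "positive_map (at_level \<sigma> n) emb_nc X_nc xbound"
proof -
 have "\<exists>N. \<forall>n. positive_map (at_level \<sigma> n) emb_nc X_nc N" using positive_map_exists by blast
 from someI_ex [OF this] show ?thesis unfolding xbound_def by blast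
qed

lemma xbound_pos: "xbound > 0"
 using pm [of 0] by (simp add: positive_map_def)

text \<open>
 The transform on the half plane, and its expansion at infinity in terms of \<open>c = b\<inverse>\<close>.
\<close>

definition half :: "'b mat => 'b mat" where
 "half b = blev (positive_map.transform (at_level \<sigma> (dim_row b)) emb_nc X_nc (iform (dim_row b) b)) (dim_row b)"

definition series :: "'b mat => 'b mat" where
 "series c = blev (positive_map.moment_series (at_level \<sigma> (dim_row c)) emb_nc X_nc (level 0 (dim_row c) c)) (dim_row c)"

lemma half_eq: "b \<in> carrier_mat n n ==> half b = blev (positive_map.transform (at_level \<sigma> n) emb_nc X_nc (iform n b)) n"
 by (auto simp: half_def)

lemma series_eq: "c \<in> carrier_mat n n ==> series c = blev (positive_map.moment_series (at_level \<sigma> n) emb_nc X_nc (level 0 n c)) n"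
 by (auto simp: series_def)

lemma half_carrier [simp]: "b \<in> carrier_mat n n ==> half b \<in> carrier_mat n n"
 by (simp add: half_eq)

lemma series_carrier [simp]: "b \<in> carrier_mat n n ==> series b \<in> carrier_mat n n"
 by (simp add: series_eq)

lemma itw_map_\<sigma>: "lrel n m S P Q ==> itw n m (map_mat \<sigma> (lev P n)) S (map_mat \<sigma> (lev Q m))"
 unfolding lrel_def by (rule itw_map) (simp_all add: \<sigma>_add \<sigma>_scaleC)

lemma lrel_approx:
 fixes b c :: "'b bfam"
 assumes "itw n m (blev b n) S (blev c m)"
 shows "lrel n m S (positive_map.approx emb_nc X_nc t b k) (positive_map.approx emb_nc X_nc t c k)"
proof -
 interpret P: positive_map "at_level \<sigma> n" emb_nc X_nc xbound by (rule pm)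
 show ?thesis
  unfolding P.approx_def
  by (intro lrel_scaleC lrel_sum lrel_power lrel_add lrel_one lrel_minus lrel_emb lrel_X assms)
qed

lemma lrel_geom:
 fixes b c :: "'b bfam"
 assumes "itw n m (blev b n) S (blev c m)"
 shows "lrel n m S (positive_map.geom emb_nc X_nc b k * emb_nc b) (positive_map.geom emb_nc X_nc c k * emb_nc c)"
proof -
 interpret P: positive_map "at_level \<sigma> n" emb_nc X_nc xbound by (rule pm)
 show ?thesis
  unfolding P.geom_def by (intro lrel_mult lrel_sum lrel_power lrel_emb lrel_X assms)
qed

lemma at_level_cong: "lev P n = lev Q n ==> at_level \<sigma> n P = at_level \<sigma> n Q"
 by (simp add: at_level_def)

lemma transform_cong:
 assumes "blev b n = blev c n"
 shows "positive_map.transform (at_level \<sigma> n) emb_nc X_nc b = positive_map.transform (at_level \<sigma> n) emb_nc X_nc c"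
proof -
 interpret P: positive_map "at_level \<sigma> n" emb_nc X_nc xbound by (rule pm)
 have "at_level \<sigma> n (P.approx t b k) = at_level \<sigma> n (P.approx t c k)" for t k
  by (rule at_level_cong [OF lrel_identity [OF lrel_approx]]) (simp add: assms itw_refl)
 then show ?thesis unfolding P.transform_def by presburger
qed

lemma moment_series_cong:
 assumes "blev b n = blev c n"
 shows "positive_map.moment_series (at_level \<sigma> n) emb_nc X_nc b = positive_map.moment_series (at_level \<sigma> n) emb_nc X_nc c"
proof -
 interpret P: positive_map "at_level \<sigma> n" emb_nc X_nc xbound by (rule pm)
 have "at_level \<sigma> n (P.geom b k * emb_nc b) = at_level \<sigma> n (P.geom c k * emb_nc c)" for k
  by (rule at_level_cong [OF lrel_identity [OF lrel_geom]]) (simp add: assms itw_refl)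
 then show ?thesis unfolding P.moment_series_def P.slim_def by presburger
qed

lemma half_tendsto:
 assumes "b \<in> Mplus n"
 shows "\<exists>t0>0. \<forall>t. 0 < t \<and> t < t0 --> (\<forall>i<n. \<forall>j<n.
  (\<lambda>k. map_mat \<sigma> (lev (positive_map.approx emb_nc X_nc t (iform n b) k) n) $$ (i, j)) \<longlonglongrightarrow> half b $$ (i, j))"
proof -
 interpret P: positive_map "at_level \<sigma> n" emb_nc X_nc xbound by (rule pm)
 obtain \<epsilon> where e: "\<epsilon> > 0" "psd (Im_part (iform n b) - of_real \<epsilon>)" "b \<in> carrier_mat n n"
  using MplusD [OF assms] .
 obtain R where "P.ainv (emb_nc (iform n b) - X_nc) R (2 / \<epsilon>)" using P.ainv_exists [OF e(2,1)] .
 from P.transform_eq_slim(2) [OF e(2,1) this]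
 obtain t0 where t0: "t0 > 0" "\<And>t. 0 < t ==> t < t0 ==>
  (\<lambda>k. at_level \<sigma> n (P.approx t (iform n b) k)) \<longlonglongrightarrow> P.transform (iform n b)" by blast
 have "(\<lambda>k. map_mat \<sigma> (lev (P.approx t (iform n b) k) n) $$ (i, j)) \<longlonglongrightarrow> half b $$ (i, j)"
  if "0 < t" "t < t0" "i < n" "j < n" for t i j
  using bounded_linear.tendsto [OF bounded_linear_entry [OF that(3,4)] t0(2) [OF that(1,2)]] e
  by (simp add: half_eq)
 then show ?thesis using t0(1) by blast
qed

lemma half_itw:
 assumes x: "x \<in> Mplus n" and y: "y \<in> Mplus m" and S: "itw n m x S y"
 shows "itw n m (half x) S (half y)"
proof -
 have c: "x \<in> carrier_mat n n" "y \<in> carrier_mat m m" using x y by (auto simp: Mplus_def)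
 obtain t1 where t1: "t1 > 0" "\<And>t i j. 0 < t ==> t < t1 ==> i < n ==> j < n ==>
  (\<lambda>k. map_mat \<sigma> (lev (positive_map.approx emb_nc X_nc t (iform n x) k) n) $$ (i, j)) \<longlonglongrightarrow> half x $$ (i, j)"
  using half_tendsto [OF x] by blast
 obtain t2 where t2: "t2 > 0" "\<And>t i j. 0 < t ==> t < t2 ==> i < m ==> j < m ==>
  (\<lambda>k. map_mat \<sigma> (lev (positive_map.approx emb_nc X_nc t (iform m y) k) m) $$ (i, j)) \<longlonglongrightarrow> half y $$ (i, j)"
  using half_tendsto [OF y] by blast
 define t where "t = min t1 t2 / 2"
 have t: "0 < t" "t < t1" "t < t2" using t1(1) t2(1) by (auto simp: t_def)
 have "itw n m (blev (iform n x) n) S (blev (iform m y) m)" using S c by (simp add: iform_def)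
 then have "\<forall>\<^sub>F k in sequentially. itw n m (map_mat \<sigma> (lev (positive_map.approx emb_nc X_nc t (iform n x) k) n)) S
   (map_mat \<sigma> (lev (positive_map.approx emb_nc X_nc t (iform m y) k) m))"
  by (intro always_eventually allI itw_map_\<sigma> lrel_approx)
 then show ?thesis
  by (rule itw_limit) (rule t1(2) [OF t(1,2)] t2(2) [OF t(1,3)]; assumption)+
qed

lemma series_sums:
 assumes c: "c \<in> carrier_mat n n" "mat_norm c * xbound < 1" and ij: "i < n" "j < n"
 shows "(\<lambda>k. map_mat \<sigma> ((map_mat nc_const c * (nc_X \<cdot>\<^sub>m 1\<^sub>m n)) ^\<^sub>m k * map_mat nc_const c) $$ (i, j))
  sums (series c $$ (i, j))"
proof -
 interpret P: positive_map "at_level \<sigma> n" emb_nc X_nc xbound by (rule pm)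
 have "norm (level 0 n c) * xbound < 1" using c by (simp add: norm_level)
 from bounded_linear.sums [OF bounded_linear_entry [OF ij] P.moment_series_sums [OF this]]
 show ?thesis using c by (simp add: series_eq lev_power)
qed

lemma series_tendsto:
 assumes c: "c \<in> carrier_mat n n" "mat_norm c * xbound < 1" and ij: "i < n" "j < n"
 shows "(\<lambda>k. map_mat \<sigma> (lev (positive_map.geom emb_nc X_nc (level 0 n c) k * emb_nc (level 0 n c)) n) $$ (i, j))
  \<longlonglongrightarrow> series c $$ (i, j)"
proof -
 interpret P: positive_map "at_level \<sigma> n" emb_nc X_nc xbound by (rule pm)
 have "norm (level 0 n c) * xbound < 1" using c by (simp add: norm_level)
 from bounded_linear.tendsto [OF bounded_linear_entry [OF ij] P.moment_series_tendsto [OF this]]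
 show ?thesis using c by (simp add: series_eq)
qed

lemma series_itw:
 assumes x: "x \<in> carrier_mat n n" "mat_norm x * xbound < 1" and y: "y \<in> carrier_mat m m" "mat_norm y * xbound < 1"
  and S: "itw n m x S y"
 shows "itw n m (series x) S (series y)"
proof -
 have "itw n m (blev (level 0 n x) n) S (blev (level 0 m y) m)" using S x y by simp
 then have "\<forall>\<^sub>F k in sequentially. itw n m (map_mat \<sigma> (lev (positive_map.geom emb_nc X_nc (level 0 n x) k * emb_nc (level 0 n x)) n)) S
   (map_mat \<sigma> (lev (positive_map.geom emb_nc X_nc (level 0 m y) k * emb_nc (level 0 m y)) m))"
  by (intro always_eventually allI itw_map_\<sigma> lrel_geom)
 then show ?thesis
  by (rule itw_limit) (rule series_tendsto [OF x] series_tendsto [OF y]; assumption)+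
qed

lemma nc_function_half: "nc_function Hplus half"
proof (rule nc_functionI)
 show "x \<in> Hplus ==> \<exists>n\<ge>1. x \<in> carrier_mat n n" for x :: "'b mat"
  unfolding Hplus_def Mplus_def by auto
 fix n m and x y :: "'b mat" and S
 assume "x \<in> Hplus" "y \<in> Hplus" "x \<in> carrier_mat n n" "y \<in> carrier_mat m m" "itw n m x S y"
 moreover have "z \<in> Mplus k" if "z \<in> Hplus" "z \<in> carrier_mat k k" for z :: "'b mat" and k
  using that unfolding Hplus_def Mplus_def by auto
 ultimately show "itw n m (half x) S (half y)" by (intro half_itw) auto
qed (auto intro: Hplus_dsum)

lemma mat_analytic_on_half: "mat_analytic_on n (Mplus n) half"
proof (rule mat_analytic_onI [where z = \<i>])
 interpret P: positive_map "at_level \<sigma> n" emb_nc X_nc xbound by (rule pm)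
 fix a :: "'b mat" assume "a \<in> Mplus n"
 then obtain \<epsilon> where e: "\<epsilon> > 0" "psd (Im_part (iform n a) - of_real \<epsilon>)" "a \<in> carrier_mat n n"
  using MplusD by blast
 show "a \<in> carrier_mat n n \<and> half a = blev (P.transform (level \<i> n a)) n"
  using e by (simp add: half_eq iform_def)
 show "quad_diff P.transform (level \<i> n a)"
  using P.quad_diff_transform [OF e(2,1)] by (simp add: iform_def)
qed

lemma analytic_half: "analytic_nc_function Hplus half"
 using nc_function_half mat_analytic_on_half by (simp add: analytic_nc_function_def Hplus_level)

definition rad :: real where "rad = 1 / (2 * xbound)"

lemma rad_pos: "rad > 0"
 using xbound_pos by (simp add: rad_def)

lemma rad_bound: "mat_norm c < rad ==> mat_norm c * xbound < 1/2"
 using xbound_pos by (simp add: rad_def field_simps)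

lemma analytic_series: "analytic_nc_function (ncball rad) series"
 unfolding analytic_nc_function_def
proof (intro conjI allI impI)
 show "nc_function (ncball rad) series"
 proof (rule nc_functionI)
  show "x \<in> ncball rad ==> \<exists>n\<ge>1. x \<in> carrier_mat n n" for x :: "'b mat"
   unfolding ncball_def by auto
  fix n m and x y :: "'b mat" and S
  assume xy: "x \<in> ncball rad" "y \<in> ncball rad" "x \<in> carrier_mat n n" "y \<in> carrier_mat m m" "itw n m x S y"
  then have "mat_norm x < rad" "mat_norm y < rad" by (auto simp: ncball_def)
  then show "itw n m (series x) S (series y)"
   using xy by (intro series_itw) (auto dest!: rad_bound)
 qed (auto intro: ncball_dsum)
 fix n :: nat assume n: "n \<ge> 1"
 interpret P: positive_map "at_level \<sigma> n" emb_nc X_nc xbound by (rule pm)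
 show "mat_analytic_on n (ncball rad \<inter> carrier_mat n n) series"
 proof (rule mat_analytic_onI [where z = 0])
  fix a :: "'b mat" assume "a \<in> ncball rad \<inter> carrier_mat n n"
  then have a: "a \<in> carrier_mat n n" "mat_norm a < rad" by (auto simp: ncball_def)
  show "a \<in> carrier_mat n n \<and> series a = blev (P.moment_series (level 0 n a)) n"
   using a by (simp add: series_eq)
  have "norm (level 0 n a) * xbound < 1" using rad_bound [OF a(2)] a(1) by (simp add: norm_level)
  then show "quad_diff P.moment_series (level 0 n a)" by (rule P.quad_diff_moment_series)
 qed
qed

lemma norm_at_level_one: "norm (at_level \<sigma> n 1) \<le> norm (\<sigma> 1)"
proof -
 have "norm (at_level \<sigma> n 1) = mat_norm (map_mat \<sigma> (1\<^sub>m n))" by (simp add: at_level_def norm_level)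
 also have "\<dots> \<le> norm (\<sigma> 1)"
  by (rule mat_norm_partial_perm [of _ n]) (auto split: if_splits)
 finally show ?thesis .
qed

lemma series_bounded: "b \<in> ncball rad ==> mat_norm (series b) \<le> 8 * rad * norm (\<sigma> 1)"
proof -
 assume "b \<in> ncball rad"
 then obtain n where b: "b \<in> carrier_mat n n" "mat_norm b < rad" by (auto simp: ncball_def)
 interpret P: positive_map "at_level \<sigma> n" emb_nc X_nc xbound by (rule pm)
 have "mat_norm (series b) \<le> norm (P.moment_series (level 0 n b))"
  using b by (simp add: series_eq mat_norm_blev_le)
 also have "\<dots> \<le> 4 * (1 / (1 - 1/2) * norm (level 0 n b)) * norm (at_level \<sigma> n 1)"
  using rad_bound [OF b(2)] b by (intro P.norm_moment_series_le) (auto simp: norm_level)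
 also have "\<dots> = 8 * mat_norm b * norm (at_level \<sigma> n 1)" using b by (simp add: norm_level)
 also have "\<dots> \<le> 8 * rad * norm (\<sigma> 1)"
  using b norm_at_level_one [of n] mat_norm_nonneg [of b] rad_pos by (intro mult_mono) auto
 finally show ?thesis .
qed

lemma series_star: "b \<in> ncball rad ==> series (mat_star b) = mat_star (series b)"
proof -
 assume "b \<in> ncball rad"
 then obtain n where b: "b \<in> carrier_mat n n" "mat_norm b < rad" by (auto simp: ncball_def)
 interpret P: positive_map "at_level \<sigma> n" emb_nc X_nc xbound by (rule pm)
 have "norm (level 0 n b) * xbound < 1" using rad_bound [OF b(2)] b(1) by (simp add: norm_level)
 from P.moment_series_star [OF this] show ?thesis
  using b by (simp add: series_eq [OF b(1)] series_eq [OF mat_star_carrier [OF b(1)]] star_level)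
qed

lemma series_zero: "series (0\<^sub>m n n) = 0\<^sub>m n n"
proof -
 interpret P: positive_map "at_level \<sigma> n" emb_nc X_nc xbound by (rule pm)
 have l0: "level 0 n (0\<^sub>m n n :: 'b mat) = 0"
  using norm_level [of "0\<^sub>m n n :: 'b mat" n] by simp
 have "(\<lambda>k. at_level \<sigma> n ((emb_nc 0 * X_nc) ^ k * emb_nc 0)) sums P.moment_series 0"
  by (rule P.moment_series_sums) simp
 then have "P.moment_series 0 = 0"
  using sums_unique2 [OF _ sums_zero] by (simp add: P.emb_0)
 then show ?thesis using series_eq [of "0\<^sub>m n n" n] by (simp add: l0)
qed

text \<open>
 At the other levels the argument is a large multiple of \<open>\<i>\<close>, so that its inverse is small there too.
\<close>

lemma series_eq_half:
 assumes b: "b \<in> Mplus n" and c: "c \<in> carrier_mat n n" "b * c = 1\<^sub>m n" "c * b = 1\<^sub>m n" "mat_norm c * xbound < 1"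
 shows "series c = half b"
proof -
 interpret P: positive_map "at_level \<sigma> n" emb_nc X_nc xbound by (rule pm)
 obtain \<epsilon> where e: "\<epsilon> > 0" "psd (Im_part (iform n b) - of_real \<epsilon>)" "b \<in> carrier_mat n n"
  using MplusD [OF b] .
 define y where "y = 1 + xbound"
 have y: "y \<ge> 1" "1 / y * xbound < 1" using xbound_pos by (auto simp: y_def)
 define B where "B = level (\<i> * complex_of_real y) n b"
 define C where "C = level (1 / (\<i> * complex_of_real y)) n c"
 have y0: "complex_of_real y \<noteq> 0" using y by simp
 have sc: "map_mat (scaleC z) (1\<^sub>m k) * map_mat (scaleC w) (1\<^sub>m k) = map_mat (scaleC (z * w)) (1\<^sub>m k :: 'b mat)" for z w k
 proof -
  have "blev (z *\<^sub>C 1 * w *\<^sub>C 1) k = blev ((z * w) *\<^sub>C 1 :: 'b bfam) k" by (simp add: scaleC_simps mult.commute)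
  then show ?thesis by simp
 qed
 have BC: "B * C = 1" "C * B = 1"
  using e c y0 by (auto intro!: bfam_eqI simp: B_def C_def blev_level sc)
 have im: "psd (Im_part B - of_real \<epsilon>)" if "\<epsilon> \<le> 1" "psd (Im_part (iform n b) - of_real \<epsilon>)" for \<epsilon>
  unfolding psd_bfam_iff
 proof
  fix k
  show "mat_pos (blev (Im_part B - of_real \<epsilon>) k)"
  proof (cases "k = n")
   case True
   then show ?thesis using that(2) e by (auto simp: psd_bfam_iff B_def iform_def dest: spec [of _ n])
  next
   case False
   have "mat_Im (map_mat (scaleC (\<i> * complex_of_real y)) (1\<^sub>m k)) - map_mat (scaleC (complex_of_real \<epsilon>)) (1\<^sub>m k)
     = map_mat (scaleC (complex_of_real (y - \<epsilon>))) (1\<^sub>m k :: 'b mat)"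
    by (rule eq_matI)
     (auto simp: mat_Im_def star_scaleC scaleC_diff_left scaleC_simps simp flip: scaleC_add_left)
   then show ?thesis using False e y that mat_pos_scale_one [of "y - \<epsilon>" k, where 'b = 'b]
    by (simp add: B_def blev_level of_real_bfam)
  qed
 qed
 define \<delta> where "\<delta> = min \<epsilon> 1"
 have \<delta>: "\<delta> > 0" "\<delta> \<le> 1" "\<delta> \<le> \<epsilon>" using e by (auto simp: \<delta>_def)
 have "psd (Im_part (iform n b) - of_real \<epsilon> + of_real (\<epsilon> - \<delta>))" using \<delta> e by (intro psd_add psd_of_real) auto
 then have imB: "psd (Im_part B - of_real \<delta>)" using \<delta> by (intro im) simp_all
 have "norm C \<le> max (mat_norm c) (1 / y)"
 proof (rule norm_bfam_le)
  fix k
  have "mat_norm (map_mat (scaleC (1 / (\<i> * complex_of_real y))) (1\<^sub>m k :: 'b mat)) \<le> 1 / y"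
   using mult_left_mono [OF mat_norm_one_le [of k, where 'b = 'b], of "1 / y"] y
   by (simp add: mat_norm_scaleC norm_divide norm_mult)
  then show "mat_norm (blev C k) \<le> max (mat_norm c) (1 / y)"
   using c by (auto simp: C_def blev_level le_max_iff_disj)
 qed
 moreover have "max (mat_norm c) (1 / y) * xbound < 1" using y c by (simp add: max_def)
 ultimately have "norm C * xbound < 1"
  using xbound_pos by (meson le_less_trans less_imp_le mult_right_mono)
 then have "P.moment_series C = P.transform B" by (rule P.moment_series_eq_transform [OF imB \<delta>(1) BC])
 moreover have "P.moment_series C = P.moment_series (level 0 n c)"
  using c by (intro moment_series_cong) (simp add: C_def)
 moreover have "P.transform B = P.transform (iform n b)"
  using e by (intro transform_cong) (simp add: B_def iform_def)
 ultimately show ?thesis using series_eq [OF c(1)] half_eq [OF e(3)] by simp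
qed

lemma continues_half: "continues_cauchy_series \<sigma> n half"
 unfolding continues_cauchy_series_def
proof (intro conjI exI ballI impI allI)
 show "mat_analytic_on n (Mplus n) half" by (rule mat_analytic_on_half)
 show "1 / xbound > 0" using xbound_pos by simp
 fix b :: "'b mat" and i j assume b: "b \<in> Mplus n" "mat_norm (mat_inv b) < 1 / xbound" and ij: "i < n" "j < n"
 obtain c where c: "c \<in> carrier_mat n n" "b * c = 1\<^sub>m n" "c * b = 1\<^sub>m n" "mat_inv b = c"
  using Mplus_inverse [OF b(1)] .
 have n: "mat_norm c * xbound < 1" using b(2) c xbound_pos by (simp add: field_simps)
 have "b \<in> carrier_mat n n" using b by (auto simp: Mplus_def)
 then have "cauchy_term \<sigma> b k = map_mat \<sigma> ((map_mat nc_const c * (nc_X \<cdot>\<^sub>m 1\<^sub>m n)) ^\<^sub>m k * map_mat nc_const c)" for k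
  by (simp add: cauchy_term_def c Let_def)
 then show "(\<lambda>k. cauchy_term \<sigma> b k $$ (i, j)) sums (half b $$ (i, j))"
  using series_sums [OF c(1) n ij] series_eq_half [OF b(1) c(1,2,3) n] by simp
qed

lemma uniform_extension_series:
 "uniform_extension0 {b. invertible_mat b \<and> mat_inv b \<in> Hplus} (\<lambda>b. half (mat_inv b)) series rad"
 unfolding uniform_extension0_def
proof (intro conjI exI ballI)
 show "rad > 0" by (rule rad_pos)
 show "analytic_nc_function (ncball rad) series" by (rule analytic_series)
 show "mat_norm (series b) \<le> 8 * rad * norm (\<sigma> 1)" if "b \<in> ncball rad" for b using that by (rule series_bounded)
 fix b :: "'b mat" assume b: "b \<in> ncball rad \<inter> {b. invertible_mat b \<and> mat_inv b \<in> Hplus}"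
 then obtain n where n: "b \<in> carrier_mat n n" "mat_norm b < rad" by (auto simp: ncball_def)
 obtain c where c: "inverts_mat b c" "inverts_mat c b" using b by (auto simp: invertible_mat_def)
 have e: "b * c = 1\<^sub>m n" "c * b = 1\<^sub>m (dim_row c)" using n c by (auto simp: inverts_mat_def)
 have "dim_col c = n" using arg_cong [OF e(1), of dim_col] by simp
 moreover have "dim_row c = n" using arg_cong [OF e(2), of dim_col] n by simp
 ultimately have cc: "c \<in> carrier_mat n n" by auto
 have ci: "mat_inv b = c" using n cc e by (intro mat_inv_eqI [of _ n]) auto
 then have "c \<in> Mplus n" using b cc by (auto simp: Hplus_def Mplus_def)
 then show "series b = half (mat_inv b)"
  unfolding ci using cc e n rad_bound [OF n(2)] by (intro series_eq_half) auto
qed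

lemma half_neg: "b \<in> Mplus n ==> half b \<in> Mminus_closed n"
proof -
 assume b: "b \<in> Mplus n"
 interpret P: positive_map "at_level \<sigma> n" emb_nc X_nc xbound by (rule pm)
 obtain \<epsilon> where e: "\<epsilon> > 0" "psd (Im_part (iform n b) - of_real \<epsilon>)" "b \<in> carrier_mat n n"
  using MplusD [OF b] .
 have "mat_pos (blev (- Im_part (P.transform (iform n b))) n)"
  using P.Im_transform_neg [OF e(2,1)] psd_bfam_iff by blast
 then show ?thesis using e by (simp add: Mminus_closed_def half_eq)
qed

lemma transform_cond_half:
 assumes "\<And>n b. n \<ge> 1 ==> b \<in> Mplus n ==> half b \<in> V n"
 shows "transform_cond V half"
 unfolding transform_cond_def
 using analytic_half assms uniform_extension_series series_star series_zero by blast

lemma psd_\<sigma>_one: "psd (\<sigma> 1)"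
proof -
 have "mat_pos (mat 1 1 (\<lambda>(i, j). \<sigma> (1 * star 1)))"
  using \<sigma>_cp [unfolded completely_positive_def, rule_format, of 1 "\<lambda>i. 1"] .
 then obtain C where C: "C \<in> carrier_mat 1 1" "mat 1 1 (\<lambda>(i, j). \<sigma> (1 * star 1)) = mat_star C * C"
  unfolding mat_pos_def by auto
 have "\<sigma> 1 = mat 1 1 (\<lambda>(i, j). \<sigma> (1 * star 1)) $$ (0, 0)" by simp
 also have "\<dots> = star (C $$ (0, 0)) * C $$ (0, 0)"
  unfolding C(2) using C(1) by (simp add: index_mult_mat' del: index_mult_mat(1))
 finally show ?thesis using psd_star_mult by metis
qed

lemma mat_Im_minus: "h \<in> carrier_mat n n ==> mat_Im (- h) = - mat_Im (h :: 'b mat)"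
 by (intro eq_matI) (auto simp: mat_Im_def star_diff scaleC_simps)

text \<open>
 An invertible \<open>\<sigma> 1\<close> is bounded below, and the imaginary part of \<open>- G b\<close> is at least a multiple
 of \<open>\<sigma> 1\<close>.
\<close>

lemma half_strict:
 assumes inv: "\<sigma> 1 * y = 1" "y * \<sigma> 1 = 1" and b: "b \<in> Mplus n"
 shows "half b \<in> Mminus n"
proof -
 interpret P: positive_map "at_level \<sigma> n" emb_nc X_nc xbound by (rule pm)
 obtain \<epsilon> where e: "\<epsilon> > 0" "psd (Im_part (iform n b) - of_real \<epsilon>)" "b \<in> carrier_mat n n"
  using MplusD [OF b] .
 define \<kappa> where "\<kappa> = \<epsilon> / (norm (iform n b) + xbound)\<^sup>2"
 have "norm (iform n b) + xbound > 0" using xbound_pos by (intro add_nonneg_pos) auto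
 then have \<kappa>: "\<kappa> > 0" using e by (simp add: \<kappa>_def)
 define \<delta> where "\<delta> = 1 / norm y"
 have "y \<noteq> 0" using inv by auto
 then have \<delta>: "\<delta> > 0" by (simp add: \<delta>_def)
 have "mat_pos (mat n n (\<lambda>(i, j). if i = j then \<sigma> 1 - of_real \<delta> else 0))"
  unfolding \<delta>_def by (intro mat_pos_diagonal psd_invertible_ge psd_\<sigma>_one inv)
 also have "mat n n (\<lambda>(i, j). if i = j then \<sigma> 1 - of_real \<delta> else 0) = (\<sigma> 1 - of_real \<delta>) \<cdot>\<^sub>m 1\<^sub>m n"
  by (rule eq_matI) auto
 finally have "mat_pos ((\<sigma> 1 - of_real \<delta>) \<cdot>\<^sub>m 1\<^sub>m n)" .
 then have p: "psd (level 0 n ((\<sigma> 1 - of_real \<delta>) \<cdot>\<^sub>m 1\<^sub>m n))" by (subst mat_pos_level_iff [symmetric]) auto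
 have "psd (- Im_part (P.transform (iform n b)) - \<kappa> *\<^sub>R at_level \<sigma> n 1 + \<kappa> *\<^sub>R level 0 n ((\<sigma> 1 - of_real \<delta>) \<cdot>\<^sub>m 1\<^sub>m n))"
  unfolding \<kappa>_def using \<kappa> \<kappa>_def by (intro psd_add psd_scaleR p P.Im_transform_lower [OF e(2,1)]) auto
 then have "mat_pos (blev (- Im_part (P.transform (iform n b)) - \<kappa> *\<^sub>R at_level \<sigma> n 1 + \<kappa> *\<^sub>R level 0 n ((\<sigma> 1 - of_real \<delta>) \<cdot>\<^sub>m 1\<^sub>m n)) n)"
  using psd_bfam_iff by blast
 moreover have "blev (- Im_part (P.transform (iform n b)) - \<kappa> *\<^sub>R at_level \<sigma> n 1 + \<kappa> *\<^sub>R level 0 n ((\<sigma> 1 - of_real \<delta>) \<cdot>\<^sub>m 1\<^sub>m n)) n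
   = mat_Im (- half b) - of_real (\<kappa> * \<delta>) \<cdot>\<^sub>m 1\<^sub>m n"
 proof -
  define H where "H = mat_Im (half b)"
  have hc: "half b \<in> carrier_mat n n" using e by simp
  then have H: "H \<in> carrier_mat n n" by (simp add: H_def)
  have e1: "blev (Im_part (P.transform (iform n b))) n = H" using e by (simp add: H_def half_eq)
  have e2: "mat_Im (- half b) = - H"
   using mat_Im_minus [OF hc] by (simp add: H_def)
  show ?thesis
   unfolding blev_simps(3,4,5) e1 e2 scaleR_scaleC
   using H by (intro eq_matI) (auto simp: scaleC_simps of_real_eq_scaleC [where 'c = 'b] algebra_simps)
 qed
 ultimately have "mat_pos (mat_Im (- half b) - of_real (\<kappa> * \<delta>) \<cdot>\<^sub>m 1\<^sub>m n)" by (simp only:)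
 moreover have "- half b \<in> carrier_mat n n" using e by simp
 moreover have "\<kappa> * \<delta> > 0" using \<kappa> \<delta> by simp
 ultimately have "- half b \<in> Mplus n" unfolding Mplus_def by blast
 moreover have "half b = - (- half b)" using e by (intro eq_matI) auto
 ultimately show ?thesis unfolding Mminus_def by blast
qed

text \<open>At \<open>b = \<i>\<close> the upper bound \<open>- Im G b \<le> \<sigma> 1\<close> transports a lower bound of the left side to \<open>\<sigma> 1\<close>.\<close>

lemma strict_imp_invertible:
 assumes "\<And>b. b \<in> Mplus 1 ==> half b \<in> Mminus 1"
 shows "\<exists>y. \<sigma> 1 * y = 1 \<and> y * \<sigma> 1 = 1"
proof -
 interpret P: positive_map "at_level \<sigma> 1" emb_nc X_nc xbound by (rule pm)
 define B :: "'b bfam" where "B = (\<i> * complex_of_real 1) *\<^sub>C 1"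
 have "Im_part B = of_real 1"
  by (rule bfam_eqI, rule eq_matI)
   (auto simp: B_def Im_part_def star_scaleC scaleC_simps of_real_bfam simp flip: scaleC_add_left)
 then have im: "psd (Im_part B - of_real 1)" by simp
 define b where "b = blev B 1"
 have b: "b \<in> Mplus 1" "b \<in> carrier_mat 1 1" using MplusI [OF im] by (auto simp: b_def)
 have tr: "P.transform (iform 1 b) = P.transform B"
  using b by (intro transform_cong) (simp add: iform_def b_def)
 obtain h where h: "h \<in> Mplus 1" "half b = - h" using assms [OF b(1)] by (auto simp: Mminus_def)
 obtain \<delta> where d: "\<delta> > 0" "psd (Im_part (iform 1 h) - of_real \<delta>)" "h \<in> carrier_mat 1 1"
  using MplusD [OF h(1)] .
 have "mat_pos (blev ((1 / 1) *\<^sub>R at_level \<sigma> 1 1 + Im_part (P.transform B)) 1)"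
 proof -
  have "psd ((1 / 1) *\<^sub>R at_level \<sigma> 1 1 + Im_part (P.transform B))"
   by (rule P.Im_transform_imaginary) (simp_all add: B_def)
  then show ?thesis unfolding psd_bfam_iff by blast
 qed
 moreover have "mat_pos (blev (Im_part (iform 1 h) - of_real \<delta>) 1)" using d psd_bfam_iff by blast
 ultimately have "mat_pos (blev ((1 / 1) *\<^sub>R at_level \<sigma> 1 1 + Im_part (P.transform B)) 1 + blev (Im_part (iform 1 h) - of_real \<delta>) 1)"
  by (rule mat_pos_add) auto
 then obtain C where C: "C \<in> carrier_mat 1 1"
  "blev ((1 / 1) *\<^sub>R at_level \<sigma> 1 1 + Im_part (P.transform B)) 1 + blev (Im_part (iform 1 h) - of_real \<delta>) 1 = mat_star C * C"
  unfolding mat_pos_def by auto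
 have hb: "blev (P.transform B) 1 = - h"
  using half_eq [OF b(2)] tr h by simp
 define H where "H = mat_Im h"
 have H: "H \<in> carrier_mat 1 1" "mat_Im (- h) = - H" using d(3) mat_Im_minus [OF d(3)] by (auto simp: H_def)
 have "\<sigma> 1 - of_real \<delta> = (blev ((1 / 1) *\<^sub>R at_level \<sigma> 1 1 + Im_part (P.transform B)) 1 + blev (Im_part (iform 1 h) - of_real \<delta>) 1) $$ (0, 0)"
  using d(3) hb H
  by (simp add: iform_def of_real_bfam of_real_eq_scaleC [where 'c = 'b] scaleR_scaleC scaleC_simps flip: H_def)
 also have "\<dots> = star (C $$ (0, 0)) * C $$ (0, 0)"
  unfolding C(2) using C(1) by (simp add: index_mult_mat' del: index_mult_mat(1))
 finally have p: "psd (\<sigma> 1 - of_real \<delta>)" using psd_star_mult by metis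
 have "Im_part (\<i> *\<^sub>C \<sigma> 1) = \<sigma> 1"
  using psd_self_adj [OF psd_\<sigma>_one]
  by (simp add: Im_part_def star_scaleC scaleC_simps scaleC_minus_left flip: scaleC_add_left)
 then have "psd (Im_part (\<i> *\<^sub>C \<sigma> 1) - of_real \<delta>)" using p by simp
 from psd_Im_imp_invertible [OF this d(1)]
 obtain y where "\<i> *\<^sub>C \<sigma> 1 * y = 1" "y * \<i> *\<^sub>C \<sigma> 1 = 1" .
 then show ?thesis
  by (intro exI [of _ "\<i> *\<^sub>C y"]) (simp add: mult_scaleC_left mult_scaleC_right)
qed

end

section \<open>Uniqueness of the analytic continuation\<close>

definition sublinear :: "('a::real_normed_vector => real) => bool" where
 "sublinear p \<longleftrightarrow> (\<forall>x y. p (x + y) \<le> p x + p y) \<and> (\<forall>r>0. \<forall>x. p (r *\<^sub>R x) = r * p x) \<and> (\<forall>x. p x \<le> norm x)"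

lemma sublinear_0: "sublinear p ==> p 0 = 0"
proof -
 assume "sublinear p"
 then have "p (2 *\<^sub>R 0) = 2 * p 0" unfolding sublinear_def by (metis zero_less_numeral)
 then show ?thesis by simp
qed

lemma sublinear_lower: "sublinear p ==> - p (- x) \<le> p x"
proof -
 assume p: "sublinear p"
 then have "p (x + - x) \<le> p x + p (- x)" unfolding sublinear_def by blast
 then show ?thesis using sublinear_0 [OF p] by simp
qed

lemma sublinear_ge: "sublinear p ==> - norm x \<le> p x"
proof -
 assume p: "sublinear p"
 then have "p (- x) \<le> norm (- x)" unfolding sublinear_def by blast
 then show ?thesis using sublinear_lower [OF p, of x] by simp
qed

text \<open>Lowering a sublinear functional as far as possible in one direction.\<close>

definition lowered :: "('a::real_normed_vector => real) => 'a => 'a => real" where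
 "lowered p y x = (INF t\<in>{0..}. p (x + t *\<^sub>R y) - t * p y)"

lemma scaled_sublinear: "sublinear p ==> 0 \<le> t ==> p (t *\<^sub>R y) = t * p y"
 by (cases "t = 0") (auto simp: sublinear_0 sublinear_def)

lemma lowered_bdd:
 assumes p: "sublinear p"
 shows "bdd_below ((\<lambda>t. p (x + t *\<^sub>R y) - t * p y) ` {0..})"
proof (rule bdd_belowI2)
 fix t :: real assume "t \<in> {0..}"
 then have "t * p y = p ((x + t *\<^sub>R y) + - x)" using scaled_sublinear [OF p, of t y] by simp
 also have "\<dots> \<le> p (x + t *\<^sub>R y) + p (- x)" using p unfolding sublinear_def by blast
 finally show "- p (- x) \<le> p (x + t *\<^sub>R y) - t * p y" by simp
qed

lemma lowered_le:
 assumes p: "sublinear p" and t: "0 \<le> t"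
 shows "lowered p y x \<le> p (x + t *\<^sub>R y) - t * p y"
 unfolding lowered_def by (rule cINF_lower [OF lowered_bdd [OF p]]) (use t in simp)

lemma sublinear_lowered:
 assumes p: "sublinear p"
 shows "sublinear (lowered p y)"
 unfolding sublinear_def
proof (intro conjI allI impI)
 fix x x'
 have *: "lowered p y (x + x') \<le> (p (x + t *\<^sub>R y) - t * p y) + (p (x' + t' *\<^sub>R y) - t' * p y)"
  if "0 \<le> t" "0 \<le> t'" for t t'
 proof -
  have "lowered p y (x + x') \<le> p ((x + x') + (t + t') *\<^sub>R y) - (t + t') * p y"
   using that by (intro lowered_le p) simp
  also have "(x + x') + (t + t') *\<^sub>R y = (x + t *\<^sub>R y) + (x' + t' *\<^sub>R y)" by (simp add: scaleR_add_left)
  also have "p \<dots> \<le> p (x + t *\<^sub>R y) + p (x' + t' *\<^sub>R y)" using p unfolding sublinear_def by blast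
  finally show ?thesis by (simp add: algebra_simps)
 qed
 have "lowered p y (x + x') - (p (x + t *\<^sub>R y) - t * p y) \<le> lowered p y x'" if "0 \<le> t" for t
  unfolding lowered_def [of p y x']
 proof (rule cINF_greatest)
  fix t' :: real assume "t' \<in> {0..}"
  then show "lowered p y (x + x') - (p (x + t *\<^sub>R y) - t * p y) \<le> p (x' + t' *\<^sub>R y) - t' * p y"
   using * [OF that, of t'] by simp
 qed simp
 then have "lowered p y (x + x') - lowered p y x' \<le> lowered p y x"
  unfolding lowered_def [of p y x] by (intro cINF_greatest) (auto simp: algebra_simps)
 then show "lowered p y (x + x') \<le> lowered p y x + lowered p y x'" by simp
next
 fix r :: real and x assume r: "r > 0"
 have *: "lowered p y (r *\<^sub>R x) \<le> r * lowered p y x" if r: "r > 0" for r x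
 proof -
  have "lowered p y (r *\<^sub>R x) / r \<le> p (x + t *\<^sub>R y) - t * p y" if "0 \<le> t" for t
  proof -
   have "lowered p y (r *\<^sub>R x) \<le> p (r *\<^sub>R x + (r * t) *\<^sub>R y) - (r * t) * p y"
    using that r by (intro lowered_le p) simp
   also have "r *\<^sub>R x + (r * t) *\<^sub>R y = r *\<^sub>R (x + t *\<^sub>R y)" by (simp add: scaleR_add_right)
   also have "p \<dots> = r * p (x + t *\<^sub>R y)" using p r unfolding sublinear_def by blast
   finally have "lowered p y (r *\<^sub>R x) \<le> (p (x + t *\<^sub>R y) - t * p y) * r" by (simp add: algebra_simps)
   then show ?thesis by (simp only: pos_divide_le_eq [OF r])
  qed
  then have "lowered p y (r *\<^sub>R x) / r \<le> lowered p y x"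
   unfolding lowered_def [of p y x] by (intro cINF_greatest) auto
  then show ?thesis using r by (simp add: divide_le_eq mult.commute)
 qed
 have "lowered p y ((1 / r) *\<^sub>R r *\<^sub>R x) \<le> (1 / r) * lowered p y (r *\<^sub>R x)" using r by (intro *) simp
 then have "r * lowered p y x \<le> lowered p y (r *\<^sub>R x)" using r by (simp add: field_simps)
 then show "lowered p y (r *\<^sub>R x) = r * lowered p y x" using * [OF r, of x] by simp
next
 fix x
 have "lowered p y x \<le> p x" using lowered_le [OF p order_refl, of y x] by simp
 also have "\<dots> \<le> norm x" using p unfolding sublinear_def by blast
 finally show "lowered p y x \<le> norm x" .
qed

text \<open>The Hahn--Banach theorem: a minimal sublinear functional is linear, because it cannot be lowered.\<close>

lemma separating_functional:
 fixes x0 :: "'a::real_normed_vector"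
 assumes "x0 \<noteq> 0"
 obtains \<phi> :: "'a => real" where "bounded_linear \<phi>" "\<phi> x0 \<noteq> 0"
proof -
 define A where "A = {p. sublinear p \<and> p (- x0) \<le> - norm x0}"
 define P where "P = (\<lambda>p q :: 'a => real. \<forall>x. q x \<le> p x)"
 have "sublinear (norm :: 'a => real)" by (auto simp: sublinear_def norm_triangle_ineq)
 then have A0: "lowered norm x0 \<in> A"
  using sublinear_lowered [of norm x0] lowered_le [of norm 1 x0 "- x0"] by (simp add: A_def)
 have po: "partial_order_on A (relation_of P A)"
  unfolding partial_order_on_def preorder_on_def refl_on_def trans_def antisym_def relation_of_def P_def
  by (auto intro: order_trans) (metis ext order_antisym)
 have chain: "\<exists>u\<in>A. \<forall>a\<in>C. P a u" if C: "C \<in> Chains (relation_of P A)" for C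
 proof (cases "C = {}")
  case True
  then show ?thesis using A0 by blast
 next
  case False
  have CA: "p \<in> A" if "p \<in> C" for p using C that by (auto simp: Chains_def relation_of_def)
  then have sl: "sublinear p" "p (- x0) \<le> - norm x0" if "p \<in> C" for p using that by (auto simp: A_def)
  have tot: "P p q \<or> P q p" if "p \<in> C" "q \<in> C" for p q
   using C that by (auto simp: Chains_def relation_of_def)
  define u where "u x = (INF p\<in>C. p x)" for x
  have bd: "bdd_below ((\<lambda>p. p x) ` C)" for x
   by (rule bdd_belowI2 [of _ "- norm x"]) (use sl sublinear_ge in blast)
  have le: "u x \<le> p x" if "p \<in> C" for p x
   unfolding u_def by (rule cINF_lower [OF bd that])
  have ge: "c \<le> u x" if "\<And>p. p \<in> C ==> c \<le> p x" for c x
   unfolding u_def by (rule cINF_greatest [OF False]) (use that in auto)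
  obtain p0 where p0: "p0 \<in> C" using False by blast
  have "sublinear u"
   unfolding sublinear_def
  proof (intro conjI allI impI)
   fix x y
   have *: "u (x + y) \<le> p x + q y" if pq: "p \<in> C" "q \<in> C" for p q
   proof -
    have "\<exists>r\<in>C. r x \<le> p x \<and> r y \<le> q y" using tot [OF pq] pq unfolding P_def by blast
    then obtain r where r: "r \<in> C" "r x \<le> p x" "r y \<le> q y" by blast
    have "u (x + y) \<le> r (x + y)" by (rule le [OF r(1)])
    also have "\<dots> \<le> r x + r y" using sl(1) [OF r(1)] unfolding sublinear_def by blast
    finally show ?thesis using r by linarith
   qed
   have "u (x + y) - p x \<le> u y" if "p \<in> C" for p
    by (rule ge) (use * [OF that] in \<open>auto simp: algebra_simps\<close>)
   then have "u (x + y) - u y \<le> u x" by (intro ge) (auto simp: algebra_simps)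
   then show "u (x + y) \<le> u x + u y" by simp
  next
   fix r :: real and x assume r: "r > 0"
   have s: "p (r *\<^sub>R x) = r * p x" if "p \<in> C" for p using sl(1) [OF that] r unfolding sublinear_def by blast
   have "u (r *\<^sub>R x) / r \<le> u x"
    by (rule ge) (use le [of _ "r *\<^sub>R x"] s r in \<open>auto simp: divide_le_eq mult.commute\<close>)
   moreover have "r * u x \<le> u (r *\<^sub>R x)"
   proof (rule ge)
    fix p assume p: "p \<in> C"
    show "r * u x \<le> p (r *\<^sub>R x)" unfolding s [OF p] using le [OF p] r by (intro mult_left_mono) auto
   qed
   ultimately show "u (r *\<^sub>R x) = r * u x" using r by (simp add: divide_le_eq mult.commute)
  next
   fix x
   have "p0 x \<le> norm x" using sl(1) [OF p0] unfolding sublinear_def by blast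
   then show "u x \<le> norm x" using le [OF p0, of x] by linarith
  qed
  moreover have "u (- x0) \<le> - norm x0" using le [OF p0, of "- x0"] sl(2) [OF p0] by linarith
  ultimately have "u \<in> A" by (simp add: A_def)
  then show ?thesis using le by (auto simp: P_def)
 qed
 obtain p where p: "p \<in> A" "\<And>q. q \<in> A ==> P p q ==> q = p"
  using predicate_Zorn [OF po chain] by blast
 have sp: "sublinear p" and px: "p (- x0) \<le> - norm x0" using p(1) by (auto simp: A_def)
 have low: "lowered p y = p" for y
 proof (rule p(2))
  have l: "lowered p y x \<le> p x" for x using lowered_le [OF sp order_refl, of y x] by simp
  then show "P p (lowered p y)" by (simp add: P_def)
  show "lowered p y \<in> A" using sublinear_lowered [OF sp] l [of "- x0"] px by (auto simp: A_def)
 qed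
 have neg: "p (- y) = - p y" for y
 proof (rule antisym)
  show "p (- y) \<le> - p y" using lowered_le [OF sp, of 1 y "- y"] sublinear_0 [OF sp] by (simp add: low)
  show "- p y \<le> p (- y)" using sublinear_lower [OF sp, of "- y"] by simp
 qed
 have add: "p (x + y) = p x + p y" for x y
 proof (rule antisym)
  show "p (x + y) \<le> p x + p y" using sp unfolding sublinear_def by blast
  have "p ((x + y) + - y) \<le> p (x + y) + p (- y)" using sp unfolding sublinear_def by blast
  then show "p x + p y \<le> p (x + y)" by (simp add: neg)
 qed
 have scale: "p (r *\<^sub>R x) = r * p x" for r x
 proof (cases "0 \<le> r")
  case True
  then show ?thesis by (rule scaled_sublinear [OF sp])
 next
  case False
  then have "p ((- r) *\<^sub>R x) = (- r) * p x" by (intro scaled_sublinear [OF sp]) simp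
  then show ?thesis using neg [of "r *\<^sub>R x"] by simp
 qed
 have "bounded_linear p"
 proof (rule bounded_linear_intro [where K = 1])
  show "norm (p x) \<le> norm x * 1" for x
  proof -
   have "p x \<le> norm x" using sp unfolding sublinear_def by blast
   then show ?thesis using sublinear_ge [OF sp, of x] by (simp add: abs_le_iff)
  qed
 qed (use add scale in auto)
 moreover have "p x0 \<noteq> 0" using px neg [of x0] assms by auto
 ultimately show ?thesis using that by blast
qed

text \<open>A continuous functional separating the two values reduces the claim to scalar functions.\<close>

lemma complex_identity_theorem:
 fixes u v :: "complex => 'b::cstar_algebra"
 assumes D: "open D" "connected D"
  and diff: "\<And>f z. f \<in> {u, v} ==> z \<in> D ==>
   \<exists>l. \<forall>e>0. \<exists>d>0. \<forall>w. cmod w < d --> norm (f (z + w) - f z - w *\<^sub>C l) \<le> e * cmod w"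
  and U: "U \<subseteq> D" "\<xi> \<in> D" "\<xi> islimpt U" "\<And>z. z \<in> U ==> u z = v z" and w: "w \<in> D"
 shows "u w = v w"
proof (rule ccontr)
 assume "u w \<noteq> v w"
 then obtain \<phi> :: "'b => real" where \<phi>: "bounded_linear \<phi>" "\<phi> (u w - v w) \<noteq> 0"
  using separating_functional [of "u w - v w"] by auto
 interpret \<phi>: bounded_linear \<phi> by (rule \<phi>)
 \<comment> \<open>the complex linear functional with real part \<open>\<phi>\<close>\<close>
 define \<psi> where "\<psi> x = Complex (\<phi> x) (- \<phi> (\<i> *\<^sub>C x))" for x
 have add: "\<psi> (x + y) = \<psi> x + \<psi> y" for x y
  by (simp add: \<psi>_def scaleC_add_right \<phi>.add complex_eq_iff)
 have scale: "\<psi> (c *\<^sub>C x) = c * \<psi> x" for c x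
 proof -
  have c: "c *\<^sub>C x = Re c *\<^sub>R x + Im c *\<^sub>R (\<i> *\<^sub>C x)" for x :: 'b
  proof -
   have "Re c *\<^sub>R x + Im c *\<^sub>R (\<i> *\<^sub>C x) = (complex_of_real (Re c) + complex_of_real (Im c) * \<i>) *\<^sub>C x"
    by (simp add: scaleR_scaleC scaleC_scaleC scaleC_add_left)
   also have "complex_of_real (Re c) + complex_of_real (Im c) * \<i> = c" by (simp add: complex_eq_iff)
   finally show ?thesis by simp
  qed
  have i: "\<i> *\<^sub>C (c *\<^sub>C x) = c *\<^sub>C (\<i> *\<^sub>C x)" by (simp add: scaleC_scaleC mult.commute)
  have ii: "\<i> *\<^sub>C (\<i> *\<^sub>C x) = - x" by (simp add: scaleC_scaleC scaleC_minus_left scaleC_one)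
  have "\<phi> (c *\<^sub>C x) = Re c * \<phi> x + Im c * \<phi> (\<i> *\<^sub>C x)"
   unfolding c [of x] by (simp add: \<phi>.add \<phi>.scaleR)
  moreover have "\<phi> (\<i> *\<^sub>C (c *\<^sub>C x)) = Re c * \<phi> (\<i> *\<^sub>C x) - Im c * \<phi> x"
   unfolding i c [of "\<i> *\<^sub>C x"] ii by (simp add: \<phi>.add \<phi>.diff \<phi>.scaleR \<phi>.neg)
  ultimately show ?thesis by (simp add: \<psi>_def complex_eq_iff)
 qed
 obtain K where K: "\<And>x. norm (\<phi> x) \<le> norm x * K" "K > 0" using \<phi>.pos_bounded by blast
 have bound: "cmod (\<psi> x) \<le> 2 * K * norm x" for x
 proof -
  have "cmod (\<psi> x) \<le> \<bar>\<phi> x\<bar> + \<bar>\<phi> (\<i> *\<^sub>C x)\<bar>" using cmod_le [of "\<psi> x"] by (simp add: \<psi>_def)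
  also have "\<dots> \<le> norm x * K + norm (\<i> *\<^sub>C x) * K" using K(1) [of x] K(1) [of "\<i> *\<^sub>C x"] by simp
  finally show ?thesis by (simp add: norm_scaleC mult_ac)
 qed
 have minus: "\<psi> (x - y) = \<psi> x - \<psi> y" for x y using add [of "x - y" y] by simp
 have "(\<lambda>z. \<psi> (f z)) holomorphic_on D" if f: "f \<in> {u, v}" for f
  unfolding holomorphic_on_open [OF D(1)]
 proof (intro ballI)
  fix z assume z: "z \<in> D"
  obtain l where l: "\<And>e. e > 0 ==> \<exists>d>0. \<forall>w. cmod w < d --> norm (f (z + w) - f z - w *\<^sub>C l) \<le> e * cmod w"
   using diff [OF f z] by blast
  have "((\<lambda>z. \<psi> (f z)) has_derivative (*) (\<psi> l)) (at z)"
   unfolding has_derivative_at_alt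
  proof (intro conjI allI impI)
   show "bounded_linear ((*) (\<psi> l))" by (rule bounded_linear_mult_right)
   fix e :: real assume e: "e > 0"
   then have "e / (2 * K) > 0" using K by simp
   then obtain d where d: "d > 0" "\<And>w. cmod w < d ==> norm (f (z + w) - f z - w *\<^sub>C l) \<le> e / (2 * K) * cmod w"
    using l by blast
   have "cmod (\<psi> (f y) - \<psi> (f z) - \<psi> l * (y - z)) \<le> e * cmod (y - z)" if "cmod (y - z) < d" for y
   proof -
    have "\<psi> (f y) - \<psi> (f z) - \<psi> l * (y - z) = \<psi> (f (z + (y - z)) - f z - (y - z) *\<^sub>C l)"
     by (simp add: minus scale mult.commute)
    then have "cmod (\<psi> (f y) - \<psi> (f z) - \<psi> l * (y - z)) \<le> 2 * K * norm (f (z + (y - z)) - f z - (y - z) *\<^sub>C l)"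
     using bound by metis
    also have "\<dots> \<le> 2 * K * (e / (2 * K) * cmod (y - z))"
     using d(2) [OF that] K by (intro mult_left_mono) auto
    also have "\<dots> = e * cmod (y - z)" using K by simp
    finally show ?thesis .
   qed
   then show "\<exists>d>0. \<forall>y. cmod (y - z) < d --> cmod (\<psi> (f y) - \<psi> (f z) - \<psi> l * (y - z)) \<le> e * cmod (y - z)"
    using d(1) by blast
  qed
  then show "\<exists>f'. ((\<lambda>z. \<psi> (f z)) has_field_derivative f') (at z)"
   by (auto simp: has_field_derivative_def)
 qed
 from this [of u] this [of v] have "(\<lambda>z. \<psi> (u z) - \<psi> (v z)) holomorphic_on D" by (intro holomorphic_intros) auto
 then have "\<psi> (u w) - \<psi> (v w) = 0"
  using analytic_continuation [of "\<lambda>z. \<psi> (u z) - \<psi> (v z)" D U \<xi> w] D U w by simp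
 then have "\<psi> (u w - v w) = 0" by (simp add: minus)
 then show False using \<phi>(2) by (simp add: \<psi>_def complex_eq_iff)
qed

lemma norm_inverse_le:
 assumes "psd (Im_part b - of_real \<epsilon>)" "\<epsilon> > 0" "b * c = 1" "c * (b :: 'c::cstar_algebra) = 1"
 shows "norm c \<le> 1 / \<epsilon>"
proof -
 have "psd (star c * (Im_part b - of_real \<epsilon>) * c)" by (rule psd_congruence [OF assms(1)])
 moreover have "star c * (Im_part b - of_real \<epsilon>) * c = - Im_part c - \<epsilon> *\<^sub>R (star c * c)"
  by (simp add: left_diff_distrib right_diff_distrib Im_part_inverse [OF assms(3,4)] of_real_def)
 ultimately have "norm (\<epsilon> *\<^sub>R (star c * c)) \<le> norm (- Im_part c)"
  using assms by (intro psd_norm_mono psd_scaleR psd_star_mult) auto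
 then have "\<epsilon> * (norm c)\<^sup>2 \<le> norm c" using norm_Im_part_le [of c] assms by (simp add: cstar_identity)
 then have "(\<epsilon> * norm c) * norm c \<le> 1 * norm c" by (simp add: power2_eq_square)
 then have "norm c = 0 \<or> \<epsilon> * norm c \<le> 1"
  using mult_right_le_imp_le [of "\<epsilon> * norm c" "norm c" 1] by fastforce
 then show ?thesis using assms(2) by (auto simp: field_simps)
qed

text \<open>
 The complex line \<open>b + \<i> z\<close> through \<open>b\<close> stays in the half plane for \<open>Re z > - \<epsilon>\<close>, and the inverses
 become small as \<open>Re z\<close> grows.
\<close>

lemma continuation_unique:
 assumes f: "continues_cauchy_series \<sigma> n f" and g: "continues_cauchy_series \<sigma> n g"
  and b: "b \<in> Mplus n"
 shows "f b = (g b :: 'b::cstar_algebra mat)"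
proof -
 obtain \<delta>1 where \<delta>1: "\<delta>1 > 0" "\<And>b i j. b \<in> Mplus n ==> mat_norm (mat_inv b) < \<delta>1 ==> i < n ==> j < n ==>
  (\<lambda>k. cauchy_term \<sigma> b k $$ (i, j)) sums (f b $$ (i, j))"
  using f unfolding continues_cauchy_series_def by blast
 obtain \<delta>2 where \<delta>2: "\<delta>2 > 0" "\<And>b i j. b \<in> Mplus n ==> mat_norm (mat_inv b) < \<delta>2 ==> i < n ==> j < n ==>
  (\<lambda>k. cauchy_term \<sigma> b k $$ (i, j)) sums (g b $$ (i, j))"
  using g unfolding continues_cauchy_series_def by blast
 define \<delta> where "\<delta> = min \<delta>1 \<delta>2"
 have \<delta>: "\<delta> > 0" using \<delta>1 \<delta>2 by (simp add: \<delta>_def)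
 have fg: "f a $$ (i, j) = g a $$ (i, j)" if "a \<in> Mplus n" "mat_norm (mat_inv a) < \<delta>" "i < n" "j < n" for a i j
  using \<delta>1(2) [of a i j] \<delta>2(2) [of a i j] that sums_unique2 by (auto simp: \<delta>_def)
 obtain \<epsilon> where e: "\<epsilon> > 0" "psd (Im_part (iform n b) - of_real \<epsilon>)" "b \<in> carrier_mat n n"
  using MplusD [OF b] .
 define B where "B z = iform n b + (\<i> * z) *\<^sub>C 1" for z
 define a where "a z = blev (B z) n" for z
 have a0: "a 0 = b" using e by (simp add: a_def B_def iform_def)
 have ImB: "Im_part (B z) = Im_part (iform n b) + of_real (Re z)" for z
 proof -
  have "(1 / (2 * \<i>)) * (\<i> * z - cnj (\<i> * z)) = complex_of_real (Re z)"
   by (simp add: complex_eq_iff)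
  then have "(1 / (2 * \<i>)) *\<^sub>C ((\<i> * z) *\<^sub>C 1 - cnj (\<i> * z) *\<^sub>C (1 :: 'b bfam)) = complex_of_real (Re z) *\<^sub>C 1"
   by (simp only: scaleC_diff_left [symmetric] scaleC_scaleC)
  then show ?thesis
   by (simp add: B_def Im_part_def star_add star_scaleC of_real_eq_scaleC [where 'c = "'b bfam"] scaleC_simps algebra_simps)
 qed
 have psdB: "psd (Im_part (B z) - of_real (\<epsilon> + Re z))" for z using e by (simp add: ImB)
 have aM: "a z \<in> Mplus n" if "Re z > - \<epsilon>" for z
  unfolding a_def using that by (intro MplusI [OF psdB]) simp
 have a_shift: "a (z + w) = a z + map_mat (scaleC (\<i> * w)) (1\<^sub>m n)" for z w
  by (simp add: a_def B_def distrib_left scaleC_add_left add.assoc [of "iform n b", symmetric] del: blev_simps(3))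
   simp
 have inv: "mat_norm (mat_inv (a z)) \<le> 1 / (\<epsilon> + Re z)" if z: "Re z > - \<epsilon>" for z
 proof -
  have p: "\<epsilon> + Re z > 0" using z by simp
  obtain c where c: "B z * c = 1" "c * B z = 1" using psd_Im_imp_invertible [OF psdB p] .
  have "blev (B z * c) n = 1\<^sub>m n" "blev (c * B z) n = 1\<^sub>m n" using c by simp_all
  then have "mat_inv (a z) = blev c n" by (intro mat_inv_eqI [of _ n]) (simp_all add: a_def)
  then show ?thesis using mat_norm_blev_le [of c n] norm_inverse_le [OF psdB p c] by simp
 qed
 define D where "D = {z. Re z > - \<epsilon>}"
 have D: "open D" "connected D"
  unfolding D_def by (rule open_halfspace_Re_gt) (rule convex_connected [OF convex_halfspace_Re_gt])
 define y where "y = 1 / \<delta>"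
 have y: "y > 0" using \<delta> by (simp add: y_def)
 have zero: "f (a z) $$ (i, j) = g (a z) $$ (i, j)" if z: "Re z > y" and ij: "i < n" "j < n" for z i j
 proof -
  have "1 / (\<epsilon> + Re z) < 1 / y" using z y e by (intro divide_strict_left_mono) auto
  also have "1 / y = \<delta>" by (simp add: y_def)
  finally show ?thesis using inv [of z] aM [of z] z y e ij fg [of "a z" i j] by simp
 qed
 have diff1: "\<exists>l. \<forall>e>0. \<exists>d>0. \<forall>w. cmod w < d --> norm (F (a (z + w)) $$ (i, j) - F (a z) $$ (i, j) - w *\<^sub>C l) \<le> e * cmod w"
  if F: "mat_analytic_on n (Mplus n) F" and z: "z \<in> D" and ij: "i < n" "j < n" for F :: "'b mat => 'b mat" and z i j
 proof -
  have az: "a z \<in> Mplus n" using z aM by (simp add: D_def)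
  then obtain L where L: "mat_clinear n L"
   "\<And>e. e > 0 ==> \<exists>d>0. \<forall>h \<in> carrier_mat n n. mat_norm h < d \<and> a z + h \<in> Mplus n -->
        mat_norm (F (a z + h) - F (a z) - L h) \<le> e * mat_norm h"
   using F unfolding mat_analytic_on_def by blast
  have Fc: "F x \<in> carrier_mat n n" if "x \<in> Mplus n" for x using F that unfolding mat_analytic_on_def by blast
  define l where "l = \<i> *\<^sub>C (L (1\<^sub>m n) $$ (i, j))"
  have Lc: "L (1\<^sub>m n) \<in> carrier_mat n n" using L(1) unfolding mat_clinear_def by simp
  have "\<exists>d>0. \<forall>w. cmod w < d --> norm (F (a (z + w)) $$ (i, j) - F (a z) $$ (i, j) - w *\<^sub>C l) \<le> e * cmod w"
   if "e > 0" for e :: real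
  proof -
   obtain d where d: "d > 0" "\<And>h. h \<in> carrier_mat n n ==> mat_norm h < d ==> a z + h \<in> Mplus n ==>
    mat_norm (F (a z + h) - F (a z) - L h) \<le> e * mat_norm h" using L(2) [OF \<open>e > 0\<close>] by blast
   obtain r where r: "r > 0" "ball z r \<subseteq> D" using D(1) z openE by blast
   have "norm (F (a (z + w)) $$ (i, j) - F (a z) $$ (i, j) - w *\<^sub>C l) \<le> e * cmod w" if w: "cmod w < min d r" for w
   proof -
    define h where "h = map_mat (scaleC (\<i> * w)) (1\<^sub>m n :: 'b mat)"
    have h: "h \<in> carrier_mat n n" by (simp add: h_def)
    have nh: "mat_norm h \<le> cmod w"
     using mult_left_mono [OF mat_norm_one_le [of n, where 'b = 'b], of "cmod w"]
     by (simp add: h_def mat_norm_scaleC norm_mult)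
    have "z + w \<in> ball z r" using w by (simp add: dist_norm)
    then have zw: "a (z + w) \<in> Mplus n" using r aM by (auto simp: D_def)
    have Lh: "L h = map_mat (scaleC (\<i> * w)) (L (1\<^sub>m n))" using L(1) unfolding mat_clinear_def h_def by simp
    have "F (a (z + w)) $$ (i, j) - F (a z) $$ (i, j) - w *\<^sub>C l = (F (a (z + w)) - F (a z) - L h) $$ (i, j)"
     using ij Fc [OF zw] Fc [OF az] Lc unfolding Lh
     by (simp add: l_def scaleC_scaleC mult.commute)
    also have "norm \<dots> \<le> mat_norm (F (a (z + w)) - F (a z) - L h)"
     using ij Lc unfolding Lh by (intro norm_index_le_mat_norm) auto
    also have "\<dots> \<le> e * mat_norm h"
     using d(2) [OF h] nh w zw unfolding a_shift h_def by simp
    also have "\<dots> \<le> e * cmod w" using nh \<open>e > 0\<close> by simp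
    finally show ?thesis .
   qed
   then show ?thesis using d(1) r(1) by (intro exI [of _ "min d r"]) auto
  qed
  then show ?thesis by blast
 qed
 have "f (a 0) $$ (i, j) = g (a 0) $$ (i, j)" if ij: "i < n" "j < n" for i j
 proof (rule complex_identity_theorem [where D = D and U = "{z. Re z > y}" and \<xi> = "complex_of_real (y + 1)"
    and u = "\<lambda>z. f (a z) $$ (i, j)" and v = "\<lambda>z. g (a z) $$ (i, j)"])
  show "complex_of_real (y + 1) islimpt {z. Re z > y}"
   by (rule interior_limit_point) (simp add: interior_open open_halfspace_Re_gt)
  show "\<exists>l. \<forall>e>0. \<exists>d>0. \<forall>w. cmod w < d --> norm (u (z + w) - u z - w *\<^sub>C l) \<le> e * cmod w"
   if "u \<in> {\<lambda>z. f (a z) $$ (i, j), \<lambda>z. g (a z) $$ (i, j)}" "z \<in> D" for u z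
   using that diff1 [OF _ that(2) ij, of f] diff1 [OF _ that(2) ij, of g] f g
   unfolding continues_cauchy_series_def by blast
 qed (use D y e zero ij in \<open>auto simp: D_def\<close>)
 moreover have "f b \<in> carrier_mat n n" "g b \<in> carrier_mat n n"
  using f g b unfolding continues_cauchy_series_def mat_analytic_on_def by blast+
 ultimately show ?thesis by (intro eq_matI) (auto simp: a0)
qed

lemma cauchy_transform_eqI:
 assumes f: "continues_cauchy_series \<sigma> n f" and b: "b \<in> Mplus n"
 shows "cauchy_transform \<sigma> b = (f b :: 'b::cstar_algebra mat)"
proof -
 have d: "dim_row b = n" using b by (auto simp: Mplus_def)
 show ?thesis
  unfolding cauchy_transform_def d
 proof (rule the_equality)
  show "\<exists>g. continues_cauchy_series \<sigma> n g \<and> f b = g b" using f by blast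
  show "w = f b" if "\<exists>g. continues_cauchy_series \<sigma> n g \<and> w = g b" for w
   using continuation_unique [OF _ f b] that by metis
 qed
qed

section \<open>Intertwining for noncommutative functions\<close>

lemma four_block_mat_eq_iff:
 assumes "A \<in> carrier_mat n n" "B \<in> carrier_mat n m" "C \<in> carrier_mat m n" "D \<in> carrier_mat m m"
  "A' \<in> carrier_mat n n" "B' \<in> carrier_mat n m" "C' \<in> carrier_mat m n" "D' \<in> carrier_mat m m"
 shows "four_block_mat A B C D = four_block_mat A' B' C' D' \<longleftrightarrow> A = A' \<and> B = B' \<and> C = C' \<and> D = D'"
proof
 assume e: "four_block_mat A B C D = four_block_mat A' B' C' D'"
 have *: "four_block_mat A B C D $$ (i, j) = four_block_mat A' B' C' D' $$ (i, j)" for i j using e by simp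
 have "A $$ (i, j) = A' $$ (i, j)" if "i < n" "j < n" for i j using * [of i j] assms that by simp
 moreover have "B $$ (i, j) = B' $$ (i, j)" if "i < n" "j < m" for i j using * [of i "j + n"] assms that by simp
 moreover have "C $$ (i, j) = C' $$ (i, j)" if "i < m" "j < n" for i j using * [of "i + n" j] assms that by simp
 moreover have "D $$ (i, j) = D' $$ (i, j)" if "i < m" "j < m" for i j using * [of "i + n" "j + n"] assms that by simp
 ultimately show "A = A' \<and> B = B' \<and> C = C' \<and> D = D'" using assms by (auto intro!: eq_matI)
qed simp

text \<open>
 An intertwiner \<open>S\<close> of \<open>x\<close> and \<open>y\<close> is the same as a unipotent matrix \<open>[[1, S], [0, 1]]\<close> commuting
 with \<open>x \<oplus> y\<close>.
\<close>

lemma nc_function_itw: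
 fixes f :: "'b::cstar_algebra mat => 'b mat"
 assumes nc: "nc_function \<Omega> f" and x: "x \<in> \<Omega>" "x \<in> carrier_mat n n" and y: "y \<in> \<Omega>" "y \<in> carrier_mat m m"
  and n: "n \<ge> 1" "m \<ge> 1" and itw: "itw n m x S y"
 shows "itw n m (f x) S (f y)"
proof -
 let ?N = "n + m"
 define T where "T = mat n m (\<lambda>(i, j). S i j)"
 define A where "A c = four_block_mat (1\<^sub>m n) (c \<cdot>\<^sub>m T) (0\<^sub>m m n) (1\<^sub>m m)" for c :: complex
 define B where "B c = (scalar_mat (A c) :: 'b mat)" for c
 define z where "z = dsum x y"
 have T: "T \<in> carrier_mat n m" and A: "A c \<in> carrier_mat ?N ?N" for c by (simp_all add: T_def A_def)
 have B: "B c \<in> carrier_mat ?N ?N" for c using A by (simp add: B_def scalar_mat_def)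
 have z: "z \<in> \<Omega>" "z \<in> carrier_mat ?N ?N" using nc x y by (auto simp: z_def nc_function_def)
 have fx: "f x \<in> carrier_mat n n" "f y \<in> carrier_mat m m" "f z \<in> carrier_mat ?N ?N"
  using nc x y z n unfolding nc_function_def by (force, force, force)
 have fz: "f z = dsum (f x) (f y)" using nc x y by (auto simp: z_def nc_function_def)
 have A0: "A 0 = 1\<^sub>m ?N" by (rule eq_matI) (auto simp: A_def T_def)
 have "A c * A (- c) = A 0" for c
 proof -
  have "- c \<cdot>\<^sub>m T + c \<cdot>\<^sub>m T = 0 \<cdot>\<^sub>m T" using T by (intro eq_matI) auto
  then show ?thesis
   unfolding A_def using T by (subst mult_four_block_mat [of _ n n _ m _ m _ _ n _ m]) auto
 qed
 from this [of 1] this [of "- 1"] have AA: "A 1 * A (- 1) = 1\<^sub>m ?N" "A (- 1) * A 1 = 1\<^sub>m ?N" by (simp_all add: A0)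
 have "scalar_mat (1\<^sub>m ?N) = (1\<^sub>m ?N :: 'b mat)" by (rule eq_matI) (auto simp: scalar_mat_def scaleC_one)
 then have BB: "B 1 * B (- 1) = 1\<^sub>m ?N" "B (- 1) * B 1 = 1\<^sub>m ?N"
  by (simp_all add: B_def AA flip: scalar_mat_mult [OF A A])
 have comm: "dsum u v * B 1 = B 1 * dsum u v \<longleftrightarrow> itw n m u S v"
  if u: "u \<in> carrier_mat n n" and v: "v \<in> carrier_mat m m" for u v
 proof -
  let ?T = "scalar_mat T :: 'b mat"
  have T': "?T \<in> carrier_mat n m" using T by (simp add: scalar_mat_def)
  have B1: "B 1 = four_block_mat (1\<^sub>m n) ?T (0\<^sub>m m n) (1\<^sub>m m)"
   using T unfolding B_def A_def scalar_mat_def by (intro eq_matI) (auto simp: scaleC_one)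
  have d: "dsum u v = four_block_mat u (0\<^sub>m n m) (0\<^sub>m m n) v" using u v by (simp add: dsum_def)
  have "dsum u v * B 1 = four_block_mat u (u * ?T) (0\<^sub>m m n) v" "B 1 * dsum u v = four_block_mat u (?T * v) (0\<^sub>m m n) v"
   unfolding d B1 using u v T' by (subst mult_four_block_mat [of _ n n _ m _ m _ _ n _ m]; simp)+
  then have "dsum u v * B 1 = B 1 * dsum u v \<longleftrightarrow> u * ?T = ?T * v"
   using u v T' by (simp add: four_block_mat_eq_iff [of _ n _ m])
  also have "\<dots> \<longleftrightarrow> itw n m u (\<lambda>i j. T $$ (i, j)) v" by (rule itw_scalar_mat [OF u v T, symmetric])
  also have "\<dots> \<longleftrightarrow> itw n m u S v" by (simp add: itw_def T_def)
  finally show ?thesis .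
 qed
 have cancel: "B 1 * w * B (- 1) = w \<longleftrightarrow> w * B 1 = B 1 * w" if w: "w \<in> carrier_mat ?N ?N" for w
 proof
  assume e: "B 1 * w * B (- 1) = w"
  have "w * B 1 = (B 1 * w * B (- 1)) * B 1" by (simp only: e)
  also have "\<dots> = (B 1 * w) * (B (- 1) * B 1)" using w B mult_carrier_mat [OF B w] by (intro assoc_mult_mat [of _ ?N ?N _ ?N _ ?N]) auto
  finally show "w * B 1 = B 1 * w" using w B [of 1] BB by simp
 next
  assume "w * B 1 = B 1 * w"
  then have "B 1 * w * B (- 1) = w * B 1 * B (- 1)" by simp
  also have "\<dots> = w * (B 1 * B (- 1))" using w B by (intro assoc_mult_mat [of _ ?N ?N _ ?N _ ?N]) auto
  finally show "B 1 * w * B (- 1) = w" using w BB by simp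
 qed
 have "B 1 * z * B (- 1) = z" using comm [OF x(2) y(2)] itw z cancel unfolding z_def by simp
 moreover have "inverts_mat (A 1) (A (- 1)) \<and> inverts_mat (A (- 1)) (A 1)"
  using A [of 1] A [of "- 1"] by (simp add: inverts_mat_def AA)
 moreover have "\<And>S T. S \<in> carrier_mat ?N ?N ==> T \<in> carrier_mat ?N ?N ==> inverts_mat S T \<and> inverts_mat T S \<and> scalar_mat S * z * scalar_mat T \<in> \<Omega> ==>
    f (scalar_mat S * z * scalar_mat T) = scalar_mat S * f z * scalar_mat T"
  using nc z n unfolding nc_function_def by (meson IntI trans_le_add1)
 ultimately have "B 1 * f z * B (- 1) = f z" using A z unfolding B_def by metis
 then have "f z * B 1 = B 1 * f z" using cancel fx by blast
 then show ?thesis using comm [OF fx(1,2)] by (simp add: fz)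
qed

section \<open>Coefficients of a germ at zero\<close>

text \<open>
 A matrix is read as a directed graph with weighted edges. The coefficient of a germ \<open>F\<close> at a word is
 the entry of \<open>F\<close> between the ends of a chain whose edges have the letters of the word as weights.
\<close>

definition chain :: "'b::zero list => 'b mat" where
 "chain bs = mat (Suc (length bs)) (Suc (length bs)) (\<lambda>(p, q). if q = Suc p then bs ! p else 0)"

lemma chain_carrier [simp]: "chain bs \<in> carrier_mat (Suc (length bs)) (Suc (length bs))"
 by (simp add: chain_def)

lemma chain_carrier': "length bs = k ==> chain bs \<in> carrier_mat (Suc k) (Suc k)"
 by auto

lemma mat_norm_chain:
 assumes "\<And>b. b \<in> set bs ==> norm b < r" "r > 0"
 shows "mat_norm (chain (bs :: 'b::cstar_algebra list)) < r"
proof -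
 define c where "c = Max (insert 0 (norm ` set bs))"
 have c: "c < r" "c \<ge> 0" "\<And>b. b \<in> set bs ==> norm b \<le> c"
  using assms by (auto simp: c_def)
 have "mat_norm (chain bs) \<le> c"
  by (rule mat_norm_partial_perm [OF chain_carrier]) (use c in \<open>auto simp: chain_def split: if_splits\<close>)
 then show ?thesis using c by simp
qed

locale nc_germ =
 fixes F :: "'b::cstar_algebra mat => 'b mat" and r K :: real
 assumes r: "r > 0" and nc: "nc_function (ncball r) F"
  and bounded: "\<And>b. b \<in> ncball r ==> mat_norm (F b) \<le> K"
begin

lemma ball: "b \<in> carrier_mat n n ==> n \<ge> 1 ==> mat_norm b < r ==> b \<in> ncball r"
 by (auto simp: ncball_def)

lemma F_carrier: "b \<in> carrier_mat n n ==> n \<ge> 1 ==> mat_norm b < r ==> F b \<in> carrier_mat n n"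
proof -
 assume b: "b \<in> carrier_mat n n" "n \<ge> 1" "mat_norm b < r"
 have "\<forall>n\<ge>1. \<forall>x \<in> ncball r \<inter> carrier_mat n n. F x \<in> carrier_mat n n"
  using nc unfolding nc_function_def by (elim conjE)
 then show "F b \<in> carrier_mat n n" using b ball [OF b] by simp
qed

lemma F_itw:
 assumes "x \<in> carrier_mat n n" "y \<in> carrier_mat m m" "n \<ge> 1" "m \<ge> 1" "mat_norm x < r" "mat_norm y < r"
  and "itw n m x S y"
 shows "itw n m (F x) S (F y)"
 by (rule nc_function_itw [OF nc ball [OF assms(1,3,5)] assms(1) ball [OF assms(2,4,6)] assms(2-4,7)])

lemma norm_F_entry:
 assumes "b \<in> carrier_mat n n" "mat_norm b < r" "i < n" "j < n"
 shows "norm (F b $$ (i, j)) \<le> K"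
proof -
 have n: "n \<ge> 1" using assms by simp
 show ?thesis
  using norm_index_le_mat_norm [of i "F b" j] F_carrier [OF assms(1) n assms(2)] bounded [OF ball [OF assms(1) n assms(2)]] assms
  by simp
qed

lemma K_nonneg: "K \<ge> 0"
proof -
 have "norm (F (0\<^sub>m 1 1) $$ (0, 0)) \<le> K" using r by (intro norm_F_entry [of _ 1]) auto
 then show ?thesis using norm_ge_zero order_trans by blast
qed

definition corner :: "'b list => 'b" where
 "corner bs = F (chain bs) $$ (0, length bs)"

lemma norm_corner: "(\<And>b. b \<in> set bs ==> norm b < r) ==> norm (corner bs) \<le> K"
 unfolding corner_def by (intro norm_F_entry [of _ "Suc (length bs)"] mat_norm_chain r) auto

lemma corner_diag:
 assumes l: "length bs = L" "length bs' = L"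
  and sm: "\<And>b. b \<in> set bs ==> norm b < r" "\<And>b. b \<in> set bs' ==> norm b < r"
  and s: "\<And>p. p < L ==> s (Suc p) *\<^sub>C bs ! p = s p *\<^sub>C bs' ! p"
 shows "s L *\<^sub>C corner bs = s 0 *\<^sub>C corner bs'"
proof -
 have "itw (Suc L) (Suc L) (chain bs) (\<lambda>p q. if p = q then s p else 0) (chain bs')"
  unfolding itw_diag_iff using l s by (auto simp: chain_def)
 then have "itw (Suc L) (Suc L) (F (chain bs)) (\<lambda>p q. if p = q then s p else 0) (F (chain bs'))"
  using l sm r by (intro F_itw mat_norm_chain chain_carrier') auto
 then show ?thesis unfolding itw_diag_iff corner_def using l by auto
qed

definition small_scale :: "'b list => real" where
 "small_scale bs = r / (2 * (1 + sum_list (map norm bs)))"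

text \<open>
 Conjugation with scalar diagonal matrices shows that the corner is homogeneous in every letter, which
 determines it also for letters that are not small.
\<close>

definition coef :: "'b list => 'b" where
 "coef bs = (let \<mu> = complex_of_real (small_scale bs) in (1 / \<mu> ^ length bs) *\<^sub>C corner (map (scaleC \<mu>) bs))"

lemma small_scale:
 "small_scale bs > 0" "0 \<le> t ==> t \<le> small_scale bs ==> b \<in> set bs ==> norm (complex_of_real t *\<^sub>C b) < r"
proof -
 have s: "sum_list (map norm bs) \<ge> 0" by (intro sum_list_nonneg) auto
 then show "small_scale bs > 0" using r by (simp add: small_scale_def)
 assume t: "0 \<le> t" "t \<le> small_scale bs" and b: "b \<in> set bs"
 have "norm b \<le> sum_list (map norm bs)" using b by (intro member_le_sum_list) auto
 then have "norm (complex_of_real t *\<^sub>C b) \<le> small_scale bs * (1 + sum_list (map norm bs))"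
  using t s unfolding norm_scaleC by (intro mult_mono) auto
 also have "\<dots> = r / 2" using s by (simp add: small_scale_def field_simps add_nonneg_eq_0_iff)
 finally show "norm (complex_of_real t *\<^sub>C b) < r" using r by simp
qed

lemma corner_scale:
 assumes "z \<noteq> 0" "\<And>b. b \<in> set bs ==> norm (z *\<^sub>C b) < r"
 shows "corner (map (scaleC z) bs) = z ^ length bs *\<^sub>C coef bs"
proof -
 define \<mu> where "\<mu> = complex_of_real (small_scale bs)"
 define s where "s p = (\<mu> / z) ^ p" for p
 have \<mu>: "\<mu> \<noteq> 0" using small_scale(1) [of bs] by (simp add: \<mu>_def)
 have "s (length bs) *\<^sub>C corner (map (scaleC z) bs) = s 0 *\<^sub>C corner (map (scaleC \<mu>) bs)"
 proof (rule corner_diag)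
  show "norm b < r" if "b \<in> set (map (scaleC z) bs)" for b using that assms by auto
  show "norm b < r" if "b \<in> set (map (scaleC \<mu>) bs)" for b
   using that small_scale(1) [of bs] small_scale(2) [of "small_scale bs" bs] by (auto simp: \<mu>_def)
  show "s (Suc p) *\<^sub>C map (scaleC z) bs ! p = s p *\<^sub>C map (scaleC \<mu>) bs ! p" if "p < length bs" for p
   using that assms by (simp add: s_def scaleC_scaleC mult.commute)
 qed auto
 then have "corner (map (scaleC \<mu>) bs) = (\<mu> / z) ^ length bs *\<^sub>C corner (map (scaleC z) bs)"
  by (simp add: s_def scaleC_one)
 then show ?thesis
  using \<mu> assms by (simp add: coef_def Let_def scaleC_scaleC scaleC_one power_divide flip: \<mu>_def)
qed

lemma coef_eq_corner: "(\<And>b. b \<in> set bs ==> norm b < r) ==> coef bs = corner bs"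
 using corner_scale [of 1 bs] by (simp add: scaleC_one [abs_def] id_def)

text \<open>
 Nodes outside a predecessor-closed set \<open>P\<close> do not contribute to the entries of \<open>F\<close> over \<open>P\<close>, and
 when the nodes of a path have no other successors in \<open>P\<close>, only the path contributes.
\<close>

lemma path_entry:
 assumes Z: "Z \<in> carrier_mat n n" "mat_norm Z < r"
  and g: "inj_on g {..length bs}" "\<And>t. t \<le> length bs ==> g t < n" "\<And>t. t \<le> length bs ==> g t \<in> P"
  and pre: "\<And>p q. p < n ==> q < n ==> q \<in> P ==> Z $$ (p, q) \<noteq> 0 ==> p \<in> P"
  and succ: "\<And>t q. t \<le> length bs ==> q < n ==> q \<in> P ==>
   Z $$ (g t, q) = (if t < length bs \<and> q = g (Suc t) then bs ! t else 0)"
 shows "F Z $$ (g 0, g (length bs)) = coef bs"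
proof -
 let ?L = "length bs"
 have n: "n \<ge> 1" using g(2) [of 0] by simp
 define Y where "Y = mat n n (\<lambda>(p, q). if p \<in> P \<and> q \<in> P then Z $$ (p, q) else 0)"
 have Y: "Y \<in> carrier_mat n n" by (simp add: Y_def)
 define E where "E = mat n n (\<lambda>(p, q). if p = q \<and> p \<in> P then 1 else 0 :: 'b)"
 have E: "E \<in> carrier_mat n n" by (simp add: E_def)
 have E1: "mat_norm E \<le> 1"
  by (rule mat_norm_partial_perm [OF E]) (auto simp: E_def split: if_splits)
 have "Y = E * Z * E"
 proof (rule eq_matI)
  fix p q assume "p < dim_row (E * Z * E)" "q < dim_col (E * Z * E)"
  then have pq: "p < n" "q < n" using E by auto
  have PZ: "(E * Z) $$ (p, l) = (if p \<in> P then Z $$ (p, l) else 0)" if l: "l < n" for l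
  proof -
   have "(E * Z) $$ (p, l) = (\<Sum>k<n. E $$ (p, k) * Z $$ (k, l))"
    using E Z pq l by (simp add: index_mult_mat' del: index_mult_mat(1))
   also have "\<dots> = (\<Sum>k<n. if k = p then if p \<in> P then Z $$ (p, l) else 0 else 0)"
    using pq by (intro sum.cong) (auto simp: E_def)
   finally show ?thesis using pq by simp
  qed
  have "(E * Z * E) $$ (p, q) = (\<Sum>k<n. (E * Z) $$ (p, k) * E $$ (k, q))"
   using index_mult_mat' [of p "E * Z" q E] pq E Z by (simp del: index_mult_mat(1))
  also have "\<dots> = (\<Sum>k<n. if k = q then Y $$ (p, q) else 0)"
  proof (rule sum.cong [OF refl])
   fix k assume k: "k \<in> {..<n}"
   then have "E $$ (k, q) = (if k = q \<and> q \<in> P then 1 else 0)" using pq by (auto simp: E_def)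
   then show "(E * Z) $$ (p, k) * E $$ (k, q) = (if k = q then Y $$ (p, q) else 0)"
    using k pq PZ [of k] by (auto simp: Y_def simp del: index_mult_mat(1))
  qed
  finally show "Y $$ (p, q) = (E * Z * E) $$ (p, q)" using pq by simp
 qed (use E Y in auto)
 also have "mat_norm \<dots> \<le> mat_norm (E * Z) * mat_norm E"
  by (rule mat_norm_mult [OF mult_carrier_mat [OF E Z(1)] E])
 also have "\<dots> \<le> (mat_norm E * mat_norm Z) * 1"
  using E1 mat_norm_mult [OF E Z(1)] by (intro mult_mono) auto
 also have "\<dots> \<le> 1 * mat_norm Z" using mult_right_mono [OF E1, of "mat_norm Z"] by simp
 finally have Ysm: "mat_norm Y < r" using Z by simp
 have small: "norm b < r" if b: "b \<in> set bs" for b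
 proof -
  obtain t where t: "t < ?L" "b = bs ! t" using b by (metis in_set_conv_nth)
  have "norm (Z $$ (g t, g (Suc t))) \<le> mat_norm Z"
   using Z t g(2) by (intro norm_index_le_mat_norm) auto
  then show ?thesis using succ [of t "g (Suc t)"] t g Z by simp
 qed
 have "itw n n Z (\<lambda>p q. if p = q then if p \<in> P then 1 else 0 else 0) Y"
  unfolding itw_diag_iff
 proof (intro allI impI)
  fix p q assume pq: "p < n" "q < n"
  have "q \<in> P --> p \<in> P \<or> Z $$ (p, q) = 0" using pre [OF pq] by blast
  then show "(if q \<in> P then 1 else 0) *\<^sub>C Z $$ (p, q) = (if p \<in> P then 1 else 0) *\<^sub>C Y $$ (p, q)"
   using pq by (auto simp: Y_def)
 qed
 then have "itw n n (F Z) (\<lambda>p q. if p = q then if p \<in> P then 1 else 0 else 0) (F Y)"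
  using Z Y n Ysm by (intro F_itw) auto
 then have "\<And>p q. p < n ==> q < n ==> (if q \<in> P then 1 else 0) *\<^sub>C F Z $$ (p, q) = (if p \<in> P then 1 else 0) *\<^sub>C F Y $$ (p, q)"
  unfolding itw_diag_iff by blast
 from this [OF g(2) g(2), of 0 ?L] have "F Z $$ (g 0, g ?L) = F Y $$ (g 0, g ?L)"
  using g(3) [of 0] g(3) [of ?L] by (simp add: scaleC_one)
 also have "\<dots> = corner bs"
 proof -
  let ?T = "\<lambda>t p. if g t = p then 1 else 0 :: complex"
  have g': "\<forall>p<Suc ?L. g p < n" using g(2) by simp
  have "itw (Suc ?L) n (chain bs) ?T Y"
   unfolding itw_fold_iff [OF g']
  proof (intro allI impI)
   fix t q assume tq: "t < Suc ?L" "q < n"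
   have "(\<Sum>l\<in>{l. l < Suc ?L \<and> g l = q}. chain bs $$ (t, l))
    = (\<Sum>l\<in>{l. l < Suc ?L \<and> g l = q}. if l = Suc t then bs ! t else 0)"
    using tq by (intro sum.cong) (auto simp: chain_def)
   also have "\<dots> = (if t < ?L \<and> q = g (Suc t) then bs ! t else 0)" by auto
   also have "\<dots> = Y $$ (g t, q)" using tq succ [of t q] g(2,3) [of t] g(3) [of "Suc t"] by (auto simp: Y_def)
   finally show "(\<Sum>l\<in>{l. l < Suc ?L \<and> g l = q}. chain bs $$ (t, l)) = Y $$ (g t, q)" .
  qed
  then have i: "itw (Suc ?L) n (F (chain bs)) ?T (F Y)"
   using small r Y Ysm n by (intro F_itw mat_norm_chain) auto
  have "{l. l < Suc ?L \<and> g l = g ?L} = {?L}" using g(1) by (auto dest: inj_onD)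
  moreover have "(\<Sum>l\<in>{l. l < Suc ?L \<and> g l = g ?L}. F (chain bs) $$ (0, l)) = F Y $$ (g 0, g ?L)"
   using i g(2) [of ?L] unfolding itw_fold_iff [OF g']
   by blast
  ultimately show ?thesis by (simp add: corner_def)
 qed
 also have "corner bs = coef bs" using coef_eq_corner small by simp
 finally show ?thesis .
qed

lemma small_scale_exists:
 assumes "finite (A :: 'b set)" "c > 0"
 obtains t where "t > 0" "\<And>b. b \<in> A ==> norm (complex_of_real t *\<^sub>C b) < c"
proof -
 define m where "m = 1 + (\<Sum>b\<in>A. norm b)"
 have m0: "m > 0" by (simp add: m_def add_pos_nonneg sum_nonneg)
 have m: "norm b < m" if "b \<in> A" for b
  using member_le_sum [OF that, of norm] assms by (simp add: m_def)
 show ?thesis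
 proof (rule that [of "c / m"])
  show "c / m > 0" using assms m0 by simp
  fix b assume "b \<in> A"
  then have "c * norm b < c * m" using m assms by (intro mult_strict_left_mono) auto
  then show "norm (complex_of_real (c / m) *\<^sub>C b) < c"
   using m0 assms by (simp add: norm_scaleC norm_divide divide_less_eq)
 qed
qed

lemma coef_homogeneous: "coef (xs @ (c *\<^sub>C x) # ys) = c *\<^sub>C coef (xs @ x # ys)"
proof -
 let ?A = "insert (c *\<^sub>C x) (insert x (set xs \<union> set ys))"
 obtain t where t: "t > 0" "\<And>b. b \<in> ?A ==> norm (complex_of_real t *\<^sub>C b) < r"
  using small_scale_exists [of ?A r] r by auto
 let ?z = "complex_of_real t"
 let ?L = "length xs + 1 + length ys"
 have c1: "corner (map (scaleC ?z) (xs @ (c *\<^sub>C x) # ys)) = ?z ^ ?L *\<^sub>C coef (xs @ (c *\<^sub>C x) # ys)"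
  using t by (subst corner_scale) auto
 have c2: "corner (map (scaleC ?z) (xs @ x # ys)) = ?z ^ ?L *\<^sub>C coef (xs @ x # ys)"
  using t by (subst corner_scale) auto
 define s where "s p = (if p \<le> length xs then c else 1)" for p
 have cx: "norm ((c * ?z) *\<^sub>C x) < r" using t(2) [of "c *\<^sub>C x"] by (simp add: scaleC_scaleC mult.commute)
 have "s ?L *\<^sub>C corner (map (scaleC ?z) (xs @ (c *\<^sub>C x) # ys)) = s 0 *\<^sub>C corner (map (scaleC ?z) (xs @ x # ys))"
  by (rule corner_diag) (use t cx in \<open>auto simp: s_def nth_append scaleC_scaleC scaleC_one nth_Cons' mult.commute\<close>)
 then have "?z ^ ?L *\<^sub>C coef (xs @ (c *\<^sub>C x) # ys) = ?z ^ ?L *\<^sub>C (c *\<^sub>C coef (xs @ x # ys))"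
  unfolding c1 c2 by (simp add: s_def scaleC_one scaleC_scaleC mult.commute)
 then have "(1 / ?z ^ ?L) *\<^sub>C ?z ^ ?L *\<^sub>C coef (xs @ (c *\<^sub>C x) # ys) = (1 / ?z ^ ?L) *\<^sub>C ?z ^ ?L *\<^sub>C (c *\<^sub>C coef (xs @ x # ys))"
  by simp
 then show ?thesis using t by (simp add: scaleC_scaleC scaleC_one)
qed

lemma coef_map_scale: "coef (xs @ map (\<lambda>b. c b *\<^sub>C b) ys) = (\<Prod>b\<leftarrow>ys. c b) *\<^sub>C coef (xs @ ys)"
proof (induction ys arbitrary: xs)
 case (Cons y ys)
 show ?case using Cons [of "xs @ [c y *\<^sub>C y]"] by (simp add: coef_homogeneous scaleC_scaleC mult.commute)
qed (simp add: scaleC_one)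

text \<open>Every letter is rescaled to the norm \<open>r / 2\<close>.\<close>

lemma norm_coef_le: "norm (coef bs) \<le> K * (2 / r) ^ length bs * (\<Prod>b\<leftarrow>bs. norm b)"
proof (cases "0 \<in> set bs")
 case True
 then obtain xs ys where "bs = xs @ 0 # ys" by (auto simp: in_set_conv_decomp)
 then have "coef bs = 0" using coef_homogeneous [of xs 0 0 ys] by simp
 moreover have "(\<Prod>b\<leftarrow>bs. norm b) = 0" using True by (force simp: prod_list_zero_iff)
 ultimately show ?thesis by simp
next
 case False
 define c where "c b = complex_of_real (r / (2 * norm b))" for b :: 'b
 have c: "norm (c b *\<^sub>C b) < r" if "b \<in> set bs" for b
  using that False r by (auto simp: c_def norm_scaleC norm_divide norm_mult)
 have "(\<Prod>b\<leftarrow>ys. c b) * complex_of_real ((2 / r) ^ length ys * (\<Prod>b\<leftarrow>ys. norm b)) = 1" if "0 \<notin> set ys" for ys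
  using that
 proof (induction ys)
  case (Cons y ys)
  have "(\<Prod>b\<leftarrow>y # ys. c b) * complex_of_real ((2 / r) ^ length (y # ys) * (\<Prod>b\<leftarrow>y # ys. norm b))
   = (c y * complex_of_real (2 / r * norm y)) * ((\<Prod>b\<leftarrow>ys. c b) * complex_of_real ((2 / r) ^ length ys * (\<Prod>b\<leftarrow>ys. norm b)))"
   by (simp add: mult_ac)
  also have "c y * complex_of_real (2 / r * norm y) = 1"
   using Cons r by (simp add: c_def field_simps flip: of_real_mult of_real_divide)
  finally show ?case using Cons by simp
 qed simp
 then have p: "complex_of_real ((2 / r) ^ length bs * (\<Prod>b\<leftarrow>bs. norm b)) * (\<Prod>b\<leftarrow>bs. c b) = 1"
  using False by (simp add: mult.commute)
 have "coef bs = complex_of_real ((2 / r) ^ length bs * (\<Prod>b\<leftarrow>bs. norm b)) *\<^sub>C coef (map (\<lambda>b. c b *\<^sub>C b) bs)"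
  using coef_map_scale [of "[]" c bs] by (simp only: append_Nil scaleC_scaleC p scaleC_one)
 also have "coef (map (\<lambda>b. c b *\<^sub>C b) bs) = corner (map (\<lambda>b. c b *\<^sub>C b) bs)"
  using c by (intro coef_eq_corner) auto
 also have "norm (complex_of_real ((2 / r) ^ length bs * (\<Prod>b\<leftarrow>bs. norm b)) *\<^sub>C \<dots>)
  \<le> ((2 / r) ^ length bs * (\<Prod>b\<leftarrow>bs. norm b)) * K"
  unfolding norm_scaleC norm_of_real
 proof (intro mult_mono norm_corner)
  have "(\<Prod>b\<leftarrow>bs. norm b) \<ge> 0" by (induction bs) auto
  then show "\<bar>(2 / r) ^ length bs * (\<Prod>b\<leftarrow>bs. norm b)\<bar> \<le> (2 / r) ^ length bs * (\<Prod>b\<leftarrow>bs. norm b)"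
   "0 \<le> (2 / r) ^ length bs * (\<Prod>b\<leftarrow>bs. norm b)" using r by simp_all
 qed (use c in auto)
 finally show ?thesis by (simp add: mult_ac)
qed

text \<open>The nodes after the modified slot are duplicated, and the two copies are entered with \<open>x\<close> and \<open>y\<close>.\<close>

lemma coef_add: "coef (xs @ (x + y) # ys) = coef (xs @ x # ys) + coef (xs @ y # ys)"
proof -
 define i where "i = length xs"
 define d where "d = Suc (length ys)"
 define L where "L = i + d"
 define n where "n = Suc (L + d)"
 let ?A = "insert x (insert y (insert (x + y) (set xs \<union> set ys)))"
 have nn: "n * n > 0" by (simp add: n_def)
 then have "r / real (n * n) > 0" using r by (simp del: of_nat_mult)
 then obtain t where t: "t > 0" "\<And>b. b \<in> ?A ==> norm (complex_of_real t *\<^sub>C b) < r / real (n * n)"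
  using small_scale_exists [of ?A "r / real (n * n)"] by auto
 define z where "z = complex_of_real t"
 have "1 \<le> real (n * n)" using nn by linarith
 then have "r / real (n * n) \<le> r / 1" using r by (intro divide_left_mono) auto
 then have t': "norm (z *\<^sub>C b) < r" if "b \<in> ?A" for b using t(2) [OF that] by (simp add: z_def)
 have z0: "z \<noteq> 0" using t by (simp add: z_def)
 define us where "us = map (scaleC z) (xs @ x # ys)"
 define vs where "vs = map (scaleC z) (xs @ y # ys)"
 define ws where "ws = map (scaleC z) (xs @ (x + y) # ys)"
 have l: "length us = L" "length vs = L" "length ws = L" by (simp_all add: us_def vs_def ws_def L_def i_def d_def)
 define Z where "Z = mat n n (\<lambda>(p, q). if p < L \<and> q = Suc p then us ! p
  else if p = i \<and> q = Suc L then vs ! i else if L < p \<and> q = Suc p then vs ! (p - d) else 0)"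
 have Z: "Z \<in> carrier_mat n n" by (simp add: Z_def)
 have inA: "us ! p \<in> scaleC z ` ?A" "vs ! p \<in> scaleC z ` ?A" if "p < L" for p
  using nth_mem [of p us] nth_mem [of p vs] that l by (auto simp: us_def vs_def)
 have "norm (Z $$ (p, q)) < r / real (n * n)" if "p < n" "q < n" for p q
 proof (cases "Z $$ (p, q) = 0")
  case True
  then show ?thesis using \<open>r / real (n * n) > 0\<close> by simp
 next
  case False
  have dL: "d \<le> L" "i < L" by (simp_all add: L_def d_def)
  have "Z $$ (p, q) \<in> scaleC z ` ?A"
   using that False dL inA [of p] inA [of i] inA [of "p - d"]
   by (auto simp: Z_def n_def split: if_splits)
  then show ?thesis using t(2) by (auto simp: z_def)
 qed
 then have "(\<Sum>p<n. \<Sum>q<n. norm (Z $$ (p, q))) < (\<Sum>p<n. \<Sum>q<n. r / real (n * n))"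
  by (intro sum_strict_mono) (auto simp: n_def)
 also have "\<dots> = r" using nn by simp
 finally have Zsm: "mat_norm Z < r" using mat_norm_le_entries [of Z] Z by simp
 have dL: "d \<le> L" "i < L" "0 < d" "L - d = i" by (simp_all add: L_def d_def)
 have eq1: "us ! p = vs ! p" "us ! p = ws ! p" if "p < L" "p \<noteq> i" for p
  using that by (auto simp: us_def vs_def ws_def i_def L_def d_def nth_append nth_Cons')
 have eq2: "us ! i + vs ! i = ws ! i"
  by (simp add: us_def vs_def ws_def i_def nth_append scaleC_add_right)
 define h where "h p = (if p \<le> L then p else p - d)" for p
 have h: "h p < Suc L" if "p < n" for p using that dL by (auto simp: h_def n_def)
 then have h': "\<forall>p<n. h p < Suc L" by blast
 have fib: "{l. l < n \<and> h l = q} = (if q \<le> i then {q} else {q, q + d})" if "q < Suc L" for q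
  using that dL by (auto simp: h_def n_def L_def)
 have "itw n (Suc L) Z (\<lambda>p q. if h p = q then 1 else 0) (chain ws)"
  unfolding itw_fold_iff [OF h']
 proof (intro allI impI)
  fix p q assume pq: "p < n" "q < Suc L"
  have "(\<Sum>l\<in>{l. l < n \<and> h l = q}. Z $$ (p, l)) = (if q \<le> i then Z $$ (p, q) else Z $$ (p, q) + Z $$ (p, q + d))"
   unfolding fib [OF pq(2)] using dL by simp
  also have "\<dots> = (if q = Suc (h p) then ws ! h p else 0)"
  proof (cases "q \<le> i")
   case True
   then have q: "q < n" using dL by (simp add: n_def)
   show ?thesis using True pq q dL eq1 [of p] by (auto simp: Z_def h_def)
  next
   case False
   then have q: "q < n" "q + d < n" using pq by (auto simp: n_def)
   consider "p < i" | "p = i" | "i < p" "p < L" | "p = L" | "L < p" by linarith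
   then show ?thesis
   proof cases
    case 2
    then show ?thesis using False pq q dL eq2 by (auto simp: Z_def h_def L_def)
   next
    case 5
    show ?thesis
    proof (cases "p = L + d")
     case True
     then show ?thesis using 5 False pq q dL by (auto simp: Z_def h_def L_def n_def)
    next
     case False
     then have "p - d < L" "p - d \<noteq> i" using 5 pq dL by (auto simp: n_def L_def)
     then show ?thesis using 5 \<open>\<not> q \<le> i\<close> pq q dL eq1 [of "p - d"] by (auto simp: Z_def h_def L_def)
    qed
   qed (use False pq q dL eq1 [of p] in \<open>auto simp: Z_def h_def L_def\<close>)
  qed
  also have "\<dots> = chain ws $$ (h p, q)" using pq h [OF pq(1)] by (simp add: chain_def l)
  finally show "(\<Sum>l\<in>{l. l < n \<and> h l = q}. Z $$ (p, l)) = chain ws $$ (h p, q)" .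
 qed
 moreover have wr: "norm b < r" if "b \<in> set ws" for b using that t' by (auto simp: ws_def)
 ultimately have "itw n (Suc L) (F Z) (\<lambda>p q. if h p = q then 1 else 0) (F (chain ws))"
  using Z Zsm r l by (intro F_itw mat_norm_chain chain_carrier') (auto simp: n_def)
 then have "(\<Sum>l\<in>{l. l < n \<and> h l = L}. F Z $$ (0, l)) = F (chain ws) $$ (0, L)"
  unfolding itw_fold_iff [OF h'] by (auto simp: n_def h_def)
 then have sum: "F Z $$ (0, L) + F Z $$ (0, L + d) = coef ws"
  using fib [of L] dL wr by (simp add: coef_eq_corner corner_def l)
 have "F Z $$ (0, length us) = coef us"
  by (rule path_entry [OF Z Zsm, of "\<lambda>t. t" us "{..L}"]) (use l dL in \<open>auto simp: Z_def n_def split: if_splits\<close>)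
 moreover have "F Z $$ ((\<lambda>t. if t \<le> i then t else t + d) 0, (\<lambda>t. if t \<le> i then t else t + d) (length vs)) = coef vs"
 proof (rule path_entry [OF Z Zsm, of "\<lambda>t. if t \<le> i then t else t + d" vs "{..i} \<union> {L<..}"])
  show "inj_on (\<lambda>t. if t \<le> i then t else t + d) {..length vs}" by (auto simp: inj_on_def split: if_splits)
  fix t q assume tq: "t \<le> length vs" "q < n" "q \<in> {..i} \<union> {L<..}"
  show "Z $$ (if t \<le> i then t else t + d, q) = (if t < length vs \<and> q = (if Suc t \<le> i then Suc t else Suc t + d) then vs ! t else 0)"
   using tq l dL eq1 [of t] by (auto simp: Z_def n_def L_def)
 qed (use l dL in \<open>auto simp: Z_def n_def L_def split: if_splits\<close>)
 ultimately have "coef ws = coef us + coef vs" using sum l dL by simp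
 moreover have "coef (map (scaleC z) bs) = z ^ length bs *\<^sub>C coef bs" for bs
  using coef_map_scale [of "[]" "\<lambda>_. z" bs] by (simp add: map_replicate_const)
 then have "coef us = z ^ L *\<^sub>C coef (xs @ x # ys)" "coef vs = z ^ L *\<^sub>C coef (xs @ y # ys)"
  "coef ws = z ^ L *\<^sub>C coef (xs @ (x + y) # ys)"
  using l by (metis us_def length_map, metis vs_def length_map, metis ws_def length_map)
 ultimately have "z ^ L *\<^sub>C coef (xs @ (x + y) # ys) = z ^ L *\<^sub>C (coef (xs @ x # ys) + coef (xs @ y # ys))"
  by (simp only: scaleC_add_right)
 then have "(1 / z ^ L) *\<^sub>C z ^ L *\<^sub>C coef (xs @ (x + y) # ys) = (1 / z ^ L) *\<^sub>C z ^ L *\<^sub>C (coef (xs @ x # ys) + coef (xs @ y # ys))"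
  by simp
 then show ?thesis using z0 by (simp add: scaleC_scaleC scaleC_one)
qed

end

section \<open>Multilinear functions of words\<close>

definition lin :: "('b ncword => 'b::cstar_algebra) => 'b ncfree => 'b" where
 "lin h p = (\<Sum>w\<in>Poly_Mapping.keys p. Poly_Mapping.lookup p w *\<^sub>C h w)"

lemma lin_superset:
 assumes "finite A" "Poly_Mapping.keys p \<subseteq> A"
 shows "lin h p = (\<Sum>w\<in>A. Poly_Mapping.lookup p w *\<^sub>C h w)"
 unfolding lin_def using assms
 by (intro sum.mono_neutral_left) (auto simp: in_keys_iff)

lemma lin_add: "lin h (p + q) = lin h p + lin h q"
proof -
 have "Poly_Mapping.keys (p + q) \<subseteq> Poly_Mapping.keys p \<union> Poly_Mapping.keys q" by (rule Poly_Mapping.keys_add)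
 then show ?thesis
  by (simp add: lin_superset [of "Poly_Mapping.keys p \<union> Poly_Mapping.keys q"] lookup_add scaleC_add_left sum.distrib)
qed

lemma lin_single: "lin h (ncsingle w c) = c *\<^sub>C h w"
 by (simp add: lin_superset [of "{w}"])

lemma lin_zero [simp]: "lin h 0 = 0"
 by (simp add: lin_def)

lemma lin_diff: "lin h (p - q) = lin h p - lin h q"
 using lin_add [of h "p - q" q] by simp

lemma word_list_insert:
 "\<exists>xs l f ys. \<forall>a. word_list (u + Coeff a + v) = xs @ (l * a * f) # (ys :: 'b::monoid_mult list)"
proof (induction u)
 case (Coeff b)
 show ?case
 proof (cases v)
  case (Coeff c)
  show ?thesis unfolding Coeff by (rule exI [of _ "[]"]) (auto simp: mult.assoc)
 next
  case (CoeffX c w)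
  show ?thesis unfolding CoeffX by (rule exI [of _ "[]"]) (auto simp: mult.assoc)
 qed
next
 case (CoeffX b u)
 then obtain xs l f ys where "\<forall>a. word_list (u + Coeff a + v) = xs @ (l * a * f) # ys" by blast
 then show ?case by (intro exI [of _ "b # xs"] exI [of _ l] exI [of _ f] exI [of _ ys]) simp
qed

lemma word_list_surj: "bs \<noteq> [] ==> \<exists>w. word_list w = bs"
proof (induction bs)
 case (Cons b bs)
 show ?case
 proof (cases "bs = []")
  case True
  then show ?thesis by (intro exI [of _ "Coeff b"]) simp
 next
  case False
  then obtain w where "word_list w = bs" using Cons by blast
  then show ?thesis by (intro exI [of _ "CoeffX b w"]) simp
 qed
qed simp

text \<open>The additivity and homogeneity in every slot are exactly the relations dividing out the ideal.\<close>

lemma word_functional_extends: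
 fixes s :: "'b::cstar_algebra list => 'b"
 assumes s_add: "\<And>xs x y ys. s (xs @ (x + y) # ys) = s (xs @ x # ys) + s (xs @ y # ys)"
  and s_scale: "\<And>xs c x ys. s (xs @ (c *\<^sub>C x) # ys) = c *\<^sub>C s (xs @ x # ys)"
 obtains \<sigma> where "\<And>p q. \<sigma> (p + q) = \<sigma> p + \<sigma> q" "\<And>c p. \<sigma> (c *\<^sub>C p) = c *\<^sub>C \<sigma> p"
  "\<And>bs. bs \<noteq> [] ==> \<sigma> (nc_word bs) = s bs"
proof -
 define L where "L = lin (\<lambda>w. s (word_list w))"
 have L0: "L (u * p * v) = 0" if words: "\<And>u v. L (ncsingle u 1 * p * ncsingle v 1) = 0" for p u v
 proof -
  have 1: "L (ncsingle u c * p * ncsingle v d) = 0" for u c v d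
  proof -
   have "L (ncsingle 0 e * q) = e *\<^sub>C L q" for e q
    by (induction q rule: ncfree_induct)
     (simp_all add: L_def mult_single lin_single distrib_left lin_add scaleC_add_right scaleC_scaleC)
   note this [of "c * d" "ncsingle u 1 * p * ncsingle v 1"]
   moreover have "ncsingle 0 (c * d) * (ncsingle u 1 * p * ncsingle v 1) = ncsingle u c * p * ncsingle v d"
    by (induction p rule: ncfree_induct) (simp_all add: mult_single distrib_left distrib_right mult_ac)
   ultimately show ?thesis using words by simp
  qed
  have 2: "L (ncsingle u c * p * v) = 0" for u c
   by (induction v rule: ncfree_induct) (use 1 in \<open>simp_all add: L_def distrib_left lin_add\<close>)
  show ?thesis
   by (induction u rule: ncfree_induct) (use 2 in \<open>simp_all add: L_def distrib_right lin_add\<close>)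
 qed
 have ideal: "L (u * p * v) = 0" if "p \<in> ncideal" for p u v
  using that
 proof (induction arbitrary: u v rule: ncideal.induct)
  case (add_rel a b)
  show ?case
  proof (rule L0)
   fix u v :: "'b ncword"
   obtain xs l f ys where w: "\<And>a. word_list (u + Coeff a + v) = xs @ (l * a * f) # ys"
    using word_list_insert [of u v] by blast
   show "L (ncsingle u 1 * (ncsingle (Coeff (a + b)) 1 - ncsingle (Coeff a) 1 - ncsingle (Coeff b) 1) * ncsingle v 1) = 0"
    by (simp add: L_def left_diff_distrib right_diff_distrib mult_single lin_diff lin_single scaleC_one w
      distrib_left distrib_right s_add)
  qed
 next
  case (scale_rel c a)
  show ?case
  proof (rule L0)
   fix u v :: "'b ncword"
   obtain xs l f ys where w: "\<And>a. word_list (u + Coeff a + v) = xs @ (l * a * f) # ys"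
    using word_list_insert [of u v] by blast
   show "L (ncsingle u 1 * (ncsingle (Coeff (c *\<^sub>C a)) 1 - ncsingle (Coeff a) c) * ncsingle v 1) = 0"
    by (simp add: L_def left_diff_distrib right_diff_distrib mult_single lin_diff lin_single scaleC_one w
      mult_scaleC_left mult_scaleC_right s_scale)
  qed
 next
  case zero
  show ?case by (simp add: L_def)
 next
  case (add p q)
  then show ?case by (simp add: L_def distrib_left distrib_right lin_add)
 next
  case (mult p a b)
  then show ?case using mult.IH [of "u * a" "b * v"] by (simp add: mult.assoc)
 qed
 define \<sigma> where "\<sigma> p = L (rep_ncpoly p)" for p
 have abs: "\<sigma> (abs_ncpoly q) = L q" for q
 proof -
  have "ncrel q q" by (simp add: ncrel_def ncideal.zero)
  then have "ncrel (rep_ncpoly (abs_ncpoly q)) q" by (rule Quotient3_rep_abs [OF Quotient3_ncpoly])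
  then show ?thesis
   using ideal [of "rep_ncpoly (abs_ncpoly q) - q" 1 1] by (simp add: \<sigma>_def ncrel_def L_def lin_diff)
 qed
 have rep: "\<exists>q. p = abs_ncpoly q" for p :: "'b ncpoly"
  using Quotient3_abs_rep [OF Quotient3_ncpoly] by metis
 have Lscale: "L (ncsingle 0 e * q) = e *\<^sub>C L q" for e q
  by (induction q rule: ncfree_induct)
   (simp_all add: L_def mult_single lin_single distrib_left lin_add scaleC_add_right scaleC_scaleC)
 show ?thesis
 proof (rule that)
  fix p q :: "'b ncpoly" and c
  obtain p' q' where "p = abs_ncpoly p'" "q = abs_ncpoly q'" using rep by meson
  then show "\<sigma> (p + q) = \<sigma> p + \<sigma> q" "\<sigma> (c *\<^sub>C p) = c *\<^sub>C \<sigma> p"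
   by (simp_all add: plus_ncpoly.abs_eq scaleC_ncpoly.abs_eq abs Lscale) (simp_all add: L_def lin_add)
 next
  fix bs :: "'b list" assume "bs \<noteq> []"
  then obtain w where w: "word_list w = bs" using word_list_surj by blast
  show "\<sigma> (nc_word bs) = s bs"
   by (simp add: abs L_def lin_single scaleC_one flip: w abs_ncpoly_single)
 qed
qed

section \<open>Walks\<close>

primrec walk :: "'b mat => nat => nat list => 'b list" where
 "walk c i [] = []"
| "walk c i (x # l) = c $$ (i, x) # walk c x l"

lemma length_walk [simp]: "length (walk c i l) = length l"
 by (induction l arbitrary: i) auto

lemma nth_walk: "t < length l ==> walk c i l ! t = c $$ (last (i # take t l), l ! t)"
 by (induction l arbitrary: i t) (auto simp: nth_Cons split: nat.split)

definition paths :: "nat => nat => nat list set" where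
 "paths n k = {l. set l \<subseteq> {..<n} \<and> length l = k}"

lemma finite_paths [simp]: "finite (paths n k)"
 unfolding paths_def by (rule finite_lists_length_eq) simp

lemma card_paths: "card (paths n k) = n ^ k"
 unfolding paths_def using card_lists_length_eq [of "{..<n}" k] by simp

lemma paths_0 [simp]: "paths n 0 = {[]}"
 by (auto simp: paths_def)

lemma sum_paths_Suc: "sum f (paths n (Suc k)) = (\<Sum>x<n. \<Sum>l\<in>paths n k. f (x # l))"
proof -
 have "paths n (Suc k) = (\<lambda>(x, l). x # l) ` ({..<n} \<times> paths n k)"
  by (auto simp: paths_def length_Suc_conv image_iff)
 moreover have "inj_on (\<lambda>(x, l). x # l) ({..<n} \<times> paths n k)" by (auto simp: inj_on_def)
 ultimately have "sum f (paths n (Suc k)) = (\<Sum>(x, l)\<in>{..<n} \<times> paths n k. f (x # l))"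
  by (simp add: sum.reindex split_def)
 then show ?thesis by (simp add: sum.cartesian_product)
qed

lemma cauchy_product_walks:
 fixes c :: "'b::cstar_algebra mat"
 assumes c: "c \<in> carrier_mat n n" and ij: "i < n" "j < n"
 shows "((map_mat nc_const c * (nc_X \<cdot>\<^sub>m 1\<^sub>m n)) ^\<^sub>m k * map_mat nc_const c) $$ (i, j)
  = (\<Sum>l\<in>paths n k. nc_word (walk c i (l @ [j])))"
 using ij(1)
proof (induction k arbitrary: i)
 case 0
 then show ?case using c ij by simp
next
 case (Suc k)
 let ?C = "map_mat nc_const c" let ?A = "?C * (nc_X \<cdot>\<^sub>m 1\<^sub>m n)"
 have C: "?C \<in> carrier_mat n n" using c by simp
 have A: "?A \<in> carrier_mat n n" using c by simp
 have Ak: "?A ^\<^sub>m k \<in> carrier_mat n n" for k using A by (rule pow_carrier_mat)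
 have comm: "?A ^\<^sub>m k * ?A = ?A * ?A ^\<^sub>m k" for k
 proof (induction k)
  case (Suc k)
  have "?A ^\<^sub>m Suc k * ?A = ?A * ?A ^\<^sub>m k * ?A" using Suc by simp
  also have "\<dots> = ?A * (?A ^\<^sub>m k * ?A)" using A Ak [of k] by (intro assoc_mult_mat [of _ n n _ n _ n])
  finally show ?case by simp
 qed (use c in simp)
 have "?A ^\<^sub>m Suc k * ?C = ?A * ?A ^\<^sub>m k * ?C" using comm by simp
 also have "\<dots> = ?A * (?A ^\<^sub>m k * ?C)" using A Ak [of k] C by (intro assoc_mult_mat [of _ n n _ n _ n])
 finally have e: "?A ^\<^sub>m Suc k * ?C = ?A * (?A ^\<^sub>m k * ?C)" .
 have entry: "(U * V) $$ (i, j) = (\<Sum>x<n. U $$ (i, x) * V $$ (x, j))"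
  if "U \<in> carrier_mat n n" "V \<in> carrier_mat n n" for U V :: "'b ncpoly mat"
  using that Suc.prems ij by (simp add: index_mult_mat' del: index_mult_mat(1))
 have "(?A ^\<^sub>m Suc k * ?C) $$ (i, j) = (\<Sum>x<n. ?A $$ (i, x) * (?A ^\<^sub>m k * ?C) $$ (x, j))"
  unfolding e by (rule entry [OF A mult_carrier_mat [OF Ak C]])
 also have "\<dots> = (\<Sum>x<n. nc_const (c $$ (i, x)) * nc_X * (\<Sum>l\<in>paths n k. nc_word (walk c x (l @ [j]))))"
 proof (rule sum.cong [OF refl])
  fix x assume x: "x \<in> {..<n}"
  have "?A $$ (i, x) = (\<Sum>y<n. ?C $$ (i, y) * (nc_X * (if y = x then 1 else 0)))"
   using c Suc.prems x by (simp add: index_mult_mat' del: index_mult_mat(1))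
  also have "\<dots> = (\<Sum>y<n. if y = x then nc_const (c $$ (i, x)) * nc_X else 0)"
   using c Suc.prems x by (intro sum.cong) auto
  finally show "?A $$ (i, x) * (?A ^\<^sub>m k * ?C) $$ (x, j)
   = nc_const (c $$ (i, x)) * nc_X * (\<Sum>l\<in>paths n k. nc_word (walk c x (l @ [j])))"
   using x Suc.IH [of x] by simp
 qed
 also have "\<dots> = (\<Sum>x<n. \<Sum>l\<in>paths n k. nc_word (walk c i ((x # l) @ [j])))"
  by (intro sum.cong refl) (simp add: sum_distrib_left nc_word_Cons flip: length_0_conv)
 also have "\<dots> = (\<Sum>l\<in>paths n (Suc k). nc_word (walk c i (l @ [j])))"
  by (simp only: sum_paths_Suc)
 finally show ?case .
qed

section \<open>Expansion of a germ over walks\<close>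

text \<open>Each colour class is a partial permutation matrix.\<close>

lemma mat_norm_coloured:
 fixes A :: "'b::cstar_algebra mat" and clr :: "nat => nat => nat"
 assumes A: "A \<in> carrier_mat n n" and c: "c \<ge> 0" "\<And>i j. i < n ==> j < n ==> norm (A $$ (i, j)) \<le> c"
  and clr: "\<And>i j. i < n ==> j < n ==> A $$ (i, j) \<noteq> 0 ==> clr i j < N"
  and row: "\<And>i j k. i < n ==> j < n ==> k < n ==> A $$ (i, j) \<noteq> 0 ==> A $$ (i, k) \<noteq> 0 ==> clr i j = clr i k ==> j = k"
  and column: "\<And>i j k. i < n ==> j < n ==> k < n ==> A $$ (i, k) \<noteq> 0 ==> A $$ (j, k) \<noteq> 0 ==> clr i k = clr j k ==> i = j"
 shows "mat_norm A \<le> real N * c"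
proof -
 define P where "P M = mat n n (\<lambda>(i, j). if clr i j < M then A $$ (i, j) else 0)" for M :: nat
 have "mat_norm (P M) \<le> real M * c" for M
 proof (induction M)
  case 0
  have "P 0 = 0\<^sub>m n n" by (rule eq_matI) (auto simp: P_def)
  then show ?case by simp
 next
  case (Suc M)
  define Q where "Q = mat n n (\<lambda>(i, j). if clr i j = M then A $$ (i, j) else 0)"
  have "P (Suc M) = P M + Q" by (rule eq_matI) (auto simp: P_def Q_def)
  moreover have "mat_norm (P M + Q) \<le> mat_norm (P M) + mat_norm Q"
   by (rule mat_norm_add [of _ n n]) (auto simp: P_def Q_def)
  moreover have "mat_norm Q \<le> c"
  proof (rule mat_norm_partial_perm [of _ n])
   fix i j k
   show "i < n ==> j < n ==> k < n ==> Q $$ (i, j) \<noteq> 0 ==> Q $$ (i, k) \<noteq> 0 ==> j = k"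
    using row [of i j k] by (auto simp: Q_def split: if_splits)
   show "i < n ==> j < n ==> k < n ==> Q $$ (i, k) \<noteq> 0 ==> Q $$ (j, k) \<noteq> 0 ==> i = j"
    using column [of i j k] by (auto simp: Q_def split: if_splits)
  qed (use c in \<open>auto simp: Q_def\<close>)
  ultimately show ?case using Suc by (simp add: algebra_simps)
 qed
 moreover have "P N = A" using A clr by (intro eq_matI) (auto simp: P_def)
 ultimately show ?thesis by metis
qed

definition tree_edge :: "nat => nat => 'b::cstar_algebra mat => complex => nat list => nat list => 'b" where
 "tree_edge N i c \<kappa> l l' =
   (if l' \<noteq> [] \<and> length l < N \<and> butlast l' = l then \<kappa> *\<^sub>C c $$ (last (i # l), last l')
   else if l' \<noteq> [] \<and> length l = N \<and> length l' = N \<and> butlast l' = butlast l then c $$ (last l, last l') else 0)"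

lemma butlast_eq_last_eq: "l \<noteq> [] ==> l' \<noteq> [] ==> butlast l = butlast l' ==> last l = last l' ==> l = l'"
 by (metis append_butlast_last_id)

context nc_germ
begin

text \<open>
 The nodes of the graph \<open>tree_edge\<close> are the walks from \<open>i\<close> of length at most \<open>N\<close>. A leaf has its
 siblings as successors, so that the end point of a walk is a covering of the graph \<open>c\<close>, and an entry
 of \<open>F c\<close> is the sum of the entries over the fibre. At the inner nodes these are coefficients. At a
 leaf, conjugation turns a factor \<open>\<kappa>\<close> on the first \<open>N\<close> steps into a factor \<open>\<kappa>\<^sup>N\<close> of the entry, which
 remains bounded by \<open>K\<close>; with \<open>\<kappa> = 2 n\<close> the at most \<open>n\<^sup>N\<close> leaves contribute at most \<open>K / 2\<^sup>N\<close>.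
 The number of colours does not depend on \<open>N\<close>, so that neither does the smallness of \<open>c\<close>.
\<close>

lemma walk_expansion:
 assumes c: "c \<in> carrier_mat n n" "mat_norm c * (real (n + n * n) * (2 * real n)) < r" and ij: "i < n" "j < n"
  and N: "N \<ge> 1" and F0: "F (0\<^sub>m 1 1) = 0\<^sub>m 1 1"
 shows "norm (F c $$ (i, j) - (\<Sum>k<N - 1. \<Sum>l\<in>paths n k. coef (walk c i (l @ [j])))) \<le> K / 2 ^ N"
proof -
 define T where "T = {l. set l \<subseteq> {..<n} \<and> length l \<le> N}"
 define M where "M = card T"
 have finT: "finite T" unfolding T_def by (rule finite_lists_length_le) simp
 obtain e where e: "bij_betw e {..<M} T"
  using ex_bij_betw_nat_finite [OF finT] unfolding M_def by (metis atLeast0LessThan)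
 define d where "d = inv_into {..<M} e"
 have ed: "e (d l) = l" "d l < M" if "l \<in> T" for l
  using bij_betw_inv_into_right [OF e that] bij_betw_apply [OF bij_betw_inv_into [OF e] that] by (auto simp: d_def)
 have de: "d (e p) = p" "e p \<in> T" if "p < M" for p
  using bij_betw_inv_into_left [OF e, of p] bij_betw_apply [OF e, of p] that by (auto simp: d_def)
 have e_inj: "e p = e q \<longleftrightarrow> p = q" if "p < M" "q < M" for p q using de that by metis
 have ne: "[] \<in> T" by (simp add: T_def)
 have M: "M \<ge> 1" using ed(2) [OF ne] by simp
 define h where "h p = last (i # e p)" for p
 have h: "\<forall>p<M. h p < n"
 proof (intro allI impI)
  fix p assume "p < M"
  then have "set (e p) \<subseteq> {..<n}" using de(2) by (auto simp: T_def)
  then show "h p < n" using ij subsetD [of "set (e p)" "{..<n}" "last (e p)"] by (simp add: h_def)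
 qed
 define Z where "Z \<kappa> = mat M M (\<lambda>(p, q). tree_edge N i c \<kappa> (e p) (e q))" for \<kappa>
 have Z: "Z \<kappa> \<in> carrier_mat M M" for \<kappa> by (simp add: Z_def)
 have Zi: "Z \<kappa> $$ (p, q) = tree_edge N i c \<kappa> (e p) (e q)" if "p < M" "q < M" for \<kappa> p q using that by (simp add: Z_def)
 have n: "n \<ge> 1" using ij by simp
 define \<kappa> where "\<kappa> = complex_of_real (2 * real n)"
 define \<beta> where "\<beta> = mat_norm c"
 have ent: "norm (c $$ (x, y)) \<le> \<beta>" if "x < n" "y < n" for x y
  using norm_index_le_mat_norm [of x c y] c that by (simp add: \<beta>_def)
 have \<beta>: "\<beta> \<ge> 0" by (simp add: \<beta>_def)
 have lasts: "last l < n" if "l \<in> T" "l \<noteq> []" for l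
  using that subsetD [of "set l" "{..<n}" "last l"] by (simp add: T_def)
 have Zsm: "mat_norm (Z \<mu>) < r" if \<mu>: "cmod \<mu> \<le> 2 * real n" for \<mu>
 proof -
  have "mat_norm (Z \<mu>) \<le> real (n + n * n) * (2 * real n * \<beta>)"
  proof (rule mat_norm_coloured [OF Z, where clr = "\<lambda>p q. if length (e p) < N then last (e q) else n + (last (e p) * n + last (e q))"])
   show "0 \<le> 2 * real n * \<beta>" using \<beta> by simp
   fix p q assume p: "p < M" and q: "q < M"
   have t: "e p \<in> T" "e q \<in> T" using de p q by auto
   have b1: "cmod \<mu> * norm (c $$ (last (i # e p), last (e q))) \<le> 2 * real n * \<beta>" if "e q \<noteq> []"
    using h p lasts [OF t(2) that] \<mu> \<beta> by (intro mult_mono ent) (auto simp: h_def)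
   have "1 * \<beta> \<le> 2 * real n * \<beta>" using n \<beta> by (intro mult_right_mono) auto
   then have b2: "norm (c $$ (last (e p), last (e q))) \<le> 2 * real n * \<beta>" if "e q \<noteq> []" "e p \<noteq> []"
    using ent [OF lasts [OF t(1) that(2)] lasts [OF t(2) that(1)]] by simp
   have "e p \<noteq> []" if "length (e p) = N" using that N by auto
   then show "norm (Z \<mu> $$ (p, q)) \<le> 2 * real n * \<beta>"
    using b1 b2 \<beta> unfolding Zi [OF p q] tree_edge_def by (auto simp: norm_scaleC)
   assume nz: "Z \<mu> $$ (p, q) \<noteq> 0"
   show "(if length (e p) < N then last (e q) else n + (last (e p) * n + last (e q))) < n + n * n"
   proof (cases "length (e p) < N")
    case True
    then have "e q \<noteq> []" using nz unfolding Zi [OF p q] tree_edge_def by (auto split: if_splits)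
    then show ?thesis using True lasts [OF t(2)] by simp
   next
    case False
    then have "e q \<noteq> []" "e p \<noteq> []" using nz N unfolding Zi [OF p q] tree_edge_def by (auto split: if_splits)
    then have l: "last (e q) < n" "last (e p) < n" using lasts t by auto
    then have "last (e p) * n + last (e q) < Suc (last (e p)) * n" by simp
    also have "\<dots> \<le> n * n" using l by (intro mult_right_mono) auto
    finally show ?thesis using False by simp
   qed
  next
   fix p q q' assume p: "p < M" "q < M" "q' < M" and nz: "Z \<mu> $$ (p, q) \<noteq> 0" "Z \<mu> $$ (p, q') \<noteq> 0"
    and co: "(if length (e p) < N then last (e q) else n + (last (e p) * n + last (e q)))
     = (if length (e p) < N then last (e q') else n + (last (e p) * n + last (e q')))"
   have "e q \<noteq> []" "e q' \<noteq> []" "butlast (e q) = butlast (e q')"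
    using nz unfolding Zi [OF p(1,2)] Zi [OF p(1,3)] tree_edge_def by (auto split: if_splits)
   moreover have "last (e q) = last (e q')" using co by (auto split: if_splits)
   ultimately have "e q = e q'" by (rule butlast_eq_last_eq)
   then show "q = q'" using e_inj p by blast
  next
   fix p p' q assume p: "p < M" "p' < M" "q < M" and nz: "Z \<mu> $$ (p, q) \<noteq> 0" "Z \<mu> $$ (p', q) \<noteq> 0"
    and co: "(if length (e p) < N then last (e q) else n + (last (e p) * n + last (e q)))
     = (if length (e p') < N then last (e q) else n + (last (e p') * n + last (e q)))"
   have t: "e p \<in> T" "e p' \<in> T" "e q \<in> T" using de p by auto
   have q0: "e q \<noteq> []" using nz unfolding Zi [OF p(1,3)] tree_edge_def by (auto split: if_splits)
   have ql: "last (e q) < n" by (rule lasts [OF t(3) q0])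
   have "e p = e p'"
   proof (cases "length (e p) < N")
    case True
    then have "length (e p') < N" using co ql by (auto split: if_splits)
    then show ?thesis using True nz unfolding Zi [OF p(1,3)] Zi [OF p(2,3)] tree_edge_def by (auto split: if_splits)
   next
    case False
    then have F': "\<not> length (e p') < N" using co ql by (auto split: if_splits)
    then have "e p \<noteq> []" "e p' \<noteq> []" "butlast (e p) = butlast (e p')"
     using False N nz unfolding Zi [OF p(1,3)] Zi [OF p(2,3)] tree_edge_def by (auto split: if_splits)
    moreover have "last (e p) = last (e p')" using co F' False n by auto
    ultimately show ?thesis by (rule butlast_eq_last_eq)
   qed
   then show "p = p'" using e_inj p by blast
  qed
  also have "\<dots> < r" using c by (simp add: \<beta>_def mult_ac)
  finally show ?thesis .
 qed
 have small: "cmod 1 \<le> 2 * real n" "cmod \<kappa> \<le> 2 * real n" using n by (simp_all add: \<kappa>_def)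
 have csm: "mat_norm c < r"
 proof -
  have "1 \<le> (n + n * n) * (2 * n)" using n by simp
  then have "1 \<le> real ((n + n * n) * (2 * n))" by linarith
  then have "\<beta> * 1 \<le> \<beta> * (real (n + n * n) * (2 * real n))" using \<beta> by (intro mult_left_mono) auto
  then show ?thesis using c by (simp add: \<beta>_def)
 qed
 have "itw M n (Z 1) (\<lambda>p q. if h p = q then 1 else 0) c"
  unfolding itw_fold_iff [OF h]
 proof (intro allI impI)
  fix p q assume pq: "p < M" "q < n"
  define l where "l = (if length (e p) < N then e p @ [q] else butlast (e p) @ [q])"
  have ep: "set (e p) \<subseteq> {..<n}" "length (e p) \<le> N" using de(2) [OF pq(1)] by (auto simp: T_def)
  have lT: "l \<in> T" using ep pq N by (auto simp: l_def T_def dest: in_set_butlastD)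
  have iff: "Z 1 $$ (p, x) \<noteq> 0 \<and> h x = q --> x = d l" if "x < M" for x
  proof (intro impI, elim conjE)
   assume nz: "Z 1 $$ (p, x) \<noteq> 0" and x: "h x = q"
   have x0: "e x \<noteq> []" "butlast (e x) = butlast l"
    using nz ep unfolding Zi [OF pq(1) that] tree_edge_def by (auto simp: l_def split: if_splits)
   have l0: "l \<noteq> []" by (simp add: l_def)
   have "last (e x) = last l" using x x0(1) by (simp add: h_def l_def)
   then have "e x = l" by (rule butlast_eq_last_eq [OF x0(1) l0 x0(2)])
   then show "x = d l" using de(1) [OF that] by simp
  qed
  have "(\<Sum>x\<in>{x. x < M \<and> h x = q}. Z 1 $$ (p, x)) = (\<Sum>x\<in>{d l}. Z 1 $$ (p, x))"
  proof (rule sum.mono_neutral_right)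
   show "{d l} \<subseteq> {x. x < M \<and> h x = q}" using ed [OF lT] by (auto simp: h_def l_def)
   show "\<forall>x\<in>{x. x < M \<and> h x = q} - {d l}. Z 1 $$ (p, x) = 0" using iff by blast
  qed simp
  also have "\<dots> = c $$ (h p, q)"
  proof (cases "length (e p) < N")
   case True
   then show ?thesis using Zi [OF pq(1) ed(2) [OF lT], of 1] ed(1) [OF lT]
    by (simp add: tree_edge_def l_def h_def scaleC_one)
  next
   case False
   then have "length (e p) = N" "e p \<noteq> []" using ep N by auto
   then show ?thesis using Zi [OF pq(1) ed(2) [OF lT], of 1] ed(1) [OF lT]
    N by (simp add: tree_edge_def l_def h_def)
  qed
  finally show "(\<Sum>x\<in>{x. x < M \<and> h x = q}. Z 1 $$ (p, x)) = c $$ (h p, q)" .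
 qed
 then have "itw M n (F (Z 1)) (\<lambda>p q. if h p = q then 1 else 0) (F c)"
  using c csm Z M n Zsm [OF small(1)] by (intro F_itw) auto
 then have "(\<Sum>x\<in>{x. x < M \<and> h x = j}. F (Z 1) $$ (d [], x)) = F c $$ (h (d []), j)"
  using itw_fold_iff [OF h] ed(2) [OF ne] ij by blast
 then have "F c $$ (i, j) = (\<Sum>x\<in>{x. x < M \<and> h x = j}. F (Z 1) $$ (d [], x))"
  using ed(1) [OF ne] by (simp add: h_def)
 also have "\<dots> = (\<Sum>l\<in>{l\<in>T. last (i # l) = j}. F (Z 1) $$ (d [], d l))"
  by (rule sum.reindex_bij_witness [of _ d e]) (use de ed in \<open>auto simp: h_def\<close>)
 also have "{l\<in>T. last (i # l) = j} = {l. l = [] \<and> i = j} \<union> (\<Union>k\<in>{..<N - 1}. (\<lambda>l. l @ [j]) ` paths n k) \<union> (\<lambda>l. l @ [j]) ` paths n (N - 1)"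
 proof (intro equalityI subsetI)
  fix l assume "l \<in> {l\<in>T. last (i # l) = j}"
  then have l: "set l \<subseteq> {..<n}" "length l \<le> N" "last (i # l) = j" by (auto simp: T_def)
  show "l \<in> {l. l = [] \<and> i = j} \<union> (\<Union>k\<in>{..<N - 1}. (\<lambda>l. l @ [j]) ` paths n k) \<union> (\<lambda>l. l @ [j]) ` paths n (N - 1)"
  proof (cases l rule: rev_cases)
   case Nil
   then show ?thesis using l by simp
  next
   case (snoc l' y)
   then have "l = l' @ [j]" "l' \<in> paths n (length l')" "length l' < N - 1 \<or> length l' = N - 1"
    using l by (auto simp: paths_def)
   then show ?thesis by auto
  qed
 qed (use ij N in \<open>auto simp: T_def paths_def\<close>)
 also have "(\<Sum>l\<in>{l. l = [] \<and> i = j} \<union> (\<Union>k\<in>{..<N - 1}. (\<lambda>l. l @ [j]) ` paths n k) \<union> (\<lambda>l. l @ [j]) ` paths n (N - 1). F (Z 1) $$ (d [], d l))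
  = (\<Sum>l\<in>{l. l = [] \<and> i = j}. F (Z 1) $$ (d [], d l)) + (\<Sum>k<N - 1. \<Sum>l\<in>paths n k. F (Z 1) $$ (d [], d (l @ [j])))
   + (\<Sum>l\<in>paths n (N - 1). F (Z 1) $$ (d [], d (l @ [j])))"
 proof -
  have f: "finite {l. l = [] \<and> i = j}" by (rule finite_subset [of _ "{[]}"]) auto
  have disj: "{l. l = [] \<and> i = j} \<inter> (\<Union>k\<in>{..<N - 1}. (\<lambda>l. l @ [j]) ` paths n k) = {}"
   "({l. l = [] \<and> i = j} \<union> (\<Union>k\<in>{..<N - 1}. (\<lambda>l. l @ [j]) ` paths n k)) \<inter> (\<lambda>l. l @ [j]) ` paths n (N - 1) = {}"
   by (auto simp: paths_def)
  have "(\<Sum>l\<in>(\<Union>k\<in>{..<N - 1}. (\<lambda>l. l @ [j]) ` paths n k). F (Z 1) $$ (d [], d l))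
   = (\<Sum>k<N - 1. \<Sum>l\<in>(\<lambda>l. l @ [j]) ` paths n k. F (Z 1) $$ (d [], d l))"
  proof (rule sum.UNION_disjoint)
   show "\<forall>k\<in>{..<N - 1}. finite ((\<lambda>l. l @ [j]) ` paths n k)" by simp
  qed (auto simp: paths_def)
  moreover have "(\<Sum>l\<in>(\<lambda>l. l @ [j]) ` paths n k. F (Z 1) $$ (d [], d l)) = (\<Sum>l\<in>paths n k. F (Z 1) $$ (d [], d (l @ [j])))" for k
   by (subst sum.reindex) (auto simp: inj_on_def)
  ultimately show ?thesis
   using f disj(1) disj(2) by (simp add: sum.union_disjoint)
 qed
 also have "(\<Sum>l\<in>{l. l = [] \<and> i = j}. F (Z 1) $$ (d [], d l)) + (\<Sum>k<N - 1. \<Sum>l\<in>paths n k. F (Z 1) $$ (d [], d (l @ [j])))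
  = (\<Sum>k<N - 1. \<Sum>l\<in>paths n k. coef (walk c i (l @ [j])))"
 proof -
  have main: "F (Z 1) $$ (d [], d l) = coef (walk c i l)" if l: "set l \<subseteq> {..<n}" "length l < N" for l
  proof -
   have tT: "take t l \<in> T" for t using l by (auto simp: T_def dest: in_set_takeD)
   have "F (Z 1) $$ ((\<lambda>t. d (take t l)) 0, (\<lambda>t. d (take t l)) (length (walk c i l))) = coef (walk c i l)"
   proof (rule path_entry [OF Z Zsm [OF small(1)], of "\<lambda>t. d (take t l)" "walk c i l" "{q. q < M \<and> take (length (e q)) l = e q}"])
    show "inj_on (\<lambda>t. d (take t l)) {..length (walk c i l)}"
    proof (rule inj_onI)
     fix t t' assume t: "t \<in> {..length (walk c i l)}" "t' \<in> {..length (walk c i l)}" "d (take t l) = d (take t' l)"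
     then have "take t l = take t' l" using ed(1) [OF tT] by metis
     then have "length (take t l) = length (take t' l)" by (rule arg_cong)
     then show "t = t'" using t by simp
    qed
    show "d (take t l) < M" for t by (rule ed(2) [OF tT])
    show "d (take t l) \<in> {q. q < M \<and> take (length (e q)) l = e q}" for t using ed [OF tT, of t] by (simp add: min_def)
    show "p \<in> {q. q < M \<and> take (length (e q)) l = e q}"
     if p: "p < M" and q: "q < M" and qP: "q \<in> {q. q < M \<and> take (length (e q)) l = e q}" and nz: "Z 1 $$ (p, q) \<noteq> 0" for p q
    proof -
     have q': "take (length (e q)) l = e q" using qP by simp
     then have "length (e q) \<le> length l" by (metis length_take min.cobounded1 min.commute)
     then have "butlast (e q) = e p" "e q \<noteq> []"
      using l nz unfolding Zi [OF p q] tree_edge_def by (auto split: if_splits)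
     then have "e p = butlast (take (length (e q)) l)" using q' by simp
     also have "\<dots> = take (length (e q) - 1) l" using \<open>length (e q) \<le> length l\<close> by (simp add: butlast_take)
     finally have "e p = take (length (e q) - 1) l" .
     then show ?thesis using p by (simp add: min_def)
    qed
    show "Z 1 $$ (d (take t l), q) = (if t < length (walk c i l) \<and> q = d (take (Suc t) l) then walk c i l ! t else 0)"
     if t: "t \<le> length (walk c i l)" and q: "q < M" and qP: "q \<in> {q. q < M \<and> take (length (e q)) l = e q}" for t q
    proof -
     have q': "take (length (e q)) l = e q" using qP by simp
     then have lq: "length (e q) \<le> length l" by (metis length_take min.cobounded1 min.commute)
     have z: "Z 1 $$ (d (take t l), q) = (if e q \<noteq> [] \<and> butlast (e q) = take t l then c $$ (last (i # take t l), last (e q)) else 0)"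
      using l t lq unfolding Zi [OF ed(2) [OF tT] q] tree_edge_def ed(1) [OF tT] by (auto simp: scaleC_one)
     have iff: "e q \<noteq> [] \<and> butlast (e q) = take t l \<longleftrightarrow> t < length l \<and> q = d (take (Suc t) l)"
     proof
      assume a: "e q \<noteq> [] \<and> butlast (e q) = take t l"
      then have "length (butlast (e q)) = length (take t l)" by simp
      then have "length (e q) - 1 = t" using t by (simp only: length_butlast length_take length_walk min_absorb2)
      moreover have "length (e q) > 0" using a by simp
      ultimately have "length (e q) = Suc t" by linarith
      then show "t < length l \<and> q = d (take (Suc t) l)" using q' lq de(1) [OF q] by auto
     next
      assume a: "t < length l \<and> q = d (take (Suc t) l)"
      then have "e q = take (Suc t) l" using ed(1) [OF tT] by simp
      then show "e q \<noteq> [] \<and> butlast (e q) = take t l" using a by (auto simp: butlast_take)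
     qed
     have "last (e q) = l ! t" if "t < length l" "q = d (take (Suc t) l)"
      using that ed(1) [OF tT, of "Suc t"] by (simp add: take_Suc_conv_app_nth)
     then show ?thesis unfolding z iff by (simp add: nth_walk)
    qed
   qed
   then show ?thesis by simp
  qed
  have "coef [] = 0"
  proof -
   have "chain ([] :: 'b list) = 0\<^sub>m 1 1" by (rule eq_matI) (auto simp: chain_def)
   then have "corner [] = 0" using F0 by (simp add: corner_def)
   then show ?thesis using coef_eq_corner [of "[]"] by simp
  qed
  then have "(\<Sum>l\<in>{l. l = [] \<and> i = j}. F (Z 1) $$ (d [], d l)) = 0" using main [of "[]"] N by (intro sum.neutral) auto
  moreover have "(\<Sum>k<N - 1. \<Sum>l\<in>paths n k. F (Z 1) $$ (d [], d (l @ [j]))) = (\<Sum>k<N - 1. \<Sum>l\<in>paths n k. coef (walk c i (l @ [j])))"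
   using ij by (intro sum.cong refl main) (auto simp: paths_def)
  ultimately show ?thesis by simp
 qed
 finally have eq: "F c $$ (i, j) - (\<Sum>k<N - 1. \<Sum>l\<in>paths n k. coef (walk c i (l @ [j])))
  = (\<Sum>l\<in>paths n (N - 1). F (Z 1) $$ (d [], d (l @ [j])))" by simp
 have \<kappa>0: "\<kappa> \<noteq> 0" using n by (simp add: \<kappa>_def)
 have "itw M M (Z \<kappa>) (\<lambda>p q. if p = q then (1 / \<kappa>) ^ length (e p) else 0) (Z 1)"
  unfolding itw_diag_iff
 proof (intro allI impI)
  fix p q assume pq: "p < M" "q < M"
  show "(1 / \<kappa>) ^ length (e q) *\<^sub>C Z \<kappa> $$ (p, q) = (1 / \<kappa>) ^ length (e p) *\<^sub>C Z 1 $$ (p, q)"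
  proof (cases "e q \<noteq> [] \<and> butlast (e q) = e p \<and> length (e p) < N")
   case True
   then have "e p = butlast (e q)" "length (e q) > 0" by auto
   then have "length (e q) = Suc (length (e p))" by simp
   then show ?thesis using True \<kappa>0 unfolding Zi [OF pq] tree_edge_def by (simp add: scaleC_scaleC)
  next
   case False
   then show ?thesis unfolding Zi [OF pq] tree_edge_def by auto
  qed
 qed
 then have "itw M M (F (Z \<kappa>)) (\<lambda>p q. if p = q then (1 / \<kappa>) ^ length (e p) else 0) (F (Z 1))"
  using Z M Zsm [OF small(1)] Zsm [OF small(2)] by (intro F_itw) auto
 then have diag: "(1 / \<kappa>) ^ length (e q) *\<^sub>C F (Z \<kappa>) $$ (p, q) = (1 / \<kappa>) ^ length (e p) *\<^sub>C F (Z 1) $$ (p, q)" if "p < M" "q < M" for p q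
  unfolding itw_diag_iff using that by blast
 have leaf: "norm (F (Z 1) $$ (d [], d (l @ [j]))) \<le> (1 / (2 * real n)) ^ N * K" if l: "l \<in> paths n (N - 1)" for l
 proof -
  have lT: "l @ [j] \<in> T" "length (l @ [j]) = N" using l ij N by (auto simp: paths_def T_def)
  have "F (Z 1) $$ (d [], d (l @ [j])) = (1 / \<kappa>) ^ N *\<^sub>C F (Z \<kappa>) $$ (d [], d (l @ [j]))"
   using diag [OF ed(2) [OF ne] ed(2) [OF lT(1)]] unfolding ed(1) [OF ne] ed(1) [OF lT(1)] lT(2)
   by (simp add: scaleC_one)
  also have "norm \<dots> \<le> (1 / (2 * real n)) ^ N * K"
   unfolding norm_scaleC
  proof (rule mult_mono)
   show "norm (F (Z \<kappa>) $$ (d [], d (l @ [j]))) \<le> K"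
    using norm_F_entry [OF Z Zsm [OF small(2)] ed(2) [OF ne] ed(2) [OF lT(1)]] .
  qed (auto simp: \<kappa>_def norm_power norm_divide norm_mult)
  finally show ?thesis .
 qed
 have "norm (\<Sum>l\<in>paths n (N - 1). F (Z 1) $$ (d [], d (l @ [j]))) \<le> (\<Sum>l\<in>paths n (N - 1). (1 / (2 * real n)) ^ N * K)"
  by (intro order_trans [OF norm_sum] sum_mono leaf)
 also have "\<dots> = real n ^ (N - 1) * ((1 / (2 * real n)) ^ N * K)" by (simp add: card_paths)
 also have "\<dots> \<le> real n ^ N * ((1 / (2 * real n)) ^ N * K)"
  using n K_nonneg by (intro mult_right_mono power_increasing) auto
 also have "\<dots> = K / 2 ^ N" using n by (simp add: power_divide power_mult_distrib field_simps)
 finally show ?thesis unfolding eq .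
qed

lemma walk_sums:
 assumes c: "c \<in> carrier_mat n n" "mat_norm c * (real (n + n * n) * (2 * real n)) < r" and ij: "i < n" "j < n"
  and F0: "F (0\<^sub>m 1 1) = 0\<^sub>m 1 1"
 shows "(\<lambda>k. \<Sum>l\<in>paths n k. coef (walk c i (l @ [j]))) sums (F c $$ (i, j))"
proof -
 define S where "S N = (\<Sum>k<N. \<Sum>l\<in>paths n k. coef (walk c i (l @ [j])))" for N
 have "(\<lambda>N. K * (1/2) ^ Suc N) \<longlonglongrightarrow> K * 0"
  by (intro tendsto_mult tendsto_const LIMSEQ_Suc LIMSEQ_realpow_zero) auto
 then have lim: "(\<lambda>N. K / 2 ^ Suc N) \<longlonglongrightarrow> 0" by (simp add: field_simps)
 have "\<forall>N. norm (F c $$ (i, j) - S N) \<le> K / 2 ^ Suc N"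
  using walk_expansion [OF c ij _ F0, of "Suc _"] by (simp add: S_def)
 then have "(\<lambda>N. F c $$ (i, j) - S N) \<longlonglongrightarrow> 0"
  by (rule Lim_null_comparison [OF always_eventually lim])
 then have "(\<lambda>N. F c $$ (i, j) - (F c $$ (i, j) - S N)) \<longlonglongrightarrow> F c $$ (i, j) - 0"
  by (intro tendsto_diff tendsto_const)
 then show ?thesis by (simp add: sums_def S_def [abs_def])
qed

end

section \<open>The linear map with given moments\<close>

context nc_germ
begin

lemma moment_map_exists:
 obtains \<sigma> where "\<And>p q. \<sigma> (p + q) = \<sigma> p + \<sigma> q" "\<And>c p. \<sigma> (c *\<^sub>C p) = c *\<^sub>C \<sigma> p"
  "\<And>bs. bs \<noteq> [] ==> \<sigma> (nc_word bs) = coef bs"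
 using word_functional_extends [of coef, OF coef_add coef_homogeneous] by metis

lemma exponentially_bounded_moments:
 assumes word: "\<And>bs. bs \<noteq> [] ==> \<sigma> (nc_word bs) = coef bs"
 shows "exponentially_bounded \<sigma>"
 unfolding exponentially_bounded_def
proof (intro exI [of _ "(2 / r) * (1 + K * (2 / r))"] allI impI)
 fix n :: nat and b :: "nat => 'b" assume n: "n \<ge> 1"
 define R where "R = 2 / r"
 have R: "R > 0" using r by (simp add: R_def)
 have KR: "K * R \<ge> 0" using K_nonneg R by simp
 have "1 + K * R \<le> (1 + K * R) ^ n" using KR n power_increasing [of 1 n "1 + K * R"] by simp
 then have "K * R \<le> (1 + K * R) ^ n" by simp
 then have "K * R * R ^ n \<le> (1 + K * R) ^ n * R ^ n" using R by (intro mult_right_mono) auto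
 then have c: "K * R ^ Suc n \<le> (R * (1 + K * R)) ^ n" by (simp add: power_mult_distrib mult_ac)
 have p: "(\<Prod>b\<leftarrow>map b [0..<Suc n]. norm b) = (\<Prod>i\<le>n. norm (b i))"
  by (induction n) (simp_all add: mult.commute)
 have "norm (\<sigma> (nc_monomial b n)) \<le> K * R ^ Suc n * (\<Prod>i\<le>n. norm (b i))"
  using norm_coef_le [of "map b [0..<Suc n]"] unfolding nc_monomial_eq_nc_word p [symmetric]
  by (subst word) (simp_all add: R_def del: upt_Suc)
 also have "\<dots> \<le> (R * (1 + K * R)) ^ n * (\<Prod>i\<le>n. norm (b i))"
  using c by (intro mult_right_mono prod_nonneg) auto
 finally show "norm (\<sigma> (nc_monomial b n)) \<le> (2 / r * (1 + K * (2 / r))) ^ n * (\<Prod>i\<le>n. norm (b i))"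
  by (simp add: R_def)
qed

lemma cauchy_term_walks:
 assumes lin: "\<And>p q. \<sigma> (p + q) = \<sigma> p + \<sigma> q" "\<And>c p. \<sigma> (c *\<^sub>C p) = c *\<^sub>C \<sigma> p"
  and word: "\<And>bs. bs \<noteq> [] ==> \<sigma> (nc_word bs) = coef bs"
  and b: "b \<in> carrier_mat n n" "mat_inv b \<in> carrier_mat n n" and ij: "i < n" "j < n"
 shows "cauchy_term \<sigma> b k $$ (i, j) = (\<Sum>l\<in>paths n k. coef (walk (mat_inv b) i (l @ [j])))"
proof -
 have s0: "\<sigma> 0 = 0" using lin(1) [of 0 0] by simp
 have sum: "\<sigma> (sum f A) = (\<Sum>x\<in>A. \<sigma> (f x))" for f and A :: "nat list set"
  by (induction A rule: infinite_finite_induct) (simp_all add: s0 lin)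
 define A where "A = map_mat nc_const (mat_inv b) * (nc_X \<cdot>\<^sub>m 1\<^sub>m n)"
 have A: "A \<in> carrier_mat n n" using b by (simp add: A_def)
 have c: "map_mat nc_const (mat_inv b) \<in> carrier_mat n n" using b by simp
 have "A ^\<^sub>m k * map_mat nc_const (mat_inv b) \<in> carrier_mat n n"
  by (rule mult_carrier_mat [OF pow_carrier_mat [OF A] c])
 then have "cauchy_term \<sigma> b k $$ (i, j) = \<sigma> ((A ^\<^sub>m k * map_mat nc_const (mat_inv b)) $$ (i, j))"
  using b ij unfolding cauchy_term_def Let_def A_def by (simp del: index_mult_mat(1))
 also have "\<dots> = (\<Sum>l\<in>paths n k. \<sigma> (nc_word (walk (mat_inv b) i (l @ [j]))))"
  unfolding A_def cauchy_product_walks [OF b(2) ij] sum ..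
 also have "\<dots> = (\<Sum>l\<in>paths n k. coef (walk (mat_inv b) i (l @ [j])))"
  by (intro sum.cong refl word) (simp flip: length_0_conv)
 finally show ?thesis .
qed

lemma continues_moment_series:
 assumes lin: "\<And>p q. \<sigma> (p + q) = \<sigma> p + \<sigma> q" "\<And>c p. \<sigma> (c *\<^sub>C p) = c *\<^sub>C \<sigma> p"
  and word: "\<And>bs. bs \<noteq> [] ==> \<sigma> (nc_word bs) = coef bs"
  and F0: "F (0\<^sub>m 1 1) = 0\<^sub>m 1 1" and n: "n \<ge> 1"
  and G: "mat_analytic_on n (Mplus n) G"
  and FG: "\<And>b. b \<in> Mplus n ==> mat_norm (mat_inv b) < r ==> F (mat_inv b) = G b"
 shows "continues_cauchy_series \<sigma> n G"
 unfolding continues_cauchy_series_def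
proof (intro conjI G)
 define w where "w = real (n + n * n) * (2 * real n)"
 have "1 \<le> (n + n * n) * (2 * n)" using n by simp
 then have "1 \<le> real ((n + n * n) * (2 * n))" by linarith
 then have w: "1 \<le> w" by (simp add: w_def)
 show "\<exists>\<delta>>0. \<forall>b\<in>Mplus n. mat_norm (mat_inv b) < \<delta> -->
   (\<forall>i<n. \<forall>j<n. (\<lambda>k. cauchy_term \<sigma> b k $$ (i, j)) sums (G b $$ (i, j)))"
 proof (intro exI [of _ "r / w"] conjI ballI impI allI)
  show "r / w > 0" using r w by simp
  fix b :: "'b mat" and i j assume b: "b \<in> Mplus n" "mat_norm (mat_inv b) < r / w" and ij: "i < n" "j < n"
  obtain c where c: "c \<in> carrier_mat n n" "mat_inv b = c" using Mplus_inverse [OF b(1)] by metis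
  have bc: "b \<in> carrier_mat n n" using b by (auto simp: Mplus_def)
  have cw: "mat_norm c * w < r" using b(2) w unfolding c(2) by (simp add: less_divide_eq)
  have "mat_norm c * 1 \<le> mat_norm c * w" using w by (intro mult_left_mono) auto
  then have "F c = G b" using FG [OF b(1)] cw c by simp
  then show "(\<lambda>k. cauchy_term \<sigma> b k $$ (i, j)) sums (G b $$ (i, j))"
   using walk_sums [OF c(1) _ ij F0] cw c(1) cauchy_term_walks [OF lin word bc _ ij] unfolding c(2) w_def by simp
 qed
qed

end

section \<open>Products of monomials\<close>

text \<open>
 The two inner coefficients of \<open>as\<close> times the adjoint of \<open>bs\<close> merge into one letter.
\<close>

definition join_word :: "'b::cstar_algebra list => 'b list => 'b list" where
 "join_word as bs = butlast as @ (last as * star (last bs)) # rev (map star (butlast bs))"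

lemma star_nc_word: "star (nc_word bs) = nc_word (rev (map star (bs :: 'b::cstar_algebra list)))"
proof (induction bs)
 case (Cons b bs)
 show ?case
 proof (cases "bs = []")
  case True
  then show ?thesis by (simp add: star_nc_const)
 next
  case False
  then show ?thesis using Cons by (simp add: nc_word_Cons nc_word_append star_mult star_nc_const star_nc_X mult.assoc)
 qed
qed simp

lemma nc_word_snoc_mult_Cons: "nc_word (as @ [x]) * nc_word (y # bs) = nc_word (as @ (x * y) # bs)"
proof -
 have 1: "nc_word [x] * nc_word (y # bs) = nc_word ((x * y) # bs)"
  by (cases "bs = []") (simp_all add: nc_word_Cons nc_const_mult mult.assoc)
 then show ?thesis by (cases "as = []") (simp_all add: nc_word_append mult.assoc)
qed

lemma nc_word_mult_star:
 assumes "as \<noteq> []" "bs \<noteq> []"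
 shows "nc_word as * star (nc_word bs) = nc_word (join_word as bs)"
proof -
 obtain as' x where as: "as = as' @ [x]" using assms(1) by (cases as rule: rev_cases) auto
 obtain bs' y where bs: "bs = bs' @ [y]" using assms(2) by (cases bs rule: rev_cases) auto
 show ?thesis
  by (simp add: as bs star_nc_word join_word_def nc_word_snoc_mult_Cons)
qed

text \<open>Conjugation with a scalar matrix.\<close>

lemma mat_pos_kernel:
 fixes M :: "nat => nat => 'b::cstar_algebra" and c :: "nat => nat => complex"
 assumes "mat_pos (mat m m (\<lambda>(a, b). M a b))"
 shows "mat_pos (mat n n (\<lambda>(i, j). \<Sum>a<m. \<Sum>b<m. (c i a * cnj (c j b)) *\<^sub>C M a b))"
proof -
 define V where "V = (mat m n (\<lambda>(a, i). cnj (c i a) *\<^sub>C 1) :: 'b mat)"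
 let ?M = "mat m m (\<lambda>(a, b). M a b)"
 have V: "V \<in> carrier_mat m n" "mat_star V \<in> carrier_mat n m" by (simp_all add: V_def)
 have M: "?M \<in> carrier_mat m m" by simp
 have SM: "mat_star V * ?M \<in> carrier_mat n m" by (rule mult_carrier_mat [OF V(2) M])
 have e1: "(mat_star V * ?M) $$ (i, b) = (\<Sum>a<m. c i a *\<^sub>C M a b)" if "i < n" "b < m" for i b
  using that V by (simp add: index_mult_mat' V_def star_scaleC mult_scaleC_left del: index_mult_mat(1))
 have "mat_star V * ?M * V = mat n n (\<lambda>(i, j). \<Sum>a<m. \<Sum>b<m. (c i a * cnj (c j b)) *\<^sub>C M a b)" (is "_ = ?R")
 proof (rule eq_matI)
  fix i j assume "i < dim_row ?R" "j < dim_col ?R"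
  then have ij: "i < n" "j < n" by auto
  have "(mat_star V * ?M * V) $$ (i, j) = (\<Sum>b<m. (mat_star V * ?M) $$ (i, b) * V $$ (b, j))"
   using index_mult_mat' [of i "mat_star V * ?M" j V] SM V ij by (simp del: index_mult_mat(1))
  also have "\<dots> = (\<Sum>b<m. \<Sum>a<m. (c i a * cnj (c j b)) *\<^sub>C M a b)"
  proof (rule sum.cong [OF refl])
   fix b assume b: "b \<in> {..<m}"
   then have "V $$ (b, j) = cnj (c j b) *\<^sub>C 1" using ij by (simp add: V_def)
   then show "(mat_star V * ?M) $$ (i, b) * V $$ (b, j) = (\<Sum>a<m. (c i a * cnj (c j b)) *\<^sub>C M a b)"
    using b e1 [OF ij(1), of b] by (simp add: mult_scaleC_right scaleC_sum_right scaleC_scaleC mult.commute del: index_mult_mat(1))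
  qed
  also have "\<dots> = (\<Sum>a<m. \<Sum>b<m. (c i a * cnj (c j b)) *\<^sub>C M a b)" by (rule sum.swap)
  finally show "(mat_star V * ?M * V) $$ (i, j) = ?R $$ (i, j)" using ij by simp
 qed (use V in auto)
 then show ?thesis using mat_pos_congruence [OF assms M V(1)] by simp
qed

section \<open>Positivity\<close>

lemma eventually_mat_norm_less:
 fixes A :: "nat => 'b::cstar_algebra mat"
 assumes "\<And>k. A k \<in> carrier_mat n n" "L \<in> carrier_mat n n"
  and "\<And>i j. i < n ==> j < n ==> (\<lambda>k. A k $$ (i, j)) \<longlonglongrightarrow> L $$ (i, j)" and "mat_norm L < r"
 shows "\<forall>\<^sub>F k in sequentially. mat_norm (A k) < r"
proof -
 have "\<forall>\<^sub>F k in sequentially. mat_norm (A k - L) < r - mat_norm L"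
  using assms(4) by (intro order_tendstoD(2) [OF mat_norm_entries_tendsto [OF assms(1-3)]]) auto
 then show ?thesis
 proof eventually_elim
  case (elim k)
  then show ?case using mat_norm_le_of_diff(2) [OF assms(1,2), of k] by linarith
 qed
qed

lemma mat_pos_rescale:
 fixes M :: "nat => nat => 'b::cstar_algebra"
 assumes "mat_pos (mat n n (\<lambda>(p, q). M p q))"
 shows "mat_pos (mat n n (\<lambda>(p, q). complex_of_real (c p * c q) *\<^sub>C M p q))"
proof -
 have "(\<Sum>a<n. \<Sum>b<n. ((if a = p then complex_of_real (c p) else 0) * cnj (if b = q then complex_of_real (c q) else 0)) *\<^sub>C M a b)
  = complex_of_real (c p * c q) *\<^sub>C M p q" if "p < n" "q < n" for p q
 proof -
  have "(\<Sum>a<n. \<Sum>b<n. ((if a = p then complex_of_real (c p) else 0) * cnj (if b = q then complex_of_real (c q) else 0)) *\<^sub>C M a b)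
   = (\<Sum>a<n. \<Sum>b<n. if b = q then if a = p then complex_of_real (c p * c q) *\<^sub>C M p q else 0 else 0)"
   by (intro sum.cong refl) auto
  then show ?thesis using that by simp
 qed
 then have "mat n n (\<lambda>(p, q). \<Sum>a<n. \<Sum>b<n. ((if a = p then complex_of_real (c p) else 0)
   * cnj (if b = q then complex_of_real (c q) else 0)) *\<^sub>C M a b) = mat n n (\<lambda>(p, q). complex_of_real (c p * c q) *\<^sub>C M p q)"
  by (intro eq_matI) auto
 then show ?thesis using mat_pos_kernel [OF assms, of n "\<lambda>p a. if a = p then complex_of_real (c p) else 0"] by simp
qed

text \<open>An intertwiner from the right column \<open>(a, b)\<close> of a two-by-two block matrix.\<close>

lemma itw_column_iff:
 fixes x y :: "'b::complex_star_algebra mat"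
 shows "itw (n + n) n x (\<lambda>p q. if p = q then a else if p = q + n then b else 0) y \<longleftrightarrow>
  (\<forall>p<n + n. \<forall>q<n. a *\<^sub>C x $$ (p, q) + b *\<^sub>C x $$ (p, q + n) = (if p < n then a *\<^sub>C y $$ (p, q) else b *\<^sub>C y $$ (p - n, q)))"
proof -
 let ?S = "\<lambda>p q. if p = q then a else if p = q + n then b else 0"
 have L: "(\<Sum>l<n + n. ?S l q *\<^sub>C x $$ (p, l)) = a *\<^sub>C x $$ (p, q) + b *\<^sub>C x $$ (p, q + n)" if "q < n" for p q
 proof -
  have "(\<Sum>l<n + n. ?S l q *\<^sub>C x $$ (p, l)) = (\<Sum>l<n. ?S l q *\<^sub>C x $$ (p, l)) + (\<Sum>l<n. ?S (l + n) q *\<^sub>C x $$ (p, l + n))"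
   by (rule sum_lessThan_add_split)
  also have "(\<Sum>l<n. ?S l q *\<^sub>C x $$ (p, l)) = (\<Sum>l<n. if l = q then a *\<^sub>C x $$ (p, q) else 0)"
   using that by (intro sum.cong) auto
  also have "(\<Sum>l<n. ?S (l + n) q *\<^sub>C x $$ (p, l + n)) = (\<Sum>l<n. if l = q then b *\<^sub>C x $$ (p, q + n) else 0)"
   using that by (intro sum.cong) auto
  finally show ?thesis using that by simp
 qed
 have R: "(\<Sum>l<n. ?S p l *\<^sub>C y $$ (l, q)) = (if p < n then a *\<^sub>C y $$ (p, q) else b *\<^sub>C y $$ (p - n, q))" if "p < n + n" for p q
 proof (cases "p < n")
  case True
  have "(\<Sum>l<n. ?S p l *\<^sub>C y $$ (l, q)) = (\<Sum>l<n. if l = p then a *\<^sub>C y $$ (p, q) else 0)"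
   using True by (intro sum.cong) auto
  then show ?thesis using True by simp
 next
  case False
  have "(\<Sum>l<n. ?S p l *\<^sub>C y $$ (l, q)) = (\<Sum>l<n. if l = p - n then b *\<^sub>C y $$ (p - n, q) else 0)"
   using False by (intro sum.cong) auto
  moreover have "p - n < n" using False that by linarith
  ultimately show ?thesis using False by simp
 qed
 show ?thesis unfolding itw_def using L R by simp
qed

context nc_germ
begin

lemma F_tendsto:
 assumes an: "mat_analytic_on n (ncball r \<inter> carrier_mat n n) F"
  and A: "\<And>k. A k \<in> carrier_mat n n" "L \<in> carrier_mat n n" "n \<ge> 1" "mat_norm L < r"
  and lim: "\<And>i j. i < n ==> j < n ==> (\<lambda>k. A k $$ (i, j)) \<longlonglongrightarrow> L $$ (i, j)" and ij: "i < n" "j < n"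
 shows "(\<lambda>k. F (A k) $$ (i, j)) \<longlonglongrightarrow> F L $$ (i, j)"
proof -
 have L: "L \<in> ncball r \<inter> carrier_mat n n" using ball A by blast
 have "\<exists>\<Lambda>. mat_clinear n \<Lambda> \<and> (\<exists>C. \<forall>h \<in> carrier_mat n n. mat_norm (\<Lambda> h) \<le> C * mat_norm h) \<and>
   (\<forall>e>0. \<exists>d>0. \<forall>h \<in> carrier_mat n n. mat_norm h < d \<and> L + h \<in> ncball r \<inter> carrier_mat n n -->
        mat_norm (F (L + h) - F L - \<Lambda> h) \<le> e * mat_norm h)"
  using an L unfolding mat_analytic_on_def by blast
 then obtain \<Lambda> C where \<Lambda>: "mat_clinear n \<Lambda>" and C: "\<And>h. h \<in> carrier_mat n n ==> mat_norm (\<Lambda> h) \<le> C * mat_norm h"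
  and E: "\<forall>e>0. \<exists>d>0. \<forall>h \<in> carrier_mat n n. mat_norm h < d \<and> L + h \<in> ncball r \<inter> carrier_mat n n -->
        mat_norm (F (L + h) - F L - \<Lambda> h) \<le> e * mat_norm h" by blast
 have "\<exists>d>0. \<forall>h \<in> carrier_mat n n. mat_norm h < d \<and> L + h \<in> ncball r \<inter> carrier_mat n n -->
        mat_norm (F (L + h) - F L - \<Lambda> h) \<le> 1 * mat_norm h" by (rule E [THEN spec, THEN mp]) simp
 then obtain d where d: "d > 0" "\<And>h. h \<in> carrier_mat n n ==> mat_norm h < d ==> L + h \<in> ncball r ==>
   mat_norm (F (L + h) - F L - \<Lambda> h) \<le> mat_norm h" by auto
 have FL: "F L \<in> carrier_mat n n" using F_carrier A by blast
 have z: "(\<lambda>k. mat_norm (A k - L)) \<longlonglongrightarrow> 0" by (rule mat_norm_entries_tendsto [OF A(1,2) lim])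
 then have z': "(\<lambda>k. (1 + C) * mat_norm (A k - L)) \<longlonglongrightarrow> (1 + C) * 0" by (intro tendsto_intros)
 have "\<forall>\<^sub>F k in sequentially. mat_norm (A k - L) < d" using d(1) by (intro order_tendstoD(2) [OF z])
 moreover have "\<forall>\<^sub>F k in sequentially. mat_norm (A k) < r" by (rule eventually_mat_norm_less [OF A(1,2) lim A(4)])
 ultimately have "\<forall>\<^sub>F k in sequentially. norm (F (A k) $$ (i, j) - F L $$ (i, j)) \<le> (1 + C) * mat_norm (A k - L)"
 proof eventually_elim
  case (elim k)
  define h where "h = A k - L"
  have h: "h \<in> carrier_mat n n" using A by (simp add: h_def minus_carrier_mat)
  have e: "L + h = A k" unfolding h_def using A(1) [of k] A(2) by (intro eq_matI) auto
  have Fk: "F (A k) \<in> carrier_mat n n" using F_carrier [OF A(1,3)] elim by blast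
  have \<Lambda>h: "\<Lambda> h \<in> carrier_mat n n" using \<Lambda> h unfolding mat_clinear_def by blast
  have 1: "mat_norm (F (A k) - F L - \<Lambda> h) \<le> mat_norm h"
   using d(2) [OF h] ball [OF A(1,3)] elim unfolding e by (simp add: h_def)
  have "norm (F (A k) $$ (i, j) - F L $$ (i, j)) = norm ((F (A k) - F L - \<Lambda> h) $$ (i, j) + \<Lambda> h $$ (i, j))"
   using Fk FL \<Lambda>h ij by simp
  also have "\<dots> \<le> mat_norm (F (A k) - F L - \<Lambda> h) + mat_norm (\<Lambda> h)"
   using \<Lambda>h ij FL by (intro order_trans [OF norm_triangle_ineq] add_mono norm_index_le_mat_norm) auto
  also have "\<dots> \<le> mat_norm h + C * mat_norm h" using 1 C [OF h] by (rule add_mono)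
  finally show ?case by (simp add: h_def algebra_simps)
 qed
 then have "(\<lambda>k. F (A k) $$ (i, j) - F L $$ (i, j)) \<longlonglongrightarrow> 0"
  by (rule Lim_null_comparison) (use z' in simp)
 then show ?thesis by (rule LIM_zero_cancel)
qed

text \<open>
 If \<open>X\<close> has imaginary part \<open>- P\<close>, then the corner of \<open>F\<close> at \<open>[[X, P], [0, X*]]\<close> is a difference
 quotient of \<open>F\<close> between \<open>X\<close> and \<open>X*\<close>, and equals \<open>- Im (F X)\<close>.
\<close>

lemma corner_eq_Im:
 assumes herm: "\<And>b. b \<in> ncball r ==> F (mat_star b) = mat_star (F b)"
  and n: "n \<ge> 1" and X: "X \<in> carrier_mat n n" "mat_norm X < r"
  and Y: "Y \<in> carrier_mat (n + n) (n + n)" "mat_norm Y < r"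
  and Yi: "\<And>p q. p < n ==> q < n ==> Y $$ (p, q) = X $$ (p, q)" "\<And>p q. p < n ==> q < n ==> Y $$ (p + n, q) = 0"
   "\<And>p q. p < n ==> q < n ==> Y $$ (p + n, q + n) = star (X $$ (q, p))"
   "\<And>p q. p < n ==> q < n ==> Y $$ (p, q + n) = (1 / (2 * \<i>)) *\<^sub>C (star (X $$ (q, p)) - X $$ (p, q))"
  and pq: "p < n" "q < n"
 shows "F Y $$ (p, q + n) = (- mat_Im (F X)) $$ (p, q)"
proof -
 let ?a = "1 / (2 * \<i>) :: complex"
 have nn: "n + n \<ge> 1" using n by simp
 have XS: "mat_star X \<in> carrier_mat n n" "mat_norm (mat_star X) < r" using X by simp_all
 have FX: "F X \<in> carrier_mat n n" "F (mat_star X) = mat_star (F X)"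
  using F_carrier [OF X(1) n X(2)] herm [OF ball [OF X(1) n X(2)]] by auto
 have "itw (n + n) n Y (\<lambda>p q. if p = q then 1 else if p = q + n then 0 else 0) X"
  unfolding itw_column_iff
 proof (intro allI impI)
  fix p q assume p: "p < n + n" and q: "q < n"
  show "1 *\<^sub>C Y $$ (p, q) + 0 *\<^sub>C Y $$ (p, q + n) = (if p < n then 1 *\<^sub>C X $$ (p, q) else 0 *\<^sub>C X $$ (p - n, q))"
   using Yi(1) [of p q] Yi(2) [of "p - n" q] p q by (auto simp: scaleC_one)
 qed
 then have "itw (n + n) n (F Y) (\<lambda>p q. if p = q then 1 else if p = q + n then 0 else 0) (F X)"
  by (intro F_itw Y X n nn)
 then have 1: "F Y $$ (p, q) = F X $$ (p, q)"
  unfolding itw_column_iff using pq by (auto simp: scaleC_one dest!: spec [of _ p])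
 have "itw (n + n) n Y (\<lambda>p q. if p = q then ?a else if p = q + n then 1 else 0) (mat_star X)"
  unfolding itw_column_iff
 proof (intro allI impI)
  fix p q assume p: "p < n + n" and q: "q < n"
  show "?a *\<^sub>C Y $$ (p, q) + 1 *\<^sub>C Y $$ (p, q + n)
   = (if p < n then ?a *\<^sub>C mat_star X $$ (p, q) else 1 *\<^sub>C mat_star X $$ (p - n, q))"
  proof (cases "p < n")
   case True
   then show ?thesis using q X by (simp add: Yi scaleC_one scaleC_diff_right)
  next
   case False
   then show ?thesis using q X p Yi(2) [of "p - n" q] Yi(3) [of "p - n" q] by (simp add: scaleC_one)
  qed
 qed
 then have "itw (n + n) n (F Y) (\<lambda>p q. if p = q then ?a else if p = q + n then 1 else 0) (F (mat_star X))"
  by (intro F_itw Y XS n nn)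
 then have "?a *\<^sub>C F Y $$ (p, q) + 1 *\<^sub>C F Y $$ (p, q + n) = ?a *\<^sub>C mat_star (F X) $$ (p, q)"
  unfolding itw_column_iff FX(2) using pq by auto
 then have "F Y $$ (p, q + n) = ?a *\<^sub>C mat_star (F X) $$ (p, q) - ?a *\<^sub>C F X $$ (p, q)"
  unfolding 1 by (simp add: scaleC_one algebra_simps)
 then show ?thesis
  using FX(1) pq by (simp add: mat_Im_def scaleC_diff_right)
qed

end

locale positive_germ = nc_germ F r K for F :: "'b::cstar_algebra mat => 'b mat" and r K +
 assumes herm: "\<And>b. b \<in> ncball r ==> F (mat_star b) = mat_star (F b)"
  and an: "\<And>n. n \<ge> 1 ==> mat_analytic_on n (ncball r \<inter> carrier_mat n n) F"
  and neg: "\<And>n b. n \<ge> 1 ==> b \<in> carrier_mat n n ==> mat_norm b < r ==> - b \<in> Mplus n ==> mat_pos (- mat_Im (F b))"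
begin

text \<open>
 The block matrix \<open>Z = [[U, D], [0, U*]]\<close> is the limit, as \<open>t\<close> decreases to \<open>0\<close>, of diagonal conjugates of
 \<open>Y = [[X, P], [0, X*]]\<close>, where \<open>X = t (U + U*) - \<i> P\<close> tends to \<open>0\<close> and \<open>- X\<close> is in the half plane. So
 the corner of \<open>F Z\<close> is a limit of positive diagonal congruences of \<open>- Im (F X)\<close>.
\<close>

lemma block_positive:
 assumes n: "n \<ge> 1" and g: "\<And>p q. p < n ==> q < n ==> U p q \<noteq> 0 ==> g q = Suc (g p)"
  and D: "mat_pos (mat n n (\<lambda>(p, q). D p q))"
  and Z: "Z = mat (n + n) (n + n) (\<lambda>(p, q). if p < n then if q < n then U p q else D p (q - n)
   else if q < n then 0 else star (U (q - n) (p - n)))" "mat_norm Z < r"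
 shows "mat_pos (mat n n (\<lambda>(p, q). F Z $$ (p, q + n)))"
proof -
 define h where "h = Suc (Max (g ` {..<n}))"
 have gh: "g p < h" if "p < n" for p using that by (simp add: h_def less_Suc_eq_le)
 have Dstar: "star (D q p) = D p q" if "p < n" "q < n" for p q
  using arg_cong [OF mat_star_eq_of_mat_pos [OF D], of "\<lambda>M. M $$ (p, q)"] that by simp
 define Q where "Q t p q = D p q + (if p = q then complex_of_real t *\<^sub>C 1 else 0)" for t p q
 define P where "P t p q = complex_of_real (t ^ (h - g p) * t ^ (h - g q)) *\<^sub>C Q t p q" for t p q
 define X where "X t = mat n n (\<lambda>(p, q). complex_of_real t *\<^sub>C (U p q + star (U q p)) - \<i> *\<^sub>C P t p q)" for t
 define Y where "Y t = mat (n + n) (n + n) (\<lambda>(p, q). if p < n then if q < n then X t $$ (p, q) else P t p (q - n)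
   else if q < n then 0 else star (X t $$ (q - n, p - n)))" for t
 define w where "w t p = (if p < n then t ^ g p else t ^ (2 * h) / t ^ g (p - n))" for t :: real and p
 \<comment> \<open>the weights turn the negligible \<open>Y t\<close> into a perturbation of \<open>Z\<close>: the grading of \<open>U\<close> absorbs
  the factor \<open>t\<close>, and the powers in \<open>P\<close> cancel in the corner\<close>
 define A where "A t = mat (n + n) (n + n) (\<lambda>(p, q). complex_of_real (w t p / w t q) *\<^sub>C Y t $$ (p, q))" for t
 have XC: "X t \<in> carrier_mat n n" and YC: "Y t \<in> carrier_mat (n + n) (n + n)" and AC: "A t \<in> carrier_mat (n + n) (n + n)" for t
  by (simp_all add: X_def Y_def A_def)
 have ZC: "Z \<in> carrier_mat (n + n) (n + n)" by (simp add: Z)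
 have nn: "n + n \<ge> 1" using n by simp
 have Pstar: "star (P t q p) = P t p q" if "p < n" "q < n" for t p q
  using that by (simp add: P_def Q_def star_add star_scaleC Dstar mult.commute)
 have Xi: "X t $$ (p, q) = complex_of_real t *\<^sub>C (U p q + star (U q p)) - \<i> *\<^sub>C P t p q" if "p < n" "q < n" for t p q
  using that by (simp add: X_def)
 have ImX: "(1 / (2 * \<i>)) *\<^sub>C (star (X t $$ (q, p)) - X t $$ (p, q)) = P t p q" if "p < n" "q < n" for t p q
 proof -
  have "star (X t $$ (q, p)) - X t $$ (p, q) = (2 * \<i>) *\<^sub>C P t p q"
   using that scaleC_add_left [of \<i> \<i> "P t p q"]
   by (simp add: Xi star_diff star_scaleC star_add star_star Pstar scaleC_minus_left add.commute)
  then show ?thesis by (simp add: scaleC_scaleC scaleC_one)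
 qed
 have XM: "- X t \<in> Mplus n" if t: "t > 0" "t \<le> 1" for t
 proof -
  have "psd (complex_of_real (t - t ^ Suc (2 * g p)) *\<^sub>C (1 :: 'b))" for p
   unfolding scaleR_scaleC [symmetric]
   using t power_decreasing [of 1 "Suc (2 * g p)" t] by (intro psd_scaleR psd_of_real [of 1, simplified]) auto
  then have "mat_pos (mat n n (\<lambda>(p, q). D p q) + mat n n (\<lambda>(p, q). if p = q then complex_of_real (t - t ^ Suc (2 * g p)) *\<^sub>C 1 else 0))"
   by (intro mat_pos_add [of _ _ n] D mat_pos_diagonal) auto
  also have "mat n n (\<lambda>(p, q). D p q) + mat n n (\<lambda>(p, q). if p = q then complex_of_real (t - t ^ Suc (2 * g p)) *\<^sub>C 1 else 0)
   = mat n n (\<lambda>(p, q). D p q + (if p = q then complex_of_real (t - t ^ Suc (2 * g p)) *\<^sub>C 1 else 0))" by (intro eq_matI) auto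
  finally have "mat_pos (mat n n (\<lambda>(p, q). complex_of_real (t ^ (h - g p) * t ^ (h - g q)) *\<^sub>C
   (D p q + (if p = q then complex_of_real (t - t ^ Suc (2 * g p)) *\<^sub>C 1 else 0))))" by (rule mat_pos_rescale)
  also have "mat n n (\<lambda>(p, q). complex_of_real (t ^ (h - g p) * t ^ (h - g q)) *\<^sub>C
   (D p q + (if p = q then complex_of_real (t - t ^ Suc (2 * g p)) *\<^sub>C 1 else 0)))
   = mat_Im (- X t) - of_real (t ^ Suc (2 * h)) \<cdot>\<^sub>m 1\<^sub>m n" (is "?L = ?R")
  proof (rule eq_matI)
   fix p q assume "p < dim_row ?R" "q < dim_col ?R"
   then have pq: "p < n" "q < n" by auto
   have "h - g p + (h - g p) + Suc (2 * g p) = Suc (2 * h)" using gh [OF pq(1)] by simp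
   then have "t ^ (h - g p) * t ^ (h - g p) * t ^ Suc (2 * g p) = t ^ Suc (2 * h)" by (metis power_add)
   then have "complex_of_real (t ^ (h - g p) * t ^ (h - g q)) *\<^sub>C (D p q + (if p = q then complex_of_real (t - t ^ Suc (2 * g p)) *\<^sub>C 1 else 0))
    = P t p q - (if p = q then of_real (t ^ Suc (2 * h)) else 0)"
    by (cases "p = q") (simp_all only: P_def Q_def of_real_eq_scaleC [where 'c = 'b] scaleC_add_right scaleC_scaleC
     of_real_mult [symmetric] right_diff_distrib of_real_diff scaleC_diff_left if_True if_False scaleC_diff_right simp_thms add_diff_eq add_0_right diff_0_right scaleC_zero_right)
   also have "P t p q = mat_Im (- X t) $$ (p, q)"
    using pq XC [of t] by (simp add: mat_Im_def star_minus flip: ImX)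
   finally show "?L $$ (p, q) = ?R $$ (p, q)" using pq XC [of t] by (simp add: mat_Im_def)
  qed (use XC [of t] in \<open>auto simp: mat_Im_def\<close>)
  finally have "mat_pos (mat_Im (- X t) - of_real (t ^ Suc (2 * h)) \<cdot>\<^sub>m 1\<^sub>m n)" .
  moreover have "t ^ Suc (2 * h) \<in> {0<..}" using t by simp
  moreover have "- X t \<in> carrier_mat n n" using XC by simp
  ultimately show ?thesis unfolding Mplus_def by blast
 qed
 have conj: "itw (n + n) (n + n) (A t) (\<lambda>p q. if p = q then complex_of_real (w t p) else 0) (Y t)" if t: "t > 0" for t
  unfolding itw_diag_iff using t by (simp add: A_def scaleC_scaleC w_def)
 have AX: "A t $$ (p, q) = U p q + complex_of_real (t\<^sup>2) *\<^sub>C star (U q p) - \<i> *\<^sub>C complex_of_real (t ^ (2 * (h - g q))) *\<^sub>C Q t p q"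
  if t: "t > 0" and pq: "p < n" "q < n" for t p q
 proof -
  let ?c = "complex_of_real (t ^ g p / t ^ g q)"
  have "g q + (h - g q) = g p + (h - g p)" using gh [OF pq(1)] gh [OF pq(2)] by simp
  then have "t ^ g q * t ^ (h - g q) = t ^ g p * t ^ (h - g p)" by (metis power_add)
  then have "t ^ g p / t ^ g q * (t ^ (h - g p) * t ^ (h - g q)) = t ^ (2 * (h - g q))"
   using t by (simp add: field_simps mult_2 power_add)
  then have 1: "?c *\<^sub>C P t p q = complex_of_real (t ^ (2 * (h - g q))) *\<^sub>C Q t p q"
   by (simp only: P_def scaleC_scaleC of_real_mult [symmetric])
  have 2: "(?c * complex_of_real t) *\<^sub>C U p q = U p q"
   using g [OF pq] t by (cases "U p q = 0") (auto simp: scaleC_one)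
  have 3: "(?c * complex_of_real t) *\<^sub>C star (U q p) = complex_of_real (t\<^sup>2) *\<^sub>C star (U q p)"
   using g [OF pq(2,1)] t by (cases "U q p = 0") (auto simp: power2_eq_square)
  have "A t $$ (p, q) = (?c * complex_of_real t) *\<^sub>C U p q + (?c * complex_of_real t) *\<^sub>C star (U q p) - \<i> *\<^sub>C ?c *\<^sub>C P t p q"
   using pq by (simp add: A_def Y_def w_def Xi scaleC_add_right scaleC_diff_right scaleC_scaleC mult.commute)
  then show ?thesis unfolding 1 2 3 .
 qed
 have AQ: "A t $$ (p, q + n) = Q t p q" if t: "t > 0" and pq: "p < n" "q < n" for t p q
 proof -
  have "2 * h = g p + (h - g p) + (g q + (h - g q))" using gh [OF pq(1)] gh [OF pq(2)] by simp
  then have "t ^ (2 * h) = t ^ g p * t ^ (h - g p) * (t ^ g q * t ^ (h - g q))" by (metis power_add)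
  then have "w t p / w t (q + n) * (t ^ (h - g p) * t ^ (h - g q)) = 1" using t pq by (simp add: w_def field_simps)
  then have "complex_of_real (w t p / w t (q + n) * (t ^ (h - g p) * t ^ (h - g q))) *\<^sub>C Q t p q = Q t p q"
   by (simp only: of_real_1 scaleC_one)
  then show ?thesis using pq by (simp only: of_real_mult) (simp add: A_def Y_def P_def scaleC_scaleC)
 qed
 have AS: "A t $$ (p + n, q + n) = star (A t $$ (q, p))" if "t > 0" "p < n" "q < n" for t p q
  using that by (simp add: A_def Y_def w_def star_scaleC)
 define t where "t k = 1 / real (Suc k)" for k
 have t0: "t k > 0" "t k \<le> 1" for k by (simp_all add: t_def)
 have tlim: "t \<longlonglongrightarrow> 0"
  unfolding t_def by (rule LIMSEQ_Suc [OF lim_1_over_n, unfolded o_def])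
 have sc: "(\<lambda>k. z k *\<^sub>C x k) \<longlonglongrightarrow> 0" if "z \<longlonglongrightarrow> 0" "x \<longlonglongrightarrow> y" for z :: "nat => complex" and x and y :: 'b
 proof (rule tendsto_norm_zero_cancel)
  have "(\<lambda>k. cmod (z k) * norm (x k)) \<longlonglongrightarrow> 0 * norm y" by (intro tendsto_intros tendsto_norm_zero that)
  then show "(\<lambda>k. norm (z k *\<^sub>C x k)) \<longlonglongrightarrow> 0" by (simp add: norm_scaleC)
 qed
 have pw: "(\<lambda>k. complex_of_real (t k ^ m) *\<^sub>C x k) \<longlonglongrightarrow> 0" if "m > 0" "x \<longlonglongrightarrow> y" for m x and y :: 'b
  using that by (intro sc [OF _ that(2)] tendsto_of_real [where a = 0, simplified] tendsto_null_power [OF tlim])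
 have iz: "(\<lambda>k. \<i> *\<^sub>C x k) \<longlonglongrightarrow> 0" if "x \<longlonglongrightarrow> 0" for x :: "nat => 'b"
  using tendsto_norm_zero [OF that] by (intro tendsto_norm_zero_cancel [of "\<lambda>k. \<i> *\<^sub>C x k"]) (simp add: norm_scaleC)
 have Qlim: "(\<lambda>k. Q (t k) p q) \<longlonglongrightarrow> D p q" for p q
  unfolding Q_def using tendsto_add [OF tendsto_const [of "D p q"] pw [of 1 "\<lambda>_. 1" 1]] by (cases "p = q") auto
 have Plim: "(\<lambda>k. P (t k) p q) \<longlonglongrightarrow> 0" if "p < n" "q < n" for p q
  unfolding P_def power_add [symmetric] using gh [OF that(1)] by (intro pw [OF _ Qlim]) simp
 have Xlim: "(\<lambda>k. X (t k) $$ (p, q)) \<longlonglongrightarrow> 0" if "p < n" "q < n" for p q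
  unfolding Xi [OF that] using tendsto_diff [OF pw [of 1, OF _ tendsto_const] iz [OF Plim [OF that]]] by simp
 have Ylim: "(\<lambda>k. Y (t k) $$ (p, q)) \<longlonglongrightarrow> 0" if "p < n + n" "q < n + n" for p q
  using that Xlim [of p q] Plim [of p "q - n"] tendsto_star [OF Xlim [of "q - n" "p - n"]]
  by (cases "p < n"; cases "q < n") (simp_all add: Y_def less_diff_conv2)
 have A1: "(\<lambda>k. A (t k) $$ (p, q)) \<longlonglongrightarrow> U p q" if "p < n" "q < n" for p q
 proof -
  have "2 * (h - g q) > 0" using gh [OF that(2)] by simp
  then have "(\<lambda>k. A (t k) $$ (p, q)) \<longlonglongrightarrow> U p q + 0 - 0"
   unfolding AX [OF t0(1) that] by (intro tendsto_diff tendsto_add tendsto_const iz pw [OF _ Qlim] pw [OF _ tendsto_const]) auto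
  then show ?thesis by simp
 qed
 have Alim: "(\<lambda>k. A (t k) $$ (p, q)) \<longlonglongrightarrow> Z $$ (p, q)" if "p < n + n" "q < n + n" for p q
 proof -
  consider "p < n" "q < n" | "p < n" "n \<le> q" | "n \<le> p" "q < n" | "n \<le> p" "n \<le> q" by linarith
  then show ?thesis
  proof cases
   case 1
   then show ?thesis using A1 [of p q] by (simp add: Z)
  next
   case 2
   then show ?thesis using that Qlim AQ [OF t0(1), of p "q - n"] by (simp add: Z)
  next
   case 3
   then show ?thesis using that by (simp add: A_def Y_def Z)
  next
   case 4
   then show ?thesis
    using that tendsto_star [OF A1 [of "q - n" "p - n"]] AS [OF t0(1), of "p - n" "q - n"] by (simp add: Z)
  qed
 qed
 have "\<forall>\<^sub>F k in sequentially. mat_norm (X (t k)) < r \<and> mat_norm (Y (t k)) < r \<and> mat_norm (A (t k)) < r"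
  by (intro eventually_conj eventually_mat_norm_less [OF XC zero_carrier_mat] eventually_mat_norm_less [OF YC zero_carrier_mat]
    eventually_mat_norm_less [OF AC ZC]) (use Xlim Ylim Alim Z r in auto)
 then obtain N where N: "\<And>k. k \<ge> N ==> mat_norm (X (t k)) < r \<and> mat_norm (Y (t k)) < r \<and> mat_norm (A (t k)) < r"
  unfolding eventually_sequentially by blast
 show ?thesis
 proof (rule mat_pos_limit [where n = n and A = "\<lambda>k. mat n n (\<lambda>(p, q). F (A (t (k + N))) $$ (p, q + n))"])
  fix k
  define s where "s = t (k + N)"
  have s: "s > 0" "mat_norm (X s) < r" "mat_norm (Y s) < r" "mat_norm (A s) < r" "s \<le> 1" using N [of "k + N"] t0 by (auto simp: s_def)
  have pos: "mat_pos (- mat_Im (F (X s)))" by (rule neg [OF n XC s(2) XM [OF s(1,5)]])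
  have FX: "F (X s) \<in> carrier_mat n n" by (rule F_carrier [OF XC n s(2)])
  have "- mat_Im (F (X s)) = mat n n (\<lambda>(p, q). (- mat_Im (F (X s))) $$ (p, q))"
   using FX by (intro eq_matI) (auto simp: mat_Im_def)
  then have "mat_pos (mat n n (\<lambda>(p, q). (- mat_Im (F (X s))) $$ (p, q)))" using pos by simp
  note mat_pos_rescale [OF this, of "\<lambda>p. s ^ g p / s ^ h"]
  also have "mat n n (\<lambda>(p, q). complex_of_real (s ^ g p / s ^ h * (s ^ g q / s ^ h)) *\<^sub>C (- mat_Im (F (X s))) $$ (p, q))
   = mat n n (\<lambda>(p, q). F (A s) $$ (p, q + n))"
  proof (rule eq_matI; simp only: dim_row_mat dim_col_mat index_mat split)
   fix p q assume pq: "p < n" "q < n"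
   have "itw (n + n) (n + n) (F (A s)) (\<lambda>p q. if p = q then complex_of_real (w s p) else 0) (F (Y s))"
    by (rule F_itw [OF AC YC nn nn s(4,3) conj [OF s(1)]])
   then have dd: "complex_of_real (w s (q + n)) *\<^sub>C F (A s) $$ (p, q + n) = complex_of_real (w s p) *\<^sub>C F (Y s) $$ (p, q + n)"
    unfolding itw_diag_iff using pq by simp
   have FY: "F (Y s) $$ (p, q + n) = (- mat_Im (F (X s))) $$ (p, q)"
   proof (rule corner_eq_Im [OF herm n XC s(2) YC s(3)])
    show "Y s $$ (p, q + n) = (1 / (2 * \<i>)) *\<^sub>C (star (X s $$ (q, p)) - X s $$ (p, q))" if "p < n" "q < n" for p q
     unfolding ImX [OF that] using that by (simp add: Y_def)
   qed (use pq in \<open>simp_all add: Y_def\<close>)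
   have w0: "w s (q + n) \<noteq> 0" using s pq by (simp add: w_def)
   have ww: "s ^ g p / s ^ h * (s ^ g q / s ^ h) = w s p / w s (q + n)"
    using pq by (simp add: w_def mult_2 power_add)
   have "complex_of_real (w s p / w s (q + n)) *\<^sub>C (- mat_Im (F (X s))) $$ (p, q)
    = (1 / complex_of_real (w s (q + n))) *\<^sub>C (complex_of_real (w s p) *\<^sub>C F (Y s) $$ (p, q + n))"
    by (simp add: FY scaleC_scaleC)
   also have "\<dots> = F (A s) $$ (p, q + n)" using w0 by (simp add: scaleC_scaleC scaleC_one flip: dd)
   finally show "complex_of_real (s ^ g p / s ^ h * (s ^ g q / s ^ h)) *\<^sub>C (- mat_Im (F (X s))) $$ (p, q) = F (A s) $$ (p, q + n)"
    unfolding ww .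
  qed
  finally show "mat_pos (mat n n (\<lambda>(p, q). F (A (t (k + N))) $$ (p, q + n)))" unfolding s_def .
 next
  fix p q assume pq: "p < n" "q < n"
  have "(\<lambda>k. F (A (t k)) $$ (p, q + n)) \<longlonglongrightarrow> F Z $$ (p, q + n)"
   by (rule F_tendsto [OF an [OF nn] AC ZC nn Z(2) Alim]) (use pq in auto)
  then have "(\<lambda>k. F (A (t (k + N))) $$ (p, q + n)) \<longlonglongrightarrow> F Z $$ (p, q + n)" by (rule LIMSEQ_ignore_initial_segment)
  then show "(\<lambda>k. mat n n (\<lambda>(p, q). F (A (t (k + N))) $$ (p, q + n)) $$ (p, q)) \<longlonglongrightarrow> mat n n (\<lambda>(p, q). F Z $$ (p, q + n)) $$ (p, q)"
   using pq by simp
 qed simp_all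
qed

end

context nc_germ
begin

lemma coef_join_word_scale:
 assumes "as \<noteq> []" "bs \<noteq> []"
 shows "coef (join_word (map (scaleC (complex_of_real t)) as) (map (scaleC (complex_of_real t)) bs))
  = complex_of_real (t ^ length as * t ^ length bs) *\<^sub>C coef (join_word as bs)"
proof -
 obtain xs x where as: "as = xs @ [x]" using assms(1) by (cases as rule: rev_cases) auto
 obtain ys y where bs: "bs = ys @ [y]" using assms(2) by (cases bs rule: rev_cases) auto
 let ?z = "complex_of_real t"
 let ?w = "xs @ (?z *\<^sub>C (x * star y)) # rev (map star ys)"
 have "join_word (map (scaleC ?z) as) (map (scaleC ?z) bs) = map (scaleC ?z) ?w"
  by (simp add: as bs join_word_def star_scaleC mult_scaleC_left mult_scaleC_right scaleC_scaleC rev_map o_def)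
 then have "coef (join_word (map (scaleC ?z) as) (map (scaleC ?z) bs)) = ?z ^ length ?w *\<^sub>C coef ?w"
  using coef_map_scale [of "[]" "\<lambda>_. ?z" ?w] by (simp add: map_replicate_const)
 also have "\<dots> = (?z ^ length ?w * ?z) *\<^sub>C coef (join_word as bs)"
  by (simp add: coef_homogeneous as bs join_word_def scaleC_scaleC)
 also have "?z ^ length ?w * ?z = complex_of_real (t ^ length as * t ^ length bs)"
  by (simp add: as bs power_add)
 finally show ?thesis .
qed

end

context positive_germ
begin

text \<open>
 The graph consists of one chain for each word, its mirror image, and edges between the ends of the
 chains and the ends of the mirror images.
\<close>

lemma word_kernel_small:
 assumes L: "\<And>a. a < m ==> L a \<noteq> []" and m: "m \<ge> 1"
  and N: "N = real (2 * (\<Sum>a<m. length (L a)))"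
  and small: "\<And>a x. a < m ==> x \<in> set (L a) ==> norm x < min 1 (r / (N * N))"
 shows "mat_pos (mat m m (\<lambda>(a, b). coef (join_word (L a) (L b))))"
proof -
 define V where "V = (SIGMA a:{..<m}. {..<length (L a)})"
 define n where "n = card V"
 have finV: "finite V" by (simp add: V_def)
 have nN: "N = real (n + n)" by (simp add: N n_def V_def)
 have V0: "(a, 0) \<in> V" if "a < m" for a using that L by (simp add: V_def)
 have "V \<noteq> {}" using V0 [of 0] m by auto
 then have n: "n \<ge> 1" using finV by (simp add: n_def Suc_le_eq card_gt_0_iff)
 obtain e where e: "bij_betw e {..<n} V"
  using ex_bij_betw_nat_finite [OF finV] unfolding n_def by (metis atLeast0LessThan)
 define d where "d = inv_into {..<n} e"
 have ed: "e (d l) = l" "d l < n" if "l \<in> V" for l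
  using bij_betw_inv_into_right [OF e that] bij_betw_apply [OF bij_betw_inv_into [OF e] that] by (auto simp: d_def)
 have de: "d (e p) = p" "e p \<in> V" if "p < n" for p
  using bij_betw_inv_into_left [OF e, of p] bij_betw_apply [OF e, of p] that by (auto simp: d_def)
 have eq_d: "q = d x \<longleftrightarrow> e q = x" if "q < n" "x \<in> V" for q x using ed de that by metis
 have inV: "fst (e p) < m" "snd (e p) < length (L (fst (e p)))" if "p < n" for p
  using de(2) [OF that] by (auto simp: V_def mem_Sigma_iff split_beta)
 define U where "U p q = (if fst (e p) = fst (e q) \<and> snd (e q) = Suc (snd (e p)) then L (fst (e p)) ! snd (e p) else 0)" for p q
 define v where "v p = (if Suc (snd (e p)) = length (L (fst (e p))) then last (L (fst (e p))) else 0)" for p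
 define D where "D p q = v p * star (v q)" for p q
 define Z where "Z = mat (n + n) (n + n) (\<lambda>(p, q). if p < n then if q < n then U p q else D p (q - n)
   else if q < n then 0 else star (U (q - n) (p - n)))"
 have Zc: "Z \<in> carrier_mat (n + n) (n + n)" by (simp add: Z_def)
 define \<rho> where "\<rho> = min 1 (r / (N * N))"
 have N0: "N > 0" using n by (simp add: nN)
 have \<rho>: "\<rho> > 0" "\<rho> \<le> 1" "N * N * \<rho> \<le> r" using r N0 by (auto simp: \<rho>_def min_def field_simps)
 have nU: "norm (U p q) < \<rho>" if "p < n" for p q
  using small [OF inV(1) [OF that], of "L (fst (e p)) ! snd (e p)"] inV [OF that] \<rho> by (auto simp: U_def \<rho>_def [symmetric])
 have nv: "norm (v p) < \<rho>" if "p < n" for p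
  using small [OF inV(1) [OF that], of "last (L (fst (e p)))"] inV [OF that] L \<rho> by (auto simp: v_def \<rho>_def [symmetric])
 have nD: "norm (D p q) < \<rho>" if "p < n" "q < n" for p q
 proof -
  have "norm (D p q) \<le> norm (v p) * norm (v q)" unfolding D_def using norm_mult_ineq [of "v p" "star (v q)"] by simp
  also have "\<dots> \<le> norm (v p) * 1" using nv [OF that(2)] \<rho> by (intro mult_left_mono) auto
  finally show ?thesis using nv [OF that(1)] by simp
 qed
 have "(\<Sum>p<n + n. \<Sum>q<n + n. norm (Z $$ (p, q))) < (\<Sum>p<n + n. \<Sum>q<n + n. \<rho>)"
  using n nU nD \<rho> by (intro sum_strict_mono) (auto simp: Z_def)
 also have "\<dots> = N * N * \<rho>" by (simp add: nN algebra_simps)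
 finally have Zsm: "mat_norm Z < r" using mat_norm_le_entries [of Z] Zc \<rho>(3) by simp
 have Dpos: "mat_pos (mat n n (\<lambda>(p, q). D p q))"
 proof -
  define C where "C = mat 1 n (\<lambda>(_, q). star (v q))"
  have C: "C \<in> carrier_mat 1 n" by (simp add: C_def)
  have "mat n n (\<lambda>(p, q). D p q) = mat_star C * C"
   by (rule eq_matI) (auto simp: C_def D_def index_mult_mat' star_star simp del: index_mult_mat(1))
  then show ?thesis using mat_pos_gram [OF C] by simp
 qed
 have pos: "mat_pos (mat n n (\<lambda>(p, q). F Z $$ (p, q + n)))"
  by (rule block_positive [OF n _ Dpos Z_def Zsm, where g = "\<lambda>p. snd (e p)"]) (auto simp: U_def split: if_splits)
 have entry: "F Z $$ (d (a, 0), d (b, 0) + n) = coef (join_word (L a) (L b))" if ab: "a < m" "b < m" for a b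
 proof -
  define k l where "k = length (L a)" and "l = length (L b)"
  have kl: "k \<ge> 1" "l \<ge> 1" using L ab by (simp_all add: k_def l_def Suc_le_eq)
  have Vab: "(a, s) \<in> V \<longleftrightarrow> s < k" "(b, s) \<in> V \<longleftrightarrow> s < l" for s using ab by (simp_all add: V_def k_def l_def)
  let ?W = "join_word (L a) (L b)"
  have lW: "length ?W = k + l - 1" using kl by (simp add: join_word_def k_def l_def)
  have W: "?W ! s = (if Suc s < k then L a ! s else if Suc s = k then last (L a) * star (last (L b)) else star (L b ! (k + l - 2 - s)))"
   if "s < k + l - 1" for s
  proof -
   have ar: "l - Suc (Suc (s - k)) = k + l - 2 - s" "l - Suc (Suc (s - k)) < l - 1" if "k \<le> s"
    using that \<open>s < k + l - 1\<close> kl by arith+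
   have "rev (map star (butlast (L b))) ! (s - k) = star (L b ! (k + l - 2 - s))" if "k \<le> s"
    using that \<open>s < k + l - 1\<close> kl ar [OF that] by (simp add: rev_nth nth_butlast flip: l_def)
   then show ?thesis using that kl
    by (auto simp: join_word_def nth_append nth_butlast nth_Cons' simp flip: k_def)
  qed
  define \<gamma> where "\<gamma> s = (if s < k then d (a, s) else d (b, k + l - 1 - s) + n)" for s
  have \<gamma>: "\<gamma> s < n + n" if "s \<le> length ?W" for s
   using that kl ed(2) [of "(a, s)"] ed(2) [of "(b, k + l - 1 - s)"] unfolding lW \<gamma>_def by (auto simp: Vab)
  have "F Z $$ (\<gamma> 0, \<gamma> (length ?W)) = coef ?W"
  proof (rule path_entry [OF Zc Zsm, of \<gamma> ?W "{q. q < n \<or> fst (e (q - n)) = b}"])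
   show "\<gamma> s < n + n" if "s \<le> length ?W" for s by (rule \<gamma> [OF that])
   show "\<gamma> s \<in> {q. q < n \<or> fst (e (q - n)) = b}" if "s \<le> length ?W" for s
    using that kl ed [of "(a, s)"] ed [of "(b, k + l - 1 - s)"] unfolding lW \<gamma>_def by (auto simp: Vab)
   show "inj_on \<gamma> {..length ?W}"
   proof (rule inj_onI)
    fix s t assume st: "s \<in> {..length ?W}" "t \<in> {..length ?W}" "\<gamma> s = \<gamma> t"
    have 1: "d (a, s) < n" "e (d (a, s)) = (a, s)" if "s < k" for s using ed [of "(a, s)"] that by (auto simp: Vab)
    have 2: "e (d (b, k + l - 1 - s)) = (b, k + l - 1 - s)" if "\<not> s < k" "s \<le> k + l - 1" for s
     using ed [of "(b, k + l - 1 - s)"] that kl by (auto simp: Vab)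
    show "s = t"
    proof (cases "s < k"; cases "t < k")
     assume "s < k" "t < k"
     then show ?thesis using st(3) 1 [of s] 1 [of t] unfolding \<gamma>_def by (metis prod.inject)
    next
     assume "\<not> s < k" "\<not> t < k"
     then show ?thesis using st 2 [of s] 2 [of t] unfolding \<gamma>_def lW by auto
    qed (use st(3) 1 in \<open>force simp: \<gamma>_def\<close>)+
   qed
   show "p \<in> {q. q < n \<or> fst (e (q - n)) = b}"
    if "p < n + n" "q < n + n" "q \<in> {q. q < n \<or> fst (e (q - n)) = b}" "Z $$ (p, q) \<noteq> 0" for p q
    using that by (auto simp: Z_def U_def split: if_splits)
   fix s q assume s: "s \<le> length ?W" and q: "q < n + n" and qP: "q \<in> {q. q < n \<or> fst (e (q - n)) = b}"
   show "Z $$ (\<gamma> s, q) = (if s < length ?W \<and> q = \<gamma> (Suc s) then ?W ! s else 0)"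
   proof (cases "s < k")
    case True
    then have sV: "(a, s) \<in> V" by (simp add: Vab)
    note es = ed [OF sV]
    show ?thesis
    proof (cases "q < n")
     case qn: True
     have "Z $$ (\<gamma> s, q) = (if e q = (a, Suc s) then L a ! s else 0)"
      using True qn q es by (auto simp: Z_def \<gamma>_def U_def prod_eq_iff)
     also have "\<dots> = (if Suc s < k \<and> q = d (a, Suc s) then L a ! s else 0)"
      using eq_d [OF qn, of "(a, Suc s)"] de(2) [OF qn] by (auto simp: Vab)
     also have "\<dots> = (if s < length ?W \<and> q = \<gamma> (Suc s) then ?W ! s else 0)"
      using True qn kl lW W [of s] by (auto simp: \<gamma>_def)
     finally show ?thesis .
    next
     case qn: False
     then have q': "q - n < n" "fst (e (q - n)) = b" using q qP by auto
     have "Z $$ (\<gamma> s, q) = (if Suc s = k then last (L a) else 0) * star (if e (q - n) = (b, l - 1) then last (L b) else 0)"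
      using True qn q q' kl es by (auto simp: Z_def \<gamma>_def D_def v_def k_def l_def prod_eq_iff)
     also have "\<dots> = (if Suc s = k \<and> q - n = d (b, l - 1) then last (L a) * star (last (L b)) else 0)"
      using eq_d [OF q'(1), of "(b, l - 1)"] kl by (auto simp: Vab)
     also have "\<dots> = (if s < length ?W \<and> q = \<gamma> (Suc s) then ?W ! s else 0)"
     proof (cases "Suc s = k")
      case t: True
      have "k + l - 1 - Suc s = l - 1" using t by simp
      then show ?thesis using t qn kl lW W [of s] by (auto simp: \<gamma>_def)
     next
      case f: False
      then have "d (a, Suc s) < n" using True ed(2) [of "(a, Suc s)"] by (simp add: Vab)
      then show ?thesis using f True qn by (auto simp: \<gamma>_def)
     qed
     finally show ?thesis .
    qed
   next
    case False
    define u where "u = k + l - 1 - s"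
    have u: "u < l" "\<gamma> s = d (b, u) + n" using False kl s by (auto simp: u_def \<gamma>_def)
    then have uV: "(b, u) \<in> V" by (simp add: Vab)
    note eu = ed [OF uV]
    have su: "s < length ?W \<longleftrightarrow> u > 0" using s by (auto simp: u_def lW)
    show ?thesis
    proof (cases "q < n")
     case qn: True
     have "q \<noteq> \<gamma> (Suc s)" using False qn by (auto simp: \<gamma>_def)
     then show ?thesis using qn q u eu by (simp add: Z_def)
    next
     case qn: False
     then have q': "q - n < n" "fst (e (q - n)) = b" using q qP by auto
     have "Z $$ (\<gamma> s, q) = (if u > 0 \<and> e (q - n) = (b, u - 1) then star (L b ! (u - 1)) else 0)"
      using qn q q' u eu by (auto simp: Z_def U_def prod_eq_iff)
     also have "\<dots> = (if u > 0 \<and> q - n = d (b, u - 1) then star (L b ! (u - 1)) else 0)"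
      using eq_d [OF q'(1), of "(b, u - 1)"] u by (auto simp: Vab)
     also have "\<dots> = (if s < length ?W \<and> q = \<gamma> (Suc s) then ?W ! s else 0)"
     proof (cases "u > 0")
      case up: True
      have "k + l - 1 - Suc s = u - 1" "k + l - 2 - s = u - 1" by (simp_all add: u_def)
      moreover have "s < k + l - 1" using su up by (simp add: lW)
      ultimately show ?thesis using su up qn False W [of s] by (auto simp: \<gamma>_def)
     qed (use su in simp)
     finally show ?thesis .
    qed
   qed
  qed
  moreover have "\<gamma> 0 = d (a, 0)" "\<gamma> (length ?W) = d (b, 0) + n" using kl by (auto simp: \<gamma>_def lW)
  ultimately show ?thesis by simp
 qed
 have "mat_pos (mat m m (\<lambda>(a, b). \<Sum>p<n. \<Sum>q<n. ((if p = d (a, 0) then 1 else 0) * cnj (if q = d (b, 0) then 1 else 0)) *\<^sub>C F Z $$ (p, q + n)))"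
  by (rule mat_pos_kernel [OF pos])
 also have "mat m m (\<lambda>(a, b). \<Sum>p<n. \<Sum>q<n. ((if p = d (a, 0) then 1 else 0) * cnj (if q = d (b, 0) then 1 else 0)) *\<^sub>C F Z $$ (p, q + n))
  = mat m m (\<lambda>(a, b). coef (join_word (L a) (L b)))"
 proof (rule eq_matI; simp only: dim_row_mat dim_col_mat index_mat split)
  fix a b assume ab: "a < m" "b < m"
  have "(\<Sum>p<n. \<Sum>q<n. ((if p = d (a, 0) then 1 else 0) * cnj (if q = d (b, 0) then 1 else 0)) *\<^sub>C F Z $$ (p, q + n))
   = (\<Sum>p<n. \<Sum>q<n. if q = d (b, 0) then if p = d (a, 0) then F Z $$ (d (a, 0), d (b, 0) + n) else 0 else 0)"
   by (intro sum.cong refl) (auto simp: scaleC_one)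
  also have "\<dots> = F Z $$ (d (a, 0), d (b, 0) + n)" using ed(2) [OF V0 [OF ab(1)]] ed(2) [OF V0 [OF ab(2)]] by simp
  finally show "(\<Sum>p<n. \<Sum>q<n. ((if p = d (a, 0) then 1 else 0) * cnj (if q = d (b, 0) then 1 else 0)) *\<^sub>C F Z $$ (p, q + n))
   = coef (join_word (L a) (L b))" using entry [OF ab] by simp
 qed
 finally show ?thesis .
qed

lemma word_kernel_positive:
 assumes L: "\<And>a. a < m ==> L a \<noteq> []"
 shows "mat_pos (mat m m (\<lambda>(a, b). coef (join_word (L a) (L b))))"
proof (cases "m = 0")
 case True
 then have "mat m m (\<lambda>(a, b). coef (join_word (L a) (L b))) = 0\<^sub>m 0 0" by (intro eq_matI) auto
 then show ?thesis by (simp only: mat_pos_zero)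
next
 case False
 define N where "N = real (2 * (\<Sum>a<m. length (L a)))"
 have "(\<Sum>a<m. length (L a)) > 0" using False L by (intro sum_pos) auto
 then have N: "N > 0" unfolding N_def by linarith
 obtain t where t: "t > 0" "\<And>x. x \<in> (\<Union>a<m. set (L a)) ==> norm (complex_of_real t *\<^sub>C x) < min 1 (r / (N * N))"
  using small_scale_exists [of "\<Union>a<m. set (L a)" "min 1 (r / (N * N))"] r N by auto
 define L' where "L' a = map (scaleC (complex_of_real t)) (L a)" for a
 have "mat_pos (mat m m (\<lambda>(a, b). coef (join_word (L' a) (L' b))))"
 proof (rule word_kernel_small)
  show "L' a \<noteq> []" if "a < m" for a using L that by (simp add: L'_def)
  show "N = real (2 * (\<Sum>a<m. length (L' a)))" by (simp add: N_def L'_def)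
  show "norm x < min 1 (r / (N * N))" if "a < m" "x \<in> set (L' a)" for a x
   using that t(2) by (auto simp: L'_def)
 qed (use False in simp)
 note mat_pos_rescale [OF this, of "\<lambda>a. 1 / t ^ length (L a)"]
 also have "mat m m (\<lambda>(a, b). complex_of_real (1 / t ^ length (L a) * (1 / t ^ length (L b))) *\<^sub>C coef (join_word (L' a) (L' b)))
  = mat m m (\<lambda>(a, b). coef (join_word (L a) (L b)))"
  unfolding L'_def using t(1) L
  by (intro eq_matI) (simp_all add: coef_join_word_scale scaleC_scaleC scaleC_one)
 finally show ?thesis .
qed

lemma completely_positive_moments:
 assumes lin: "\<And>p q. \<sigma> (p + q) = \<sigma> p + \<sigma> q" "\<And>c p. \<sigma> (c *\<^sub>C p) = c *\<^sub>C \<sigma> p"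
  and word: "\<And>bs. bs \<noteq> [] ==> \<sigma> (nc_word bs) = coef bs"
 shows "completely_positive \<sigma>"
 unfolding completely_positive_def
proof (intro allI)
 fix n and P :: "nat => 'b ncpoly"
 have s0: "\<sigma> 0 = 0" using lin(1) [of 0 0] by simp
 have ssum: "\<sigma> (\<Sum>x<k. f x) = (\<Sum>x<k. \<sigma> (f x))" for f and k :: nat
  by (induction k) (simp_all add: s0 lin)
 have "\<forall>i. \<exists>A c. finite A \<and> [] \<notin> A \<and> P i = (\<Sum>w\<in>A. c w *\<^sub>C nc_word w)" using ncpoly_expansion by blast
 then obtain A where "\<forall>i. \<exists>c. finite (A i) \<and> [] \<notin> A i \<and> P i = (\<Sum>w\<in>A i. c w *\<^sub>C nc_word w)"
  by (rule choice [THEN exE])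
 then obtain c where "\<forall>i. finite (A i) \<and> [] \<notin> A i \<and> P i = (\<Sum>w\<in>A i. c i w *\<^sub>C nc_word w)"
  by (rule choice [THEN exE])
 then have A: "finite (A i)" "[] \<notin> A i" "P i = (\<Sum>w\<in>A i. c i w *\<^sub>C nc_word w)" for i by blast+
 define B where "B = (\<Union>i<n. A i)"
 have B: "finite B" "[] \<notin> B" using A by (auto simp: B_def)
 define m where "m = card B"
 obtain L where L: "bij_betw L {..<m} B"
  using ex_bij_betw_nat_finite [OF B(1)] unfolding m_def by (metis atLeast0LessThan)
 have LB: "L a \<noteq> []" if "a < m" for a using bij_betw_apply [OF L, of a] that B by auto
 define c' where "c' i a = (if L a \<in> A i then c i (L a) else 0)" for i a
 have P: "P i = (\<Sum>a<m. c' i a *\<^sub>C nc_word (L a))" if "i < n" for i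
 proof -
  have "A i \<subseteq> B" using that by (auto simp: B_def)
  then have "P i = (\<Sum>w\<in>B. (if w \<in> A i then c i w else 0) *\<^sub>C nc_word w)"
   unfolding A(3) using B(1) by (intro sum.mono_neutral_cong_left) auto
  also have "\<dots> = (\<Sum>a<m. c' i a *\<^sub>C nc_word (L a))"
   unfolding c'_def by (rule sum.reindex_bij_betw [OF L, symmetric])
  finally show ?thesis .
 qed
 have "mat_pos (mat n n (\<lambda>(i, j). \<Sum>a<m. \<Sum>b<m. (c' i a * cnj (c' j b)) *\<^sub>C coef (join_word (L a) (L b))))"
  by (rule mat_pos_kernel [OF word_kernel_positive [OF LB]])
 also have "mat n n (\<lambda>(i, j). \<Sum>a<m. \<Sum>b<m. (c' i a * cnj (c' j b)) *\<^sub>C coef (join_word (L a) (L b)))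
  = mat n n (\<lambda>(i, j). \<sigma> (P i * star (P j)))"
 proof (rule eq_matI; simp only: dim_row_mat dim_col_mat index_mat split)
  fix i j assume ij: "i < n" "j < n"
  have "P i * star (P j) = (\<Sum>a<m. \<Sum>b<m. (c' i a * cnj (c' j b)) *\<^sub>C (nc_word (L a) * star (nc_word (L b))))"
   unfolding P [OF ij(1)] P [OF ij(2)]
   by (simp add: star_sum star_scaleC sum_product mult_scaleC_left mult_scaleC_right scaleC_scaleC mult.commute)
  also have "\<dots> = (\<Sum>a<m. \<Sum>b<m. (c' i a * cnj (c' j b)) *\<^sub>C nc_word (join_word (L a) (L b)))"
   by (intro sum.cong refl) (simp add: nc_word_mult_star LB)
  finally have "\<sigma> (P i * star (P j)) = (\<Sum>a<m. \<Sum>b<m. (c' i a * cnj (c' j b)) *\<^sub>C \<sigma> (nc_word (join_word (L a) (L b))))"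
   by (simp add: ssum lin)
  also have "\<dots> = (\<Sum>a<m. \<Sum>b<m. (c' i a * cnj (c' j b)) *\<^sub>C coef (join_word (L a) (L b)))"
   by (intro sum.cong refl) (simp add: word join_word_def)
  finally show "(\<Sum>a<m. \<Sum>b<m. (c' i a * cnj (c' j b)) *\<^sub>C coef (join_word (L a) (L b))) = \<sigma> (P i * star (P j))" ..
 qed
 finally show "mat_pos (mat n n (\<lambda>(i, j). \<sigma> (P i * star (P j))))" .
qed

end

section \<open>Proof of the equivalence\<close>

text \<open>
 \<open>Im c = - c\<^sup>* (Im b) c\<close>, and \<open>c\<^sup>* c\<close> is bounded below as \<open>c\<close> is invertible.
\<close>

lemma Mplus_inverse_lower:
 assumes "b \<in> Mplus n"
 obtains c :: "'b::cstar_algebra mat" where "c \<in> carrier_mat n n" "b * c = 1\<^sub>m n" "c * b = 1\<^sub>m n" "- c \<in> Mplus n"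
proof -
 obtain \<epsilon> where e: "\<epsilon> > 0" "psd (Im_part (iform n b) - of_real \<epsilon>)" "b \<in> carrier_mat n n"
  using MplusD [OF assms] .
 define B where "B = iform n b"
 obtain C where C: "B * C = 1" "C * B = 1" using psd_Im_imp_invertible [OF e(2,1)] unfolding B_def .
 have CS: "star C * star B = 1" "star B * star C = 1" using C by (simp_all flip: star_mult)
 have i1: "star C * C * (B * star B) = 1"
  using C CS by (metis mult.assoc mult_1_right)
 have i2: "B * star B * (star C * C) = 1"
  using C CS by (metis mult.assoc mult_1_left)
 define \<delta> where "\<delta> = 1 / norm (B * star B)"
 have "B * star B \<noteq> 0" using i1 by auto
 then have \<delta>: "\<delta> > 0" by (simp add: \<delta>_def)
 have "psd (star C * C - of_real \<delta>)"
  unfolding \<delta>_def by (rule psd_invertible_ge [OF psd_star_mult i1 i2])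
 moreover have "psd (star C * (Im_part B - of_real \<epsilon>) * C)" using psd_congruence [OF e(2)] by (simp add: B_def)
 ultimately have "psd (star C * (Im_part B - of_real \<epsilon>) * C + \<epsilon> *\<^sub>R (star C * C - of_real \<delta>))"
  using e by (intro psd_add psd_scaleR) auto
 moreover have "star C * (Im_part B - of_real \<epsilon>) * C + \<epsilon> *\<^sub>R (star C * C - of_real \<delta>) = Im_part (- C) - of_real (\<epsilon> * \<delta>)"
  by (simp add: left_diff_distrib right_diff_distrib Im_part_inverse [OF C] scaleR_diff_right)
   (simp add: of_real_def Im_part_def star_minus scaleC_diff_right)
 ultimately have "blev (- C) n \<in> Mplus n" using e \<delta> by (intro MplusI [of _ "\<epsilon> * \<delta>"]) auto
 moreover have "blev (B * C) n = 1\<^sub>m n" "blev (C * B) n = 1\<^sub>m n" using C by simp_all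
 ultimately show ?thesis using that [of "blev C n"] e by (simp add: B_def iform_def)
qed

theorem transform_cond_imp_cp:
 fixes G :: "'b::cstar_algebra mat => 'b mat"
 assumes cond: "transform_cond V G" and V: "\<And>n. n \<ge> 1 ==> V n \<subseteq> Mminus_closed n"
 shows "\<exists>\<sigma>. is_cp_transform \<sigma> G"
proof -
 let ?D = "{b :: 'b mat. invertible_mat b \<and> mat_inv b \<in> Hplus}"
 obtain F r where ext: "uniform_extension0 ?D (\<lambda>b. G (mat_inv b)) F r"
  and herm: "\<forall>b \<in> ncball r. F (mat_star b) = mat_star (F b)" and F0: "\<forall>n\<ge>1. F (0\<^sub>m n n) = 0\<^sub>m n n"
  using cond unfolding transform_cond_def by blast
 have GV: "G b \<in> V n" if "n \<ge> 1" "b \<in> Mplus n" for n b using cond that unfolding transform_cond_def by blast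
 have Gan: "analytic_nc_function Hplus G" using cond unfolding transform_cond_def by blast
 obtain K where r: "r > 0" and an: "analytic_nc_function (ncball r) F" and K: "\<forall>b \<in> ncball r. mat_norm (F b) \<le> K"
  and FH: "\<forall>b \<in> ncball r \<inter> ?D. F b = G (mat_inv b)"
  using ext unfolding uniform_extension0_def by blast
 have FG: "F b = G c" if "n \<ge> 1" "mat_norm b < r" "b \<in> carrier_mat n n" "c \<in> Mplus n" "b * c = 1\<^sub>m n" "c * b = 1\<^sub>m n" for n b c
 proof -
  have cc: "c \<in> carrier_mat n n" using that by (auto simp: Mplus_def)
  have "mat_inv b = c" using that cc by (intro mat_inv_eqI [of _ n]) auto
  moreover have "invertible_mat b" using that cc by (auto simp: invertible_mat_def inverts_mat_def)
  moreover have "b \<in> ncball r" "c \<in> Hplus" using that by (auto simp: ncball_def Hplus_def)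
  ultimately show ?thesis using FH by auto
 qed
 interpret positive_germ F r K
 proof unfold_locales
  show "r > 0" "nc_function (ncball r) F" using r an by (simp_all add: analytic_nc_function_def)
  show "mat_norm (F b) \<le> K" "F (mat_star b) = mat_star (F b)" if "b \<in> ncball r" for b using K herm that by auto
  show "mat_analytic_on n (ncball r \<inter> carrier_mat n n) F" if "n \<ge> 1" for n
   using an that by (simp add: analytic_nc_function_def)
  fix n and b :: "'b mat" assume n: "n \<ge> 1" and b: "b \<in> carrier_mat n n" "mat_norm b < r" "- b \<in> Mplus n"
  obtain c where c: "c \<in> carrier_mat n n" "- b * c = 1\<^sub>m n" "c * - b = 1\<^sub>m n" "- c \<in> Mplus n"
   using Mplus_inverse_lower [OF b(3)] .
  have "b * - c = 1\<^sub>m n" "- c * b = 1\<^sub>m n" using b c by (simp_all add: uminus_mult_left_mat uminus_mult_right_mat)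
  then have "F b = G (- c)" using FG [OF n b(2,1) c(4)] by simp
  then have "F b \<in> Mminus_closed n" using GV [OF n c(4)] V [OF n] by auto
  then show "mat_pos (- mat_Im (F b))" by (simp add: Mminus_closed_def)
 qed
 obtain \<sigma> where \<sigma>: "\<And>p q. \<sigma> (p + q) = \<sigma> p + \<sigma> q" "\<And>c p. \<sigma> (c *\<^sub>C p) = c *\<^sub>C \<sigma> p"
  "\<And>bs. bs \<noteq> [] ==> \<sigma> (nc_word bs) = coef bs"
  using moment_map_exists by metis
 have "G b = cauchy_transform \<sigma> b" if n: "n \<ge> 1" and b: "b \<in> Mplus n" for n b
 proof (rule cauchy_transform_eqI [symmetric, OF _ b], rule continues_moment_series [OF \<sigma> _ n])
  show "F (0\<^sub>m 1 1) = 0\<^sub>m 1 1" using F0 by simp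
  show "mat_analytic_on n (Mplus n) G" using Gan n by (simp add: analytic_nc_function_def Hplus_level)
  fix a :: "'b mat" assume a: "a \<in> Mplus n" "mat_norm (mat_inv a) < r"
  obtain c where c: "c \<in> carrier_mat n n" "a * c = 1\<^sub>m n" "c * a = 1\<^sub>m n" "mat_inv a = c" using Mplus_inverse [OF a(1)] .
  then show "F (mat_inv a) = G a" using FG [OF n _ c(1) a(1)] a by simp
 qed
 moreover have "completely_positive \<sigma>" by (rule completely_positive_moments [OF \<sigma>])
 moreover have "exponentially_bounded \<sigma>" by (rule exponentially_bounded_moments [OF \<sigma>(3)])
 ultimately show ?thesis unfolding is_cp_transform_def using \<sigma> by blast
qed

lemma transform_cond_cong:
 assumes cond: "transform_cond V H" and eq: "\<And>n b. n \<ge> 1 ==> b \<in> Mplus n ==> G b = H b"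
 shows "transform_cond V G"
proof -
 have GH: "G b = H b" if "b \<in> Hplus" for b using eq that by (auto simp: Hplus_def)
 have "nc_function Hplus H" and an: "\<And>n. n \<ge> 1 ==> mat_analytic_on n (Hplus \<inter> carrier_mat n n) H"
  using cond unfolding transform_cond_def analytic_nc_function_def by blast+
 then have "nc_function Hplus G" unfolding nc_function_def using GH by simp
 moreover have "mat_analytic_on n (Hplus \<inter> carrier_mat n n) G" if "n \<ge> 1" for n
  using an [OF that] unfolding mat_analytic_on_def using GH by (simp cong: conj_cong)
 ultimately have "analytic_nc_function Hplus G" by (simp add: analytic_nc_function_def)
 moreover have "uniform_extension0 {b. invertible_mat b \<and> mat_inv b \<in> Hplus} (\<lambda>b. G (mat_inv b)) F r
  \<longleftrightarrow> uniform_extension0 {b. invertible_mat b \<and> mat_inv b \<in> Hplus} (\<lambda>b. H (mat_inv b)) F r" for F r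
  unfolding uniform_extension0_def using GH by auto
 ultimately show ?thesis using cond eq unfolding transform_cond_def by simp
qed

lemma Mminus_subset_closed: "Mminus n \<subseteq> (Mminus_closed n :: 'b::cstar_algebra mat set)"
proof
 fix b :: "'b mat" assume "b \<in> Mminus n"
 then obtain a where a: "a \<in> Mplus n" "b = - a" by (auto simp: Mminus_def)
 obtain \<epsilon> where e: "\<epsilon> > 0" "psd (Im_part (iform n a) - of_real \<epsilon>)" "a \<in> carrier_mat n n"
  using MplusD [OF a(1)] .
 have "psd (Im_part (iform n a) - of_real \<epsilon> + of_real \<epsilon>)" using e by (intro psd_add psd_of_real) auto
 then have "mat_pos (mat_Im a)" using e(3) by (auto simp: psd_bfam_iff iform_def dest: spec [of _ n])
 moreover have "- mat_Im b = mat_Im a"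
  using e(3) unfolding a(2) by (intro eq_matI) (auto simp: mat_Im_def star_minus scaleC_diff_right)
 ultimately show "b \<in> Mminus_closed n" using e(3) a(2) by (simp add: Mminus_closed_def)
qed

theorem theoremA1:
  fixes G :: "'b::cstar_algebra mat \<Rightarrow> 'b mat"
  assumes G_carrier: "\<And>n b. n \<ge> 1 \<Longrightarrow> b \<in> Mplus n \<Longrightarrow> G b \<in> carrier_mat n n"
  shows "(transform_cond Mminus_closed G \<longleftrightarrow> (\<exists>\<sigma>. is_cp_transform \<sigma> G)) \<and>
         (transform_cond Mminus G \<longleftrightarrow>
            (\<exists>\<sigma>. is_cp_transform \<sigma> G \<and> (\<exists>c. \<sigma> 1 * c = 1 \<and> c * \<sigma> 1 = 1)))"
proof -
 have loc: "cp_map \<sigma>" and half: "\<And>n b. n \<ge> 1 ==> b \<in> Mplus n ==> G b = cp_map.half \<sigma> b"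
  if "is_cp_transform \<sigma> G" for \<sigma>
 proof -
  show l: "cp_map \<sigma>" using that unfolding is_cp_transform_def by unfold_locales blast+
  show "G b = cp_map.half \<sigma> b" if "n \<ge> 1" "b \<in> Mplus n" for n b
   using \<open>is_cp_transform \<sigma> G\<close> that cauchy_transform_eqI [OF cp_map.continues_half [OF l] that(2)]
   unfolding is_cp_transform_def by simp
 qed
 have weak: "transform_cond Mminus_closed G \<longleftrightarrow> (\<exists>\<sigma>. is_cp_transform \<sigma> G)"
 proof
  assume "transform_cond Mminus_closed G"
  then show "\<exists>\<sigma>. is_cp_transform \<sigma> G" by (rule transform_cond_imp_cp) simp
 next
  assume "\<exists>\<sigma>. is_cp_transform \<sigma> G"
  then obtain \<sigma> where \<sigma>: "is_cp_transform \<sigma> G" by blast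
  interpret cp_map \<sigma> by (rule loc [OF \<sigma>])
  show "transform_cond Mminus_closed G"
   by (rule transform_cond_cong [OF transform_cond_half [OF half_neg] half [OF \<sigma>]])
 qed
 moreover have "transform_cond Mminus G \<longleftrightarrow> (\<exists>\<sigma>. is_cp_transform \<sigma> G \<and> (\<exists>c. \<sigma> 1 * c = 1 \<and> c * \<sigma> 1 = 1))"
 proof
  assume cond: "transform_cond Mminus G"
  then obtain \<sigma> where \<sigma>: "is_cp_transform \<sigma> G"
   using transform_cond_imp_cp [OF cond Mminus_subset_closed] by blast
  interpret cp_map \<sigma> by (rule loc [OF \<sigma>])
  have "half b \<in> Mminus 1" if "b \<in> Mplus 1" for b
   using cond half [OF \<sigma> _ that] that unfolding transform_cond_def by fastforce
  then show "\<exists>\<sigma>. is_cp_transform \<sigma> G \<and> (\<exists>c. \<sigma> 1 * c = 1 \<and> c * \<sigma> 1 = 1)"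
   using \<sigma> strict_imp_invertible by blast
 next
  assume "\<exists>\<sigma>. is_cp_transform \<sigma> G \<and> (\<exists>c. \<sigma> 1 * c = 1 \<and> c * \<sigma> 1 = 1)"
  then obtain \<sigma> c where \<sigma>: "is_cp_transform \<sigma> G" and c: "\<sigma> 1 * c = 1" "c * \<sigma> 1 = 1" by blast
  interpret cp_map \<sigma> by (rule loc [OF \<sigma>])
  show "transform_cond Mminus G"
   by (rule transform_cond_cong [OF transform_cond_half [OF half_strict [OF c]] half [OF \<sigma>]])
 qed
 ultimately show ?thesis by blast
qed

end
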